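(* Assume the standing setting of the context. Let $1\le m\le n$, let $\gamma$ be a contraction of $\{1,\dots,n\}$ with $m$ components, let $\sigma$ be an ordering of its components, and let $F:\mathcal{D}_\varepsilon^n\to\mathbb{R}$ be $\mathscr{C}^1$ in each time variable. Then for every $p\ge2$ and $T\in[0,1]$ there exist constants $\kappa_{\gamma,i}(\mathbf{p})>0$ (not depending on $\varepsilon$, $T$ or $F$) and a constant $C$ depending on $p$ (not on $\varepsilon$, $T$ or $F$) such that $$\mathbb{E}_p\Big[\sup_{t\in[0,T]}\big|(\mathcal{I}^\varepsilon_{\gamma,\sigma}F)_t\big|\Big]\le C\!\!\sum_{\substack{\mathbf{p}\in\mathscr{P}_m:\\ \mathbf{p}^{-1}(1)\cap\Gamma_1(\gamma)=\emptyset}}\!\!\varepsilon^{\alpha_\gamma(\mathbf{p})}\|F^{\gamma,\sigma}\|_{L^{\mathbf{p}}_\varepsilon}^{\beta_{\gamma,p}(\mathbf{p})}\Bigg(\prod_{\substack{i\in\mathbf{p}^{-1}(\infty)\setminus\Gamma_1(\gamma):\\ i\ge2}}\varepsilon^{-\kappa_{\gamma,i}(\mathbf{p})}\|F^{\gamma,\sigma}\|_{\mathscr{C}^1_{s_i}(L^\infty_\varepsilon)}^{\beta^{(i)}_{\gamma,p}(\mathbf{p})}\Bigg)^{1/p},$$ where $$\alpha_\gamma(\mathbf{p})=(d+\mathbf{k})\Big(\sum_{i=1}^m|\gamma_i|-2|\mathbf{p}^{-1}(1)|-|\mathbf{p}^{-1}(2)|\Big),\qquad \beta_{\gamma,p}(\mathbf{p})=\Big(\frac{p-1}{p}\Big)^{\#\{i\in\mathbf{p}^{-1}(\infty)\setminus\Gamma_1(\gamma):\,i\ge2\}},$$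 and $\beta^{(i)}_{\gamma,p}(\mathbf{p})=\big(\frac{p-1}{p}\big)^{\#\{j\in\mathbf{p}^{-1}(\infty)\setminus\Gamma_1(\gamma):\,j\ge i+1\}}$.
   Context: Standing setting. Fix $d\in\mathbb{N}$, $\varepsilon\in(0,1]$ with $\varepsilon^{-1}\in\mathbb{N}$; $\Lambda_\varepsilon=(\varepsilon\mathbb{Z}/\mathbb{Z})^d$, $\mathcal{D}_\varepsilon=[0,\infty)\times\Lambda_\varepsilon$, $\mathcal{D}_{\varepsilon,t}=[0,t)\times\Lambda_\varepsilon$. On a filtered probability space with the usual conditions, $(\mathbb{M}_\varepsilon(t,x))_{t\ge0}$, $x\in\Lambda_\varepsilon$, are càdlàg square-integrable martingales, $\Delta_t\mathbb{M}_\varepsilon(x)=\mathbb{M}_\varepsilon(t,x)-\mathbb{M}_\varepsilon(t-,x)$, with non-random constants independent of $\varepsilon,s,t,x$: (A1) $\langle\mathbb{M}_\varepsilon(x),\mathbb{M}_\varepsilon(y)\rangle=0$ for $x\ne y$, $\langle\mathbb{M}_\varepsilon(x)\rangle_t=\varepsilon^{-d}\int_0^t\mathcal{C}_\varepsilon(s,x)ds$, $\mathcal{C}_\varepsilon$ progressively measurable, $|\mathcal{C}_\varepsilon|\le C$ a.s.; (A2) for every $T>0$, a.s. no two distinct $\mathbb{M}_\varepsilon(x),\mathbb{M}_\varepsilon(y)$ jump simultaneously in $[0,T]$; (A3) there are $\mathbf{k}>-d/2$, $c>0$ with a.s. $|\Delta_t\mathbb{M}_\varepsilon(x)|=c\varepsilon^{\mathbf{k}}$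 whenever nonzero; (A4) $\mathbb{M}_\varepsilon(t,x)=\sum_{0\le s\le t}\Delta_s\mathbb{M}_\varepsilon(x)-\varepsilon^{-\mathbf{k}-d}\int_0^t\mathtt{C}_\varepsilon(s,x)ds$, $\mathtt{C}_\varepsilon$ progressively measurable, $|\mathtt{C}_\varepsilon|\le C$ a.s. $\mathbb{E}_pX=\mathbb{E}[|X|^p]^{1/p}$. Integrals. $\mathbf{M}_\varepsilon$ is the random measure on $\mathcal{D}_\varepsilon$ with $\int F\,d\mathbf{M}_\varepsilon=\sum_x\varepsilon^d\int_0^\infty F(s,x)d\mathbb{M}_\varepsilon(s,x)$, and $\mathbf{M}_\varepsilon^{\otimes n}$ the product measure on $\mathcal{D}_\varepsilon^n$. A contraction $\gamma$ of $\{1,\dots,n\}$ is an equivalence relation; its classes are components. An ordering $\sigma$ is a bijection from $\{1,\dots,m\}$ to the components; write $\gamma_j:=\sigma(j)$. Let $\mathcal{D}_\gamma$ be the set of $(z_1,\dots,z_n)\in\mathcal{D}_\varepsilon^n$ with $z_i=z_j$ iff $i,j$ lie in the same component, from which are removed all points having two coordinates with equal time components and different space components; $\mathcal{D}_{\gamma,\sigma}$ is the set of $((s_1,x_1),\dots,(s_n,x_n))\in\mathcal{D}_\gamma$ with $s_i<s_j$ whenever the component of $i$ precedes that of $j$ in the order $\sigma$. Define $(\mathcal{I}^\varepsilon_{\gamma,\sigma}F)_t=\int_{\mathcal{D}_{\gamma,\sigma}\cap\mathcal{D}_{\varepsilon,t}^n}F\,d\mathbf{M}_\varepsilon^{\otimes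 n}$. Define $F^{\gamma,\sigma}:\mathcal{D}_\varepsilon^m\to\mathbb{R}$ by $F^{\gamma,\sigma}(z_1,\dots,z_m)=F(\bar z_1,\dots,\bar z_n)$ with $\bar z_i=z_j$ for $i\in\gamma_j$; write $z_j=(s_j,x_j)$. $\Gamma_1(\gamma)=\{i\in\{1,\dots,m\}:|\gamma_i|=1\}$. Norms. For $H$ on $[0,T]\times\Lambda_\varepsilon$ and $q\in\{1,2\}$, $\|H\|_{L^q_\varepsilon}=(\varepsilon^d\sum_{x}\int_0^T|H(r,x)|^qdr)^{1/q}$, $\|H\|_{L^\infty_\varepsilon}=\sup_{[0,T]\times\Lambda_\varepsilon}|H|$. $\mathscr{P}_m$ is the set of functions $\mathbf{p}:\{1,\dots,m\}\to\{1,2,\infty\}$. For $\mathbf{p}\in\mathscr{P}_1$, $\|H\|_{L^{\mathbf{p}}_\varepsilon}=\|H\|_{L^{\mathbf{p}(1)}_\varepsilon}$; for $m\ge2$ and $H$ on $\mathcal{D}_\varepsilon^m$, recursively $\|H\|_{L^{\mathbf{p}}_\varepsilon}=\big\|\,z_m\mapsto\|H(\cdot,z_m)\mathbb{1}_{s_m>s_{m-1}}\|_{L^{\mathbf{p}|_{\{1,\dots,m-1\}}}_\varepsilon}\big\|_{L^{\mathbf{p}(m)}_\varepsilon}$, where the inner norm is in $(z_1,\dots,z_{m-1})$. $\|H\|_{\mathscr{C}^1_{s_i}(L^\infty_\varepsilon)}=\sup|H|+\sup|\partial_{s_i}H|$, suprema over all arguments with times in $[0,T]$. *)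

theory Defs
  imports "HOL-Probability.Probability"
begin

type_synonym site = "nat \<Rightarrow> nat"
type_synonym pt = "real \<times> site"

text \<open>N = 1/eps. Points of the torus (eps Z/Z)^d are encoded by their integer
 coordinates k with x = k/N, i.e. extensional maps from {0..<d} to {0..<N}.\<close>
definition Lam :: "nat \<Rightarrow> nat \<Rightarrow> site set" where
  "Lam N d = PiE {..<d} (\<lambda>_. {..<N})"

definition eps :: "nat \<Rightarrow> real" where
  "eps N = 1 / real N"

text \<open>Jump of a path, with the convention X(0-) = X(0).\<close>
definition jmp :: "(real \<Rightarrow> real) \<Rightarrow> real \<Rightarrow> real" where
  "jmp X t = (if t \<le> 0 then 0 else X t - Lim (at_left t) X)"

definition cadlag :: "(real \<Rightarrow> real) \<Rightarrow> bool" where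
  "cadlag X \<longleftrightarrow> (\<forall>t\<ge>0. continuous (at_right t) X) \<and> (\<forall>t>0. \<exists>l. (X \<longlongrightarrow> l) (at_left t))"

definition filtration_usual :: "'a measure \<Rightarrow> (real \<Rightarrow> 'a measure) \<Rightarrow> bool" where
  "filtration_usual P Fl \<longleftrightarrow>
     (\<forall>t\<ge>0. subalgebra P (Fl t)) \<and>
     (\<forall>s t. 0 \<le> s \<longrightarrow> s \<le> t \<longrightarrow> sets (Fl s) \<subseteq> sets (Fl t)) \<and>
     (\<forall>t\<ge>0. sets (Fl t) = (\<Inter>u\<in>{t<..}. sets (Fl u))) \<and>
     (\<forall>A B. A \<subseteq> space P \<longrightarrow> B \<in> sets P \<longrightarrow> A \<subseteq> B \<longrightarrow> emeasure P B = 0 \<longrightarrow> A \<in> sets (Fl 0))"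

definition mart :: "'a measure \<Rightarrow> (real \<Rightarrow> 'a measure) \<Rightarrow> (real \<Rightarrow> 'a \<Rightarrow> real) \<Rightarrow> bool" where
  "mart P Fl X \<longleftrightarrow>
     (\<forall>t\<ge>0. X t \<in> borel_measurable (Fl t) \<and> integrable P (X t)) \<and>
     (\<forall>s t. 0 \<le> s \<longrightarrow> s \<le> t \<longrightarrow> (AE \<omega> in P. real_cond_exp P (Fl s) (X t) \<omega> = X s \<omega>))"

definition progressive :: "(real \<Rightarrow> 'a measure) \<Rightarrow> (real \<Rightarrow> 'a \<Rightarrow> real) \<Rightarrow> bool" where
  "progressive Fl Y \<longleftrightarrow>
     (\<forall>t\<ge>0. (\<lambda>(s, \<omega>). Y s \<omega>) \<in> borel_measurable (restrict_space borel {0..t} \<Otimes>\<^sub>M Fl t))"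

text \<open>Standing assumptions (A1)-(A4) for a fixed eps = 1/N, with constants d, k, c, Cb.
  (A1) is unfolded: <M(x),M(y)> = 0 means M(x)M(y) is a martingale; <M(x)>_t = A_t with
  A continuous adapted (hence predictable) of finite variation means M(x)^2 - A is a martingale.\<close>
definition standing_setting ::
  "nat \<Rightarrow> real \<Rightarrow> real \<Rightarrow> real \<Rightarrow> 'a measure \<Rightarrow> (real \<Rightarrow> 'a measure) \<Rightarrow>
   (real \<Rightarrow> site \<Rightarrow> 'a \<Rightarrow> real) \<Rightarrow> (real \<Rightarrow> site \<Rightarrow> 'a \<Rightarrow> real) \<Rightarrow> (real \<Rightarrow> site \<Rightarrow> 'a \<Rightarrow> real) \<Rightarrow> nat \<Rightarrow> bool" where
  "standing_setting d k c Cb P Fl M Cq Cd N \<longleftrightarrow>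
     prob_space P \<and> filtration_usual P Fl \<and>
     (\<forall>x\<in>Lam N d. mart P Fl (\<lambda>t. M t x) \<and> (\<forall>t\<ge>0. integrable P (\<lambda>\<omega>. (M t x \<omega>)\<^sup>2)) \<and>
        (\<forall>\<omega>\<in>space P. cadlag (\<lambda>t. M t x \<omega>))) \<and>
     \<comment> \<open>(A1)\<close>
     (\<forall>x\<in>Lam N d. \<forall>y\<in>Lam N d. x \<noteq> y \<longrightarrow> mart P Fl (\<lambda>t \<omega>. M t x \<omega> * M t y \<omega>)) \<and>
     (\<forall>x\<in>Lam N d. progressive Fl (\<lambda>s. Cq s x) \<and>
        mart P Fl (\<lambda>t \<omega>. (M t x \<omega>)\<^sup>2 - real N ^ d * set_lebesgue_integral lborel {0..t} (\<lambda>s. Cq s x \<omega>))) \<and>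
     (AE \<omega> in P. \<forall>s\<ge>0. \<forall>x\<in>Lam N d. \<bar>Cq s x \<omega>\<bar> \<le> Cb) \<and>
     \<comment> \<open>(A2)\<close>
     (\<forall>T>0. AE \<omega> in P. \<forall>t\<in>{0..T}. \<forall>x\<in>Lam N d. \<forall>y\<in>Lam N d. x \<noteq> y \<longrightarrow>
        jmp (\<lambda>r. M r x \<omega>) t = 0 \<or> jmp (\<lambda>r. M r y \<omega>) t = 0) \<and>
     \<comment> \<open>(A3)\<close>
     (AE \<omega> in P. \<forall>t\<ge>0. \<forall>x\<in>Lam N d. jmp (\<lambda>r. M r x \<omega>) t \<noteq> 0 \<longrightarrow>
        \<bar>jmp (\<lambda>r. M r x \<omega>) t\<bar> = c * eps N powr k) \<and>
     \<comment> \<open>(A4)\<close>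
     (\<forall>x\<in>Lam N d. progressive Fl (\<lambda>s. Cd s x)) \<and>
     (AE \<omega> in P. \<forall>s\<ge>0. \<forall>x\<in>Lam N d. \<bar>Cd s x \<omega>\<bar> \<le> Cb) \<and>
     (AE \<omega> in P. \<forall>t\<ge>0. \<forall>x\<in>Lam N d.
        M t x \<omega> = (\<Sum>s\<in>{s\<in>{0..t}. jmp (\<lambda>r. M r x \<omega>) s \<noteq> 0}. jmp (\<lambda>r. M r x \<omega>) s)
          - real N powr (k + real d) * set_lebesgue_integral lborel {0..t} (\<lambda>s. Cd s x \<omega>))"

text \<open>Lebesgue-Stieltjes integral over [0,t) of G against a path X of finite variation,
  via any Jordan-type decomposition X = P - Q (P, Q nondecreasing, right-continuous,
  constant on (-infinity,0], so that dX has no mass at 0 in accordance with X(0-)=X(0)).\<close>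
definition LS_int :: "(real \<Rightarrow> real) \<Rightarrow> (real \<Rightarrow> real) \<Rightarrow> real \<Rightarrow> real" where
  "LS_int X G t =
    (let PQ = (SOME PQ. mono (fst PQ) \<and> mono (snd PQ) \<and>
                 (\<forall>a. continuous (at_right a) (fst PQ)) \<and> (\<forall>a. continuous (at_right a) (snd PQ)) \<and>
                 (\<forall>a\<le>0. fst PQ a = fst PQ 0 \<and> snd PQ a = snd PQ 0) \<and>
                 (\<forall>a\<ge>0. X a = fst PQ a - snd PQ a))
     in set_lebesgue_integral (interval_measure (fst PQ)) {0..<t} G
        - set_lebesgue_integral (interval_measure (snd PQ)) {0..<t} G)"

text \<open>Integral over [0,t) x Lambda against the restriction of M_eps^{(x)q} to the full
  diagonal {z_1 = ... = z_q}: for q = 1 this is M_eps itself (eps^d sum_x int dM(s,x));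
  for q >= 2 only atoms contribute, each with weight (eps^d Delta_s M(x))^q.\<close>
definition dM_int :: "nat \<Rightarrow> nat \<Rightarrow> (real \<Rightarrow> site \<Rightarrow> real) \<Rightarrow> nat \<Rightarrow> (pt \<Rightarrow> real) \<Rightarrow> real \<Rightarrow> real" where
  "dM_int N d Mp q G t =
    (if q = 1 then (\<Sum>x\<in>Lam N d. eps N ^ d * LS_int (\<lambda>s. Mp s x) (\<lambda>s. G (s, x)) t)
     else (\<Sum>x\<in>Lam N d. \<Sum>s\<in>{s\<in>{0..<t}. jmp (\<lambda>r. Mp r x) s \<noteq> 0}.
             G (s, x) * (eps N ^ d * jmp (\<lambda>r. Mp r x) s) ^ q))"

definition z0 :: "nat \<Rightarrow> pt" where "z0 = (\<lambda>_. (0, \<lambda>_. 0))"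

fun ITI :: "nat \<Rightarrow> nat \<Rightarrow> (real \<Rightarrow> site \<Rightarrow> real) \<Rightarrow> (nat \<Rightarrow> nat) \<Rightarrow> nat \<Rightarrow> ((nat \<Rightarrow> pt) \<Rightarrow> real) \<Rightarrow> real \<Rightarrow> real" where
  "ITI N d Mp ks 0 H t = H z0"
| "ITI N d Mp ks (Suc j) H t =
     dM_int N d Mp (ks (Suc j)) (\<lambda>w. ITI N d Mp ks j (\<lambda>z. H (z(Suc j := w))) (fst w)) t"

text \<open>sigma j = gamma_j is the j-th component; cls i is the index of the component of i.\<close>
definition cls :: "(nat \<Rightarrow> nat set) \<Rightarrow> nat \<Rightarrow> nat \<Rightarrow> nat" where
  "cls \<sigma> m i = (THE j. j \<in> {1..m} \<and> i \<in> \<sigma> j)"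

definition Fgs :: "nat \<Rightarrow> (nat \<Rightarrow> nat set) \<Rightarrow> nat \<Rightarrow> ((nat \<Rightarrow> pt) \<Rightarrow> real) \<Rightarrow> (nat \<Rightarrow> pt) \<Rightarrow> real" where
  "Fgs n \<sigma> m F z = F (\<lambda>i\<in>{1..n}. z (cls \<sigma> m i))"

definition Iint :: "nat \<Rightarrow> nat \<Rightarrow> (real \<Rightarrow> site \<Rightarrow> real) \<Rightarrow> nat \<Rightarrow> (nat \<Rightarrow> nat set) \<Rightarrow> nat \<Rightarrow>
    ((nat \<Rightarrow> pt) \<Rightarrow> real) \<Rightarrow> real \<Rightarrow> real" where
  "Iint N d Mp n \<sigma> m F t = ITI N d Mp (\<lambda>j. card (\<sigma> j)) m (Fgs n \<sigma> m F) t"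

definition epowr :: "ennreal \<Rightarrow> real \<Rightarrow> ennreal" where
  "epowr x a = (if x = \<infinity> then \<infinity> else ennreal (enn2real x powr a))"

datatype expo = E1 | E2 | Einf

definition Lnorm :: "nat \<Rightarrow> nat \<Rightarrow> real \<Rightarrow> expo \<Rightarrow> (pt \<Rightarrow> ennreal) \<Rightarrow> ennreal" where
  "Lnorm N d T q G = (case q of
      E1 \<Rightarrow> ennreal (eps N ^ d) * (\<Sum>x\<in>Lam N d. \<integral>\<^sup>+ r. G (r, x) * indicator {0..T} r \<partial>lborel)
    | E2 \<Rightarrow> epowr (ennreal (eps N ^ d) * (\<Sum>x\<in>Lam N d. \<integral>\<^sup>+ r. (G (r, x))\<^sup>2 * indicator {0..T} r \<partial>lborel)) (1/2)
    | Einf \<Rightarrow> (SUP w\<in>{0..T} \<times> Lam N d. G w))"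

fun normL :: "nat \<Rightarrow> nat \<Rightarrow> real \<Rightarrow> (nat \<Rightarrow> expo) \<Rightarrow> nat \<Rightarrow> ((nat \<Rightarrow> pt) \<Rightarrow> real) \<Rightarrow> ennreal" where
  "normL N d T pv 0 H = ennreal \<bar>H z0\<bar>"
| "normL N d T pv (Suc j) H =
     Lnorm N d T (pv (Suc j)) (\<lambda>w. normL N d T pv j
        (\<lambda>z. H (z(Suc j := w)) * (if j = 0 then 1 else if fst (z j) < fst w then 1 else 0)))"

definition tderiv :: "(real \<Rightarrow> real) \<Rightarrow> real \<Rightarrow> real" where
  "tderiv f s = (SOME D. (f has_real_derivative D) (at s within {0..}))"

definition C1norm :: "nat \<Rightarrow> nat \<Rightarrow> real \<Rightarrow> nat \<Rightarrow> nat \<Rightarrow> ((nat \<Rightarrow> pt) \<Rightarrow> real) \<Rightarrow> ennreal" where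
  "C1norm N d T m i H =
    (let Z = {z. \<forall>j\<in>{1..m}. z j \<in> {0..T} \<times> Lam N d};
         \<phi> = (\<lambda>z s. H (z(i := (s, snd (z i)))))
     in if (\<forall>z\<in>Z. \<exists>D. (\<phi> z has_real_derivative D) (at (fst (z i)) within {0..}))
        then (SUP z\<in>Z. ennreal \<bar>H z\<bar>) + (SUP z\<in>Z. ennreal \<bar>tderiv (\<phi> z) (fst (z i))\<bar>)
        else \<infinity>)"

definition C1_time :: "nat \<Rightarrow> nat \<Rightarrow> nat \<Rightarrow> ((nat \<Rightarrow> pt) \<Rightarrow> real) \<Rightarrow> bool" where
  "C1_time N d n F \<longleftrightarrow>
    (\<forall>z\<in>PiE {1..n} (\<lambda>_. {0..} \<times> Lam N d). \<forall>i\<in>{1..n}.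
       \<exists>F'. continuous_on {0..} F' \<and>
         (\<forall>s\<ge>0. ((\<lambda>s. F (z(i := (s, snd (z i))))) has_real_derivative F' s) (at s within {0..})))"

definition Gamma1 :: "(nat \<Rightarrow> nat set) \<Rightarrow> nat \<Rightarrow> nat set" where
  "Gamma1 \<sigma> m = {i\<in>{1..m}. card (\<sigma> i) = 1}"

definition Padm :: "(nat \<Rightarrow> nat set) \<Rightarrow> nat \<Rightarrow> (nat \<Rightarrow> expo) set" where
  "Padm \<sigma> m = {pv \<in> PiE {1..m} (\<lambda>_. {E1, E2, Einf}). {i\<in>{1..m}. pv i = E1} \<inter> Gamma1 \<sigma> m = {}}"

definition Jinf :: "(nat \<Rightarrow> nat set) \<Rightarrow> nat \<Rightarrow> (nat \<Rightarrow> expo) \<Rightarrow> nat set" where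
  "Jinf \<sigma> m pv = {i\<in>{1..m}. pv i = Einf \<and> i \<notin> Gamma1 \<sigma> m \<and> i \<ge> 2}"

definition alpha :: "nat \<Rightarrow> real \<Rightarrow> (nat \<Rightarrow> nat set) \<Rightarrow> nat \<Rightarrow> (nat \<Rightarrow> expo) \<Rightarrow> real" where
  "alpha d k \<sigma> m pv = (real d + k) *
     (real (\<Sum>i\<in>{1..m}. card (\<sigma> i)) - 2 * real (card {i\<in>{1..m}. pv i = E1})
       - real (card {i\<in>{1..m}. pv i = E2}))"

definition beta :: "real \<Rightarrow> (nat \<Rightarrow> nat set) \<Rightarrow> nat \<Rightarrow> (nat \<Rightarrow> expo) \<Rightarrow> real" where
  "beta p \<sigma> m pv = ((p - 1) / p) ^ card (Jinf \<sigma> m pv)"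

definition beta_i :: "real \<Rightarrow> (nat \<Rightarrow> nat set) \<Rightarrow> nat \<Rightarrow> (nat \<Rightarrow> expo) \<Rightarrow> nat \<Rightarrow> real" where
  "beta_i p \<sigma> m pv i = ((p - 1) / p) ^ card {j\<in>Jinf \<sigma> m pv. j \<ge> i + 1}"

definition RHS :: "nat \<Rightarrow> nat \<Rightarrow> real \<Rightarrow> real \<Rightarrow> real \<Rightarrow> ((nat \<Rightarrow> expo) \<Rightarrow> nat \<Rightarrow> real) \<Rightarrow>
    real \<Rightarrow> (nat \<Rightarrow> nat set) \<Rightarrow> nat \<Rightarrow> ((nat \<Rightarrow> pt) \<Rightarrow> real) \<Rightarrow> ennreal" where
  "RHS N d k p T \<kappa> Cst \<sigma> m G =
    ennreal Cst * (\<Sum>pv\<in>Padm \<sigma> m.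
       ennreal (eps N powr alpha d k \<sigma> m pv) * epowr (normL N d T pv m G) (beta p \<sigma> m pv) *
       epowr (\<Prod>i\<in>Jinf \<sigma> m pv. ennreal (eps N powr (- \<kappa> pv i)) *
                 epowr (C1norm N d T m i G) (beta_i p \<sigma> m pv i)) (1 / p))"

end

theory Submission
 imports Defs
begin

text \<open>Integrating out the last component turns the iterated integral into a one-parameter stochastic
integral against the noise (component of size one) or a sum over its jumps (larger component), whose
integrand is an iterated integral of one level less. A component of size one is handled by the
compensated Ito formula for even powers, absorption and Doob's inequality, and contributes an L2 norm
plus a jump-sized multiple of a supremum norm; a larger component is handled by the bound on the jump
intensity and contributes L1 and supremum norms. This gives the estimate for even exponents without
any derivative norms; since times lie in [0,1] and the spatial measure is normalised, every mixed norm is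
bounded by the supremum, and the exponents on the right-hand side sum to one, so the stated bound follows.\<close>

section \<open>Riemann sums and one-sided continuity\<close>

text \<open>Two obstacles shape the proof. Integrands are adapted processes with left-continuous
  paths, and every fact about their sums over jumps or their integrals is obtained as a limit of
  Riemann sums on the deterministic grids \<open>tp u n\<close>, by Fatou or dominated convergence.
  The jump intensity comes from the quadratic variation: a jump has size exactly \<open>a\<close>,
  so Chebyshev at level \<open>a/2\<close> bounds the conditional probability of a jump in a short
  interval. Domination is uniform: all integrals are bounded by a constant times a power of one plus
  the number of jumps before time 1, a variable with all moments. The second obstacle is the
  regularity of \<open>F\<close>. It is C1 in each variable separately, while a component with
  several elements moves along a diagonal. From the second component on, a finite and nontrivial
  right-hand side forces differentiability along that diagonal. For the first component no such norm
  occurs and only Borel measurability is left, so jump sums must also be treated for deterministic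
  Borel integrands. This works because jump times almost surely avoid any fixed null set.\<close>

abbreviation borel_on :: "real => (real => real) => bool" where
 "borel_on u f \<equiv> (%s. indicator {0..<u} s * f s) \<in> borel_measurable borel"

definition tp :: "real => nat => nat => real" where
 "tp u n i = u * real i / real n"

text \<open>Cells are open on the left and closed on the right, hence the ceiling minus one: the
  grid point attached to \<open>s\<close> lies strictly before \<open>s\<close> even when
  \<open>s\<close> is itself a grid point. A Riemann sum then weights the jump at \<open>s\<close>
  by the integrand strictly before it.\<close>

definition tidx :: "real => nat => real => nat" where
 "tidx u n s = nat (\<lceil>real n * s / u\<rceil> - 1)"

definition lgrid :: "real => nat => real => real" where
 "lgrid u n s = tp u n (tidx u n s)"

lemma tp_0 [simp]: "tp u n 0 = 0"
 by (simp add: tp_def)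

lemma tp_n [simp]: "n > 0 ==> tp u n n = u"
 by (simp add: tp_def)

lemma tp_mono: "u \<ge> 0 ==> i <= j ==> tp u n i <= tp u n j"
 unfolding tp_def by (intro divide_right_mono mult_left_mono) auto

lemma tp_nonneg: "u \<ge> 0 ==> 0 <= tp u n i"
 by (simp add: tp_def)

lemma tp_Suc: "tp u n (Suc i) = tp u n i + u / real n"
 by (simp add: tp_def field_simps add_divide_distrib)

lemma tp_le: "u \<ge> 0 ==> i <= n ==> n > 0 ==> tp u n i <= u"
 using tp_mono[of u i n n] by simp

lemma tp_less: "u > 0 ==> i < n ==> tp u n i < u"
 by (simp add: tp_def divide_simps)

lemma tidx_props:
 assumes "u > 0" "n > 0" "0 < s" "s <= u"
 shows "tidx u n s < n" "tp u n (tidx u n s) < s" "s <= tp u n (Suc (tidx u n s))"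
proof -
 let ?r = "real n * s / u"
 have r0: "?r > 0" using assms by simp
 then have c1: "\<lceil>?r\<rceil> \<ge> 1" by linarith
 have rn: "?r <= real n" using assms by (simp add: divide_simps)
 then have c2: "\<lceil>?r\<rceil> <= int n" by (simp add: ceiling_le_iff)
 have e: "real (tidx u n s) = of_int \<lceil>?r\<rceil> - 1"
  unfolding tidx_def using c1 by (simp add: of_nat_nat)
 show "tidx u n s < n" unfolding tidx_def using c1 c2 assms(2) by linarith
 have "real (tidx u n s) < ?r" unfolding e by linarith
 then show "tp u n (tidx u n s) < s"
  unfolding tp_def using assms by (simp add: field_simps)
 have "?r <= real (Suc (tidx u n s))" using e by (simp add: le_of_int_ceiling)
 then show "s <= tp u n (Suc (tidx u n s))"
  unfolding tp_def using assms by (simp add: field_simps)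
qed

lemma tidx_unique:
 assumes "u > 0" "n > 0" "tp u n i < s" "s <= tp u n (Suc i)"
 shows "tidx u n s = i"
proof -
 let ?r = "real n * s / u"
 have "real i < ?r" "?r <= real i + 1"
  using assms unfolding tp_def by (simp_all add: field_simps)
 then have "\<lceil>?r\<rceil> = int i + 1" by (simp add: ceiling_eq_iff)
 then show ?thesis unfolding tidx_def by simp
qed

lemma tidx_iff:
 assumes "u > 0" "n > 0" "i < n"
 shows "tp u n i < s \<and> s <= tp u n (Suc i) \<longleftrightarrow> 0 < s \<and> s <= u \<and> tidx u n s = i"
proof
 assume A: "tp u n i < s \<and> s <= tp u n (Suc i)"
 have "0 <= tp u n i" using assms by (simp add: tp_nonneg)
 moreover have "tp u n (Suc i) <= u" using assms by (intro tp_le) auto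
 ultimately show "0 < s \<and> s <= u \<and> tidx u n s = i"
  using A tidx_unique[OF assms(1,2)] by force
next
 assume "0 < s \<and> s <= u \<and> tidx u n s = i"
 then show "tp u n i < s \<and> s <= tp u n (Suc i)"
  using tidx_props[OF assms(1,2)] by blast
qed

lemma lgrid_bounds:
 assumes "u > 0" "n > 0" "0 < s" "s <= u"
 shows "lgrid u n s < s" "s - u / real n <= lgrid u n s" "0 <= lgrid u n s" "lgrid u n s < u"
 using tidx_props[OF assms] tp_less[of u "tidx u n s" n] assms unfolding lgrid_def
 by (auto simp: tp_Suc tp_nonneg)

lemma lgrid_at_left:
 assumes "u > 0" "0 < s" "s <= u"
 shows "filterlim (%n. lgrid u n s) (at_left s) sequentially"
proof -
 have ev: "\<forall>\<^sub>F n in sequentially. n > (0::nat)" by (simp add: eventually_gt_at_top)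
 have "(%n. u / real n) \<longlonglongrightarrow> 0" by (rule lim_const_over_n)
 then have l: "(%n. s - u / real n) \<longlonglongrightarrow> s" using tendsto_diff[OF tendsto_const] by force
 have lg: "lgrid u n s < s" "s - u / real n <= lgrid u n s" if "n > 0" for n
  using lgrid_bounds[OF assms(1) that assms(2,3)] by auto
 have "(%n. lgrid u n s) \<longlonglongrightarrow> s"
 proof (rule tendsto_sandwich[OF _ _ l tendsto_const])
  show "\<forall>\<^sub>F n in sequentially. s - u / real n <= lgrid u n s"
   using ev by (rule eventually_mono) (rule lg)
  show "\<forall>\<^sub>F n in sequentially. lgrid u n s <= s"
   using ev by (rule eventually_mono) (rule less_imp_le[OF lg(1)])
 qed
 moreover have "\<forall>\<^sub>F n in sequentially. lgrid u n s \<in> {..<s} \<and> lgrid u n s \<noteq> s"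
  using ev by (rule eventually_mono) (metis lg(1) lessThan_iff less_irrefl)
 ultimately show ?thesis unfolding filterlim_at by blast
qed

lemma sum_tidx:
 fixes f :: "nat => real => 'b::comm_monoid_add"
 assumes "u > 0" "n > 0" "finite S" "S \<subseteq> {0<..u}"
 shows "(\<Sum>i<n. \<Sum>s\<in>{s\<in>S. tp u n i < s \<and> s <= tp u n (Suc i)}. f i s) = (\<Sum>s\<in>S. f (tidx u n s) s)"
proof -
 have "(\<Sum>i<n. \<Sum>s\<in>{s\<in>S. tp u n i < s \<and> s <= tp u n (Suc i)}. f i s)
   = (\<Sum>i<n. \<Sum>s\<in>{s\<in>S. tidx u n s = i}. f (tidx u n s) s)"
 proof (intro sum.cong)
  fix i assume "i \<in> {..<n}"
  then show "{s\<in>S. tp u n i < s \<and> s <= tp u n (Suc i)} = {s\<in>S. tidx u n s = i}"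
   using tidx_iff[OF assms(1,2), of i] assms(4) by auto
 qed auto
 also have "\<dots> = (\<Sum>s\<in>S. f (tidx u n s) s)"
  using tidx_props(1)[OF assms(1,2)] assms(3,4) by (intro sum.group) auto
 finally show ?thesis .
qed

lemma indicator_tidx:
 fixes c :: "nat => real"
 assumes "u > 0" "n > 0"
 shows "indicator {0<..u} s * c (tidx u n s) = (\<Sum>i<n. c i * indicator {tp u n i<..tp u n (Suc i)} s)"
proof (cases "s \<in> {0<..u}")
 case True
 have "(\<Sum>i<n. c i * indicator {tp u n i<..tp u n (Suc i)} s) = (\<Sum>i<n. if i = tidx u n s then c i else 0)"
  using tidx_iff[OF assms, of _ s] True by (intro sum.cong) (auto simp: indicator_def)
 also have "\<dots> = c (tidx u n s)"
  using tidx_props(1)[OF assms] True by simp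
 finally show ?thesis using True by simp
next
 case False
 have "(\<Sum>i<n. c i * indicator {tp u n i<..tp u n (Suc i)} s) = (\<Sum>i<n. 0)"
  using tidx_iff[OF assms, of _ s] False by (intro sum.cong) (auto simp: indicator_def)
 then show ?thesis using False by simp
qed

lemma sum_tidx_integral:
 fixes f :: "real => real"
 assumes "u > 0" "n > 0" "set_integrable lborel {0<..u} f"
 shows "(\<Sum>i<n. c i * (LINT s:{tp u n i<..tp u n (Suc i)}|lborel. f s)) = (LINT s:{0<..u}|lborel. c (tidx u n s) * f s)"
  "set_integrable lborel {0<..u} (%s. c (tidx u n s) * f s)"
proof -
 have i: "set_integrable lborel {tp u n i<..tp u n (Suc i)} f" if "i < n" for i
  by (rule set_integrable_subset[OF assms(3)]) (auto simp: tidx_iff[OF assms(1,2) that, simplified])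
 have eq: "indicator {0<..u} s * (c (tidx u n s) * f s) = (\<Sum>i<n. c i * (indicator {tp u n i<..tp u n (Suc i)} s * f s))" for s
 proof -
  have "indicator {0<..u} s * (c (tidx u n s) * f s) = (indicator {0<..u} s * c (tidx u n s)) * f s" by simp
  also have "\<dots> = (\<Sum>i<n. c i * (indicator {tp u n i<..tp u n (Suc i)} s * f s))"
   unfolding indicator_tidx[OF assms(1,2)] by (simp only: sum_distrib_right mult.assoc)
  finally show ?thesis .
 qed
 show "(\<Sum>i<n. c i * (LINT s:{tp u n i<..tp u n (Suc i)}|lborel. f s)) = (LINT s:{0<..u}|lborel. c (tidx u n s) * f s)"
  unfolding set_lebesgue_integral_def real_scaleR_def eq using i
  by (subst Bochner_Integration.integral_sum) (auto simp: set_integrable_def)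
 show "set_integrable lborel {0<..u} (%s. c (tidx u n s) * f s)"
  unfolding set_integrable_def real_scaleR_def eq using i
  by (intro Bochner_Integration.integrable_sum integrable_mult_right) (auto simp: set_integrable_def)
qed

section \<open>Borel measurability from one-sided regularity\<close>

text \<open>A left-continuous function is the pointwise limit of the step functions
  \<open>f (lgrid u n s)\<close>, since \<open>lgrid u n s\<close> tends to \<open>s\<close>
  strictly from the left. The value at 0 is carried separately by \<open>F\<close>, because 0
  belongs to no cell.\<close>

lemma left_cont_borel:
 fixes f :: "real => real"
 assumes "\<And>s. 0 < s ==> s < u ==> (f \<longlongrightarrow> f s) (at_left s)"
 shows "borel_on u f"
proof (cases "u > 0")
 case True
 define F where "F = (%n s. indicator {0} s * f 0 + indicator {0<..<u} s * (indicator {0<..u} s * f (tp u n (tidx u n s))))"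
 have m: "F (Suc n) \<in> borel_measurable borel" for n
  unfolding F_def indicator_tidx[OF True zero_less_Suc, of _ "%i. f (tp u (Suc n) i)"] by measurable
 have "(%n. F (Suc n) s) \<longlonglongrightarrow> indicator {0..<u} s * f s" for s
 proof (cases "s \<in> {0<..<u}")
  case s: True
  have "(%n. f (lgrid u n s)) \<longlonglongrightarrow> f s"
   using s by (intro filterlim_compose[OF assms lgrid_at_left]) auto
  then have "(%n. f (lgrid u (Suc n) s)) \<longlonglongrightarrow> f s" by (rule LIMSEQ_Suc)
  moreover have "F (Suc n) s = f (lgrid u (Suc n) s)" for n
   using s unfolding F_def lgrid_def by simp
  ultimately show ?thesis using s by simp
 next
  case False
  then have "F (Suc n) s = indicator {0..<u} s * f s" for n
   using True unfolding F_def by (auto simp: indicator_def)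
  then show ?thesis by simp
 qed
 then show ?thesis by (rule borel_measurable_LIMSEQ_real[OF _ m])
next
 case False
 then have "{0..<u} = {}" by auto
 then show ?thesis by simp
qed

text \<open>The open set \<open>U\<close> of points strictly inside one of the chosen left
  neighbourhoods covers \<open>A\<close> up to countably many points: for two leftover points the
  intervals \<open>(r s, s)\<close> are disjoint, so the rationals picked in them are
  distinct.\<close>

lemma left_nbhd_borel:
 fixes A :: "real set"
 assumes "\<And>s. s \<in> A ==> \<exists>r<s. {r<..s} \<subseteq> A"
 shows "A \<in> sets borel"
proof -
 obtain r where r: "\<And>s. s \<in> A ==> r s < s \<and> {r s<..s} \<subseteq> A" using assms by metis
 define U where "U = (\<Union>s\<in>A. {r s<..<s})"
 have U: "open U" unfolding U_def by auto
 have UA: "U \<subseteq> A" unfolding U_def using r by fastforce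
 have "\<forall>s\<in>A. \<exists>q::rat. r s < of_rat q \<and> of_rat q < s" using r of_rat_dense by blast
 then obtain q :: "real => rat" where q: "\<And>s. s \<in> A ==> r s < of_rat (q s) \<and> of_rat (q s) < s" by metis
 have "inj_on q (A - U)"
 proof (rule inj_onI, rule ccontr)
  have *: False if "s \<in> A - U" "t \<in> A - U" "q s = q t" "s < t" for s t
  proof -
   have "r t < of_rat (q s)" "of_rat (q s) < s" using q[of s] q[of t] that by auto
   then have "s \<in> {r t<..<t}" using that by auto
   then show False using that unfolding U_def by blast
  qed
  fix s t assume "s \<in> A - U" "t \<in> A - U" "q s = q t" "s \<noteq> t"
  then show False using *[of s t] *[of t s] by linarith
 qed
 moreover have "countable (q ` (A - U))" by (rule countableI_type)
 ultimately have "countable (A - U)" by (rule countable_image_inj_on[rotated])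
 then have "A - U \<in> sets borel"
  by (rule sets.countable[rotated]) simp
 moreover have "A = U \<union> (A - U)" using UA by auto
 ultimately show ?thesis using U by (metis borel_open sets.Un)
qed

text \<open>Superlevel sets of a function that is lower semicontinuous from the left satisfy the
  hypothesis of \<open>left_nbhd_borel\<close>. Mixed norms of slices enjoy just this one-sided
  property, and this is how their measurability in the last time is obtained.\<close>

lemma left_lsc_borel:
 fixes f :: "real => ennreal"
 assumes "\<And>s X. 0 < s ==> s <= u ==> (\<And>n. 0 < X n \<and> X n < s) ==> X \<longlonglongrightarrow> s ==> f s <= liminf (%n. f (X n))"
 shows "(%s. f s * indicator {0..u} s) \<in> borel_measurable borel"
proof -
 have A: "{s\<in>{0<..u}. a < f s} \<in> sets borel" for a
 proof (rule left_nbhd_borel, rule ccontr)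
  fix s assume s: "s \<in> {s\<in>{0<..u}. a < f s}" and n: "\<not> (\<exists>r<s. {r<..s} \<subseteq> {s\<in>{0<..u}. a < f s})"
  have "\<exists>x. max 0 (s - 1 / real (Suc n)) < x \<and> x < s \<and> f x <= a" for n
  proof -
   let ?r = "max 0 (s - 1 / real (Suc n))"
   have "?r < s" using s by auto
   then obtain x where "x \<in> {?r<..s}" "x \<notin> {s\<in>{0<..u}. a < f s}" using n by blast
   then show ?thesis using s by (intro exI[of _ x]) (auto simp: not_less order.order_iff_strict)
  qed
  then obtain X where X: "\<And>n. max 0 (s - 1 / real (Suc n)) < X n \<and> X n < s \<and> f (X n) <= a" by metis
  have "(%n. 1 / real (Suc n)) \<longlonglongrightarrow> 0" using lim_1_over_n LIMSEQ_Suc by blast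
  then have l: "(%n. s - 1 / real (Suc n)) \<longlonglongrightarrow> s" using tendsto_diff[OF tendsto_const] by force
  have XX: "s - 1 / real (Suc n) <= X n" "X n <= s" "0 < X n" "X n < s" for n
   using X[of n] by (auto simp del: of_nat_Suc)
  have "X \<longlonglongrightarrow> s"
   by (rule tendsto_sandwich[OF _ _ l tendsto_const]) (use XX in auto)
  moreover have "0 < X n \<and> X n < s" for n using XX by simp
  ultimately have "f s <= liminf (%n. f (X n))" using assms s by auto
  also have "\<dots> <= liminf (%n. a)" using X by (intro Liminf_mono) auto
  finally have "f s <= a" by (simp add: Liminf_const)
  then show False using s by auto
 qed
 have "(%s. f s * indicator {0<..u} s) \<in> borel_measurable borel"
 proof (rule borel_measurableI_greater)
  fix a :: ennreal
  have "{s. a < f s * indicator {0<..u} s} = {s\<in>{0<..u}. a < f s}"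
   by (auto simp: indicator_def)
  then show "{s\<in>space borel. a < f s * indicator {0<..u} s} \<in> sets borel" using A by simp
 qed
 then have "(%s. f s * indicator {0<..u} s + f 0 * indicator ({0} \<inter> {0..u}) s) \<in> borel_measurable borel" by simp
 also have "(%s. f s * indicator {0<..u} s + f 0 * indicator ({0} \<inter> {0..u}) s) = (%s. f s * indicator {0..u} s)"
  by (auto simp: indicator_def fun_eq_iff)
 finally show ?thesis .
qed

section \<open>Limits of Riemann sums for jumps and drift\<close>

lemma finite_real_gap:
 fixes S :: "real set"
 assumes "finite S"
 obtains g where "g > 0" "\<And>s t. s \<in> S ==> t \<in> S ==> s < t ==> g <= t - s"
proof (cases "\<exists>s\<in>S. \<exists>t\<in>S. s < t")
 case True
 let ?D = "(%(s,t). t - s) ` {(s,t) \<in> S \<times> S. s < t}"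
 have f: "finite ?D" using assms by (intro finite_imageI finite_subset[OF _ finite_SigmaI[OF assms assms]]) auto
 have ne: "?D \<noteq> {}" using True by auto
 show ?thesis
 proof (rule that[of "Min ?D"])
  show "Min ?D > 0" using f ne by (subst Min_gr_iff) auto
  fix s t assume "s \<in> S" "t \<in> S" "s < t"
  then have "t - s \<in> ?D" by (auto intro!: image_eqI[of _ _ "(s,t)"])
  then show "Min ?D <= t - s" using f by (rule Min_le[rotated])
 qed
next
 case False
 then show ?thesis by (intro that[of 1]) auto
qed

text \<open>As \<open>\<psi>\<close> vanishes near 0, it filters out the cells without a jump as
  soon as the Lipschitz drift \<open>A\<close> moves by less than \<open>r\<close> per cell. Once
  the mesh is also below the smallest gap between jumps, each remaining cell holds exactly one of
  them.\<close>

lemma Riemann_jumps: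
 fixes M A G j \<psi> :: "real => real"
 assumes u: "u > 0" and S: "finite S" "S \<subseteq> {0<..u}"
  and M: "\<And>t. 0 <= t ==> t <= u ==> M t = (\<Sum>s\<in>{s\<in>S. s <= t}. j s) + A t"
  and A: "\<And>s t. 0 <= s ==> s <= t ==> t <= u ==> \<bar>A t - A s\<bar> <= L * (t - s)"
  and r: "r > 0" "\<And>y. \<bar>y\<bar> < r ==> \<psi> y = 0"
  and \<psi>: "\<And>s. s \<in> S ==> isCont \<psi> (j s)"
  and G: "\<And>s. s \<in> S ==> (G \<longlongrightarrow> G s) (at_left s)"
 shows "(%n. \<Sum>i<n. G (tp u n i) * \<psi> (M (tp u n (Suc i)) - M (tp u n i))) \<longlonglongrightarrow> (\<Sum>s\<in>S. G s * \<psi> (j s))"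
proof -
 obtain g where g: "g > 0" "\<And>s t. s \<in> S ==> t \<in> S ==> s < t ==> g <= t - s"
  using finite_real_gap[OF S(1)] by blast
 define e where "e = (%n s. A (tp u n (Suc (tidx u n s))) - A (tp u n (tidx u n s)))"
 have inc: "M (tp u n (Suc i)) - M (tp u n i) = (\<Sum>s\<in>{s\<in>S. tp u n i < s \<and> s <= tp u n (Suc i)}. j s) + (A (tp u n (Suc i)) - A (tp u n i))"
  if "i < n" for n i
 proof -
  have b: "0 <= tp u n i" "tp u n i <= tp u n (Suc i)" "tp u n (Suc i) <= u" "tp u n i <= u"
   using u that tp_less[of u i n] by (auto intro: tp_nonneg tp_mono tp_le)
  have "{s\<in>S. s <= tp u n (Suc i)} = {s\<in>S. s <= tp u n i} \<union> {s\<in>S. tp u n i < s \<and> s <= tp u n (Suc i)}"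
   using b by auto
  then have "(\<Sum>s\<in>{s\<in>S. s <= tp u n (Suc i)}. j s) = (\<Sum>s\<in>{s\<in>S. s <= tp u n i}. j s) + (\<Sum>s\<in>{s\<in>S. tp u n i < s \<and> s <= tp u n (Suc i)}. j s)"
   using S(1) by (simp only:) (intro sum.union_disjoint, auto)
  then show ?thesis using M[of "tp u n (Suc i)"] M[of "tp u n i"] b by simp
 qed
 have el: "\<bar>A (tp u n (Suc i)) - A (tp u n i)\<bar> <= L * (u / real n)" if "i < n" for n i
  using A[of "tp u n i" "tp u n (Suc i)"] u that
  by (simp add: tp_Suc tp_nonneg) (metis Suc_leI tp_Suc tp_le less_nat_zero_code not_gr_zero order_less_imp_le)
 have l0: "(%n. u / real n) \<longlonglongrightarrow> 0" by (rule lim_const_over_n)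
 then have l1: "(%n. L * (u / real n)) \<longlonglongrightarrow> 0" using tendsto_mult_right_zero by blast
 have ev: "\<forall>\<^sub>F n in sequentially. u / real n < g \<and> L * (u / real n) < r \<and> n > (0::nat)"
  using order_tendstoD(2)[OF l0 g(1)] order_tendstoD(2)[OF l1 r(1)] eventually_gt_at_top[of 0]
  by eventually_elim simp
 have eq: "\<forall>\<^sub>F n in sequentially. (\<Sum>i<n. G (tp u n i) * \<psi> (M (tp u n (Suc i)) - M (tp u n i)))
   = (\<Sum>s\<in>S. G (lgrid u n s) * \<psi> (j s + e n s))"
  using ev
 proof eventually_elim
  case (elim n)
  have "G (tp u n i) * \<psi> (M (tp u n (Suc i)) - M (tp u n i))
    = (\<Sum>s\<in>{s\<in>S. tp u n i < s \<and> s <= tp u n (Suc i)}. G (tp u n i) * \<psi> (j s + (A (tp u n (Suc i)) - A (tp u n i))))"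
   if i: "i < n" for i
  proof (cases "{s\<in>S. tp u n i < s \<and> s <= tp u n (Suc i)} = {}")
   case True
   show ?thesis unfolding inc[OF i] True using r(2) el[OF i] elim by simp
  next
   case False
   then obtain s where s: "s \<in> S" "tp u n i < s" "s <= tp u n (Suc i)" by auto
   have "t = s" if t: "t \<in> S" "tp u n i < t" "t <= tp u n (Suc i)" for t
   proof (rule ccontr)
    assume "t \<noteq> s"
    then have "g <= \<bar>t - s\<bar>" using g(2)[of s t] g(2)[of t s] s t by (cases "t < s") auto
    moreover have "\<bar>t - s\<bar> < u / real n" using s t unfolding tp_Suc by linarith
    ultimately show False using elim by simp
   qed
   then have "{s\<in>S. tp u n i < s \<and> s <= tp u n (Suc i)} = {s}" using s by blast
   then show ?thesis unfolding inc[OF i] by simp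
  qed
  then have "(\<Sum>i<n. G (tp u n i) * \<psi> (M (tp u n (Suc i)) - M (tp u n i)))
    = (\<Sum>i<n. \<Sum>s\<in>{s\<in>S. tp u n i < s \<and> s <= tp u n (Suc i)}. G (tp u n i) * \<psi> (j s + (A (tp u n (Suc i)) - A (tp u n i))))"
   by (intro sum.cong) auto
  also have "\<dots> = (\<Sum>s\<in>S. G (lgrid u n s) * \<psi> (j s + e n s))"
   unfolding e_def lgrid_def using elim by (intro sum_tidx[OF u _ S]) simp
  finally show ?case .
 qed
 \<comment> \<open>Finitely many terms remain. The weights converge by left continuity of
   \<open>G\<close> at the jumps, the arguments of \<open>\<psi>\<close> because the drift
   \<open>e n s\<close> over one cell vanishes.\<close>
 have "(%n. \<Sum>s\<in>S. G (lgrid u n s) * \<psi> (j s + e n s)) \<longlonglongrightarrow> (\<Sum>s\<in>S. G s * \<psi> (j s))"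
 proof (intro tendsto_sum tendsto_mult)
  fix s assume s: "s \<in> S"
  then have s0: "0 < s" "s <= u" using S(2) by auto
  show "(%n. G (lgrid u n s)) \<longlonglongrightarrow> G s"
   by (rule filterlim_compose[OF G[OF s] lgrid_at_left[OF u s0]])
  have "\<forall>\<^sub>F n in sequentially. norm (e n s) <= L * (u / real n)"
   using ev by eventually_elim (unfold e_def real_norm_def, rule el, rule tidx_props(1)[OF u _ s0], simp)
  then have "(%n. e n s) \<longlonglongrightarrow> 0" by (rule Lim_null_comparison[OF _ l1])
  then have "(%n. j s + e n s) \<longlonglongrightarrow> j s" using tendsto_add[OF tendsto_const[of "j s"]] by fastforce
  then show "(%n. \<psi> (j s + e n s)) \<longlonglongrightarrow> \<psi> (j s)"
   by (rule isCont_tendsto_compose[OF \<psi>[OF s]])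
 qed
 then show ?thesis by (rule Lim_transform_eventually) (use eq in eventually_elim, rule sym)
qed

text \<open>The sum is the integral of the step function \<open>G (lgrid u n s)\<close> against
  \<open>D\<close>, and dominated convergence applies. The endpoint \<open>u\<close> is discarded as
  a null set, since left continuity of \<open>G\<close> is known only before it.\<close>

lemma Riemann_drift:
 fixes G D :: "real => real"
 assumes u: "u > 0" and D: "set_borel_measurable borel {0<..u} D" "\<And>s. 0 < s ==> s <= u ==> \<bar>D s\<bar> <= B"
  and G: "\<And>s. 0 < s ==> s < u ==> (G \<longlongrightarrow> G s) (at_left s)" "\<And>s. 0 <= s ==> s < u ==> \<bar>G s\<bar> <= K"
 shows "(%n. \<Sum>i<n. G (tp u n i) * (LINT s:{tp u n i<..tp u n (Suc i)}|lborel. D s)) \<longlonglongrightarrow> (LINT s:{0<..<u}|lborel. G s * D s)"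
proof -
 have K: "K \<ge> 0" using G(2)[of 0] u by force
 have B: "B \<ge> 0" using D(2)[of u] u by force
 have Di: "set_integrable lborel {0<..u} D"
  unfolding set_integrable_def
 proof (rule Bochner_Integration.integrable_bound[where f="%s. B * indicator {0<..u} s"])
  show "(%s. indicator {0<..u} s *\<^sub>R D s) \<in> borel_measurable lborel"
   using D(1) by (simp add: set_borel_measurable_def)
  show "AE s in lborel. norm (indicator {0<..u} s *\<^sub>R D s) <= norm (B * indicator {0<..u} s)"
   using D(2) B by (intro AE_I2) (auto simp: indicator_def)
  show "integrable lborel (%s. B * indicator {0<..u} s)"
   using u by (intro integrable_mult_right integrable_real_indicator) auto
 qed
 have eq: "\<forall>\<^sub>F n in sequentially. (LINT s:{0<..u}|lborel. G (lgrid u n s) * D s) = (\<Sum>i<n. G (tp u n i) * (LINT s:{tp u n i<..tp u n (Suc i)}|lborel. D s))"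
  using eventually_gt_at_top[of 0]
  by eventually_elim (simp add: lgrid_def sum_tidx_integral(1)[OF u _ Di, where c="%i. G (tp u _ i)"])
 have "(%n. LINT s:{0<..u}|lborel. G (lgrid u (Suc n) s) * D s) \<longlonglongrightarrow> (LINT s|lborel. indicator {0<..<u} s *\<^sub>R (G s * D s))"
  unfolding set_lebesgue_integral_def
 proof (rule integral_dominated_convergence[where w="%s. K * B * indicator {0<..u} s"])
  show "integrable lborel (%s. K * B * indicator {0<..u} s)"
   using u by (intro integrable_mult_right integrable_real_indicator) auto
  show m: "(%s. indicator {0<..u} s *\<^sub>R (G (lgrid u (Suc n) s) * D s)) \<in> borel_measurable lborel" for n
   using sum_tidx_integral(2)[OF u zero_less_Suc Di, where c="%i. G (tp u (Suc n) i)"] unfolding lgrid_def set_integrable_def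
   by (rule borel_measurable_integrable)
  show lim: "AE s in lborel. (%n. indicator {0<..u} s *\<^sub>R (G (lgrid u (Suc n) s) * D s)) \<longlonglongrightarrow> indicator {0<..<u} s *\<^sub>R (G s * D s)"
  proof (rule AE_mp[OF AE_lborel_singleton[of u]], rule AE_I2, rule impI)
   fix s assume "s \<noteq> u"
   show "(%n. indicator {0<..u} s *\<^sub>R (G (lgrid u (Suc n) s) * D s)) \<longlonglongrightarrow> indicator {0<..<u} s *\<^sub>R (G s * D s)"
   proof (cases "s \<in> {0<..<u}")
    case True
    then have "(%n. G (lgrid u n s)) \<longlonglongrightarrow> G s"
     by (intro filterlim_compose[OF G(1) lgrid_at_left[OF u]]) auto
    then have "(%n. G (lgrid u (Suc n) s)) \<longlonglongrightarrow> G s" by (rule LIMSEQ_Suc)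
    then show ?thesis using True by (auto intro!: tendsto_intros)
   next
    case False
    then show ?thesis using \<open>s \<noteq> u\<close> by (auto simp: indicator_def)
   qed
  qed
  show "AE s in lborel. norm (indicator {0<..u} s *\<^sub>R (G (lgrid u (Suc n) s) * D s)) <= K * B * indicator {0<..u} s" for n
  proof (rule AE_I2)
   fix s
   show "norm (indicator {0<..u} s *\<^sub>R (G (lgrid u (Suc n) s) * D s)) <= K * B * indicator {0<..u} s"
   proof (cases "s \<in> {0<..u}")
    case True
    then have "\<bar>G (lgrid u (Suc n) s)\<bar> <= K" "\<bar>D s\<bar> <= B"
     using G(2) lgrid_bounds[OF u zero_less_Suc[of n], of s] D(2) by auto
    then have "\<bar>G (lgrid u (Suc n) s)\<bar> * \<bar>D s\<bar> <= K * B" using K by (intro mult_mono) auto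
    then show ?thesis using True by (simp add: abs_mult)
   qed simp
  qed
  have "(%s. indicator {0<..<u} s *\<^sub>R (G s * D s)) = (%s. (indicator {0..<u} s * G s) * (indicator {0<..u} s * D s))"
   by (auto simp: indicator_def fun_eq_iff)
  moreover have "(%s. (indicator {0..<u} s * G s) * (indicator {0<..u} s * D s)) \<in> borel_measurable lborel"
   using left_cont_borel[OF G(1)] D(1) by (simp add: set_borel_measurable_def)
  ultimately show "(%s. indicator {0<..<u} s *\<^sub>R (G s * D s)) \<in> borel_measurable lborel" by simp
 qed
 then have "(%n. LINT s:{0<..u}|lborel. G (lgrid u n s) * D s) \<longlonglongrightarrow> (LINT s:{0<..<u}|lborel. G s * D s)"
  unfolding set_lebesgue_integral_def by (rule LIMSEQ_imp_Suc)
 then show ?thesis by (rule Lim_transform_eventually[OF _ eq])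
qed

section \<open>The Ito formula along a single path\<close>

lemma set_integrable_bounded:
 fixes D :: "real => real"
 assumes "(%s. indicator A s * D s) \<in> borel_measurable borel" "\<And>s. s \<in> A ==> \<bar>D s\<bar> <= B" "A \<in> sets borel" "A \<subseteq> {a..b}"
 shows "set_integrable lborel A D" "\<bar>LINT s:A|lborel. D s\<bar> <= B * measure lborel A"
proof -
 have fin: "emeasure lborel A < \<infinity>"
  using emeasure_mono[OF assms(4), of lborel] emeasure_lborel_Icc_eq[of a b] by (auto simp: less_top[symmetric] top_unique split: if_splits)
 have iB: "integrable lborel (%s. B * indicator A s)"
  using fin assms(3) by (intro integrable_mult_right integrable_real_indicator) auto
 have le: "norm (indicator A s *\<^sub>R D s) <= B * indicator A s" for s
  using assms(2) by (auto simp: indicator_def)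
 show i: "set_integrable lborel A D"
  unfolding set_integrable_def
 proof (rule Bochner_Integration.integrable_bound[OF iB])
  show "(%s. indicator A s *\<^sub>R D s) \<in> borel_measurable lborel" using assms(1) by simp
  show "AE s in lborel. norm (indicator A s *\<^sub>R D s) <= norm (B * indicator A s)"
   using order_trans[OF le abs_ge_self] by (intro AE_I2) simp
 qed
 have "\<bar>LINT s:A|lborel. D s\<bar> <= (\<integral>s. norm (indicator A s *\<^sub>R D s) \<partial>lborel)"
  unfolding set_lebesgue_integral_def using integral_norm_bound[of lborel "%s. indicator A s *\<^sub>R D s"] by simp
 also have "\<dots> <= (\<integral>s. B * indicator A s \<partial>lborel)"
  using i iB le by (intro integral_mono) (auto simp: set_integrable_def)
 also have "\<dots> = B * measure lborel A" using assms(3) by simp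
 finally show "\<bar>LINT s:A|lborel. D s\<bar> <= B * measure lborel A" .
qed

lemma finite_locally_left:
 fixes S :: "real set" assumes "finite S"
 obtains e where "e > 0" "S \<inter> {t - e<..<t} = {}" "S \<inter> {t<..<t + e} = {}"
proof (cases "S - {t} = {}")
 case True
 then show ?thesis by (intro that[of 1]) auto
next
 case False
 let ?e = "Min ((%s. \<bar>s - t\<bar>) ` (S - {t}))"
 have f: "finite ((%s. \<bar>s - t\<bar>) ` (S - {t}))" using assms by simp
 have ne: "(%s. \<bar>s - t\<bar>) ` (S - {t}) \<noteq> {}" using False by blast
 have pos: "?e > 0" using Min_gr_iff[OF f ne, of 0] by auto
 have le: "?e <= \<bar>s - t\<bar>" if "s \<in> S" "s \<noteq> t" for s using f that by (intro Min_le) auto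
 have "s \<notin> {t - ?e<..<t}" "s \<notin> {t<..<t + ?e}" if "s \<in> S" for s
  using le[OF that] by (cases "s = t"; force)+
 then show ?thesis using pos by (intro that[of ?e]) blast+
qed

lemma sum_less_split:
 fixes S :: "real set" and g :: "real => 'b::comm_monoid_add"
 assumes "finite S" "a <= b"
 shows "(\<Sum>s\<in>{s\<in>S. s < b}. g s) = (\<Sum>s\<in>{s\<in>S. s < a}. g s) + (\<Sum>s\<in>{s\<in>S. a <= s \<and> s < b}. g s)"
proof -
 have "{s\<in>S. s < b} = {s\<in>S. s < a} \<union> {s\<in>S. a <= s \<and> s < b}" using assms by auto
 then show ?thesis using assms(1) by (simp add: sum.union_disjoint disjoint_iff)
qed

lemma set_lebesgue_integral_split:
 fixes g :: "real => real"
 assumes "0 <= a" "a <= b" "set_integrable lborel {0..<a} g" "set_integrable lborel {a..<b} g"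
 shows "(LINT s:{0..<b}|lborel. g s) = (LINT s:{0..<a}|lborel. g s) + (LINT s:{a..<b}|lborel. g s)"
proof -
 have "{0..<b} = {0..<a} \<union> {a..<b}" using assms by auto
 then show ?thesis using set_integral_Un[OF _ assms(3,4)] by simp
qed

text \<open>Change of variables for a left-continuous path with finitely many jumps and an
  absolutely continuous drift. The difference \<open>\<Psi>\<close> of the two sides is continuous
  with zero derivative outside a finite set, hence constant. As \<open>D\<close> is merely
  measurable, \<open>X\<close> cannot be differentiated at a given time; instead the increments of
  \<open>\<Psi>\<close> are shown to be quadratically small.\<close>

lemma ito_path:
 fixes X j D f f' :: "real => real"
 assumes U: "0 <= U" and S: "finite S" "S \<subseteq> {0<..}"
  and D: "borel_on U D" "\<And>s. 0 <= s ==> s < U ==> \<bar>D s\<bar> <= B"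
  and X: "\<And>t. 0 <= t ==> t <= U ==> X t = (\<Sum>s\<in>{s\<in>S. s < t}. j s) + (LINT s:{0..<t}|lborel. D s)"
  and f: "\<And>x. (f has_real_derivative f' x) (at x)"
  and f': "\<And>R. \<exists>C. \<forall>x y. \<bar>x\<bar> <= R --> \<bar>y\<bar> <= R --> \<bar>f' x - f' y\<bar> <= C * \<bar>x - y\<bar>"
  and t: "0 <= t" "t <= U"
 shows "f (X t) = f 0 + (\<Sum>s\<in>{s\<in>S. s < t}. f (X s + j s) - f (X s)) + (LINT s:{0..<t}|lborel. f' (X s) * D s)"
proof (cases "U = 0")
 case True
 then have "t = 0" using t by simp
 moreover have S0: "{s \<in> S. s < 0} = {}" using S(2) by auto
 ultimately show ?thesis using X[of 0] U by (simp add: S0 set_lebesgue_integral_def del: Collect_empty_eq)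
next
 case False
 then have U: "0 < U" using U by simp
 have B: "B \<ge> 0" using D(2)[of 0] U by force
 have Dm: "(%s. indicator {a..<b} s * D s) \<in> borel_measurable borel" if "0 <= a" "b <= U" for a b
 proof -
  have "(%s. indicator {a..<b} s * D s) = (%s. indicator {a..<b} s * (indicator {0..<U} s * D s))"
   using that by (auto simp: indicator_def fun_eq_iff)
  then show ?thesis using D(1) by simp
 qed
 have Di: "set_integrable lborel {a..<b} D" "\<bar>LINT s:{a..<b}|lborel. D s\<bar> <= B * (b - a)" if "0 <= a" "a <= b" "b <= U" for a b
 proof -
  have "\<bar>D s\<bar> <= B" if "s \<in> {a..<b}" for s using D(2)[of s] \<open>0 <= a\<close> \<open>b <= U\<close> that by simp
  moreover have "{a..<b} \<subseteq> {a..b}" by auto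
  ultimately show "set_integrable lborel {a..<b} D" "\<bar>LINT s:{a..<b}|lborel. D s\<bar> <= B * (b - a)"
   using set_integrable_bounded[OF Dm[OF \<open>0 <= a\<close> \<open>b <= U\<close>], of B a b] \<open>a <= b\<close> by simp_all
 qed
 have Xinc: "X b = X a + (\<Sum>s\<in>{s\<in>S. a <= s \<and> s < b}. j s) + (LINT s:{a..<b}|lborel. D s)" if "0 <= a" "a <= b" "b <= U" for a b
 proof -
  have "(LINT s:{0..<b}|lborel. D s) = (LINT s:{0..<a}|lborel. D s) + (LINT s:{a..<b}|lborel. D s)"
   using that by (intro set_lebesgue_integral_split Di(1)) auto
  moreover note sum_less_split[OF S(1) that(2), of j]
  ultimately show ?thesis using X[of a] X[of b] that by simp
 qed
 define Sj where "Sj = (\<Sum>s\<in>S. \<bar>j s\<bar>)"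
 \<comment> \<open>\<open>Sj + B * U\<close> bounds \<open>X\<close>, and one more \<open>Sj\<close>
   bounds its value right after a jump. On this range \<open>C1\<close> will be a Lipschitz constant
   and \<open>C2\<close> a bound of \<open>f'\<close>.\<close>
 define R where "R = 2 * Sj + B * U"
 have Sj: "\<bar>sum j T\<bar> <= Sj" if "T \<subseteq> S" for T
  unfolding Sj_def by (rule order_trans[OF sum_abs sum_mono2[OF S(1) that]]) auto
 have Sj0: "Sj \<ge> 0" unfolding Sj_def by (simp add: sum_nonneg)
 have Xb: "\<bar>X t\<bar> <= Sj + B * U" if "0 <= t" "t <= U" for t
 proof -
  have "B * t <= B * U" using that B by (simp add: mult_left_mono)
  then show ?thesis using X[OF that] Di(2)[of 0 t] Sj[of "{s\<in>S. s < t}"] that by auto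
 qed
 have XR: "\<bar>X t\<bar> <= R" "\<bar>X t + (if t \<in> S then j t else 0)\<bar> <= R" if "0 <= t" "t <= U" for t
  using Xb[OF that] Sj0 Sj[of "{t}"] unfolding R_def by (auto split: if_splits)
 obtain C where C0: "\<And>x y. \<bar>x\<bar> <= R ==> \<bar>y\<bar> <= R ==> \<bar>f' x - f' y\<bar> <= C * \<bar>x - y\<bar>" using f'[of R] by blast
 define C1 where "C1 = max C 0"
 have C1: "\<bar>f' x - f' y\<bar> <= C1 * \<bar>x - y\<bar>" if "\<bar>x\<bar> <= R" "\<bar>y\<bar> <= R" for x y
  using C0[OF that] by (rule order_trans) (simp add: C1_def mult_right_mono)
 have C10: "C1 \<ge> 0" by (simp add: C1_def)
 have R0: "R \<ge> 0" using Sj0 B U unfolding R_def by simp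
 define C2 where "C2 = \<bar>f' 0\<bar> + C1 * R"
 have C2: "\<bar>f' x\<bar> <= C2" if "\<bar>x\<bar> <= R" for x
 proof -
  have "C1 * \<bar>x\<bar> <= C1 * R" using that C10 by (intro mult_left_mono) auto
  then show ?thesis using C1[of x 0] that R0 unfolding C2_def by simp
 qed
 have f'c: "isCont f' x" for x
 proof -
  obtain C where C: "\<And>y z. \<bar>y\<bar> <= \<bar>x\<bar> + 1 ==> \<bar>z\<bar> <= \<bar>x\<bar> + 1 ==> \<bar>f' y - f' z\<bar> <= C * \<bar>y - z\<bar>"
   using f'[of "\<bar>x\<bar> + 1"] by blast
  have "(f' \<longlongrightarrow> f' x) (at x)"
  proof (rule LIM_zero_cancel, rule Lim_null_comparison)
   show "\<forall>\<^sub>F y in at x. norm (f' y - f' x) <= C * \<bar>y - x\<bar>"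
    unfolding eventually_at using C by (intro exI[of _ 1]) (auto simp: dist_real_def)
   show "((%y. C * \<bar>y - x\<bar>) \<longlongrightarrow> 0) (at x)" by (auto intro!: tendsto_eq_intros)
  qed
  then show ?thesis by (simp add: isCont_def)
 qed
 \<comment> \<open>The mean value theorem gives both: a quadratic error for the first-order
   expansion, by the Lipschitz bound of \<open>f'\<close>, and Lipschitz continuity of
   \<open>f\<close> itself.\<close>
 have mvt: "\<bar>f y - f x - f' x * (y - x)\<bar> <= C1 * \<bar>y - x\<bar> * \<bar>y - x\<bar> \<and> \<bar>f y - f x\<bar> <= C2 * \<bar>y - x\<bar>" if "\<bar>x\<bar> <= R" "\<bar>y\<bar> <= R" for x y
 proof -
  obtain z where z: "min x y <= z" "z <= max x y" "f y - f x = f' z * (y - x)"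
  proof (cases x y rule: linorder_cases)
   case less
   from MVT2[OF this, of f f'] f obtain z where "z > x" "z < y" "f y - f x = (y - x) * f' z" by blast
   then show ?thesis by (intro that[of z]) (auto simp: algebra_simps)
  next
   case equal then show ?thesis using that by auto
  next
   case greater
   from MVT2[OF this, of f f'] f obtain z where "z > y" "z < x" "f x - f y = (x - y) * f' z" by blast
   then show ?thesis by (intro that[of z]) (auto simp: algebra_simps)
  qed
  have zR: "\<bar>z\<bar> <= R" "\<bar>z - x\<bar> <= \<bar>y - x\<bar>" using z that by auto
  have "\<bar>f y - f x - f' x * (y - x)\<bar> = \<bar>f' z - f' x\<bar> * \<bar>y - x\<bar>"
   unfolding z(3) by (simp add: abs_mult[symmetric] algebra_simps)
  also have "\<dots> <= (C1 * \<bar>y - x\<bar>) * \<bar>y - x\<bar>"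
   using C1[OF zR(1) that(1)] zR(2) C10 by (intro mult_right_mono order_trans[OF C1[OF zR(1) that(1)]] mult_left_mono) auto
  finally show ?thesis using C2[OF zR(1)] unfolding z(3) abs_mult by (simp add: mult_right_mono)
 qed
 have Xl: "(X \<longlongrightarrow> X s) (at_left s)" if "0 < s" "s < U" for s
 proof -
  obtain e where e: "e > 0" "S \<inter> {s - e<..<s} = {}" by (rule finite_locally_left[OF S(1), of s])
  have ev: "\<forall>\<^sub>F r in at_left s. max 0 (s - e) < r \<and> r < s"
   by (rule eventually_at_leftI[of "max 0 (s - e)"]) (use that e(1) in auto)
  show ?thesis
  proof (rule LIM_zero_cancel, rule Lim_null_comparison)
   show "\<forall>\<^sub>F r in at_left s. norm (X r - X s) <= B * (s - r)"
    using ev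
   proof eventually_elim
    case (elim r)
    have "q \<notin> S" if "r <= q" "q < s" for q using e(2) elim that by (auto simp: disjoint_iff)
    then have "{q \<in> S. r <= q \<and> q < s} = {}" by blast
    moreover have "0 <= r" "r <= s" "s <= U" using elim that by auto
    ultimately show ?case using Xinc[of r s] Di(2)[of r s] by (simp del: Collect_empty_eq)
   qed
   show "((%r. B * (s - r)) \<longlongrightarrow> 0) (at_left s)" by (auto intro!: tendsto_eq_intros)
  qed
 qed
 have Xm: "borel_on U X"
  by (rule left_cont_borel[OF Xl])
 have f'm: "f' \<in> borel_measurable borel"
  using f'c by (intro borel_measurable_continuous_onI) (simp add: continuous_on_eq_continuous_at)
 have gm: "(%s. indicator {a..<b} s * (g (X s) * D s)) \<in> borel_measurable borel" if "0 <= a" "b <= U" "g \<in> borel_measurable borel" for a b and g :: "real => real"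
 proof -
  have "(%s. indicator {a..<b} s * (g (X s) * D s)) = (%s. g (indicator {0..<U} s * X s) * (indicator {a..<b} s * D s))"
   using that by (auto simp: indicator_def fun_eq_iff)
  then show ?thesis using measurable_compose[OF Xm that(3)] Dm[OF that(1,2)] by simp
 qed
 have gb: "\<bar>f' (X s) * D s\<bar> <= C2 * B" if "0 <= s" "s < U" for s
  unfolding abs_mult using C2[OF XR(1)] D(2) that B C2[of 0] R0 by (intro mult_mono) auto
 have gi: "set_integrable lborel {a..<b} (%s. f' (X s) * D s)" "\<bar>LINT s:{a..<b}|lborel. f' (X s) * D s\<bar> <= C2 * B * (b - a)"
  if "0 <= a" "a <= b" "b <= U" for a b
 proof -
  have "\<bar>f' (X s) * D s\<bar> <= C2 * B" if "s \<in> {a..<b}" for s using gb[of s] \<open>0 <= a\<close> \<open>b <= U\<close> that by simp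
  moreover have "{a..<b} \<subseteq> {a..b}" by auto
  ultimately show "set_integrable lborel {a..<b} (%s. f' (X s) * D s)" "\<bar>LINT s:{a..<b}|lborel. f' (X s) * D s\<bar> <= C2 * B * (b - a)"
   using set_integrable_bounded[OF gm[OF \<open>0 <= a\<close> \<open>b <= U\<close> f'm], of "C2 * B" a b] \<open>a <= b\<close> by simp_all
 qed
 define \<Psi> where "\<Psi> = (%t. f (X t) - (\<Sum>s\<in>{s\<in>S. s < t}. f (X s + j s) - f (X s)) - (LINT s:{0..<t}|lborel. f' (X s) * D s))"
 have \<Psi>inc: "\<Psi> b - \<Psi> a = f (X b) - f (X a) - (\<Sum>s\<in>{s\<in>S. a <= s \<and> s < b}. f (X s + j s) - f (X s)) - (LINT s:{a..<b}|lborel. f' (X s) * D s)"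
  if "0 <= a" "a <= b" "b <= U" for a b
 proof -
  have "(LINT s:{0..<b}|lborel. f' (X s) * D s) = (LINT s:{0..<a}|lborel. f' (X s) * D s) + (LINT s:{a..<b}|lborel. f' (X s) * D s)"
   using that by (intro set_lebesgue_integral_split gi(1)) auto
  moreover note sum_less_split[OF S(1) that(2), of "%s. f (X s + j s) - f (X s)"]
  ultimately show ?thesis unfolding \<Psi>_def by linarith
 qed
 \<comment> \<open>On an interval without jumps both \<open>f (X b) - f (X a)\<close> and the drift
   integral equal \<open>f' (X a) * (X b - X a)\<close> up to a quadratic error, the former by
   Taylor expansion, the latter by freezing \<open>f' (X s)\<close> at \<open>s = a\<close>.\<close>
 have quad: "\<bar>\<Psi> b - \<Psi> a\<bar> <= 2 * C1 * B * B * (b - a) * (b - a)"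
  if ab: "0 <= a" "a <= b" "b <= U" and no: "{s\<in>S. a <= s \<and> s < b} = {}" for a b
 proof -
  have dX: "X r - X a = (LINT s:{a..<r}|lborel. D s)" "\<bar>X r - X a\<bar> <= B * (r - a)" if "a <= r" "r <= b" for r
  proof -
   have e: "{s\<in>S. a <= s \<and> s < r} = {}" using no that by auto
   have "r <= U" using ab that by simp
   then show "X r - X a = (LINT s:{a..<r}|lborel. D s)" using Xinc[OF ab(1) that(1)] unfolding e by simp
   then show "\<bar>X r - X a\<bar> <= B * (r - a)" using Di(2)[of a r] ab that by simp
  qed
  have i1: "set_integrable lborel {a..<b} (%s. f' (X a) * D s)" using Di(1)[OF ab] by (rule set_integrable_mult_right)
  have "(LINT s:{a..<b}|lborel. f' (X s) * D s) - f' (X a) * (X b - X a) = (LINT s:{a..<b}|lborel. f' (X s) * D s - f' (X a) * D s)"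
   using dX(1)[of b] ab gi(1)[OF ab] i1 by (simp add: set_integral_diff)
  also have "\<bar>\<dots>\<bar> <= (C1 * (B * (b - a)) * B) * measure lborel {a..<b}"
  proof (rule set_integrable_bounded(2)[where a=a and b=b])
   have "(%s. indicator {a..<b} s * (f' (X s) * D s - f' (X a) * D s)) = (%s. indicator {a..<b} s * (f' (X s) * D s) - f' (X a) * (indicator {a..<b} s * D s))"
    by (auto simp: algebra_simps)
   then show "(%s. indicator {a..<b} s * (f' (X s) * D s - f' (X a) * D s)) \<in> borel_measurable borel"
    using gm[OF ab(1,3) f'm] Dm[OF ab(1,3)] by simp
   fix s assume s: "s \<in> {a..<b}"
   have "\<bar>f' (X s) * D s - f' (X a) * D s\<bar> = \<bar>f' (X s) - f' (X a)\<bar> * \<bar>D s\<bar>"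
    by (simp add: abs_mult[symmetric] algebra_simps)
   also have "\<dots> <= (C1 * (B * (b - a))) * B"
   proof (rule mult_mono)
    have "\<bar>X s - X a\<bar> <= B * (s - a)" using dX(2)[of s] s by auto
    also have "\<dots> <= B * (b - a)" using s B by (intro mult_left_mono) auto
    finally show "\<bar>f' (X s) - f' (X a)\<bar> <= C1 * (B * (b - a))"
     using C10 XR(1)[of s] XR(1)[of a] s ab by (intro order_trans[OF C1] mult_left_mono) auto
    show "\<bar>D s\<bar> <= B" using D(2) s ab by auto
    show "0 <= C1 * (B * (b - a))" using C10 B ab by simp
   qed simp
   finally show "\<bar>f' (X s) * D s - f' (X a) * D s\<bar> <= C1 * (B * (b - a)) * B" .
  qed auto
  finally have 1: "\<bar>(LINT s:{a..<b}|lborel. f' (X s) * D s) - f' (X a) * (X b - X a)\<bar> <= C1 * B * B * (b - a) * (b - a)"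
   using ab by (simp add: mult_ac)
  have "C1 * \<bar>X b - X a\<bar> * \<bar>X b - X a\<bar> <= C1 * (B * (b - a)) * (B * (b - a))"
   using dX(2)[of b] ab C10 B by (intro mult_mono) auto
  then have 2: "\<bar>f (X b) - f (X a) - f' (X a) * (X b - X a)\<bar> <= C1 * B * B * (b - a) * (b - a)"
   using mvt[of "X a" "X b"] XR(1)[of a] XR(1)[of b] ab by (simp add: mult_ac)
  show ?thesis using 1 2 \<Psi>inc[OF ab] unfolding no by (auto simp: abs_if split: if_splits)
 qed
 have lip: "\<bar>\<Psi> b - \<Psi> a\<bar> <= 2 * C2 * B * (b - a)"
  if ab: "0 <= a" "a < b" "b <= U" and no: "{s\<in>S. a < s \<and> s < b} = {}" for a b
 proof -
  let ?j = "if a \<in> S then j a else 0"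
  have "s = a" if "s \<in> S" "a <= s" "s < b" for s
   using no that by (cases "s = a") (auto simp: order.order_iff_strict)
  then have S1: "{s\<in>S. a <= s \<and> s < b} = (if a \<in> S then {a} else {})" using ab by auto
  have x: "X b - (X a + ?j) = (LINT s:{a..<b}|lborel. D s)" using Xinc[of a b] ab unfolding S1 by (auto split: if_splits)
  have "\<Psi> b - \<Psi> a = f (X b) - f (X a + ?j) - (LINT s:{a..<b}|lborel. f' (X s) * D s)"
   using \<Psi>inc[of a b] ab unfolding S1 by (auto split: if_splits)
  moreover have "\<bar>f (X b) - f (X a + ?j)\<bar> <= C2 * \<bar>X b - (X a + ?j)\<bar>"
   using mvt[OF XR(2)[of a] XR(1)[of b]] ab by simp
  moreover have "C2 * \<bar>X b - (X a + ?j)\<bar> <= C2 * (B * (b - a))"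
   unfolding x using Di(2)[of a b] ab C2[of 0] R0 by (intro mult_left_mono) auto
  moreover have "\<bar>LINT s:{a..<b}|lborel. f' (X s) * D s\<bar> <= C2 * (B * (b - a))"
   using gi(2)[of a b] ab by (simp add: mult.assoc)
  moreover have "2 * C2 * B * (b - a) = C2 * (B * (b - a)) + C2 * (B * (b - a))" by simp
  ultimately show ?thesis by linarith
 qed
 have "\<Psi> t = \<Psi> 0"
 proof (rule has_derivative_zero_unique_strong_interval[where k="S \<union> {0, U}" and a=0 and b=U and f=\<Psi> and x=t and y="\<Psi> 0"])
  show "finite (S \<union> {0, U})" using S by simp
  show "continuous_on {0..U} \<Psi>"
   unfolding continuous_on_def
  proof
   fix s assume s: "s \<in> {0..U}"
   obtain e where e: "e > 0" "S \<inter> {s - e<..<s} = {}" "S \<inter> {s<..<s + e} = {}" by (rule finite_locally_left[OF S(1), of s])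
   show "(\<Psi> \<longlongrightarrow> \<Psi> s) (at s within {0..U})"
   proof (rule LIM_zero_cancel, rule Lim_null_comparison)
    show "((%r. 2 * C2 * B * \<bar>r - s\<bar>) \<longlongrightarrow> 0) (at s within {0..U})" by (auto intro!: tendsto_eq_intros)
    have "norm (\<Psi> r - \<Psi> s) <= 2 * C2 * B * \<bar>r - s\<bar>" if r: "r \<in> {0..U}" "r \<noteq> s" "\<bar>r - s\<bar> < e" for r
    proof (cases "r < s")
     case True
     have "q \<notin> S" if "r < q" "q < s" for q using e(2) r that by (auto simp: disjoint_iff)
     then have "{q\<in>S. r < q \<and> q < s} = {}" by blast
     then show ?thesis using lip[of r s] r s True by (auto simp: abs_minus_commute)
    next
     case False
     have "q \<notin> S" if "s < q" "q < r" for q using e(3) r that by (auto simp: disjoint_iff)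
     then have "{q\<in>S. s < q \<and> q < r} = {}" by blast
     then show ?thesis using lip[of s r] r s False by (auto simp: abs_minus_commute)
    qed
    then show "\<forall>\<^sub>F r in at s within {0..U}. norm (\<Psi> r - \<Psi> s) <= 2 * C2 * B * \<bar>r - s\<bar>"
     unfolding eventually_at using e(1) by (intro exI[of _ e]) (auto simp: dist_real_def)
   qed
  qed
  show "t \<in> {0..U}" using t by simp
  fix s assume s: "s \<in> {0..U} - (S \<union> {0, U})"
  obtain e where e: "e > 0" "S \<inter> {s - e<..<s} = {}" "S \<inter> {s<..<s + e} = {}" by (rule finite_locally_left[OF S(1), of s])
  define K where "K = 2 * C1 * B * B"
  have q: "\<bar>\<Psi> r - \<Psi> s\<bar> <= K * \<bar>r - s\<bar> * \<bar>r - s\<bar>" if r: "r \<in> {0..U}" "\<bar>r - s\<bar> < e" for r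
  proof (cases "r < s")
   case True
   have "q \<notin> S" if "r <= q" "q < s" for q using e(2) r that by (auto simp: disjoint_iff)
   then have "{q\<in>S. r <= q \<and> q < s} = {}" by auto
   then show ?thesis using quad[of r s] r s True unfolding K_def by (auto simp: abs_minus_commute)
  next
   case False
   have "q \<notin> S" if "s <= q" "q < r" for q
    using e(3) r s that by (cases "q = s") (auto simp: disjoint_iff)
   then have "{q\<in>S. s <= q \<and> q < r} = {}" by auto
   then show ?thesis using quad[of s r] r s False unfolding K_def by (auto simp: abs_minus_commute)
  qed
  have "((%r. (\<Psi> r - \<Psi> s) /\<^sub>R norm (r - s)) \<longlongrightarrow> 0) (at s within {0..U})"
  proof (rule Lim_null_comparison)
   show "((%r. K * \<bar>r - s\<bar>) \<longlongrightarrow> 0) (at s within {0..U})" by (auto intro!: tendsto_eq_intros)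
   have "norm ((\<Psi> r - \<Psi> s) /\<^sub>R norm (r - s)) <= K * \<bar>r - s\<bar>" if "r \<in> {0..U}" "r \<noteq> s" "\<bar>r - s\<bar> < e" for r
    using q[of r] that by (simp add: divide_simps abs_mult)
   then show "\<forall>\<^sub>F r in at s within {0..U}. norm ((\<Psi> r - \<Psi> s) /\<^sub>R norm (r - s)) <= K * \<bar>r - s\<bar>"
    unfolding eventually_at using e(1) by (intro exI[of _ e]) (auto simp: dist_real_def)
  qed
  then show "(\<Psi> has_derivative (%h. 0)) (at s within {0..U})"
   unfolding has_derivative_at_within by simp
 qed simp
 moreover have "\<Psi> 0 = f 0"
 proof -
  have "{s \<in> S. s < 0} = {}" using S(2) by auto
  then show ?thesis using X[of 0] U unfolding \<Psi>_def by (simp add: \<open>{s \<in> S. s < 0} = {}\<close> set_lebesgue_integral_def del: Collect_empty_eq)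
 qed
 ultimately show ?thesis unfolding \<Psi>_def by simp
qed

text \<open>Infinitely many such jumps would accumulate at some \<open>l\<close>. On either side of
  \<open>l\<close> the path stays within \<open>a/4\<close> of its one-sided limit, so every jump
  close to \<open>l\<close> but different from it is smaller than \<open>a\<close>.\<close>

lemma cadlag_finite_jumps:
 assumes X: "cadlag X" and a: "a > 0"
 shows "finite {s\<in>{0..t}. a <= \<bar>jmp X s\<bar>}"
proof (rule ccontr)
 let ?T = "{s\<in>{0..t}. a <= \<bar>jmp X s\<bar>}"
 assume "infinite ?T"
 then obtain l where l: "l \<in> {0..t}" "l islimpt ?T"
  using compact_eq_Bolzano_Weierstrass[of "{0..t}"] compact_Icc by (metis (no_types, lifting) mem_Collect_eq subsetI)
 have small: "\<bar>jmp X s\<bar> < a" if s: "0 < s" "b < s" and near: "\<And>r. b < r ==> r <= s ==> dist (X r) y < a/4" for s b y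
 proof -
  obtain z where z: "(X \<longlongrightarrow> z) (at_left s)" using X s unfolding cadlag_def by auto
  have "\<forall>\<^sub>F r in at_left s. dist (X r) y <= a/4"
   by (rule eventually_at_leftI[OF _ s(2)]) (use near in \<open>auto intro: less_imp_le\<close>)
  moreover have "((%r. dist (X r) y) \<longlongrightarrow> dist z y) (at_left s)" by (intro tendsto_intros z)
  ultimately have "dist z y <= a/4" by (intro tendsto_upperbound[of "%r. dist (X r) y" _ "at_left s"]) auto
  moreover have "dist (X s) y < a/4" using near[of s] s by simp
  moreover have "jmp X s = X s - z" unfolding jmp_def using s tendsto_Lim[OF _ z] by simp
  ultimately show ?thesis using a unfolding dist_real_def by linarith
 qed
 have "(X \<longlongrightarrow> X l) (at_right l)" using X l unfolding cadlag_def continuous_within by simp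
 then have "\<forall>\<^sub>F r in at_right l. dist (X r) (X l) < a/4" using a by (intro tendstoD) auto
 then obtain b where b: "b > l" "\<And>r. l < r ==> r < b ==> dist (X r) (X l) < a/4"
  unfolding eventually_at_right_field by blast
 have R: "s \<notin> ?T" if "l < s" "s < b" for s
 proof -
  have "0 < s" using l(1) that by simp
  then have "\<bar>jmp X s\<bar> < a" using b that by (intro small[of s l "X l"]) auto
  then show ?thesis by simp
 qed
 have "\<exists>b'<l. \<forall>s. b' < s --> s < l --> s \<notin> ?T"
 proof (cases "l = 0")
  case True then show ?thesis by (intro exI[of _ "-1"]) auto
 next
  case False
  then have "l > 0" using l(1) by simp
  then obtain z where z: "(X \<longlongrightarrow> z) (at_left l)" using X unfolding cadlag_def by auto
  then have "\<forall>\<^sub>F r in at_left l. dist (X r) z < a/4" using a by (intro tendstoD) auto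
  then obtain c where c: "c < l" "\<And>r. c < r ==> r < l ==> dist (X r) z < a/4"
   unfolding eventually_at_left_field by blast
  have "s \<notin> ?T" if "max 0 c < s" "s < l" for s
  proof -
   have "\<bar>jmp X s\<bar> < a" using c that by (intro small[of s c z]) auto
   then show ?thesis by simp
  qed
  then show ?thesis using c \<open>l > 0\<close> by (intro exI[of _ "max 0 c"]) auto
 qed
 then obtain b' where b': "b' < l" "\<And>s. b' < s ==> s < l ==> s \<notin> ?T" by blast
 obtain y where "y \<in> ?T" "y \<in> {b'<..<b}" "y \<noteq> l"
  using islimptE[OF l(2), of "{b'<..<b}"] b b' by auto
 then show False using R[of y] b'(2)[of y] by (cases "y < l") auto
qed

section \<open>Elementary inequalities for powers\<close>

text \<open>Only the tail of the binomial expansion from order \<open>n\<close> on remains. Each of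
  its monomials is bounded by the first term if \<open>\<bar>y\<bar> <= \<bar>x\<bar>\<close> and by
  the second otherwise, and the binomial coefficients sum to at most \<open>2 ^ p\<close>.\<close>

lemma power_diff_bound:
 fixes x y :: real
 assumes p: "n <= p"
 shows "\<bar>(x + y) ^ p - (\<Sum>k<n. real (p choose k) * x ^ (p - k) * y ^ k)\<bar> <= 2 ^ p * (\<bar>x\<bar> ^ (p - n) * \<bar>y\<bar> ^ n + \<bar>y\<bar> ^ p)"
proof -
 have "(x + y) ^ p = (y + x) ^ p" by (simp add: add.commute)
 also have "\<dots> = (\<Sum>k\<le>p. real (p choose k) * y ^ k * x ^ (p - k))" by (rule binomial_ring)
 also have "\<dots> = (\<Sum>k<n. real (p choose k) * y ^ k * x ^ (p - k)) + (\<Sum>k\<in>{n..p}. real (p choose k) * y ^ k * x ^ (p - k))"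
 proof -
  have "{..p} = {..<n} \<union> {n..p}" using p by auto
  then show ?thesis by (simp only:) (rule sum.union_disjoint, auto)
 qed
 finally have "(x + y) ^ p - (\<Sum>k<n. real (p choose k) * x ^ (p - k) * y ^ k) = (\<Sum>k\<in>{n..p}. real (p choose k) * y ^ k * x ^ (p - k))"
  by (simp add: mult_ac)
 also have "\<bar>\<dots>\<bar> <= (\<Sum>k\<in>{n..p}. real (p choose k) * (\<bar>x\<bar> ^ (p - n) * \<bar>y\<bar> ^ n + \<bar>y\<bar> ^ p))"
 proof (rule order_trans[OF sum_abs sum_mono])
  fix k assume k: "k \<in> {n..p}"
  have "\<bar>y\<bar> ^ k * \<bar>x\<bar> ^ (p - k) <= \<bar>x\<bar> ^ (p - n) * \<bar>y\<bar> ^ n + \<bar>y\<bar> ^ p"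
  proof (cases "\<bar>y\<bar> <= \<bar>x\<bar>")
   case True
   have "\<bar>y\<bar> ^ k * \<bar>x\<bar> ^ (p - k) = \<bar>y\<bar> ^ n * \<bar>y\<bar> ^ (k - n) * \<bar>x\<bar> ^ (p - k)"
    using k by (simp add: power_add[symmetric])
   also have "\<dots> <= \<bar>y\<bar> ^ n * \<bar>x\<bar> ^ (k - n) * \<bar>x\<bar> ^ (p - k)"
    using True by (intro mult_right_mono mult_left_mono power_mono) auto
   also have "\<dots> = \<bar>y\<bar> ^ n * \<bar>x\<bar> ^ (p - n)" using k by (simp add: power_add[symmetric] mult.assoc)
   finally show ?thesis by (simp add: mult.commute add_increasing2)
  next
   case False
   have "\<bar>y\<bar> ^ k * \<bar>x\<bar> ^ (p - k) <= \<bar>y\<bar> ^ k * \<bar>y\<bar> ^ (p - k)"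
    using False by (intro mult_left_mono power_mono) auto
   also have "\<dots> = \<bar>y\<bar> ^ p" using k by (simp add: power_add[symmetric])
   finally show ?thesis by (simp add: add_increasing)
  qed
  then show "\<bar>real (p choose k) * y ^ k * x ^ (p - k)\<bar> <= real (p choose k) * (\<bar>x\<bar> ^ (p - n) * \<bar>y\<bar> ^ n + \<bar>y\<bar> ^ p)"
   by (simp add: abs_mult power_abs mult.assoc mult_left_mono)
 qed
 also have "\<dots> = (\<Sum>k\<in>{n..p}. real (p choose k)) * (\<bar>x\<bar> ^ (p - n) * \<bar>y\<bar> ^ n + \<bar>y\<bar> ^ p)" by (simp add: sum_distrib_right)
 also have "\<dots> <= 2 ^ p * (\<bar>x\<bar> ^ (p - n) * \<bar>y\<bar> ^ n + \<bar>y\<bar> ^ p)"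
 proof (rule mult_right_mono)
  have "(\<Sum>k\<in>{n..p}. p choose k) <= (\<Sum>k\<le>p. p choose k)" by (intro sum_mono2) auto
  also have "\<dots> = 2 ^ p" by (rule choose_row_sum)
  finally have "real (\<Sum>k\<in>{n..p}. p choose k) <= real (2 ^ p)" by (rule of_nat_mono)
  then show "(\<Sum>k\<in>{n..p}. real (p choose k)) <= 2 ^ p" by simp
 qed auto
 finally show ?thesis .
qed

lemma power_diff_bound1:
 fixes x y :: real
 assumes "1 <= p"
 shows "\<bar>(x + y) ^ p - x ^ p\<bar> <= 2 ^ p * (\<bar>x\<bar> ^ (p - 1) * \<bar>y\<bar> + \<bar>y\<bar> ^ p)"
 using power_diff_bound[of 1 p x y] assms by simp

lemma power_diff_bound2:
 fixes x y :: real
 assumes "2 <= p"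
 shows "\<bar>(x + y) ^ p - x ^ p - real p * x ^ (p - 1) * y\<bar> <= 2 ^ p * (\<bar>x\<bar> ^ (p - 2) * y ^ 2 + \<bar>y\<bar> ^ p)"
 using power_diff_bound[of 2 p x y] assms by (simp add: numeral_2_eq_2 diff_diff_eq)

text \<open>The Lipschitz condition on the derivative that \<open>ito_path\<close> asks for, in the
  case of the function \<open>x ^ p\<close>.\<close>

lemma power_deriv_lipschitz:
 "\<exists>C. \<forall>x y::real. \<bar>x\<bar> <= R --> \<bar>y\<bar> <= R --> \<bar>real p * x ^ (p - 1) - real p * y ^ (p - 1)\<bar> <= C * \<bar>x - y\<bar>"
proof (intro exI allI impI)
 fix x y :: real assume "\<bar>x\<bar> <= R" "\<bar>y\<bar> <= R"
 let ?q = "p - 1"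
 have "\<bar>x ^ ?q - y ^ ?q\<bar> = \<bar>x - y\<bar> * \<bar>\<Sum>i<?q. x ^ i * y ^ (?q - Suc i)\<bar>"
  by (subst power_diff_sumr2) (simp add: abs_mult mult.commute)
 also have "\<dots> <= \<bar>x - y\<bar> * (\<Sum>i<?q. R ^ i * R ^ (?q - Suc i))"
 proof (intro mult_left_mono order_trans[OF sum_abs sum_mono])
  fix i
  show "\<bar>x ^ i * y ^ (?q - Suc i)\<bar> <= R ^ i * R ^ (?q - Suc i)"
   unfolding abs_mult power_abs using \<open>\<bar>x\<bar> <= R\<close> \<open>\<bar>y\<bar> <= R\<close> by (intro mult_mono power_mono) auto
 qed simp
 finally have "real p * \<bar>x ^ ?q - y ^ ?q\<bar> <= real p * (\<bar>x - y\<bar> * (\<Sum>i<?q. R ^ i * R ^ (?q - Suc i)))"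
  by (rule mult_left_mono) simp
 then show "\<bar>real p * x ^ (p - 1) - real p * y ^ (p - 1)\<bar> <= (real p * (\<Sum>i<?q. R ^ i * R ^ (?q - Suc i))) * \<bar>x - y\<bar>"
  by (simp add: abs_mult right_diff_distrib[symmetric] mult_ac)
qed

section \<open>Stieltjes integrals against paths with jumps and drift\<close>

text \<open>A functional monotone class principle. The cases \<open>lin\<close> and
  \<open>lim\<close> supply common bounds for the functions involved, so that an invariant about
  integrals may rely on integrability and on dominated convergence.\<close>

lemma bounded_borel_induct [consumes 2, case_names set lin lim]:
 fixes f :: "real => real"
 assumes f: "f \<in> borel_measurable borel" "\<And>x. \<bar>f x\<bar> <= K"
  and set: "\<And>A. A \<in> sets borel ==> P (indicator A)"
  and lin: "\<And>f g a K. f \<in> borel_measurable borel ==> g \<in> borel_measurable borel ==> (\<And>x. \<bar>f x\<bar> <= K) ==> (\<And>x. \<bar>g x\<bar> <= K)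
    ==> P f ==> P g ==> P (%x. a * f x + g x)"
  and lim: "\<And>F f K. (\<And>n. F n \<in> borel_measurable borel) ==> (\<And>n x. \<bar>F n x\<bar> <= K) ==> (\<And>n. P (F n)) ==> (\<And>x. (%n. F n x) \<longlonglongrightarrow> f x) ==> P f"
 shows "P f"
proof -
 have simple: "P g" if g: "simple_function borel g" for g :: "real => real"
 proof -
  let ?R = "g ` UNIV"
  have fin: "finite ?R" using g by (simp add: simple_function_def)
  have bm: "g -` {y} \<in> sets borel" for y using g simple_functionD(2)[OF g, of "{y}"] by simp
  have "P (%x. \<Sum>y\<in>Y. y * indicator (g -` {y}) x)" if "finite Y" for Y
   using that
  proof (induction Y)
   case empty
   have "P (indicator {})" by (rule set) simp
   then show ?case by (simp add: indicator_def[abs_def] cong: if_cong)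
  next
   case (insert y Y)
   have "P (%x. y * indicator (g -` {y}) x + (\<Sum>y\<in>Y. y * indicator (g -` {y}) x))"
   proof (rule lin[where K="1 + (\<Sum>y\<in>Y. \<bar>y\<bar>)"])
    show "(%x. \<Sum>y\<in>Y. y * indicator (g -` {y}) x) \<in> borel_measurable borel"
     using bm by (intro borel_measurable_sum borel_measurable_times) auto
    show "\<bar>\<Sum>y\<in>Y. y * indicator (g -` {y}) x\<bar> <= 1 + (\<Sum>y\<in>Y. \<bar>y\<bar>)" for x
     by (rule order_trans[OF sum_abs]) (intro add_increasing sum_mono, auto simp: indicator_def)
    show "\<bar>indicator (g -` {y}) x :: real\<bar> <= 1 + (\<Sum>y\<in>Y. \<bar>y\<bar>)" for x
     using sum_nonneg[of Y abs] by (auto simp: indicator_def)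
   qed (use bm insert set in auto)
   then show ?case by (simp only: sum.insert[OF insert(1,2)])
  qed
  then have "P (%x. \<Sum>y\<in>?R. y * indicator (g -` {y}) x)" using fin .
  moreover have "(\<Sum>y\<in>?R. y * indicator (g -` {y}) x) = g x" for x
  proof -
   have "(\<Sum>y\<in>?R. y * indicator (g -` {y}) x) = (\<Sum>y\<in>?R. if y = g x then g x else 0)"
    by (intro sum.cong) (auto simp: indicator_def)
   then show ?thesis using fin by simp
  qed
  ultimately show ?thesis by simp
 qed
 obtain F where F: "\<And>i. simple_function borel (F i)" "\<And>x. (%i. F i x) \<longlonglongrightarrow> f x" "\<And>i x. dist (F i x) 0 <= 2 * dist (f x) 0"
  using borel_measurable_implies_sequence_metric[OF f(1), of 0] by auto
 show ?thesis
 proof (rule lim[where F=F and K="2 * K"])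
  show "F n \<in> borel_measurable borel" for n using F(1) by (rule borel_measurable_simple_function)
  show "\<bar>F n x\<bar> <= 2 * K" for n x using F(3)[of n x] f(2)[of x] by (simp add: dist_real_def)
 qed (use F simple in auto)
qed

text \<open>Constancy of \<open>F\<close> on the negative half-line excludes an atom at 0, so that
  the closed interval has the mass expected of a half-open one.\<close>

lemma interval_measure_Icc:
 fixes F :: "real => real"
 assumes mono: "mono F" and rc: "\<And>a. continuous (at_right a) F" and c: "\<And>a. a <= 0 ==> F a = F 0" and b: "0 <= b"
 shows "emeasure (interval_measure F) {0..b} = ennreal (F b - F 0)"
proof -
 let ?M = "interval_measure F"
 have io: "emeasure ?M {x<..y} = ennreal (F y - F x)" if "x <= y" for x y
  by (rule emeasure_interval_measure_Ioc[OF that monoD[OF mono] rc])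
 have "emeasure ?M {-1<..<0} <= emeasure ?M {-1<..0}" by (rule emeasure_mono) auto
 then have z: "emeasure ?M {-1<..<0} = 0" using io[of "-1" 0] c[of "-1"] by simp
 have "{-1<..b} = {-1<..<0} \<union> {0..b}" using b by auto
 then have "emeasure ?M {-1<..b} = emeasure ?M {-1<..<0} + emeasure ?M {0..b}"
  by (simp add: plus_emeasure disjoint_iff)
 then show ?thesis using z io[of "-1" b] c[of "-1"] b by simp
qed

text \<open>The common test functional for the Jordan decompositions in \<^const>\<open>LS_int\<close>: it vanishes on the
 \<open>\<pi>\<close>-system of half-lines and is continuous under bounded pointwise convergence.\<close>

lemma LS_int_unique:
 fixes X p q j D G :: "real => real"
 assumes p: "mono p" "\<And>a. continuous (at_right a) p" "\<And>a. a <= 0 ==> p a = p 0"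
  and q: "mono q" "\<And>a. continuous (at_right a) q" "\<And>a. a <= 0 ==> q a = q 0"
  and X: "\<And>a. 0 <= a ==> X a = p a - q a"
  and u: "0 <= u" and J: "finite J" "J \<subseteq> {0<..u}"
  and D: "(%s. indicator {0..u} s * D s) \<in> borel_measurable borel" "\<And>s. 0 <= s ==> s <= u ==> \<bar>D s\<bar> <= B"
  and XD: "\<And>t. 0 <= t ==> t <= u ==> X t = X 0 + (\<Sum>s\<in>{s\<in>J. s <= t}. j s) + (LINT s:{0..t}|lborel. D s)"
  and G: "G \<in> borel_measurable borel" "\<And>s. \<bar>G s\<bar> <= K"
 shows "(LINT s:{0..u}|interval_measure p. G s) - (LINT s:{0..u}|interval_measure q. G s)
  = (\<Sum>s\<in>J. G s * j s) + (LINT s:{0..u}|lborel. G s * D s)"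
proof -
 have fin: "emeasure (interval_measure p) {0..u} < \<infinity>" "emeasure (interval_measure q) {0..u} < \<infinity>"
  using interval_measure_Icc[OF p u] interval_measure_Icc[OF q u] by simp_all
 have si: "set_integrable M {0..u} f" if M: "sets M = sets borel" "emeasure M {0..u} < \<infinity>"
  and f: "f \<in> borel_measurable borel" "\<And>x. \<bar>f x\<bar> <= K" for M :: "real measure" and f :: "real => real" and K
  unfolding set_integrable_def
 proof (rule Bochner_Integration.integrable_bound[where f="%s. K * indicator {0..u} s"])
  show "integrable M (%s. K * indicator {0..u} s)"
   using M by (intro integrable_mult_right integrable_real_indicator) auto
  have "{0..u} \<in> sets M" "f \<in> borel_measurable M" using M f by (auto cong: measurable_cong_sets)
  then show "(%s. indicator {0..u} s *\<^sub>R f s) \<in> borel_measurable M" by measurable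
  have "0 <= K" using f(2)[of 0] by linarith
  then show "AE s in M. norm (indicator {0..u} s *\<^sub>R f s) <= norm (K * indicator {0..u} s)"
   using f(2) by (intro AE_I2) (auto simp: indicator_def)
 qed
 have B: "0 <= B" using D(2)[of 0] u by force
 have siD: "set_integrable lborel {0..u} (%s. f s * D s)" if f: "f \<in> borel_measurable borel" "\<And>x. \<bar>f x\<bar> <= K" for f K
 proof (rule set_integrable_bounded(1)[where B="K * B" and a=0 and b=u])
  have "(%s. indicator {0..u} s * (f s * D s)) = (%s. f s * (indicator {0..u} s * D s))" by auto
  then show "(%s. indicator {0..u} s * (f s * D s)) \<in> borel_measurable borel" using D(1) f(1) by simp
  have "0 <= K" using f(2)[of 0] by linarith
  then show "\<bar>f s * D s\<bar> <= K * B" if "s \<in> {0..u}" for s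
   unfolding abs_mult using f(2) D(2) that by (intro mult_mono) auto
 qed auto
 define \<Phi> where "\<Phi> = (%f. (LINT s:{0..u}|interval_measure p. f s) - (LINT s:{0..u}|interval_measure q. f s)
   - (\<Sum>s\<in>J. f s * j s) - (LINT s:{0..u}|lborel. f s * D s))"
 have linP: "\<Phi> (%x. a * f x + g x) = a * \<Phi> f + \<Phi> g"
  if f: "f \<in> borel_measurable borel" "\<And>x. \<bar>f x\<bar> <= K" and g: "g \<in> borel_measurable borel" "\<And>x. \<bar>g x\<bar> <= K" for f g a K
 proof -
  have "(LINT s:{0..u}|M. a * f s + g s) = a * (LINT s:{0..u}|M. f s) + (LINT s:{0..u}|M. g s)"
   if "sets M = sets borel" "emeasure M {0..u} < \<infinity>" for M
   using si[OF that f] si[OF that g] by (simp add: set_integral_add)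
  moreover have "(LINT s:{0..u}|lborel. (a * f s + g s) * D s) = a * (LINT s:{0..u}|lborel. f s * D s) + (LINT s:{0..u}|lborel. g s * D s)"
   using siD[OF f] siD[OF g] by (simp add: distrib_right mult.assoc set_integral_add)
  moreover have "(\<Sum>s\<in>J. (a * f s + g s) * j s) = a * (\<Sum>s\<in>J. f s * j s) + (\<Sum>s\<in>J. g s * j s)"
   by (simp add: distrib_right sum.distrib sum_distrib_left mult.assoc)
  ultimately show ?thesis unfolding \<Phi>_def using fin by (simp add: algebra_simps)
 qed
 have limP: "(%n. \<Phi> (F n)) \<longlonglongrightarrow> \<Phi> f"
  if F: "\<And>n. F n \<in> borel_measurable borel" "\<And>n x. \<bar>F n x\<bar> <= K" "\<And>x. (%n. F n x) \<longlonglongrightarrow> f x" for F f K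
 proof -
  have K: "0 <= K" using F(2)[of 0 0] by linarith
  have f: "f \<in> borel_measurable borel" by (rule borel_measurable_LIMSEQ_real[OF F(3) F(1)])
  have 1: "(%n. LINT s:{0..u}|M. F n s) \<longlonglongrightarrow> (LINT s:{0..u}|M. f s)"
   if M: "sets M = sets borel" "emeasure M {0..u} < \<infinity>" for M
   unfolding set_lebesgue_integral_def
  proof (rule integral_dominated_convergence[where w="%s. K * indicator {0..u} s"])
   show "integrable M (%s. K * indicator {0..u} s)"
    using M by (intro integrable_mult_right integrable_real_indicator) auto
   have [measurable]: "{0..u} \<in> sets M" "f \<in> borel_measurable M" "F n \<in> borel_measurable M" for n
    using M f F by (auto cong: measurable_cong_sets)
   show "(%s. indicator {0..u} s *\<^sub>R f s) \<in> borel_measurable M" "(%s. indicator {0..u} s *\<^sub>R F n s) \<in> borel_measurable M" for n by measurable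
   show "AE s in M. (%n. indicator {0..u} s *\<^sub>R F n s) \<longlonglongrightarrow> indicator {0..u} s *\<^sub>R f s"
    using F(3) by (intro AE_I2 tendsto_intros) auto
   show "AE s in M. norm (indicator {0..u} s *\<^sub>R F n s) <= K * indicator {0..u} s" for n
    using F(2) by (intro AE_I2) (auto simp: indicator_def)
  qed
  have 2: "(%n. LINT s:{0..u}|lborel. F n s * D s) \<longlonglongrightarrow> (LINT s:{0..u}|lborel. f s * D s)"
   unfolding set_lebesgue_integral_def
  proof (rule integral_dominated_convergence[where w="%s. K * B * indicator {0..u} s"])
   show "integrable lborel (%s. K * B * indicator {0..u} s)"
    using u by (intro integrable_mult_right integrable_real_indicator) auto
   have fb: "\<bar>f x\<bar> <= K" for x
    using F(2) by (intro LIMSEQ_le_const2[OF tendsto_rabs[OF F(3)]]) auto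
   show "(%s. indicator {0..u} s *\<^sub>R (f s * D s)) \<in> borel_measurable lborel"
    using siD[OF f fb] unfolding set_integrable_def by (rule borel_measurable_integrable)
   show "(%s. indicator {0..u} s *\<^sub>R (F n s * D s)) \<in> borel_measurable lborel" for n
    using siD[OF F(1,2)] unfolding set_integrable_def by (rule borel_measurable_integrable)
   show "AE s in lborel. (%n. indicator {0..u} s *\<^sub>R (F n s * D s)) \<longlonglongrightarrow> indicator {0..u} s *\<^sub>R (f s * D s)"
    using F(3) by (intro AE_I2 tendsto_intros) auto
   show "AE s in lborel. norm (indicator {0..u} s *\<^sub>R (F n s * D s)) <= K * B * indicator {0..u} s" for n
   proof (rule AE_I2)
    fix s
    show "norm (indicator {0..u} s *\<^sub>R (F n s * D s)) <= K * B * indicator {0..u} s"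
    proof (cases "s \<in> {0..u}")
     case True
     then have "\<bar>F n s\<bar> * \<bar>D s\<bar> <= K * B" using F(2) D(2) K by (intro mult_mono) auto
     then show ?thesis using True by (simp add: abs_mult)
    qed simp
   qed
  qed
  have "sets (interval_measure p) = sets borel" "sets (interval_measure q) = sets borel" by simp_all
  note 3 = 1[OF this(1) fin(1)] 1[OF this(2) fin(2)]
  show ?thesis unfolding \<Phi>_def
   by (intro tendsto_diff 2 3 tendsto_sum tendsto_mult F(3) tendsto_const)
 qed
 \<comment> \<open>On a half-line the functional compares two expressions for the increment of
   \<open>X\<close> over \<open>[0, min b u]\<close>: one through \<open>p - q\<close>, the other
   through the jumps and the drift.\<close>
 have pz: "\<Phi> (indicator {..b}) = 0" for b :: real
 proof (cases "b < 0")
  case True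
  then have z: "indicator {0..u} s * indicator {..b} s = (0::real)" for s by (auto simp: indicator_def)
  have "(\<Sum>s\<in>J. indicator {..b} s * j s) = 0" using J True by (intro sum.neutral) auto
  moreover have "(LINT s:{0..u}|M. indicator {..b} s :: real) = 0" "(LINT s:{0..u}|M. indicator {..b} s * D s) = 0" for M :: "real measure"
   unfolding set_lebesgue_integral_def real_scaleR_def mult.assoc[symmetric] z by simp_all
  ultimately show ?thesis unfolding \<Phi>_def by simp
 next
  case False
  let ?b = "min b u"
  have b: "0 <= ?b" "?b <= u" using False u by auto
  have i: "indicator {0..u} s * indicator {..b} s = (indicator {0..?b} s :: real)" for s
   by (auto simp: indicator_def)
  have 1: "(LINT s:{0..u}|interval_measure F. indicator {..b} s :: real) = F ?b - F 0"
   if F: "mono F" "\<And>a. continuous (at_right a) F" "\<And>a. a <= 0 ==> F a = F 0" for F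
  proof -
   have "(LINT s:{0..u}|interval_measure F. indicator {..b} s :: real) = measure (interval_measure F) {0..?b}"
    unfolding set_lebesgue_integral_def real_scaleR_def i by simp
   then show ?thesis using interval_measure_Icc[OF F b(1)] monoD[OF F(1) b(1)] by (simp add: measure_def)
  qed
  have 2: "(LINT s:{0..u}|lborel. indicator {..b} s * D s) = (LINT s:{0..?b}|lborel. D s)"
   unfolding set_lebesgue_integral_def real_scaleR_def mult.assoc[symmetric] i ..
  have "(\<Sum>s\<in>J. indicator {..b} s * j s) = (\<Sum>s\<in>J. if s <= ?b then j s else 0)"
   using J by (intro sum.cong) (auto simp: indicator_def)
  also have "\<dots> = (\<Sum>s\<in>{s\<in>J. s <= ?b}. j s)" using J(1) by (simp add: sum.inter_filter)
  finally have 3: "(\<Sum>s\<in>J. indicator {..b} s * j s) = (\<Sum>s\<in>{s\<in>J. s <= ?b}. j s)" .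
  have "X ?b = X 0 + (\<Sum>s\<in>{s\<in>J. s <= ?b}. j s) + (LINT s:{0..?b}|lborel. D s)" by (rule XD[OF b])
  then show ?thesis unfolding \<Phi>_def using 1[OF p] 1[OF q] 2 3 X[OF b(1)] X[of 0] by linarith
 qed
 have all1: "\<Phi> (indicator A) = 0" if A: "A \<in> sets borel" for A
 proof -
  \<comment> \<open>Complements require the indicator of the whole line, which is no half-line; on
    \<open>[0,u]\<close> it agrees with that of \<open>{..u}\<close>.\<close>
  have mu: "\<Phi> (indicator UNIV) = 0"
  proof -
   have e: "indicator {0..u} s * indicator UNIV s = indicator {0..u} s * (indicator {..u} s :: real)" for s
    by (auto simp: indicator_def)
   have "(LINT s:{0..u}|M. indicator UNIV s :: real) = (LINT s:{0..u}|M. indicator {..u} s)"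
    "(LINT s:{0..u}|M. indicator UNIV s * D s) = (LINT s:{0..u}|M. indicator {..u} s * D s)" for M :: "real measure"
    unfolding set_lebesgue_integral_def real_scaleR_def mult.assoc[symmetric] e by (rule refl)+
   moreover have "(\<Sum>s\<in>J. indicator UNIV s * j s) = (\<Sum>s\<in>J. indicator {..u} s * j s)"
    using J by (intro sum.cong) auto
   ultimately show ?thesis using pz[of u] unfolding \<Phi>_def by simp
  qed
  have S: "sets borel = sigma_sets UNIV (range (%b::real. {..b}))"
   by (subst borel_eq_atMost) (simp add: sets_measure_of)
  have "Int_stable (range (%b::real. {..b}))" by (auto simp: Int_stable_def)
  moreover have "range (%b::real. {..b}) \<subseteq> Pow UNIV" by simp
  moreover have "A \<in> sigma_sets UNIV (range (%b::real. {..b}))" using A S by simp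
  ultimately show ?thesis
  proof (induction rule: sigma_sets_induct_disjoint)
   case (basic A) then show ?case using pz by auto
  next
   case empty then show ?case by (simp add: \<Phi>_def set_lebesgue_integral_def)
  next
   case (compl A)
   then have m: "A \<in> sets borel" using S by simp
   have "indicator (UNIV - A) = (%x. (-1) * indicator A x + indicator UNIV x :: real)" by (auto simp: indicator_def fun_eq_iff)
   then show ?case using linP[of "indicator A" 1 "indicator UNIV" "-1"] m compl mu by simp
  next
   case (union A)
   then have m: "A i \<in> sets borel" for i using S by auto
   have s: "\<Phi> (indicator (\<Union>i<n. A i)) = 0" for n
   proof (induction n)
    case 0 show ?case by (simp add: \<Phi>_def set_lebesgue_integral_def)
   next
    case (Suc n)
    have "A n \<inter> A i = {}" if "i < n" for i using union(1) that by (auto simp: disjoint_family_on_def)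
    then have "A n \<inter> (\<Union>i<n. A i) = {}" by blast
    then have "indicator (\<Union>i<Suc n. A i) = (%x. 1 * indicator (A n) x + indicator (\<Union>i<n. A i) x :: real)"
     by (auto simp: indicator_def fun_eq_iff less_Suc_eq)
    then show ?case using linP[of "indicator (A n)" 1 "indicator (\<Union>i<n. A i)" 1] m Suc union(3) by simp
   qed
   have "(%n. \<Phi> (indicator (\<Union>i<n. A i))) \<longlonglongrightarrow> \<Phi> (indicator (\<Union>i. A i))"
    by (rule limP[where K=1]) (use m in \<open>auto intro: LIMSEQ_indicator_UN\<close>)
   then show ?case unfolding s by (simp add: LIMSEQ_const_iff)
  qed
 qed
 have "\<Phi> G = 0"
  using G
 proof (induction rule: bounded_borel_induct)
  case (set A) then show ?case by (rule all1)
 next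
  case (lin f g a K)
  have "\<Phi> (%x. a * f x + g x) = a * \<Phi> f + \<Phi> g" by (rule linP) (rule lin)+
  then show ?case using lin by simp
 next
  case (lim F f K)
  have "(%n. \<Phi> (F n)) \<longlonglongrightarrow> \<Phi> f" by (rule limP) (rule lim)+
  then show ?case using lim by (simp add: LIMSEQ_const_iff)
 qed
 then show ?thesis unfolding \<Phi>_def by simp
qed

lemma ivl_disj_int_two_Icc_Ioc: "{0..r} \<inter> {r<..t::real} = {}"
 by auto

text \<open>Applied to the positive and to the negative parts of jumps and drift, this verifies the
  side conditions of the choice in \<open>LS_int\<close>, so that a decomposition of the required
  kind exists.\<close>

lemma Jordan_part:
 fixes w E :: "real => real"
 assumes J: "\<And>t. finite {s\<in>J. s <= t}" "J \<subseteq> {0<..}" and w: "\<And>s. 0 <= w s"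
  and E: "\<And>t. (%s. indicator {0..t} s * E s) \<in> borel_measurable borel" "\<And>s. 0 <= s ==> 0 <= E s \<and> E s <= B"
 defines "Z \<equiv> %t. (\<Sum>s\<in>{s\<in>J. s <= t}. w s) + (LINT s:{0..t}|lborel. E s)"
 shows "mono Z" "continuous (at_right a) Z" "a <= 0 ==> Z a = Z 0"
proof -
 have B: "B \<ge> 0" using E(2)[of 0] by simp
 have Ei: "set_integrable lborel {0..t} E" for t
  using E by (intro set_integrable_bounded(1)[where B=B and a=0 and b=t]) auto
 have neg: "Z t = 0" if "t <= 0" for t
 proof -
  have "{s\<in>J. s <= t} = {}" using J(2) that by force
  moreover have "(LINT s:{0..t}|lborel. E s) = 0"
  proof (cases "t = 0")
   case True
   then show ?thesis using set_integrable_bounded(2)[OF E(1)[of 0], of B 0 0] E(2) by simp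
  next
   case False then show ?thesis using that by (simp add: set_lebesgue_integral_def)
  qed
  ultimately show ?thesis unfolding Z_def by (simp del: Collect_empty_eq)
 qed
 show "a <= 0 ==> Z a = Z 0" using neg by simp
 have inc: "\<exists>i. Z t = Z r + (\<Sum>s\<in>{s\<in>J. r < s \<and> s <= t}. w s) + i \<and> 0 <= i \<and> i <= B * (t - r)" if "0 <= r" "r <= t" for r t
 proof -
  have "{s\<in>J. s <= t} = {s\<in>J. s <= r} \<union> {s\<in>J. r < s \<and> s <= t}" using that by auto
  moreover have "finite {s\<in>J. r < s \<and> s <= t}" by (rule finite_subset[OF _ J(1)[of t]]) auto
  ultimately have 1: "(\<Sum>s\<in>{s\<in>J. s <= t}. w s) = (\<Sum>s\<in>{s\<in>J. s <= r}. w s) + (\<Sum>s\<in>{s\<in>J. r < s \<and> s <= t}. w s)"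
   using J(1)[of r] by (simp add: sum.union_disjoint disjoint_iff)
  have m: "(%s. indicator {r<..t} s * E s) \<in> borel_measurable borel"
  proof -
   have "(%s. indicator {r<..t} s * E s) = (%s. indicator {r<..t} s * (indicator {0..t} s * E s))"
    using that by (auto simp: indicator_def fun_eq_iff)
   then show ?thesis using E(1) by simp
  qed
  have b: "\<bar>E s\<bar> <= B" if "s \<in> {r<..t}" for s using E(2)[of s] that \<open>0 <= r\<close> by auto
  have sb: "{r<..t} \<subseteq> {r..t}" by auto
  have i: "set_integrable lborel {r<..t} E" "\<bar>LINT s:{r<..t}|lborel. E s\<bar> <= B * (t - r)"
   using set_integrable_bounded[OF m b _ sb] that by simp_all
  have "{0..t} = {0..r} \<union> {r<..t}" using that by auto
  then have 2: "(LINT s:{0..t}|lborel. E s) = (LINT s:{0..r}|lborel. E s) + (LINT s:{r<..t}|lborel. E s)"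
   using set_integral_Un[OF ivl_disj_int_two_Icc_Ioc Ei[of r] i(1)] by simp
  have "0 <= (LINT s:{r<..t}|lborel. E s)"
   unfolding set_lebesgue_integral_def using E(2) \<open>0 <= r\<close> by (intro integral_nonneg_AE AE_I2) (auto simp: indicator_def)
  then show ?thesis unfolding Z_def using 1 2 i(2) by (intro exI[of _ "LINT s:{r<..t}|lborel. E s"]) simp
 qed
 have mono0: "Z r <= Z t" if "0 <= r" "r <= t" for r t
 proof -
  have "0 <= (\<Sum>s\<in>{s\<in>J. r < s \<and> s <= t}. w s)" using w by (simp add: sum_nonneg)
  then show ?thesis using inc[OF that] by auto
 qed
 have "Z r = Z (max 0 r)" for r using neg[of r] neg[of 0] by (cases "r <= 0") (auto simp: max_def)
 then show "mono Z" by (intro monoI) (metis mono0 max.cobounded1 max.mono order_refl)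
 show "continuous (at_right a) Z"
 proof (cases "a < 0")
  case True
  have "\<forall>\<^sub>F r in at_right a. 0 = Z r"
   by (rule eventually_at_rightI[OF _ True]) (use neg in simp)
  then show ?thesis using neg[of a] True unfolding continuous_within by (simp add: tendsto_eventually eventually_mono)
 next
  case False
  obtain e where e: "e > 0" "{s\<in>J. s <= a + 1} \<inter> {a<..<a + e} = {}" by (rule finite_locally_left[OF J(1), of "a + 1" a])
  have "\<forall>\<^sub>F r in at_right a. norm (Z r - Z a) <= B * (r - a)"
  proof (rule eventually_at_rightI)
   show "a < a + min 1 e" using e by simp
   fix r assume r: "r \<in> {a<..<a + min 1 e}"
   have "{s\<in>J. a < s \<and> s <= r} = {}" using e(2) r by (auto simp: disjoint_iff)
   then show "norm (Z r - Z a) <= B * (r - a)" using inc[of a r] r False by (auto simp del: Collect_empty_eq)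
  qed
  then have "((%r. Z r - Z a) \<longlongrightarrow> 0) (at_right a)"
   by (rule Lim_null_comparison) (auto intro!: tendsto_eq_intros)
  then show ?thesis unfolding continuous_within by (rule LIM_zero_cancel)
 qed
qed

text \<open>The choice inside \<open>LS_int\<close> is harmless: the pair \<open>(Zp, Zm)\<close>
  shows that a decomposition exists, and by \<open>LS_int_unique\<close> every decomposition gives
  the same value. The Stieltjes integral thus becomes a finite jump sum plus a drift integral, and
  only this form is used from here on.\<close>

lemma LS_int_eq:
 fixes X j D G :: "real => real"
 assumes J: "\<And>t. finite {s\<in>J. s <= t}" "J \<subseteq> {0<..}"
  and D: "\<And>t. (%s. indicator {0..t} s * D s) \<in> borel_measurable borel" "\<And>s. 0 <= s ==> \<bar>D s\<bar> <= B"
  and X: "\<And>t. 0 <= t ==> X t = (\<Sum>s\<in>{s\<in>J. s <= t}. j s) + (LINT s:{0..t}|lborel. D s)"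
  and u: "0 <= u"
  and G: "borel_on u G" "\<And>s. 0 <= s ==> s < u ==> \<bar>G s\<bar> <= K"
 shows "LS_int X G u = (\<Sum>s\<in>{s\<in>J. s < u}. G s * j s) + (LINT s:{0..<u}|lborel. G s * D s)"
proof -
 define Q where "Q = (%PQ::(real => real) \<times> (real => real). mono (fst PQ) \<and> mono (snd PQ) \<and>
         (\<forall>a. continuous (at_right a) (fst PQ)) \<and> (\<forall>a. continuous (at_right a) (snd PQ)) \<and>
         (\<forall>a\<le>0. fst PQ a = fst PQ 0 \<and> snd PQ a = snd PQ 0) \<and>
         (\<forall>a\<ge>0. X a = fst PQ a - snd PQ a))"
 define Zp where "Zp = (%t. (\<Sum>s\<in>{s\<in>J. s <= t}. max 0 (j s)) + (LINT s:{0..t}|lborel. max 0 (D s)))"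
 define Zm where "Zm = (%t. (\<Sum>s\<in>{s\<in>J. s <= t}. max 0 (- j s)) + (LINT s:{0..t}|lborel. max 0 (- D s)))"
 have mp: "(%s. indicator {0..t} s * max 0 (D s)) \<in> borel_measurable borel" for t
 proof -
  have "(%s. indicator {0..t} s * max 0 (D s)) = (%s. max 0 (indicator {0..t} s * D s))" by (auto simp: indicator_def)
  then show ?thesis using D(1)[of t] by simp
 qed
 have mm: "(%s. indicator {0..t} s * max 0 (- D s)) \<in> borel_measurable borel" for t
 proof -
  have "(%s. indicator {0..t} s * max 0 (- D s)) = (%s. max 0 (- (indicator {0..t} s * D s)))" by (auto simp: indicator_def)
  then show ?thesis using D(1)[of t] by simp
 qed
 have B: "B \<ge> 0" using D(2)[of 0] by force
 have bp: "0 <= max 0 (D s) \<and> max 0 (D s) <= B" "0 <= max 0 (- D s) \<and> max 0 (- D s) <= B" if "0 <= s" for s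
  using D(2)[OF that] B by auto
 have "Q (Zp, Zm)"
  unfolding Q_def fst_conv snd_conv
 proof (intro conjI allI impI)
  fix a :: real
  show "mono Zp" "continuous (at_right a) Zp" "a <= 0 ==> Zp a = Zp 0"
   unfolding Zp_def by (rule Jordan_part[OF J _ mp bp(1)]; simp)+
  show "mono Zm" "continuous (at_right a) Zm" "a <= 0 ==> Zm a = Zm 0"
   unfolding Zm_def by (rule Jordan_part[OF J _ mm bp(2)]; simp)+
  assume a: "0 <= a"
  have "set_integrable lborel {0..a} (%s. max 0 (D s))"
   by (rule set_integrable_bounded(1)[OF mp, where B=B and a=0 and b=a]) (use bp in auto)
  moreover have "set_integrable lborel {0..a} (%s. max 0 (- D s))"
   by (rule set_integrable_bounded(1)[OF mm, where B=B and a=0 and b=a]) (use bp in auto)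
  ultimately have "(LINT s:{0..a}|lborel. max 0 (D s) - max 0 (- D s)) = (LINT s:{0..a}|lborel. max 0 (D s)) - (LINT s:{0..a}|lborel. max 0 (- D s))"
   by (rule set_integral_diff(2))
  moreover have "max 0 x - max 0 (- x) = x" for x :: real by (simp add: max_def)
  ultimately show "X a = Zp a - Zm a"
   unfolding Zp_def Zm_def X[OF a] by (simp add: sum_subtractf[symmetric])
 qed
 then have "Q (SOME PQ. Q PQ)" by (rule someI)
 then obtain p q where pq: "(SOME PQ. Q PQ) = (p, q)" and Qpq: "Q (p, q)" by (cases "SOME PQ. Q PQ") auto
 have p: "mono p" "\<And>a. continuous (at_right a) p" "\<And>a. a <= 0 ==> p a = p 0"
  and q: "mono q" "\<And>a. continuous (at_right a) q" "\<And>a. a <= 0 ==> q a = q 0"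
  and Xpq: "\<And>a. 0 <= a ==> X a = p a - q a"
  using Qpq unfolding Q_def fst_conv snd_conv by blast+
 \<comment> \<open>\<open>LS_int\<close> integrates over \<open>[0,u)\<close>,
   \<open>LS_int_unique\<close> over \<open>[0,u]\<close>. Cutting \<open>G\<close> off reconciles
   the two and makes it bounded and Borel on the whole line.\<close>
 define G' where "G' = (%s. indicator {0..<u} s * G s)"
 have e: "indicator {0..<u} s * y = indicator {0..u} s * (indicator {0..<u} s * y)" for s y :: real by (auto simp: indicator_def)
 have L: "LS_int X G u = (LINT s:{0..u}|interval_measure p. G' s) - (LINT s:{0..u}|interval_measure q. G' s)"
  unfolding LS_int_def Q_def[symmetric] pq Let_def fst_conv snd_conv set_lebesgue_integral_def real_scaleR_def G'_def e[symmetric] ..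
 have X0: "X 0 = 0"
 proof -
  have "{s\<in>J. s <= 0} = {}" using J(2) by force
  moreover have "(LINT s:{0..0}|lborel. D s) = 0"
   using set_integrable_bounded(2)[OF D(1)[of 0], of B 0 0] D(2) by simp
  ultimately show ?thesis using X[of 0] by (simp del: Collect_empty_eq)
 qed
 have "LS_int X G u = (\<Sum>s\<in>{s\<in>J. s <= u}. G' s * j s) + (LINT s:{0..u}|lborel. G' s * D s)"
  unfolding L
 proof (rule LS_int_unique[OF p q Xpq u])
  show "finite {s\<in>J. s <= u}" "{s\<in>J. s <= u} \<subseteq> {0<..u}" using J by auto
  show "(%s. indicator {0..u} s * D s) \<in> borel_measurable borel" by (rule D)
  show "\<bar>D s\<bar> <= B" if "0 <= s" for s by (rule D(2)[OF that])
  show "X t = X 0 + (\<Sum>s\<in>{s \<in> {s \<in> J. s <= u}. s <= t}. j s) + (LINT s:{0..t}|lborel. D s)" if "0 <= t" "t <= u" for t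
  proof -
   have "{s \<in> {s \<in> J. s <= u}. s <= t} = {s\<in>J. s <= t}" using that by auto
   then show ?thesis using X[OF that(1)] X0 by simp
  qed
  show "G' \<in> borel_measurable borel" unfolding G'_def by (rule G)
  show "\<bar>G' s\<bar> <= \<bar>K\<bar>" for s using G(2)[of s] by (auto simp: G'_def indicator_def)
 qed
 moreover have "(\<Sum>s\<in>{s\<in>J. s <= u}. G' s * j s) = (\<Sum>s\<in>{s\<in>J. s < u}. G s * j s)"
  by (rule sum.mono_neutral_cong_right[OF J(1)]) (use J(2) in \<open>auto simp: G'_def indicator_def\<close>)
 moreover have "(LINT s:{0..u}|lborel. G' s * D s) = (LINT s:{0..<u}|lborel. G s * D s)"
  unfolding set_lebesgue_integral_def real_scaleR_def G'_def mult.assoc e[symmetric] ..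
 ultimately show ?thesis by simp
qed

section \<open>Pure-jump martingales with drift\<close>

text \<open>The almost sure properties of one realisation: \<open>a\<close> is the common jump size,
  \<open>L\<close> the prefactor of the drift and \<open>B\<close> the bound of its density. Borel
  measurability of the density in time is part of it because all integrals are computed path by
  path.\<close>

definition good_path :: "site set => real => real => real => (real => site => real) => (real => site => real) => bool" where
 "good_path S a L B mp cd \<longleftrightarrow>
  (\<forall>x\<in>S. cadlag (%t. mp t x) \<and>
   (\<forall>t\<ge>0. jmp (%r. mp r x) t \<noteq> 0 --> \<bar>jmp (%r. mp r x) t\<bar> = a) \<and>
   (\<forall>t\<ge>0. \<forall>y\<in>S. x \<noteq> y --> jmp (%r. mp r x) t = 0 \<or> jmp (%r. mp r y) t = 0) \<and>
   (\<forall>s\<ge>0. \<bar>cd s x\<bar> <= B) \<and> (\<forall>t. (%s. indicator {0..t} s * cd s x) \<in> borel_measurable borel) \<and>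
   (\<forall>t\<ge>0. mp t x = (\<Sum>s\<in>{s\<in>{0..t}. jmp (%r. mp r x) s \<noteq> 0}. jmp (%r. mp r x) s)
     - L * set_lebesgue_integral lborel {0..t} (%s. cd s x)))"

abbreviation jset :: "(real => site => real) => site => real set" where
 "jset mp x \<equiv> {s. jmp (%r. mp r x) s \<noteq> 0}"

lemma jset_pos: "jset mp x \<subseteq> {0<..}"
 by (auto simp: jmp_def split: if_splits)

lemma good_pathD:
 assumes "good_path S a L B mp cd" "x \<in> S" "a > 0"
 shows "finite {s\<in>jset mp x. s <= t}" "finite {s\<in>jset mp x. s < t}"
  "s \<in> jset mp x ==> \<bar>jmp (%r. mp r x) s\<bar> = a"
  "0 <= t ==> mp t x = (\<Sum>s\<in>{s\<in>jset mp x. s <= t}. jmp (%r. mp r x) s) + (LINT s:{0..t}|lborel. - L * cd s x)"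
  "y \<in> S ==> x \<noteq> y ==> jset mp x \<inter> jset mp y = {}"
  "0 <= s ==> \<bar>- L * cd s x\<bar> <= \<bar>L\<bar> * B"
  "(%s. indicator {0..t} s * (- L * cd s x)) \<in> borel_measurable borel"
proof -
 note g = bspec[OF assms(1)[unfolded good_path_def] assms(2)]
 have c: "cadlag (%t. mp t x)" using g by (rule conjunct1)
 have j: "jmp (%r. mp r x) t \<noteq> 0 ==> 0 <= t ==> \<bar>jmp (%r. mp r x) t\<bar> = a" for t using g by blast
 have eq: "{s\<in>jset mp x. s <= t} = {s\<in>{0..t}. jmp (%r. mp r x) s \<noteq> 0}" for t
  using jset_pos[of mp x] by auto
 show a: "\<bar>jmp (%r. mp r x) s\<bar> = a" if "s \<in> jset mp x" for s
  using j[of s] that jset_pos[of mp x] by auto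
 have "{s\<in>jset mp x. s <= t} \<subseteq> {s\<in>{0..t}. a <= \<bar>jmp (%r. mp r x) s\<bar>}"
  unfolding eq using a by auto
 then show f: "finite {s\<in>jset mp x. s <= t}"
  by (rule finite_subset[OF _ cadlag_finite_jumps[OF c assms(3)]])
 show "finite {s\<in>jset mp x. s < t}" by (rule finite_subset[OF _ f]) auto
 show "mp t x = (\<Sum>s\<in>{s\<in>jset mp x. s <= t}. jmp (%r. mp r x) s) + (LINT s:{0..t}|lborel. - L * cd s x)" if "0 <= t"
 proof -
  have "mp t x = (\<Sum>s\<in>{s\<in>{0..t}. jmp (%r. mp r x) s \<noteq> 0}. jmp (%r. mp r x) s)
     - L * set_lebesgue_integral lborel {0..t} (%s. cd s x)" using g that by blast
  moreover have "(LINT s:{0..t}|lborel. - L * cd s x) = - L * (LINT s:{0..t}|lborel. cd s x)"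
   by (rule set_integral_mult_right)
  ultimately show ?thesis unfolding eq by simp
 qed
 show "jset mp x \<inter> jset mp y = {}" if "y \<in> S" "x \<noteq> y"
 proof -
  have "s \<notin> jset mp y" if "s \<in> jset mp x" for s
  proof -
   have "0 <= s" using jset_pos[of mp x] that by auto
   then have "jmp (%r. mp r x) s = 0 \<or> jmp (%r. mp r y) s = 0" using g \<open>y \<in> S\<close> \<open>x \<noteq> y\<close> by blast
   then show ?thesis using that by simp
  qed
  then show ?thesis by blast
 qed
 show "\<bar>- L * cd s x\<bar> <= \<bar>L\<bar> * B" if "0 <= s"
 proof -
  have "\<bar>cd s x\<bar> <= B" using g that by blast
  then show ?thesis by (simp add: abs_mult mult_left_mono)
 qed
 have "(%s. indicator {0..t} s * (- L * cd s x)) = (%s. - L * (indicator {0..t} s * cd s x))" by (simp add: mult_ac)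
 then show "(%s. indicator {0..t} s * (- L * cd s x)) \<in> borel_measurable borel"
  using borel_measurable_times[OF borel_measurable_const spec[OF conjunct1[OF conjunct2[OF conjunct2[OF conjunct2[OF conjunct2[OF g]]]]], of t], of "- L"] by simp
qed

lemma good_path_increment:
 assumes g: "good_path S a L B mp cd" "x \<in> S" "a > 0" and B: "0 <= B" and st: "0 <= s" "s <= t"
 shows "\<bar>(LINT r:{0..t}|lborel. - L * cd r x) - (LINT r:{0..s}|lborel. - L * cd r x)\<bar> <= \<bar>L\<bar> * B * (t - s)"
  "mp t x - mp s x = (\<Sum>r\<in>{r\<in>jset mp x. s < r \<and> r <= t}. jmp (%r. mp r x) r) + (LINT r:{s<..t}|lborel. - L * cd r x)"
  "\<bar>LINT r:{s<..t}|lborel. - L * cd r x\<bar> <= \<bar>L\<bar> * B * (t - s)"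
proof -
 note d = good_pathD[OF g]
 have "(%r. indicator {s<..t} r * (- L * cd r x)) = (%r. indicator {s<..t} r * (indicator {0..t} r * (- L * cd r x)))"
  using st by (auto simp: indicator_def fun_eq_iff)
 then have m: "(%r. indicator {s<..t} r * (- L * cd r x)) \<in> borel_measurable borel" using d(7)[of t] by simp
 have b: "\<bar>- L * cd r x\<bar> <= \<bar>L\<bar> * B" if "r \<in> {s<..t}" for r using d(6) that st by auto
 have sb: "{s<..t} \<subseteq> {s..t}" by auto
 have i1: "set_integrable lborel {s<..t} (%r. - L * cd r x)" "\<bar>LINT r:{s<..t}|lborel. - L * cd r x\<bar> <= \<bar>L\<bar> * B * (t - s)"
  using set_integrable_bounded[OF m b _ sb] st by simp_all
 then show "\<bar>LINT r:{s<..t}|lborel. - L * cd r x\<bar> <= \<bar>L\<bar> * B * (t - s)" by simp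
 have i2: "set_integrable lborel {0..s} (%r. - L * cd r x)"
  using d(6) by (intro set_integrable_bounded(1)[OF d(7), of _ "\<bar>L\<bar> * B" 0 s]) auto
 have "{0..t} = {0..s} \<union> {s<..t}" using st by auto
 then have 1: "(LINT r:{0..t}|lborel. - L * cd r x) = (LINT r:{0..s}|lborel. - L * cd r x) + (LINT r:{s<..t}|lborel. - L * cd r x)"
  using set_integral_Un[OF ivl_disj_int_two_Icc_Ioc i2 i1(1)] by simp
 then show "\<bar>(LINT r:{0..t}|lborel. - L * cd r x) - (LINT r:{0..s}|lborel. - L * cd r x)\<bar> <= \<bar>L\<bar> * B * (t - s)"
  using i1(2) by simp
 have "{r\<in>jset mp x. r <= t} = {r\<in>jset mp x. r <= s} \<union> {r\<in>jset mp x. s < r \<and> r <= t}" using st by auto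
 then have "(\<Sum>r\<in>{r\<in>jset mp x. r <= t}. jmp (%r. mp r x) r) = (\<Sum>r\<in>{r\<in>jset mp x. r <= s} \<union> {r\<in>jset mp x. s < r \<and> r <= t}. jmp (%r. mp r x) r)"
  by (rule arg_cong)
 also have "\<dots> = (\<Sum>r\<in>{r\<in>jset mp x. r <= s}. jmp (%r. mp r x) r) + (\<Sum>r\<in>{r\<in>jset mp x. s < r \<and> r <= t}. jmp (%r. mp r x) r)"
 proof (rule sum.union_disjoint)
  show "finite {r\<in>jset mp x. s < r \<and> r <= t}" by (rule finite_subset[OF _ d(1)[of t]]) auto
 qed (use d(1)[of s] in auto)
 finally have 2: "(\<Sum>r\<in>{r\<in>jset mp x. r <= t}. jmp (%r. mp r x) r) = (\<Sum>r\<in>{r\<in>jset mp x. r <= s}. jmp (%r. mp r x) r) + (\<Sum>r\<in>{r\<in>jset mp x. s < r \<and> r <= t}. jmp (%r. mp r x) r)" .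
 then show "mp t x - mp s x = (\<Sum>r\<in>{r\<in>jset mp x. s < r \<and> r <= t}. jmp (%r. mp r x) r) + (LINT r:{s<..t}|lborel. - L * cd r x)"
  using d(4)[of t] d(4)[of s] st 1 2 by linarith
qed

lemma good_path_LS_int:
 assumes g: "good_path S a L B mp cd" "x \<in> S" "a > 0" and u: "0 <= u"
  and G: "borel_on u G" "\<And>s. 0 <= s ==> s < u ==> \<bar>G s\<bar> <= K"
 shows "LS_int (%s. mp s x) G u = (\<Sum>s\<in>{s\<in>jset mp x. s < u}. G s * jmp (%r. mp r x) s) + (LINT s:{0..<u}|lborel. G s * (- L * cd s x))"
 by (rule LS_int_eq[where J="jset mp x" and B="\<bar>L\<bar> * B" and K=K])
  (rule good_pathD[OF g] jset_pos u G | assumption)+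

text \<open>Each jump equals \<open>a\<close> or \<open>- a\<close>, so continuity of
  \<open>\<psi>\<close> at these two values is what \<open>Riemann_jumps\<close> amounts to.\<close>

lemma good_path_Riemann:
 fixes \<psi> G :: "real => real"
 assumes g: "good_path S a L B mp cd" "x \<in> S" "a > 0" "0 <= B" and u: "0 < u"
  and \<psi>: "\<And>y. \<bar>y\<bar> < r ==> \<psi> y = 0" "0 < r" "isCont \<psi> a" "isCont \<psi> (- a)"
  and G: "\<And>s. s \<in> jset mp x ==> s <= u ==> (G \<longlongrightarrow> G s) (at_left s)"
 shows "(%n. \<Sum>i<n. G (tp u n i) * \<psi> (mp (tp u n (Suc i)) x - mp (tp u n i) x)) \<longlonglongrightarrow> (\<Sum>s\<in>{s\<in>jset mp x. s <= u}. G s * \<psi> (jmp (%r. mp r x) s))"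
proof (rule Riemann_jumps[where r=r and \<psi>=\<psi> and G=G and S="{s\<in>jset mp x. s <= u}" and j="%s. jmp (%r. mp r x) s" and M="%t. mp t x" and A="%t. LINT r:{0..t}|lborel. - L * cd r x" and L="\<bar>L\<bar> * B"])
 note d = good_pathD[OF g(1-3)]
 show "finite {s\<in>jset mp x. s <= u}" by (rule d)
 show "{s\<in>jset mp x. s <= u} \<subseteq> {0<..u}" using jset_pos[of mp x] by auto
 show "mp t x = (\<Sum>s\<in>{s \<in> {s \<in> jset mp x. s <= u}. s <= t}. jmp (%r. mp r x) s) + (LINT r:{0..t}|lborel. - L * cd r x)"
  if "0 <= t" "t <= u" for t
 proof -
  have "{s \<in> {s \<in> jset mp x. s <= u}. s <= t} = {s\<in>jset mp x. s <= t}" using that by auto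
  then show ?thesis using d(4)[OF that(1)] by simp
 qed
 show "isCont \<psi> (jmp (%r. mp r x) s)" if "s \<in> {s \<in> jset mp x. s <= u}" for s
 proof -
  have "jmp (%r. mp r x) s = a \<or> jmp (%r. mp r x) s = - a" using d(3)[of s] that by auto
  then show ?thesis using \<psi>(3,4) by auto
 qed
 show "\<bar>(LINT r:{0..t}|lborel. - L * cd r x) - (LINT r:{0..s}|lborel. - L * cd r x)\<bar> <= \<bar>L\<bar> * B * (t - s)"
  if "0 <= s" "s <= t" for s t by (rule good_path_increment(1)[OF g that])
qed (use \<psi> u G in auto)

lemma set_lebesgue_integral_open:
 fixes f :: "real => real"
 assumes "borel_on u f"
 shows "(LINT s:{0<..<u}|lborel. f s) = (LINT s:{0..<u}|lborel. f s)"
 unfolding set_lebesgue_integral_def real_scaleR_def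
proof (rule integral_cong_AE)
 have "(%s. indicator {0<..<u} s * f s) = (%s. indicator {0<..<u} s * (indicator {0..<u} s * f s))"
  by (auto simp: indicator_def fun_eq_iff)
 then show "(%s. indicator {0<..<u} s * f s) \<in> borel_measurable lborel" using assms by simp
 show "(%s. indicator {0..<u} s * f s) \<in> borel_measurable lborel" using assms by simp
 show "AE s in lborel. indicator {0<..<u} s * f s = indicator {0..<u} s * f s"
  by (rule AE_mp[OF AE_lborel_singleton[of 0] AE_I2]) (auto simp: indicator_def)
qed

text \<open>The last cell ends at \<open>u\<close> and would see a jump there, whereas the integral
  over \<open>[0,u)\<close> does not; hence the condition \<open>u \<notin> jset mp x\<close>. The
  second claim is uniform in \<open>n\<close> and serves as a dominating bound for
  expectations.\<close>

lemma good_path_Riemann_full: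
 assumes g: "good_path S a L B mp cd" "x \<in> S" "a > 0" "0 <= B" and u: "0 < u" "u \<notin> jset mp x"
  and G: "\<And>s. 0 < s ==> s < u ==> (G \<longlongrightarrow> G s) (at_left s)" "\<And>s. 0 <= s ==> s < u ==> \<bar>G s\<bar> <= K"
 shows "(%n. \<Sum>i<n. G (tp u n i) * (mp (tp u n (Suc i)) x - mp (tp u n i) x)) \<longlonglongrightarrow>
   (\<Sum>s\<in>{s\<in>jset mp x. s < u}. G s * jmp (%r. mp r x) s) + (LINT s:{0..<u}|lborel. G s * (- L * cd s x))"
  "\<And>n. \<bar>\<Sum>i<n. G (tp u n i) * (mp (tp u n (Suc i)) x - mp (tp u n i) x)\<bar> <= K * (a * real (card {s\<in>jset mp x. s < u}) + \<bar>L\<bar> * B * u)"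
proof -
 note d = good_pathD[OF g(1-3)]
 have eq: "{s\<in>jset mp x. s <= u} = {s\<in>jset mp x. s < u}" using u(2) by (auto simp: order.order_iff_strict)
 have K: "0 <= K" using G(2)[of 0] u by force
 let ?j = "%s. jmp (%r. mp r x) s"
 have split: "(\<Sum>i<n. G (tp u n i) * (mp (tp u n (Suc i)) x - mp (tp u n i) x))
   = (\<Sum>s\<in>{s\<in>jset mp x. s <= u}. G (lgrid u n s) * ?j s) + (\<Sum>i<n. G (tp u n i) * (LINT s:{tp u n i<..tp u n (Suc i)}|lborel. - L * cd s x))" if n: "n > 0" for n
 proof -
  have "mp (tp u n (Suc i)) x - mp (tp u n i) x = (\<Sum>r\<in>{r\<in>{s\<in>jset mp x. s <= u}. tp u n i < r \<and> r <= tp u n (Suc i)}. ?j r)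
    + (LINT r:{tp u n i<..tp u n (Suc i)}|lborel. - L * cd r x)" if "i < n" for i
  proof -
   have "tp u n (Suc i) <= u" "0 <= tp u n i" "tp u n i <= tp u n (Suc i)" using that u by (auto intro: tp_le tp_nonneg tp_mono)
   moreover from this have "{r\<in>{s\<in>jset mp x. s <= u}. tp u n i < r \<and> r <= tp u n (Suc i)} = {r\<in>jset mp x. tp u n i < r \<and> r <= tp u n (Suc i)}" by auto
   ultimately show ?thesis using good_path_increment(2)[OF g] by simp
  qed
  then have "(\<Sum>i<n. G (tp u n i) * (mp (tp u n (Suc i)) x - mp (tp u n i) x))
   = (\<Sum>i<n. (\<Sum>r\<in>{r\<in>{s\<in>jset mp x. s <= u}. tp u n i < r \<and> r <= tp u n (Suc i)}. G (tp u n i) * ?j r)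
    + G (tp u n i) * (LINT r:{tp u n i<..tp u n (Suc i)}|lborel. - L * cd r x))"
   by (intro sum.cong) (simp_all add: distrib_left sum_distrib_left)
  also have "\<dots> = (\<Sum>i<n. (\<Sum>r\<in>{r\<in>{s\<in>jset mp x. s <= u}. tp u n i < r \<and> r <= tp u n (Suc i)}. G (tp u n i) * ?j r))
    + (\<Sum>i<n. G (tp u n i) * (LINT r:{tp u n i<..tp u n (Suc i)}|lborel. - L * cd r x))" by (rule sum.distrib)
  also have "(\<Sum>i<n. (\<Sum>r\<in>{r\<in>{s\<in>jset mp x. s <= u}. tp u n i < r \<and> r <= tp u n (Suc i)}. G (tp u n i) * ?j r))
   = (\<Sum>s\<in>{s\<in>jset mp x. s <= u}. G (lgrid u n s) * ?j s)"
   unfolding lgrid_def using u n jset_pos[of mp x] by (intro sum_tidx d(1)) auto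
  finally show ?thesis .
 qed
 have l1: "(%n. \<Sum>s\<in>{s\<in>jset mp x. s <= u}. G (lgrid u n s) * ?j s) \<longlonglongrightarrow> (\<Sum>s\<in>{s\<in>jset mp x. s <= u}. G s * ?j s)"
 proof (intro tendsto_sum tendsto_mult tendsto_const)
  fix s assume "s \<in> {s\<in>jset mp x. s <= u}"
  then have "0 < s" "s < u" unfolding eq using jset_pos[of mp x] by auto
  then show "(%n. G (lgrid u n s)) \<longlonglongrightarrow> G s"
   by (intro filterlim_compose[OF G(1) lgrid_at_left[OF u(1)]]) auto
 qed
 have l2: "(%n. \<Sum>i<n. G (tp u n i) * (LINT s:{tp u n i<..tp u n (Suc i)}|lborel. - L * cd s x)) \<longlonglongrightarrow> (LINT s:{0<..<u}|lborel. G s * (- L * cd s x))"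
 proof (rule Riemann_drift[OF u(1) _ _ G])
  have "(%s. indicator {0<..u} s * (- L * cd s x)) = (%s. indicator {0<..u} s * (indicator {0..u} s * (- L * cd s x)))"
   by (auto simp: indicator_def fun_eq_iff)
  then show "set_borel_measurable borel {0<..u} (%s. - L * cd s x)"
   unfolding set_borel_measurable_def using d(7)[of u] by simp
  show "\<bar>- L * cd s x\<bar> <= \<bar>L\<bar> * B" if "0 < s" for s using d(6) that by simp
 qed
 have l3: "(LINT s:{0<..<u}|lborel. G s * (- L * cd s x)) = (LINT s:{0..<u}|lborel. G s * (- L * cd s x))"
 proof (rule set_lebesgue_integral_open)
  have "(%s. indicator {0..<u} s * (G s * (- L * cd s x))) = (%s. (indicator {0..<u} s * G s) * (indicator {0..u} s * (- L * cd s x)))"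
   by (auto simp: indicator_def fun_eq_iff)
  then show "borel_on u (%s. (G s * (- L * cd s x)))"
   using left_cont_borel[OF G(1)] d(7)[of u] by simp
 qed
 have "(%n. (\<Sum>s\<in>{s\<in>jset mp x. s <= u}. G (lgrid u n s) * ?j s) + (\<Sum>i<n. G (tp u n i) * (LINT s:{tp u n i<..tp u n (Suc i)}|lborel. - L * cd s x))) \<longlonglongrightarrow>
   (\<Sum>s\<in>{s\<in>jset mp x. s < u}. G s * ?j s) + (LINT s:{0..<u}|lborel. G s * (- L * cd s x))"
  using tendsto_add[OF l1 l2[unfolded l3]] unfolding eq .
 then show "(%n. \<Sum>i<n. G (tp u n i) * (mp (tp u n (Suc i)) x - mp (tp u n i) x)) \<longlonglongrightarrow>
   (\<Sum>s\<in>{s\<in>jset mp x. s < u}. G s * ?j s) + (LINT s:{0..<u}|lborel. G s * (- L * cd s x))"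
  by (rule Lim_transform_eventually) (rule eventually_mono[OF eventually_gt_at_top[of 0]], rule split[symmetric])
 fix n
 show "\<bar>\<Sum>i<n. G (tp u n i) * (mp (tp u n (Suc i)) x - mp (tp u n i) x)\<bar> <= K * (a * real (card {s\<in>jset mp x. s < u}) + \<bar>L\<bar> * B * u)"
 proof (cases "n = 0")
  case True then show ?thesis using K g(3,4) u by simp
 next
  case False
  have "\<bar>\<Sum>s\<in>{s\<in>jset mp x. s <= u}. G (lgrid u n s) * ?j s\<bar> <= (\<Sum>s\<in>{s\<in>jset mp x. s <= u}. K * a)"
  proof (rule order_trans[OF sum_abs sum_mono])
   fix s assume s: "s \<in> {s\<in>jset mp x. s <= u}"
   then have "0 < s" using jset_pos[of mp x] by auto
   then have "0 <= lgrid u n s" "lgrid u n s < u" using lgrid_bounds[OF u(1), of n s] s False by auto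
   then show "\<bar>G (lgrid u n s) * ?j s\<bar> <= K * a" unfolding abs_mult using G(2) d(3)[of s] s K by (intro mult_mono) auto
  qed
  also have "\<dots> = K * (a * real (card {s\<in>jset mp x. s < u}))" unfolding eq by simp
  finally have 1: "\<bar>\<Sum>s\<in>{s\<in>jset mp x. s <= u}. G (lgrid u n s) * ?j s\<bar> <= K * (a * real (card {s\<in>jset mp x. s < u}))" .
  have "\<bar>\<Sum>i<n. G (tp u n i) * (LINT s:{tp u n i<..tp u n (Suc i)}|lborel. - L * cd s x)\<bar> <= (\<Sum>i<n. K * (\<bar>L\<bar> * B * (u / real n)))"
  proof (rule order_trans[OF sum_abs sum_mono])
   fix i assume i: "i \<in> {..<n}"
   have t: "0 <= tp u n i" "tp u n i <= tp u n (Suc i)" "tp u n i < u" using i u tp_less[of u i n] by (auto intro: tp_nonneg tp_mono)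
   have "\<bar>LINT s:{tp u n i<..tp u n (Suc i)}|lborel. - L * cd s x\<bar> <= \<bar>L\<bar> * B * (u / real n)"
    using good_path_increment(3)[OF g t(1,2)] by (simp add: tp_Suc)
   then show "\<bar>G (tp u n i) * (LINT s:{tp u n i<..tp u n (Suc i)}|lborel. - L * cd s x)\<bar> <= K * (\<bar>L\<bar> * B * (u / real n))"
    unfolding abs_mult[of "G (tp u n i)"] using G(2)[OF t(1,3)] K by (intro mult_mono) auto
  qed
  also have "\<dots> = K * (\<bar>L\<bar> * B * u)" using False by simp
  finally have 2: "\<bar>\<Sum>i<n. G (tp u n i) * (LINT s:{tp u n i<..tp u n (Suc i)}|lborel. - L * cd s x)\<bar> <= K * (\<bar>L\<bar> * B * u)" .
  have n: "n > 0" using False by simp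
  show ?thesis unfolding split[OF n] distrib_left using 1 2 by linarith
 qed
qed

section \<open>Jump intensity from the quadratic variation\<close>

text \<open>\<open>\<kappa>\<close> bounds the jump intensity of a site. The factor
  \<open>1/4\<close> in \<open>quad\<close> is chosen so that Chebyshev's inequality at level
  \<open>a/2\<close> gives exactly \<open>\<kappa> * (t - s)\<close>. Integrating over events of the
  past expresses a conditional bound without conditional expectations.\<close>

locale jump_noise = prob_space P for P :: "'a measure" +
 fixes Fl :: "real => 'a measure" and M Cd :: "real => site => 'a => real"
  and S :: "site set" and a L B \<kappa> :: real
 assumes filt: "filtration_usual P Fl" and finS: "finite S" and a: "0 < a" and B: "0 <= B" and \<kappa>: "0 <= \<kappa>"
  and mart: "\<And>x. x \<in> S ==> mart P Fl (%t. M t x)"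
  and sq: "\<And>x t. x \<in> S ==> 0 <= t ==> integrable P (%w. (M t x w)\<^sup>2)"
  and quad: "\<And>x s t A. x \<in> S ==> 0 <= s ==> s <= t ==> A \<in> sets (Fl s) ==>
    (\<integral>w. indicator A w * ((M t x w)\<^sup>2 - (M s x w)\<^sup>2) \<partial>P) <= a\<^sup>2 / 4 * \<kappa> * (t - s) * prob A"
  and good: "AE w in P. good_path S a L B (%s x. M s x w) (%s x. Cd s x w)"
begin

abbreviation J :: "site => 'a => real set" where "J x w \<equiv> {s. jmp (%r. M r x w) s \<noteq> 0}"
abbreviation jp :: "site => 'a => real => real" where "jp x w s \<equiv> jmp (%r. M r x w) s"

lemma subalg: "0 <= t ==> subalgebra P (Fl t)"
 using conjunct1[OF filt[unfolded filtration_usual_def]] by simp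

lemma space_Fl: "0 <= t ==> space (Fl t) = space P"
 using subalg[of t] unfolding subalgebra_def by blast

lemma Fl_mono: "0 <= s ==> s <= t ==> A \<in> sets (Fl s) ==> A \<in> sets (Fl t)"
 using conjunct1[OF conjunct2[OF filt[unfolded filtration_usual_def]]] by (meson subsetD)

lemma meas_Fl_P: "0 <= t ==> f \<in> borel_measurable (Fl t) ==> f \<in> borel_measurable P"
 using measurable_from_subalg[OF subalg] by blast

lemma meas_Fl_mono: "0 <= s ==> s <= t ==> f \<in> borel_measurable (Fl s) ==> f \<in> borel_measurable (Fl t)"
 by (rule measurable_from_subalg[of "Fl t" "Fl s"])
  (simp_all add: subalgebra_def space_Fl subset_eq Fl_mono)

lemma meas_M: "x \<in> S ==> 0 <= t ==> M t x \<in> borel_measurable (Fl t)"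
 using mart[of x] unfolding mart_def by simp

lemma meas_MP: "x \<in> S ==> 0 <= t ==> M t x \<in> borel_measurable P"
 by (rule meas_Fl_P[OF _ meas_M])

lemma null_Fl: "0 <= t ==> A \<subseteq> N ==> N \<in> null_sets P ==> A \<in> sets (Fl t)"
proof -
 assume t: "0 <= t" and A: "A \<subseteq> N" and N: "N \<in> null_sets P"
 have "N \<in> sets P" "emeasure P N = 0" using N by auto
 moreover have "A \<subseteq> space P" using A sets.sets_into_space[OF \<open>N \<in> sets P\<close>] by simp
 ultimately have "A \<in> sets (Fl 0)"
  using conjunct2[OF conjunct2[OF conjunct2[OF filt[unfolded filtration_usual_def]]]] A by simp
 then show ?thesis using Fl_mono[of 0 t] t by simp
qed

text \<open>This is where the usual conditions enter: subsets of null sets belong to every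
  \<open>Fl t\<close>, so almost sure limits of adapted Riemann sums stay adapted.\<close>

lemma meas_Fl_AE:
 assumes t: "0 <= t" and g: "g \<in> borel_measurable (Fl t)" and AE: "AE w in P. f w = g w"
 shows "f \<in> borel_measurable (Fl t)"
proof (rule measurableI)
 obtain N where N: "N \<in> null_sets P" "{w\<in>space P. f w \<noteq> g w} \<subseteq> N"
  using AE by (auto simp: eventually_ae_filter)
 fix A :: "'b set" assume A: "A \<in> sets borel"
 have "f -` A \<inter> space (Fl t) = (g -` A \<inter> space (Fl t) - N) \<union> (f -` A \<inter> N \<inter> space (Fl t))"
  unfolding space_Fl[OF t] using N(2) by auto
 moreover have "g -` A \<inter> space (Fl t) \<in> sets (Fl t)" using g A by (rule measurable_sets)
 moreover have "N \<in> sets (Fl t)" "f -` A \<inter> N \<inter> space (Fl t) \<in> sets (Fl t)"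
  using null_Fl[OF t _ N(1)] by auto
 ultimately show "f -` A \<inter> space (Fl t) \<in> sets (Fl t)" by simp
qed simp

text \<open>The factor \<open>Z\<close> is known at time \<open>s\<close> and can be pulled out of
  the conditional expectation of \<open>M t x\<close>. Applied to each cell, this is the source of
  all mean-zero statements below.\<close>

lemma mart_orth:
 assumes x: "x \<in> S" and st: "0 <= s" "s <= t" and Z: "Z \<in> borel_measurable (Fl s)"
  and i: "integrable P (%w. Z w * M t x w)"
 shows "integrable P (%w. Z w * M s x w)" "(\<integral>w. Z w * M t x w \<partial>P) = (\<integral>w. Z w * M s x w \<partial>P)"
proof -
 interpret sigma_finite_subalgebra P "Fl s"
  by (rule finite_measure_subalgebra_is_sigma_finite) (auto simp: finite_measure_subalgebra_def finite_measure_subalgebra_axioms_def subalg[OF st(1)] finite_measure_axioms)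
 have [measurable]: "Z \<in> borel_measurable P" "M t x \<in> borel_measurable P" "M s x \<in> borel_measurable P"
  using meas_Fl_P[OF st(1) Z] meas_MP[OF x] st by auto
 have ae: "AE w in P. Z w * real_cond_exp P (Fl s) (M t x) w = Z w * M s x w"
 proof (rule eventually_mono)
  show "AE w in P. real_cond_exp P (Fl s) (M t x) w = M s x w" using mart[OF x] st unfolding mart_def by simp
 qed simp
 have t0: "0 <= t" using st by simp
 note c = real_cond_exp_intg[OF i Z meas_Fl_P[OF t0 meas_M[OF x t0]]]
 show "integrable P (%w. Z w * M s x w)"
  by (rule Bochner_Integration.integrable_cong_AE_imp[OF c(1) _ ae]) measurable
 show "(\<integral>w. Z w * M t x w \<partial>P) = (\<integral>w. Z w * M s x w \<partial>P)"
  unfolding c(2)[symmetric] by (rule integral_cong_AE[OF _ _ ae]) measurable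
qed

text \<open>On an event of the past the cross term \<open>M s x * M t x\<close> has the same
  integral as the square of \<open>M s x\<close>. Hence the squared increment integrates like the
  increment of the squares, to which \<open>quad\<close> applies.\<close>

lemma quad_set:
 assumes x: "x \<in> S" and st: "0 <= s" "s <= t" and A: "A \<in> sets (Fl s)"
 shows "(\<integral>\<^sup>+w. indicator A w * ennreal ((M t x w - M s x w)\<^sup>2) \<partial>P) <= ennreal (a\<^sup>2 / 4 * \<kappa> * (t - s)) * emeasure P A"
proof -
 have t0: "0 <= t" using st by simp
 have AP: "A \<in> sets P" using A subalg[OF st(1)] unfolding subalgebra_def by blast
 have m[measurable]: "M t x \<in> borel_measurable P" "M s x \<in> borel_measurable P" "A \<in> sets P"
  using meas_MP[OF x] st AP by auto
 have mA: "(%w. indicator A w * M s x w) \<in> borel_measurable (Fl s)"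
  using A meas_M[OF x st(1)] by measurable
 have ist: "integrable P (%w. M s x w * M t x w)"
 proof (rule Bochner_Integration.integrable_bound[OF Bochner_Integration.integrable_add[OF sq[OF x st(1)] sq[OF x t0]]])
  have "\<bar>u * v\<bar> <= u\<^sup>2 + v\<^sup>2" for u v :: real
  proof -
   have "2 * (\<bar>u\<bar> * \<bar>v\<bar>) <= u\<^sup>2 + v\<^sup>2" using sum_squares_bound[of "\<bar>u\<bar>" "\<bar>v\<bar>"] by simp
   moreover have "0 <= \<bar>u\<bar> * \<bar>v\<bar>" by simp
   ultimately show ?thesis unfolding abs_mult by linarith
  qed
  then show "AE w in P. norm (M s x w * M t x w) <= norm ((M s x w)\<^sup>2 + (M t x w)\<^sup>2)" by (intro AE_I2) simp
 qed measurable
 have iA: "integrable P (%w. indicator A w * f w)" if "integrable P f" for f :: "'a => real"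
  using integrable_mult_indicator[OF AP that] by simp
 have e: "(\<integral>w. indicator A w * (M s x w * M t x w) \<partial>P) = (\<integral>w. indicator A w * (M s x w)\<^sup>2 \<partial>P)"
  using mart_orth(2)[OF x st mA] iA[OF ist] by (simp add: mult.assoc power2_eq_square)
 have "(\<integral>w. indicator A w * (M t x w - M s x w)\<^sup>2 \<partial>P)
   = (\<integral>w. indicator A w * (M t x w)\<^sup>2 - 2 * (indicator A w * (M s x w * M t x w)) + indicator A w * (M s x w)\<^sup>2 \<partial>P)"
  by (intro Bochner_Integration.integral_cong) (auto simp: power2_eq_square algebra_simps)
 also have "\<dots> = (\<integral>w. indicator A w * (M t x w)\<^sup>2 \<partial>P) - 2 * (\<integral>w. indicator A w * (M s x w * M t x w) \<partial>P) + (\<integral>w. indicator A w * (M s x w)\<^sup>2 \<partial>P)"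
  using iA[OF sq[OF x st(1)]] iA[OF sq[OF x t0]] iA[OF ist] by simp
 also have "\<dots> = (\<integral>w. indicator A w * ((M t x w)\<^sup>2 - (M s x w)\<^sup>2) \<partial>P)"
  unfolding e using iA[OF sq[OF x st(1)]] iA[OF sq[OF x t0]] by (simp add: right_diff_distrib)
 also have "\<dots> <= a\<^sup>2 / 4 * \<kappa> * (t - s) * prob A" by (rule quad[OF x st A])
 finally have le: "(\<integral>w. indicator A w * (M t x w - M s x w)\<^sup>2 \<partial>P) <= a\<^sup>2 / 4 * \<kappa> * (t - s) * prob A" .
 have ii: "integrable P (%w. indicator A w * (M t x w - M s x w)\<^sup>2)"
 proof (rule iA)
  have "integrable P (%w. (M t x w)\<^sup>2 - 2 * (M s x w * M t x w) + (M s x w)\<^sup>2)"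
   using sq[OF x st(1)] sq[OF x t0] ist by simp
  then show "integrable P (%w. (M t x w - M s x w)\<^sup>2)" by (simp add: power2_eq_square algebra_simps)
 qed
 have "(\<integral>\<^sup>+w. indicator A w * ennreal ((M t x w - M s x w)\<^sup>2) \<partial>P) = (\<integral>\<^sup>+w. ennreal (indicator A w * (M t x w - M s x w)\<^sup>2) \<partial>P)"
  by (intro nn_integral_cong) (simp split: split_indicator)
 also have "\<dots> = ennreal (\<integral>w. indicator A w * (M t x w - M s x w)\<^sup>2 \<partial>P)"
  by (rule nn_integral_eq_integral[OF ii]) simp
 also have "\<dots> <= ennreal (a\<^sup>2 / 4 * \<kappa> * (t - s) * prob A)" using le by (rule ennreal_leI)
 also have "\<dots> = ennreal (a\<^sup>2 / 4 * \<kappa> * (t - s)) * emeasure P A"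
  unfolding emeasure_eq_measure using \<kappa> st by (intro ennreal_mult) auto
 finally show ?thesis .
qed

text \<open>From events to nonnegative weights by monotone approximation. The weight plays the part
  of conditioning on the past up to time \<open>s\<close>.\<close>

lemma quad_fun:
 fixes Z :: "'a => ennreal"
 assumes x: "x \<in> S" and st: "0 <= s" "s <= t" and Z: "Z \<in> borel_measurable (Fl s)"
 shows "(\<integral>\<^sup>+w. Z w * ennreal ((M t x w - M s x w)\<^sup>2) \<partial>P) <= ennreal (a\<^sup>2 / 4 * \<kappa> * (t - s)) * (\<integral>\<^sup>+w. Z w \<partial>P)"
proof -
 let ?c = "ennreal (a\<^sup>2 / 4 * \<kappa> * (t - s))" and ?D = "%w. ennreal ((M t x w - M s x w)\<^sup>2)"
 have t0: "0 <= t" using st by simp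
 have [measurable]: "M t x \<in> borel_measurable P" "M s x \<in> borel_measurable P"
  using meas_MP[OF x] st by auto
 have mP: "f \<in> borel_measurable P" if "f \<in> borel_measurable (Fl s)" for f :: "'a => ennreal"
  using meas_Fl_P[OF st(1) that] .
 show ?thesis
  using Z
 proof (induction rule: borel_measurable_induct)
  case (cong f g)
  then have e: "\<And>w. w \<in> space P ==> f w = g w" using space_Fl[OF st(1)] by simp
  have "(\<integral>\<^sup>+w. g w * ?D w \<partial>P) = (\<integral>\<^sup>+w. f w * ?D w \<partial>P)" "(\<integral>\<^sup>+w. g w \<partial>P) = (\<integral>\<^sup>+w. f w \<partial>P)"
   using e by (auto intro!: nn_integral_cong)
  then show ?case using cong by simp
 next
  case (set A)
  then have "A \<in> sets P" using subalg[OF st(1)] unfolding subalgebra_def by blast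
  then show ?case using quad_set[OF x st set] by (simp add: nn_integral_indicator)
 next
  case (mult u c)
  have [measurable]: "u \<in> borel_measurable P" using mult mP by blast
  have "(\<integral>\<^sup>+w. c * u w * ?D w \<partial>P) = c * (\<integral>\<^sup>+w. u w * ?D w \<partial>P)"
   by (simp add: nn_integral_cmult[symmetric] mult.assoc)
  also have "\<dots> <= c * (?c * (\<integral>\<^sup>+w. u w \<partial>P))" using mult by (intro mult_left_mono) auto
  also have "\<dots> = ?c * (\<integral>\<^sup>+w. c * u w \<partial>P)" by (simp add: nn_integral_cmult mult_ac)
  finally show ?case .
 next
  case (add u v)
  have [measurable]: "u \<in> borel_measurable P" "v \<in> borel_measurable P" using add mP by blast+
  show ?case using add by (simp add: distrib_right distrib_left nn_integral_add add_mono)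
 next
  case (seq U)
  have m[measurable]: "U i \<in> borel_measurable P" for i using seq mP by blast
  have s1: "(\<integral>\<^sup>+w. (SUP i. U i) w * ?D w \<partial>P) = (SUP i. \<integral>\<^sup>+w. U i w * ?D w \<partial>P)"
   unfolding SUP_apply SUP_mult_right_ennreal
   using seq(3) by (intro nn_integral_monotone_convergence_SUP) (auto simp: incseq_def le_fun_def intro!: mult_right_mono)
  have s2: "(\<integral>\<^sup>+w. (SUP i. U i) w \<partial>P) = (SUP i. \<integral>\<^sup>+w. U i w \<partial>P)"
   unfolding SUP_apply using seq(3) by (intro nn_integral_monotone_convergence_SUP) auto
  show ?case unfolding s1 s2 SUP_mult_left_ennreal using seq by (intro SUP_mono') auto
 qed
qed

text \<open>Chebyshev's inequality: an increment above \<open>a/2\<close> contributes more than a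
  quarter of the square of \<open>a\<close> to the squared increment.\<close>

lemma jump_prob:
 fixes Z :: "'a => ennreal"
 assumes x: "x \<in> S" and st: "0 <= s" "s <= t" and Z: "Z \<in> borel_measurable (Fl s)"
 shows "(\<integral>\<^sup>+w. Z w * indicator {y. a/2 < \<bar>y\<bar>} (M t x w - M s x w) \<partial>P) <= ennreal (\<kappa> * (t - s)) * (\<integral>\<^sup>+w. Z w \<partial>P)"
proof -
 have [measurable]: "M t x \<in> borel_measurable P" "M s x \<in> borel_measurable P" "Z \<in> borel_measurable P"
  using meas_MP[OF x] meas_Fl_P[OF st(1) Z] st by auto
 have ind: "indicator {y. a/2 < \<bar>y\<bar>} y <= ennreal (4 / a\<^sup>2) * ennreal (y\<^sup>2)" for y
 proof (cases "a/2 < \<bar>y\<bar>")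
  case True
  then have "(a/2)\<^sup>2 <= \<bar>y\<bar>\<^sup>2" using a by (intro power_mono) auto
  then have "1 <= 4 / a\<^sup>2 * y\<^sup>2" using a by (simp add: field_simps)
  then show ?thesis using True by (simp add: ennreal_mult[symmetric])
 qed simp
 have "(\<integral>\<^sup>+w. Z w * indicator {y. a/2 < \<bar>y\<bar>} (M t x w - M s x w) \<partial>P) <= (\<integral>\<^sup>+w. ennreal (4 / a\<^sup>2) * (Z w * ennreal ((M t x w - M s x w)\<^sup>2)) \<partial>P)"
  using mult_left_mono[OF ind] by (intro nn_integral_mono) (simp add: mult.left_commute)
 also have "\<dots> = ennreal (4 / a\<^sup>2) * (\<integral>\<^sup>+w. Z w * ennreal ((M t x w - M s x w)\<^sup>2) \<partial>P)"
  by (rule nn_integral_cmult) measurable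
 also have "\<dots> <= ennreal (4 / a\<^sup>2) * (ennreal (a\<^sup>2 / 4 * \<kappa> * (t - s)) * (\<integral>\<^sup>+w. Z w \<partial>P))"
  by (intro mult_left_mono quad_fun[OF x st Z]) simp
 also have "\<dots> = ennreal (\<kappa> * (t - s)) * (\<integral>\<^sup>+w. Z w \<partial>P)"
 proof -
  have "ennreal (4 / a\<^sup>2) * ennreal (a\<^sup>2 / 4 * \<kappa> * (t - s)) = ennreal (4 / a\<^sup>2 * (a\<^sup>2 / 4 * \<kappa> * (t - s)))"
   using \<kappa> st by (intro ennreal_mult[symmetric]) auto
  also have "4 / a\<^sup>2 * (a\<^sup>2 / 4 * \<kappa> * (t - s)) = \<kappa> * (t - s)" using a by simp
  finally show ?thesis by (simp add: mult.assoc[symmetric])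
 qed
 finally show ?thesis .
qed

end

context jump_noise
begin

text \<open>The threshold \<open>a/2\<close> separates increments caused by the drift from genuine
  jumps \<open>a\<close> and \<open>- a\<close>, near which the indicator is locally constant. It is
  therefore an admissible \<open>\<psi>\<close> for the Riemann sums over jumps.\<close>

lemma jump_indicator:
 "\<bar>y\<bar> < a/2 ==> indicator {y. a/2 < \<bar>y\<bar>} y = (0::real)"
 "isCont (indicator {y. a/2 < \<bar>y\<bar>} :: real => real) a"
 "isCont (indicator {y. a/2 < \<bar>y\<bar>} :: real => real) (- a)"
proof -
 show "\<bar>y\<bar> < a/2 ==> indicator {y. a/2 < \<bar>y\<bar>} y = (0::real)" by simp
 have c: "isCont (indicator {y. a/2 < \<bar>y\<bar>} :: real => real) b" if "a/2 < \<bar>b\<bar>" for b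
 proof -
  have "open {y. a/2 < \<bar>y\<bar>}" by (intro open_Collect_less continuous_intros)
  then have "\<forall>\<^sub>F y in nhds b. y \<in> {y. a/2 < \<bar>y\<bar>}" using that by (intro eventually_nhds_in_open) auto
  then have "\<forall>\<^sub>F y in nhds b. indicator {y. a/2 < \<bar>y\<bar>} y = (1::real)" by (rule eventually_mono) simp
  then show ?thesis using isCont_cong[of "indicator {y. a/2 < \<bar>y\<bar>}" "%_. 1" b] by simp
 qed
 show "isCont (indicator {y. a/2 < \<bar>y\<bar>} :: real => real) a" "isCont (indicator {y. a/2 < \<bar>y\<bar>} :: real => real) (- a)"
  by (rule c, use a in simp)+
qed

text \<open>A jump at \<open>u\<close> forces the increments over short intervals ending at
  \<open>u\<close> to exceed \<open>a/2\<close> eventually. By \<open>jump_prob\<close> the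
  probabilities of these events tend to 0, and Fatou's lemma concludes.\<close>

lemma no_fixed_jump:
 assumes x: "x \<in> S" and u: "0 < u"
 shows "AE w in P. u \<notin> J x w"
proof -
 define A where "A = (%n w. indicator {y. a/2 < \<bar>y\<bar>} (M u x w - M (u - u / real (Suc n)) x w) :: ennreal)"
 have t: "0 <= u - u / real (Suc n)" "u - u / real (Suc n) <= u" for n using u by (auto simp: field_simps)
 have m[measurable]: "A n \<in> borel_measurable P" for n
 proof -
  have [measurable]: "M u x \<in> borel_measurable P" "M (u - u / real (Suc n)) x \<in> borel_measurable P"
   using meas_MP[OF x] meas_MP[OF x t(1)] u by auto
  show ?thesis unfolding A_def by measurable
 qed
 have "(\<integral>\<^sup>+w. liminf (%n. A n w) \<partial>P) <= liminf (%n. \<integral>\<^sup>+w. A n w \<partial>P)" by (rule nn_integral_liminf) measurable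
 also have "\<dots> <= liminf (%n. ennreal (\<kappa> * (u / real (Suc n))))"
 proof (rule Liminf_mono, rule always_eventually, rule allI)
  fix n
  show "(\<integral>\<^sup>+w. A n w \<partial>P) <= ennreal (\<kappa> * (u / real (Suc n)))"
   using jump_prob[OF x t, of "%_. 1"] unfolding A_def by (simp add: emeasure_space_1)
 qed
 also have "\<dots> = 0"
 proof -
  have "(%n. \<kappa> * (u / real n)) \<longlonglongrightarrow> 0" using tendsto_mult_right_zero[OF lim_const_over_n] by blast
  then have "(%n. \<kappa> * (u / real (Suc n))) \<longlonglongrightarrow> 0" by (rule LIMSEQ_Suc)
  then have "(%n. ennreal (\<kappa> * (u / real (Suc n)))) \<longlonglongrightarrow> ennreal 0" by (rule tendsto_ennrealI)
  then show ?thesis using lim_imp_Liminf[OF sequentially_bot] by (metis ennreal_0)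
 qed
 finally have "(\<integral>\<^sup>+w. liminf (%n. A n w) \<partial>P) = 0" by simp
 then have "AE w in P. liminf (%n. A n w) = 0" by (subst (asm) nn_integral_0_iff_AE) measurable
 then show ?thesis using good
 proof eventually_elim
  case (elim w)
  show ?case
  proof
   assume j: "u \<in> J x w"
   let ?X = "%r. M r x w"
   note d = good_pathD[OF elim(2) x a]
   have c: "cadlag ?X" using elim(2) x unfolding good_path_def by blast
   obtain z where z: "(?X \<longlongrightarrow> z) (at_left u)" using c u unfolding cadlag_def by blast
   have jz: "jp x w u = ?X u - z" unfolding jmp_def using u tendsto_Lim[OF _ z] by simp
   have "(%n. u - u / real n) \<longlonglongrightarrow> u - 0" by (intro tendsto_diff tendsto_const lim_const_over_n)
   then have "(%n. u - u / real (Suc n)) \<longlonglongrightarrow> u" using LIMSEQ_Suc by fastforce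
   then have "filterlim (%n. u - u / real (Suc n)) (at_left u) sequentially"
    unfolding filterlim_at using u by (simp add: field_simps)
   then have "(%n. ?X u - ?X (u - u / real (Suc n))) \<longlonglongrightarrow> ?X u - z"
    by (intro tendsto_diff tendsto_const filterlim_compose[OF z])
   then have "(%n. \<bar>?X u - ?X (u - u / real (Suc n))\<bar>) \<longlonglongrightarrow> a"
    using tendsto_rabs d(3)[OF j] unfolding jz by fastforce
   then have "\<forall>\<^sub>F n in sequentially. a/2 < \<bar>?X u - ?X (u - u / real (Suc n))\<bar>"
    using a by (intro order_tendstoD(1)) auto
   then have "\<forall>\<^sub>F n in sequentially. A n w = 1" unfolding A_def by (rule eventually_mono) simp
   then have "liminf (%n. A n w) = liminf (%n. 1)" by (rule Liminf_eq)
   then show False using elim(1) by (simp add: Liminf_const)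
  qed
 qed
qed

section \<open>Left-continuous adapted integrands\<close>

text \<open>These processes serve as integrands in place of predictable ones: the value at a jump
  time is determined by the strict past, and values at grid points just before it approximate
  it.\<close>

definition LA :: "real => (real => 'a => real) => bool" where
 "LA u Y \<longleftrightarrow> (\<forall>s. 0 <= s --> s < u --> Y s \<in> borel_measurable (Fl s)) \<and>
   (AE w in P. \<forall>s. 0 < s --> s < u --> ((%r. Y r w) \<longlongrightarrow> Y s w) (at_left s))"

lemma LA_meas: "LA u Y ==> 0 <= s ==> s < u ==> Y s \<in> borel_measurable (Fl s)"
 unfolding LA_def by blast

lemma LA_measP: "LA u Y ==> 0 <= s ==> s < u ==> Y s \<in> borel_measurable P"
 using LA_meas meas_Fl_P by blast

lemma LA_lim: "LA u Y ==> AE w in P. \<forall>s. 0 < s --> s < u --> ((%r. Y r w) \<longlongrightarrow> Y s w) (at_left s)"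
 unfolding LA_def by blast

lemma LA_combine:
 assumes "LA u Y" "LA u Z" "continuous_on UNIV (%p::real \<times> real. f (fst p) (snd p))"
 shows "LA u (%s w. f (Y s w) (Z s w) :: real)"
proof -
 have fm: "(%p. f (fst p) (snd p)) \<in> borel_measurable (borel \<Otimes>\<^sub>M borel)"
  unfolding borel_prod using assms(3) by (rule borel_measurable_continuous_onI)
 have c: "isCont (%p. f (fst p) (snd p)) q" for q
  using assms(3) unfolding continuous_on_eq_continuous_at[OF open_UNIV] by blast
 have "AE w in P. \<forall>s. 0 < s --> s < u --> ((%r. f (Y r w) (Z r w)) \<longlongrightarrow> f (Y s w) (Z s w)) (at_left s)"
  using LA_lim[OF assms(1)] LA_lim[OF assms(2)]
 proof eventually_elim
  case (elim w)
  show ?case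
  proof (intro allI impI)
   fix s assume "0 < s" "s < u"
   then have "((%r. (Y r w, Z r w)) \<longlongrightarrow> (Y s w, Z s w)) (at_left s)" using elim by (intro tendsto_Pair) blast+
   from isCont_tendsto_compose[OF c this] show "((%r. f (Y r w) (Z r w)) \<longlongrightarrow> f (Y s w) (Z s w)) (at_left s)" by simp
  qed
 qed
 moreover have "(%w. f (Y s w) (Z s w)) \<in> borel_measurable (Fl s)" if "0 <= s" "s < u" for s
  using measurable_compose[OF measurable_Pair[OF LA_meas[OF assms(1) that] LA_meas[OF assms(2) that]] fm] by simp
 ultimately show ?thesis unfolding LA_def by blast
qed

lemma LA_mult: "LA u Y ==> LA u Z ==> LA u (%s w. Y s w * Z s w)"
 by (rule LA_combine) (auto intro!: continuous_intros)

lemma LA_add: "LA u Y ==> LA u Z ==> LA u (%s w. Y s w + Z s w)"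
 by (rule LA_combine) (auto intro!: continuous_intros)

lemma LA_compose: "LA u Y ==> continuous_on UNIV f ==> LA u (%s w. f (Y s w) :: real)"
 by (rule LA_combine) (auto intro!: continuous_intros elim: continuous_on_compose2)

lemma LA_det: "(\<And>s. 0 < s ==> s < u ==> (f \<longlongrightarrow> f s) (at_left s)) ==> LA u (%s w. f s)"
 unfolding LA_def by auto

lemma LA_const: "LA u (%s w. c)"
 by (rule LA_det) simp

lemma LA_subset: "LA u Y ==> v <= u ==> LA v Y"
 unfolding LA_def by (auto elim!: eventually_mono)

lemma Riemann_jumps_AE:
 assumes x: "x \<in> S" and u: "0 < u" and Y: "LA u Y"
  and \<psi>: "\<And>y. \<bar>y\<bar> < r ==> \<psi> y = 0" "0 < r" "isCont \<psi> a" "isCont \<psi> (- a)"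
 shows "AE w in P. (%n. \<Sum>i<n. Y (tp u n i) w * \<psi> (M (tp u n (Suc i)) x w - M (tp u n i) x w)) \<longlonglongrightarrow>
   (\<Sum>s\<in>{s\<in>J x w. s < u}. Y s w * \<psi> (jp x w s))"
 using LA_lim[OF Y] good no_fixed_jump[OF x u]
proof eventually_elim
 case (elim w)
 have eq: "{s\<in>J x w. s <= u} = {s\<in>J x w. s < u}" using elim(3) by (auto simp: order.order_iff_strict)
 have "((%r. Y r w) \<longlongrightarrow> Y s w) (at_left s)" if "s \<in> J x w" "s <= u" for s
 proof -
  have "0 < s" using that jset_pos[of "%s x. M s x w" x] by auto
  moreover have "s < u" using that eq by auto
  ultimately show ?thesis using elim(1) by blast
 qed
 from good_path_Riemann[OF elim(2) x a B u \<psi> this] show ?case unfolding eq .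
qed

lemma Riemann_full_AE:
 assumes x: "x \<in> S" and u: "0 < u" and Y: "LA u Y" and V: "AE w in P. \<forall>s. 0 <= s --> s < u --> \<bar>Y s w\<bar> <= V w"
 shows "AE w in P. (%n. \<Sum>i<n. Y (tp u n i) w * (M (tp u n (Suc i)) x w - M (tp u n i) x w)) \<longlonglongrightarrow>
   LS_int (%s. M s x w) (%s. Y s w) u"
  "AE w in P. \<forall>n. \<bar>\<Sum>i<n. Y (tp u n i) w * (M (tp u n (Suc i)) x w - M (tp u n i) x w)\<bar> <= V w * (a * real (card {s\<in>J x w. s < u}) + \<bar>L\<bar> * B * u)"
proof -
 have *: "AE w in P. ((%n. \<Sum>i<n. Y (tp u n i) w * (M (tp u n (Suc i)) x w - M (tp u n i) x w)) \<longlonglongrightarrow>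
   LS_int (%s. M s x w) (%s. Y s w) u) \<and> (\<forall>n. \<bar>\<Sum>i<n. Y (tp u n i) w * (M (tp u n (Suc i)) x w - M (tp u n i) x w)\<bar> <= V w * (a * real (card {s\<in>J x w. s < u}) + \<bar>L\<bar> * B * u))"
  using LA_lim[OF Y] good no_fixed_jump[OF x u] V
 proof eventually_elim
  case (elim w)
  have l: "((%r. Y r w) \<longlongrightarrow> Y s w) (at_left s)" if "0 < s" "s < u" for s using elim(1) that by blast
  have b: "\<bar>Y s w\<bar> <= V w" if "0 <= s" "s < u" for s using elim(4) that by blast
  show ?case
   using good_path_Riemann_full[OF elim(2) x a B u elim(3) l b]
    good_path_LS_int[OF elim(2) x a less_imp_le[OF u] left_cont_borel[OF l] b] by simp
 qed
 show "AE w in P. (%n. \<Sum>i<n. Y (tp u n i) w * (M (tp u n (Suc i)) x w - M (tp u n i) x w)) \<longlonglongrightarrow>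
   LS_int (%s. M s x w) (%s. Y s w) u"
  "AE w in P. \<forall>n. \<bar>\<Sum>i<n. Y (tp u n i) w * (M (tp u n (Suc i)) x w - M (tp u n i) x w)\<bar> <= V w * (a * real (card {s\<in>J x w. s < u}) + \<bar>L\<bar> * B * u)"
  using * by (auto elim!: eventually_mono)
qed

lemma expect_left_cont:
 assumes Y: "LA u Y" and V: "integrable P V" "AE w in P. \<forall>s. 0 <= s --> s < u --> \<bar>Y s w\<bar> <= V w" and s: "0 < s" "s < u"
 shows "((%r. expectation (Y r)) \<longlongrightarrow> expectation (Y s)) (at_left s)"
proof (rule tendsto_at_left_sequentially[where b=0])
 show "0 < s" by fact
 fix X :: "nat => real" assume X: "\<And>n. X n < s" "\<And>n. 0 < X n" "incseq X" "X \<longlonglongrightarrow> s"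
 have XF: "filterlim X (at_left s) sequentially" unfolding filterlim_at using X by (auto simp: less_imp_neq)
 show "(%n. expectation (Y (X n))) \<longlonglongrightarrow> expectation (Y s)"
 proof (rule integral_dominated_convergence[where w=V])
  show "Y s \<in> borel_measurable P" by (rule LA_measP[OF Y]) (use s in auto)
  show "Y (X n) \<in> borel_measurable P" for n
   by (rule LA_measP[OF Y]) (use X(1)[of n] X(2)[of n] s in auto)
  show "AE w in P. (%n. Y (X n) w) \<longlonglongrightarrow> Y s w"
   using LA_lim[OF Y]
  proof eventually_elim
   case (elim w)
   then have "((%r. Y r w) \<longlongrightarrow> Y s w) (at_left s)" using s by blast
   then show ?case by (rule filterlim_compose[OF _ XF])
  qed
  show "AE w in P. norm (Y (X n) w) <= V w" for n
   using V(2)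
  proof eventually_elim
   case (elim w)
   have "0 <= X n" "X n < u" using X(1)[of n] X(2)[of n] s by auto
   then show ?case using elim by simp
  qed
 qed (rule V)
qed

text \<open>The sum over jumps is a limit of Riemann sums in which a cell counts if its increment
  exceeds \<open>a/2\<close>. By \<open>jump_prob\<close> the mean of each summand is at most
  \<open>\<kappa>\<close> times the cell length times the mean of \<open>Y\<close> at the left end.
  Fatou's lemma handles the left side, and the right side is a deterministic Riemann sum with
  left-continuous integrand.\<close>

lemma jump_intensity_LA:
 assumes x: "x \<in> S" and u: "0 < u" and Y: "LA u Y" and V: "integrable P V" "AE w in P. \<forall>s. 0 <= s --> s < u --> 0 <= Y s w \<and> Y s w <= V w"
 shows "(\<integral>\<^sup>+w. ennreal (\<Sum>s\<in>{s\<in>J x w. s < u}. Y s w) \<partial>P) <= ennreal (\<kappa> * (LINT s:{0<..<u}|lborel. expectation (Y s)))"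
proof -
 let ?\<psi> = "indicator {y. a/2 < \<bar>y\<bar>} :: real => real"
 have V': "AE w in P. \<forall>s. 0 <= s --> s < u --> \<bar>Y s w\<bar> <= V w" using V(2) by (elim eventually_mono) auto
 define R where "R = (%n w. \<Sum>i<n. Y (tp u n i) w * ?\<psi> (M (tp u n (Suc i)) x w - M (tp u n i) x w))"
 have t: "0 <= tp u n i" "tp u n i <= tp u n (Suc i)" "tp u n i < u" "0 <= tp u n (Suc i)" if "i < n" for n i
  using that u tp_less[of u i n] by (auto intro: tp_nonneg tp_mono)
 have mY: "Y (tp u n i) \<in> borel_measurable P" if "i < n" for n i by (rule LA_measP[OF Y]) (use t[OF that] in auto)
 have ey: "0 <= expectation (Y (tp u n i))" "(\<integral>\<^sup>+w. ennreal (Y (tp u n i) w) \<partial>P) = ennreal (expectation (Y (tp u n i)))" if "i < n" for n i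
 proof -
  have ae: "AE w in P. 0 <= Y (tp u n i) w" using V(2) t[OF that] by (auto elim: eventually_mono)
  then show "0 <= expectation (Y (tp u n i))" by (rule integral_nonneg_AE)
  have "AE w in P. norm (Y (tp u n i) w) <= norm (V w)"
   using V(2)
  proof eventually_elim
   case (elim w)
   then have "0 <= Y (tp u n i) w \<and> Y (tp u n i) w <= V w" using t[OF that] by blast
   then show ?case by simp
  qed
  then have "integrable P (Y (tp u n i))" by (rule Bochner_Integration.integrable_bound[OF V(1) mY[OF that]])
  then show "(\<integral>\<^sup>+w. ennreal (Y (tp u n i) w) \<partial>P) = ennreal (expectation (Y (tp u n i)))" using ae by (rule nn_integral_eq_integral)
 qed
 have mR: "R n \<in> borel_measurable P" for n
 proof -
  have "?\<psi> \<in> borel_measurable borel" by measurable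
  then have "(%w. ?\<psi> (M (tp u n (Suc i)) x w - M (tp u n i) x w)) \<in> borel_measurable P" if "i < n" for i
   by (rule measurable_compose[rotated]) (intro borel_measurable_diff meas_MP[OF x] t that)
  then show ?thesis unfolding R_def by (intro borel_measurable_sum borel_measurable_times mY) auto
 qed
 have lim0: "AE w in P. (%n. \<Sum>i<n. Y (tp u n i) w * ?\<psi> (M (tp u n (Suc i)) x w - M (tp u n i) x w)) \<longlonglongrightarrow>
   (\<Sum>s\<in>{s\<in>J x w. s < u}. Y s w * ?\<psi> (jp x w s))"
  by (rule Riemann_jumps_AE[OF x u Y, where r="a/2"]) (use a jump_indicator in auto)
 have lim: "AE w in P. (%n. R n w) \<longlonglongrightarrow> (\<Sum>s\<in>{s\<in>J x w. s < u}. Y s w)"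
  using lim0 good
 proof eventually_elim
  case (elim w)
  have "(\<Sum>s\<in>{s\<in>J x w. s < u}. Y s w * ?\<psi> (jp x w s)) = (\<Sum>s\<in>{s\<in>J x w. s < u}. Y s w)"
   using good_pathD(3)[OF elim(2) x a] a by (intro sum.cong) auto
  then show ?case using elim(1) a unfolding R_def by simp
 qed
 have "(\<integral>\<^sup>+w. ennreal (\<Sum>s\<in>{s\<in>J x w. s < u}. Y s w) \<partial>P) = (\<integral>\<^sup>+w. liminf (%n. ennreal (R n w)) \<partial>P)"
 proof (rule nn_integral_cong_AE, use lim in eventually_elim)
  case (elim w)
  from tendsto_ennrealI[OF this] show ?case by (rule lim_imp_Liminf[OF sequentially_bot, symmetric])
 qed
 also have "\<dots> <= liminf (%n. \<integral>\<^sup>+w. ennreal (R n w) \<partial>P)"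
  using mR by (intro nn_integral_liminf) auto
 also have "\<dots> <= liminf (%n. ennreal (\<kappa> * (\<Sum>i<n. expectation (Y (tp u n i)) * (LINT s:{tp u n i<..tp u n (Suc i)}|lborel. 1))))"
 proof (rule Liminf_mono, rule always_eventually, rule allI)
  fix n
  have "(\<integral>\<^sup>+w. ennreal (R n w) \<partial>P) <= (\<integral>\<^sup>+w. (\<Sum>i<n. ennreal (Y (tp u n i) w) * indicator {y. a/2 < \<bar>y\<bar>} (M (tp u n (Suc i)) x w - M (tp u n i) x w)) \<partial>P)"
  proof (rule nn_integral_mono)
   fix w
   \<comment> \<open>Nonnegativity of \<open>Y\<close> holds only almost surely, whereas this
     comparison is made for every \<open>w\<close>; hence the positive part.\<close>
   have "ennreal (R n w) <= ennreal (\<Sum>i<n. max 0 (Y (tp u n i) w) * ?\<psi> (M (tp u n (Suc i)) x w - M (tp u n i) x w))"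
    unfolding R_def by (intro ennreal_leI sum_mono mult_right_mono) auto
   also have "\<dots> = (\<Sum>i<n. ennreal (max 0 (Y (tp u n i) w) * ?\<psi> (M (tp u n (Suc i)) x w - M (tp u n i) x w)))"
    by (intro sum_ennreal[symmetric]) simp
   also have "\<dots> = (\<Sum>i<n. ennreal (Y (tp u n i) w) * indicator {y. a/2 < \<bar>y\<bar>} (M (tp u n (Suc i)) x w - M (tp u n i) x w))"
    by (intro sum.cong) (auto split: split_indicator simp: max_def ennreal_neg)
   finally show "ennreal (R n w) <= (\<Sum>i<n. ennreal (Y (tp u n i) w) * indicator {y. a/2 < \<bar>y\<bar>} (M (tp u n (Suc i)) x w - M (tp u n i) x w))" .
  qed
  also have "\<dots> = (\<Sum>i<n. \<integral>\<^sup>+w. ennreal (Y (tp u n i) w) * indicator {y. a/2 < \<bar>y\<bar>} (M (tp u n (Suc i)) x w - M (tp u n i) x w) \<partial>P)"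
  proof (rule nn_integral_sum)
   fix i assume "i \<in> {..<n}"
   then have i: "i < n" by simp
   have "(indicator {y. a/2 < \<bar>y\<bar>} :: real => ennreal) \<in> borel_measurable borel" by measurable
   then have "(%w. indicator {y. a/2 < \<bar>y\<bar>} (M (tp u n (Suc i)) x w - M (tp u n i) x w) :: ennreal) \<in> borel_measurable P"
    by (rule measurable_compose[rotated]) (intro borel_measurable_diff meas_MP[OF x] t[OF i])
   then show "(%w. ennreal (Y (tp u n i) w) * indicator {y. a/2 < \<bar>y\<bar>} (M (tp u n (Suc i)) x w - M (tp u n i) x w)) \<in> borel_measurable P"
    using mY[OF i] by simp
  qed
  also have "\<dots> <= (\<Sum>i<n. ennreal (\<kappa> * (tp u n (Suc i) - tp u n i)) * (\<integral>\<^sup>+w. ennreal (Y (tp u n i) w) \<partial>P))"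
  proof (rule sum_mono)
   fix i assume "i \<in> {..<n}"
   then have i: "i < n" by simp
   have "(%w. ennreal (Y (tp u n i) w)) \<in> borel_measurable (Fl (tp u n i))"
    using LA_meas[OF Y t(1,3)[OF i]] by simp
   from jump_prob[OF x t(1,2)[OF i] this]
   show "(\<integral>\<^sup>+w. ennreal (Y (tp u n i) w) * indicator {y. a/2 < \<bar>y\<bar>} (M (tp u n (Suc i)) x w - M (tp u n i) x w) \<partial>P)
    <= ennreal (\<kappa> * (tp u n (Suc i) - tp u n i)) * (\<integral>\<^sup>+w. ennreal (Y (tp u n i) w) \<partial>P)" .
  qed
  also have "\<dots> = (\<Sum>i<n. ennreal (\<kappa> * (expectation (Y (tp u n i)) * (LINT s:{tp u n i<..tp u n (Suc i)}|lborel. 1))))"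
  proof (rule sum.cong)
   fix i assume "i \<in> {..<n}"
   then have i: "i < n" by simp
   have "(LINT s:{tp u n i<..tp u n (Suc i)}|lborel. 1) = tp u n (Suc i) - tp u n i"
    using t[OF i] by (simp add: set_lebesgue_integral_def)
   then show "ennreal (\<kappa> * (tp u n (Suc i) - tp u n i)) * (\<integral>\<^sup>+w. ennreal (Y (tp u n i) w) \<partial>P) = ennreal (\<kappa> * (expectation (Y (tp u n i)) * (LINT s:{tp u n i<..tp u n (Suc i)}|lborel. 1)))"
    using ey[OF i] \<kappa> t[OF i] by (simp add: ennreal_mult[symmetric] mult_ac)
  qed simp
  also have "\<dots> = ennreal (\<kappa> * (\<Sum>i<n. expectation (Y (tp u n i)) * (LINT s:{tp u n i<..tp u n (Suc i)}|lborel. 1)))"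
  proof -
   have "0 <= (LINT s:{tp u n i<..tp u n (Suc i)}|lborel. (1::real))" if "i < n" for i
    using t[OF that] by (simp add: set_lebesgue_integral_def)
   then show ?thesis using ey \<kappa> by (subst sum_ennreal) (auto simp: sum_distrib_left)
  qed
  finally show "(\<integral>\<^sup>+w. ennreal (R n w) \<partial>P) <= ennreal (\<kappa> * (\<Sum>i<n. expectation (Y (tp u n i)) * (LINT s:{tp u n i<..tp u n (Suc i)}|lborel. 1)))" .
 qed
 also have "\<dots> = ennreal (\<kappa> * (LINT s:{0<..<u}|lborel. expectation (Y s)))"
 proof -
  have "(%n. \<Sum>i<n. expectation (Y (tp u n i)) * (LINT s:{tp u n i<..tp u n (Suc i)}|lborel. 1)) \<longlonglongrightarrow> (LINT s:{0<..<u}|lborel. expectation (Y s) * 1)"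
  proof (rule Riemann_drift[OF u, where B=1 and K="expectation (%w. \<bar>V w\<bar>)"])
   show "set_borel_measurable borel {0<..u} (%s. 1::real)" by (simp add: set_borel_measurable_def)
   show "((%s. expectation (Y s)) \<longlongrightarrow> expectation (Y s)) (at_left s)" if "0 < s" "s < u" for s
    by (rule expect_left_cont[OF Y V(1) V' that])
   show "\<bar>expectation (Y s)\<bar> <= expectation (%w. \<bar>V w\<bar>)" if "0 <= s" "s < u" for s
   proof -
    have ae: "AE w in P. \<bar>Y s w\<bar> <= \<bar>V w\<bar>" using V'
    proof eventually_elim
     case (elim w)
     then have "\<bar>Y s w\<bar> <= V w" using that by blast
     then show ?case by linarith
    qed
    have m: "Y s \<in> borel_measurable P" using LA_measP[OF Y that] .
    have "integrable P (Y s)" by (rule Bochner_Integration.integrable_bound[OF V(1) m]) (use ae in simp)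
    then have "expectation (%w. \<bar>Y s w\<bar>) <= expectation (%w. \<bar>V w\<bar>)"
     using V(1) ae by (intro integral_mono_AE integrable_abs) auto
    then show ?thesis using integral_abs_bound[of P "Y s"] by linarith
   qed
  qed simp
  then have "(%n. ennreal (\<kappa> * (\<Sum>i<n. expectation (Y (tp u n i)) * (LINT s:{tp u n i<..tp u n (Suc i)}|lborel. 1)))) \<longlonglongrightarrow> ennreal (\<kappa> * (LINT s:{0<..<u}|lborel. expectation (Y s)))"
   by (intro tendsto_ennrealI tendsto_mult tendsto_const) simp
  then show ?thesis by (rule lim_imp_Liminf[OF sequentially_bot])
 qed
 finally show ?thesis .
qed

end

context jump_noise
begin

lemma meas_Fl_lim:
 fixes g :: "nat => 'a => real"
 assumes t: "0 <= t" and g: "\<And>n. g n \<in> borel_measurable (Fl t)" and AE: "AE w in P. (%n. g n w) \<longlonglongrightarrow> f w"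
 shows "f \<in> borel_measurable (Fl t)"
proof (rule meas_Fl_AE[OF t])
 show "(%w. lim (%n. g n w)) \<in> borel_measurable (Fl t)" using g by measurable
 show "AE w in P. f w = lim (%n. g n w)" using AE by (rule eventually_mono) (rule limI[symmetric])
qed

lemma Riemann_meas:
 assumes x: "x \<in> S" and u: "0 < u" and Y: "LA u Y" and \<psi>: "\<psi> \<in> borel_measurable borel"
 shows "(%w. \<Sum>i<n. Y (tp u n i) w * \<psi> (M (tp u n (Suc i)) x w - M (tp u n i) x w)) \<in> borel_measurable (Fl u)"
proof (intro borel_measurable_sum borel_measurable_times)
 fix i assume "i \<in> {..<n}"
 then have t: "0 <= tp u n i" "tp u n i <= tp u n (Suc i)" "tp u n i < u" "0 <= tp u n (Suc i)" "tp u n (Suc i) <= u"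
  using u tp_less[of u i n] by (auto intro: tp_nonneg tp_mono tp_le)
 show "Y (tp u n i) \<in> borel_measurable (Fl u)"
  by (rule meas_Fl_mono[OF t(1) _ LA_meas[OF Y t(1,3)]]) (use t in simp)
 have "M (tp u n i) x \<in> borel_measurable (Fl u)" "M (tp u n (Suc i)) x \<in> borel_measurable (Fl u)"
  using t by (auto intro!: meas_Fl_mono[OF _ _ meas_M[OF x]])
 then show "(%w. \<psi> (M (tp u n (Suc i)) x w - M (tp u n i) x w)) \<in> borel_measurable (Fl u)"
  by (intro measurable_compose[OF _ \<psi>]) simp
qed

text \<open>The power \<open>y ^ q\<close> is truncated below \<open>a/2\<close> so that it vanishes
  near 0. Its values at the actual jumps are unaffected, since these have modulus
  \<open>a\<close>.\<close>

lemma jump_sum_adapted_LA: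
 assumes x: "x \<in> S" and u: "0 < u" and Y: "LA u Y"
 shows "(%w. \<Sum>s\<in>{s\<in>J x w. s < u}. Y s w * jp x w s ^ q) \<in> borel_measurable (Fl u)"
proof (rule meas_Fl_lim)
 let ?\<psi> = "%y::real. y ^ q * indicator {y. a/2 < \<bar>y\<bar>} y"
 show "(%w. \<Sum>i<n. Y (tp u n i) w * ?\<psi> (M (tp u n (Suc i)) x w - M (tp u n i) x w)) \<in> borel_measurable (Fl u)" for n
  by (rule Riemann_meas[OF x u Y]) measurable
 have "AE w in P. (%n. \<Sum>i<n. Y (tp u n i) w * ?\<psi> (M (tp u n (Suc i)) x w - M (tp u n i) x w)) \<longlonglongrightarrow>
   (\<Sum>s\<in>{s\<in>J x w. s < u}. Y s w * ?\<psi> (jp x w s))"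
 proof (rule Riemann_jumps_AE[OF x u Y, where r="a/2"])
  show "isCont ?\<psi> a" "isCont ?\<psi> (- a)" using jump_indicator(2,3) by (intro continuous_intros; simp)+
 qed (use a in auto)
 then show "AE w in P. (%n. \<Sum>i<n. Y (tp u n i) w * ?\<psi> (M (tp u n (Suc i)) x w - M (tp u n i) x w)) \<longlonglongrightarrow>
   (\<Sum>s\<in>{s\<in>J x w. s < u}. Y s w * jp x w s ^ q)"
  using good
 proof eventually_elim
  case (elim w)
  have "(\<Sum>s\<in>{s\<in>J x w. s < u}. Y s w * ?\<psi> (jp x w s)) = (\<Sum>s\<in>{s\<in>J x w. s < u}. Y s w * jp x w s ^ q)"
   using good_pathD(3)[OF elim(2) x a] a by (intro sum.cong) auto
  then show ?case using elim(1) by simp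
 qed
qed (use u in simp)

section \<open>Deterministic Borel factors at jump times\<close>

text \<open>The expected number of jumps in an open set is at most \<open>\<kappa>\<close> times its
  measure, by \<open>jump_intensity_LA\<close> for continuous functions increasing to the indicator.
  Take open sets \<open>U n\<close> around \<open>Ng\<close> whose measures tend to 0: a jump in
  \<open>Ng\<close> would be counted for every \<open>n\<close>, which Fatou's lemma excludes almost
  surely.\<close>

lemma jumps_avoid_null:
 assumes x: "x \<in> S" and u: "0 < u" and N: "negligible Ng"
 shows "AE w in P. {s\<in>J x w. s < u} \<inter> Ng = {}"
proof -
 have "\<exists>U. open U \<and> Ng \<subseteq> U \<and> emeasure lborel U <= ennreal (1 / real (Suc n))" for n
 proof -
  have Ns: "Ng \<in> null_sets lebesgue" using N negligible_iff_null_sets by blast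
  then have "Ng \<in> sets lebesgue" by auto
  from sets_lebesgue_outer_open[OF this, of "1 / real (Suc n)"]
  obtain T where T: "open T" "Ng \<subseteq> T" "T - Ng \<in> lmeasurable" "emeasure lebesgue (T - Ng) < ennreal (1 / real (Suc n))"
   by (auto simp del: of_nat_Suc)
  have "emeasure lborel T = emeasure lebesgue T" using T(1) by simp
  also have "\<dots> = emeasure lebesgue (T - Ng)"
   using T(1) Ns by (subst emeasure_Diff_null_set) auto
  finally show ?thesis using T by (intro exI[of _ T]) auto
 qed
 then obtain U where U: "\<And>n. open (U n)" "\<And>n. Ng \<subseteq> U n" "\<And>n. emeasure lborel (U n) <= ennreal (1 / real (Suc n))" by metis
 \<comment> \<open>At a point of \<open>U n\<close> the distance to the complement is positive, so
   \<open>f n k\<close> equals 1 there for large \<open>k\<close>, while it vanishes off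
   \<open>U n\<close>.\<close>
 define f where "f = (%n k s. min 1 (real k * infdist s (- U n)))"
 have fc: "continuous_on UNIV (f n k)" for n k unfolding f_def by (intro continuous_intros)
 have fl: "(f n k \<longlongrightarrow> f n k s) (at_left s)" for n k s
  using fc[of n k] by (simp add: continuous_on_def) (meson UNIV_I at_le subset_UNIV tendsto_mono filterlim_at_split)
 have f01: "0 <= f n k s" "f n k s <= 1" for n k s unfolding f_def by (auto simp: infdist_nonneg)
 have fU: "f n k s <= indicator (U n) s" for n k s
  unfolding f_def by (cases "s \<in> U n") auto
 define D where "D = (%n k w. ennreal (\<Sum>s\<in>{s\<in>J x w. s < u}. f n k s))"
 have m[measurable]: "D n k \<in> borel_measurable P" for n k
  unfolding D_def using meas_Fl_P[OF less_imp_le[OF u] jump_sum_adapted_LA[OF x u LA_det, of "f n k" 0]] fl by simp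
 have Dle: "(\<integral>\<^sup>+w. D n k w \<partial>P) <= ennreal \<kappa> * ennreal (1 / real (Suc n))" for n k
 proof -
  have "(\<integral>\<^sup>+w. D n k w \<partial>P) <= ennreal (\<kappa> * (LINT s:{0<..<u}|lborel. expectation (%w. f n k s)))"
   unfolding D_def by (rule jump_intensity_LA[OF x u, where V="%_. 1"]) (use f01 fl in \<open>auto intro!: LA_det\<close>)
  also have "\<dots> = ennreal \<kappa> * ennreal (LINT s:{0<..<u}|lborel. f n k s)"
  proof -
   have "0 <= (LINT s:{0<..<u}|lborel. f n k s)" using f01 by (auto simp: set_lebesgue_integral_def intro!: integral_nonneg_AE)
   then show ?thesis using \<kappa> by (simp add: prob_space ennreal_mult)
  qed
  also have "ennreal (LINT s:{0<..<u}|lborel. f n k s) <= emeasure lborel (U n)"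
  proof -
   have fb: "f n k \<in> borel_measurable borel" using fc by (rule borel_measurable_continuous_onI)
   have "set_integrable lborel {0<..<u} (f n k)"
    by (rule set_integrable_bounded(1)[where B=1 and a=0 and b=u]) (use fb f01 in auto)
   then have "ennreal (LINT s:{0<..<u}|lborel. f n k s) = (\<integral>\<^sup>+s. ennreal (indicator {0<..<u} s *\<^sub>R f n k s) \<partial>lborel)"
    unfolding set_lebesgue_integral_def set_integrable_def using f01 by (intro nn_integral_eq_integral[symmetric]) auto
   also have "\<dots> <= (\<integral>\<^sup>+s. indicator (U n) s \<partial>lborel)"
   proof (rule nn_integral_mono)
    fix s
    have "indicator {0<..<u} s *\<^sub>R f n k s <= indicator (U n) s"
     using fU[of n k s] by (auto simp: indicator_def)
    then have "ennreal (indicator {0<..<u} s *\<^sub>R f n k s) <= ennreal (indicator (U n) s)" by (rule ennreal_leI)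
    then show "ennreal (indicator {0<..<u} s *\<^sub>R f n k s) <= indicator (U n) s" by (simp add: ennreal_indicator)
   qed
   also have "\<dots> = emeasure lborel (U n)" using U(1) by simp
   finally show ?thesis .
  qed
  also have "\<dots> <= ennreal (1 / real (Suc n))" by (rule U)
  finally show ?thesis by (simp add: mult_left_mono)
 qed
 define W where "W = (%n w. liminf (%k. D n k w))"
 have mW[measurable]: "W n \<in> borel_measurable P" for n unfolding W_def by measurable
 have Wle: "(\<integral>\<^sup>+w. W n w \<partial>P) <= ennreal \<kappa> * ennreal (1 / real (Suc n))" for n
 proof -
  have "(\<integral>\<^sup>+w. W n w \<partial>P) <= liminf (%k. \<integral>\<^sup>+w. D n k w \<partial>P)" unfolding W_def by (rule nn_integral_liminf) measurable
  also have "\<dots> <= liminf (%k. ennreal \<kappa> * ennreal (1 / real (Suc n)))" by (intro Liminf_mono always_eventually allI Dle)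
  finally show ?thesis by (simp add: Liminf_const)
 qed
 have "(\<integral>\<^sup>+w. liminf (%n. W n w) \<partial>P) <= liminf (%n. \<integral>\<^sup>+w. W n w \<partial>P)" by (rule nn_integral_liminf) measurable
 also have "\<dots> <= liminf (%n. ennreal (\<kappa> * (1 / real (Suc n))))"
 proof (intro Liminf_mono always_eventually allI)
  fix n
  show "(\<integral>\<^sup>+w. W n w \<partial>P) <= ennreal (\<kappa> * (1 / real (Suc n)))"
   using Wle[of n] ennreal_mult[OF \<kappa>, of "1 / real (Suc n)"] by simp
 qed
 also have "\<dots> = 0"
 proof -
  have "(%n. \<kappa> * (1 / real n)) \<longlonglongrightarrow> 0" using tendsto_mult_right_zero[OF lim_const_over_n] by blast
  then have "(%n. \<kappa> * (1 / real (Suc n))) \<longlonglongrightarrow> 0" by (rule LIMSEQ_Suc)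
  then have "(%n. ennreal (\<kappa> * (1 / real (Suc n)))) \<longlonglongrightarrow> ennreal 0" by (rule tendsto_ennrealI)
  then show ?thesis using lim_imp_Liminf[OF sequentially_bot] by (metis ennreal_0)
 qed
 finally have "(\<integral>\<^sup>+w. liminf (%n. W n w) \<partial>P) = 0" by simp
 then have "AE w in P. liminf (%n. W n w) = 0" by (subst (asm) nn_integral_0_iff_AE) measurable
 then show ?thesis using good
 proof eventually_elim
  case (elim w)
  show ?case
  proof (rule ccontr)
   assume "\<not> ?thesis"
   then obtain s where s: "s \<in> J x w" "s < u" "s \<in> Ng" by auto
   have fin: "finite {s\<in>J x w. s < u}" by (rule good_pathD(2)[OF elim(2) x a])
   have "1 <= W n w" for n
   proof -
    have sU: "s \<in> U n" using U(2)[of n] s by auto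
    \<comment> \<open>\<open>infdist\<close> to the empty set is 0 by convention, so the complement
      of \<open>U n\<close> must be nonempty; a set of finite measure is not the whole line.\<close>
    have "U n \<noteq> UNIV"
    proof
     assume "U n = UNIV"
     then show False using U(3)[of n] by (simp add: emeasure_lborel_UNIV top_unique)
    qed
    then have i: "0 < infdist s (- U n)" using sU U(1)[of n] by (intro infdist_pos_not_in_closed) auto
    obtain k0 where k0: "1 / infdist s (- U n) <= real k0" using real_arch_simple by blast
    have "f n k s = 1" if "k \<ge> k0" for k
    proof -
     have "1 / infdist s (- U n) <= real k" using k0 that by simp
     then show ?thesis unfolding f_def using i by (simp add: field_simps min_def)
    qed
    moreover have "f n k s <= (\<Sum>s\<in>{s\<in>J x w. s < u}. f n k s)" for k
     using f01 s fin by (intro member_le_sum) auto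
    ultimately have "\<forall>\<^sub>F k in sequentially. 1 <= D n k w"
     unfolding D_def eventually_sequentially by (metis ennreal_1 ennreal_leI)
    then show ?thesis unfolding W_def by (rule Liminf_bounded)
   qed
   then have "1 <= liminf (%n. W n w)" by (intro Liminf_bounded always_eventually) auto
   then show False using elim(1) by simp
  qed
 qed
qed

text \<open>A Lebesgue measurable function is an almost everywhere limit of continuous functions.
  Clamping these to \<open>[lo, K]\<close> preserves the bound and, for nonnegative
  \<open>H\<close>, the sign.\<close>

lemma Borel_continuous_approx:
 fixes H :: "real => real"
 assumes H: "borel_on u H" "\<And>s. 0 <= s ==> s < u ==> \<bar>H s\<bar> <= K" and K: "0 <= K"
 obtains N g where "negligible N" "\<And>n. continuous_on UNIV (g n)" "\<And>n s. \<bar>g n s\<bar> <= K"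
  "(\<And>s. 0 <= s ==> s < u ==> 0 <= H s) ==> (\<And>n s. 0 <= g n s)"
  "\<And>s. s \<notin> N ==> 0 <= s ==> s < u ==> (%n. g n s) \<longlonglongrightarrow> H s"
proof -
 let ?h = "%s. indicator {0..<u} s * H s"
 have "?h \<in> borel_measurable lebesgue" using H(1) by (simp add: measurable_completion)
 then have "?h measurable_on UNIV" by (rule lebesgue_measurable_imp_measurable_on) simp
 then obtain N g where Ng: "negligible N" "\<And>n. continuous_on UNIV (g n)" "\<And>s. s \<notin> N ==> (%n. g n s) \<longlonglongrightarrow> ?h s"
  unfolding measurable_on_def by auto
 define lo where "lo = (if \<forall>s. 0 <= s --> s < u --> 0 <= H s then 0 else - K)"
 have lo: "lo <= 0" "\<bar>lo\<bar> <= K" unfolding lo_def using K by auto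
 show ?thesis
 proof (rule that[of N "%n s. max lo (min K (g n s))"])
  show "negligible N" by fact
  show "continuous_on UNIV (%s. max lo (min K (g n s)))" for n by (intro continuous_intros Ng)
  show "\<bar>max lo (min K (g n s))\<bar> <= K" for n s using lo K by auto
  show "0 <= max lo (min K (g n s))" if "\<And>s. 0 <= s ==> s < u ==> 0 <= H s" for n s
   unfolding lo_def using that by auto
  show "(%n. max lo (min K (g n s))) \<longlonglongrightarrow> H s" if s: "s \<notin> N" "0 <= s" "s < u" for s
  proof -
   have "(%n. max lo (min K (g n s))) \<longlonglongrightarrow> max lo (min K (?h s))"
    by (intro tendsto_intros Ng(3) s)
   moreover have "max lo (min K (?h s)) = H s"
    using H(2)[OF s(2,3)] s unfolding lo_def by (auto simp: max_def min_def)
   ultimately show ?thesis by simp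
  qed
 qed
qed

lemma continuous_at_left: "continuous_on UNIV (g :: real => real) ==> (g \<longlongrightarrow> g s) (at_left s)"
 by (meson UNIV_I continuous_on_def at_le subset_UNIV tendsto_mono)

text \<open>Along almost every path the jump times avoid the exceptional set, so convergence off a
  null set already gives convergence of the jump sum term by term.\<close>

lemma jump_sum_limit:
 assumes x: "x \<in> S" and u: "0 < u" and N: "negligible N" and g: "\<And>s. s \<notin> N ==> 0 <= s ==> s < u ==> (%n. g n s) \<longlonglongrightarrow> H s"
 shows "AE w in P. (%n. \<Sum>s\<in>{s\<in>J x w. s < u}. Y s w * g n s * y s w) \<longlonglongrightarrow> (\<Sum>s\<in>{s\<in>J x w. s < u}. Y s w * H s * y s w :: real)"
 using jumps_avoid_null[OF x u N]
proof eventually_elim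
 case (elim w)
 show ?case
 proof (intro tendsto_sum tendsto_mult tendsto_const g)
  fix s assume s: "s \<in> {s\<in>J x w. s < u}"
  then show "s \<notin> N" "s < u" using elim by auto
  show "0 <= s" using s jset_pos[of "%s x. M s x w" x] by auto
 qed
qed

lemma jump_sum_adapted:
 assumes x: "x \<in> S" and u: "0 < u" and Y: "LA u Y"
  and H: "borel_on u H" "\<And>s. 0 <= s ==> s < u ==> \<bar>H s\<bar> <= K"
 shows "(%w. \<Sum>s\<in>{s\<in>J x w. s < u}. Y s w * H s * jp x w s ^ q) \<in> borel_measurable (Fl u)"
proof -
 have K: "0 <= K" using H(2)[of 0] u by force
 obtain N g where g: "negligible N" "\<And>n. continuous_on UNIV (g n)" "\<And>s. s \<notin> N ==> 0 <= s ==> s < u ==> (%n. g n s) \<longlonglongrightarrow> H s"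
  by (rule Borel_continuous_approx[OF H K]) auto
 show ?thesis
 proof (rule meas_Fl_lim[OF _ _ jump_sum_limit[OF x u g(1,3)]])
  show "(%w. \<Sum>s\<in>{s\<in>J x w. s < u}. Y s w * g n s * jp x w s ^ q) \<in> borel_measurable (Fl u)" for n
   by (rule jump_sum_adapted_LA[OF x u LA_mult[OF Y LA_det]]) (rule continuous_at_left[OF g(2)])
 qed (use u in auto)
qed

text \<open>The continuous approximations of \<open>H\<close> converge at all jump times almost
  surely and at almost every time. Fatou's lemma passes to the limit on the left, dominated
  convergence on the right.\<close>

lemma jump_intensity:
 assumes x: "x \<in> S" and u: "0 < u" and Y: "LA u Y" and V: "integrable P V" "AE w in P. \<forall>s. 0 <= s --> s < u --> 0 <= Y s w \<and> Y s w <= V w"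
  and H: "borel_on u H" "\<And>s. 0 <= s ==> s < u ==> 0 <= H s \<and> H s <= K"
 shows "(\<integral>\<^sup>+w. ennreal (\<Sum>s\<in>{s\<in>J x w. s < u}. Y s w * H s) \<partial>P) <= ennreal (\<kappa> * (LINT s:{0..<u}|lborel. expectation (Y s) * H s))"
proof -
 have K: "0 <= K" using H(2)[of 0] u by force
 have Hb: "\<bar>H s\<bar> <= K" if "0 <= s" "s < u" for s using H(2)[OF that] by simp
 obtain N g where g: "negligible N" "\<And>n. continuous_on UNIV (g n)" "\<And>n s. \<bar>g n s\<bar> <= K" "\<And>n s. 0 <= g n s"
   "\<And>s. s \<notin> N ==> 0 <= s ==> s < u ==> (%n. g n s) \<longlonglongrightarrow> H s"
  using Borel_continuous_approx[OF H(1) Hb K] H(2) by metis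
 have LAg: "LA u (%s w. Y s w * g n s)" for n
  by (rule LA_mult[OF Y LA_det]) (rule continuous_at_left[OF g(2)])
 have V': "AE w in P. \<forall>s. 0 <= s --> s < u --> \<bar>Y s w\<bar> <= V w" using V(2) by (rule eventually_mono) auto
 have Vg: "AE w in P. \<forall>s. 0 <= s --> s < u --> 0 <= Y s w * g n s \<and> Y s w * g n s <= V w * K" for n
  using V(2)
 proof eventually_elim
  case (elim w)
  show ?case
  proof (intro allI impI)
   fix s assume "0 <= s" "s < u"
   then have "0 <= Y s w \<and> Y s w <= V w" using elim by blast
   then show "0 <= Y s w * g n s \<and> Y s w * g n s <= V w * K"
    using g(3)[of n s] g(4)[of n s] by (auto intro!: mult_mono)
  qed
 qed
 have mD: "(%w. \<Sum>s\<in>{s\<in>J x w. s < u}. Y s w * g n s) \<in> borel_measurable P" for n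
  using meas_Fl_P[OF less_imp_le[OF u] jump_sum_adapted_LA[OF x u LAg[of n], of 0]] by simp
 have eY: "((%r. expectation (Y r)) \<longlongrightarrow> expectation (Y s)) (at_left s)" if "0 < s" "s < u" for s
  by (rule expect_left_cont[OF Y V(1) V' that])
 have em: "borel_on u (%s. expectation (Y s))"
  by (rule left_cont_borel[OF eY])
 have eb: "\<bar>expectation (Y s)\<bar> <= expectation V" if "0 <= s" "s < u" for s
 proof -
  have ae: "AE w in P. 0 <= Y s w \<and> Y s w <= V w" using V(2) by (rule eventually_mono) (use that in blast)
  have m: "Y s \<in> borel_measurable P" using LA_measP[OF Y that] .
  have "integrable P (Y s)" by (rule Bochner_Integration.integrable_bound[OF V(1) m]) (use ae in auto)
  then have "expectation (Y s) <= expectation V" using V(1) ae by (intro integral_mono_AE) auto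
  moreover have "0 <= expectation (Y s)" using ae by (intro integral_nonneg_AE) auto
  ultimately show ?thesis by simp
 qed
 have eV: "0 <= expectation V" using eb[of 0] u by linarith
 have lim1: "AE w in P. (%n. \<Sum>s\<in>{s\<in>J x w. s < u}. Y s w * g n s) \<longlonglongrightarrow> (\<Sum>s\<in>{s\<in>J x w. s < u}. Y s w * H s)"
  using jump_sum_limit[OF x u g(1,5), where Y=Y and y="%_ _. 1"] by simp
 have "(\<integral>\<^sup>+w. ennreal (\<Sum>s\<in>{s\<in>J x w. s < u}. Y s w * H s) \<partial>P) = (\<integral>\<^sup>+w. liminf (%n. ennreal (\<Sum>s\<in>{s\<in>J x w. s < u}. Y s w * g n s)) \<partial>P)"
 proof (rule nn_integral_cong_AE, use lim1 in eventually_elim)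
  case (elim w)
  from tendsto_ennrealI[OF this] show ?case by (rule lim_imp_Liminf[OF sequentially_bot, symmetric])
 qed
 also have "\<dots> <= liminf (%n. \<integral>\<^sup>+w. ennreal (\<Sum>s\<in>{s\<in>J x w. s < u}. Y s w * g n s) \<partial>P)"
  using mD by (intro nn_integral_liminf) auto
 also have "\<dots> <= liminf (%n. ennreal (\<kappa> * (LINT s:{0<..<u}|lborel. expectation (%w. Y s w * g n s))))"
  by (intro Liminf_mono always_eventually allI jump_intensity_LA[OF x u LAg _ Vg]) (use V(1) in simp)
 also have "\<dots> = liminf (%n. ennreal (\<kappa> * (LINT s:{0..<u}|lborel. expectation (Y s) * g n s)))"
 proof -
  have "(LINT s:{0<..<u}|lborel. expectation (%w. Y s w * g n s)) = (LINT s:{0..<u}|lborel. expectation (Y s) * g n s)" for n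
  proof -
   have "g n \<in> borel_measurable borel" using g(2) by (rule borel_measurable_continuous_onI)
   then have "borel_on u (%s. (expectation (Y s) * g n s))"
    using borel_measurable_times[OF em] by (simp add: mult.assoc)
   from set_lebesgue_integral_open[OF this] show ?thesis by simp
  qed
  then show ?thesis by simp
 qed
 also have "\<dots> = ennreal (\<kappa> * (LINT s:{0..<u}|lborel. expectation (Y s) * H s))"
 proof -
  have "(%n. LINT s:{0..<u}|lborel. expectation (Y s) * g n s) \<longlonglongrightarrow> (LINT s:{0..<u}|lborel. expectation (Y s) * H s)"
   unfolding set_lebesgue_integral_def
  proof (rule integral_dominated_convergence[where w="%s. expectation V * K * indicator {0..<u} s"])
   show "integrable lborel (%s. expectation V * K * indicator {0..<u} s)"
    using u by (intro integrable_mult_right integrable_real_indicator) auto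
   have "(%s. indicator {0..<u} s *\<^sub>R (expectation (Y s) * H s)) = (%s. (indicator {0..<u} s * expectation (Y s)) * (indicator {0..<u} s * H s))"
    by (auto simp: indicator_def)
   then show "(%s. indicator {0..<u} s *\<^sub>R (expectation (Y s) * H s)) \<in> borel_measurable lborel" using em H(1) by simp
   have gm: "g n \<in> borel_measurable borel" for n using g(2) by (rule borel_measurable_continuous_onI)
   show "(%s. indicator {0..<u} s *\<^sub>R (expectation (Y s) * g n s)) \<in> borel_measurable lborel" for n
    using borel_measurable_times[OF em gm] by (simp add: mult.assoc)
   have "N \<in> null_sets lebesgue" using g(1) negligible_iff_null_sets by blast
   then have "AE s in lebesgue. s \<notin> N" by (rule AE_not_in)
   then have "AE s in lborel. s \<notin> N" by (rule AE_completion_iff[THEN iffD1])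
   then show "AE s in lborel. (%n. indicator {0..<u} s *\<^sub>R (expectation (Y s) * g n s)) \<longlonglongrightarrow> indicator {0..<u} s *\<^sub>R (expectation (Y s) * H s)"
   proof eventually_elim
    case (elim s)
    show ?case
    proof (cases "s \<in> {0..<u}")
     case True
     then have "(%n. g n s) \<longlonglongrightarrow> H s" using g(5)[OF elim] by auto
     then show ?thesis by (intro tendsto_intros)
    qed simp
   qed
   show "AE s in lborel. norm (indicator {0..<u} s *\<^sub>R (expectation (Y s) * g n s)) <= expectation V * K * indicator {0..<u} s" for n
   proof (rule AE_I2)
    fix s
    have "\<bar>expectation (Y s)\<bar> * \<bar>g n s\<bar> <= expectation V * K" if "0 <= s" "s < u"
     using eb[OF that] g(3) eV by (intro mult_mono) auto
    then show "norm (indicator {0..<u} s *\<^sub>R (expectation (Y s) * g n s)) <= expectation V * K * indicator {0..<u} s"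
     by (auto simp: indicator_def abs_mult)
   qed
  qed
  then have "(%n. ennreal (\<kappa> * (LINT s:{0..<u}|lborel. expectation (Y s) * g n s))) \<longlonglongrightarrow> ennreal (\<kappa> * (LINT s:{0..<u}|lborel. expectation (Y s) * H s))"
   by (intro tendsto_ennrealI tendsto_mult tendsto_const)
  then show ?thesis by (rule lim_imp_Liminf[OF sequentially_bot])
 qed
 finally show ?thesis .
qed

end

text \<open>The strict inequality in the index set makes a jump sum constant just to the left of
  \<open>s\<close>, and therefore left continuous in its upper limit.\<close>

lemma jump_sum_left_const:
 fixes A :: "real set" and f :: "real => 'b::comm_monoid_add"
 assumes "finite {q\<in>A. q < s}"
 shows "\<forall>\<^sub>F r in at_left s. {q\<in>A. q < r} = {q\<in>A. q < s}"
proof -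
 obtain e where e: "e > 0" "{q\<in>A. q < s} \<inter> {s - e<..<s} = {}" by (rule finite_locally_left[OF assms])
 show ?thesis
 proof (rule eventually_at_leftI)
  show "s - e < s" using e by simp
  fix r assume r: "r \<in> {s - e<..<s}"
  have "q < r" if "q \<in> A" "q < s" for q
  proof (rule ccontr)
   assume "\<not> q < r"
   then have "q \<in> {q\<in>A. q < s} \<inter> {s - e<..<s}" using that r by auto
   then show False using e by simp
  qed
  then show "{q\<in>A. q < r} = {q\<in>A. q < s}" using r by auto
 qed
qed

text \<open>To the left of \<open>s\<close> the jump sum has become constant and the drift part is
  Lipschitz in the upper limit. This is why an integral over \<open>[0,t)\<close> can serve as the
  integrand of the next level.\<close>

lemma good_path_LS_left:
 assumes g: "good_path S a L B mp cd" "x \<in> S" "a > 0" and B: "0 <= B" and s: "0 < s" "s <= u"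
  and G: "borel_on u G" "\<And>s. 0 <= s ==> s < u ==> \<bar>G s\<bar> <= K"
 shows "((%t. LS_int (%s. mp s x) G t) \<longlongrightarrow> LS_int (%s. mp s x) G s) (at_left s)"
proof -
 note d = good_pathD[OF g]
 have K: "0 <= K" using G(2)[of 0] s by force
 have Gm: "(%s. indicator {p..<q} s * G s) \<in> borel_measurable borel" if "0 <= p" "q <= u" for p q
 proof -
  have "(%s. indicator {p..<q} s * G s) = (%s. indicator {p..<q} s * (indicator {0..<u} s * G s))"
   using that by (auto simp: indicator_def fun_eq_iff)
  then show ?thesis using G(1) by simp
 qed
 have GD: "set_integrable lborel {p..<q} (%s. G s * (- L * cd s x))" "\<bar>LINT s:{p..<q}|lborel. G s * (- L * cd s x)\<bar> <= K * (\<bar>L\<bar> * B) * (q - p)"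
  if "0 <= p" "p <= q" "q <= u" for p q
 proof -
  have "(%s. indicator {p..<q} s * (G s * (- L * cd s x))) = (%s. (indicator {p..<q} s * G s) * (indicator {0..u} s * (- L * cd s x)))"
   using that by (auto simp: indicator_def fun_eq_iff)
  then have m: "(%s. indicator {p..<q} s * (G s * (- L * cd s x))) \<in> borel_measurable borel"
   using borel_measurable_times[OF Gm[OF that(1,3)] d(7)[of u]] by simp
  have b: "\<bar>G s * (- L * cd s x)\<bar> <= K * (\<bar>L\<bar> * B)" if "s \<in> {p..<q}" for s
   unfolding abs_mult[of "G s"] using G(2)[of s] d(6)[of s] that \<open>0 <= p\<close> \<open>q <= u\<close> K by (intro mult_mono) auto
  have sb: "{p..<q} \<subseteq> {p..q}" by auto
  show "set_integrable lborel {p..<q} (%s. G s * (- L * cd s x))" "\<bar>LINT s:{p..<q}|lborel. G s * (- L * cd s x)\<bar> <= K * (\<bar>L\<bar> * B) * (q - p)"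
   using set_integrable_bounded[OF m b _ sb] that by simp_all
 qed
 have LS: "LS_int (%s. mp s x) G t = (\<Sum>r\<in>{r\<in>jset mp x. r < t}. G r * jmp (%r. mp r x) r) + (LINT s:{0..<t}|lborel. G s * (- L * cd s x))"
  if "0 <= t" "t <= u" for t
  by (rule good_path_LS_int[OF g that(1) Gm G(2)]) (use that in auto)
 have "\<forall>\<^sub>F r in at_left s. {q\<in>jset mp x. q < r} = {q\<in>jset mp x. q < s} \<and> 0 < r \<and> r < s"
  by (intro eventually_conj jump_sum_left_const d(2) eventually_at_leftI[of 0 s]) (use s in auto)
 then have "\<forall>\<^sub>F r in at_left s. norm (LS_int (%s. mp s x) G r - LS_int (%s. mp s x) G s) <= K * (\<bar>L\<bar> * B) * (s - r)"
 proof eventually_elim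
  case (elim r)
  then have r: "0 <= r" "r <= s" by auto
  have "(LINT s:{0..<s}|lborel. G s * (- L * cd s x)) = (LINT s:{0..<r}|lborel. G s * (- L * cd s x)) + (LINT s:{r..<s}|lborel. G s * (- L * cd s x))"
   using r s by (intro set_lebesgue_integral_split GD) auto
  moreover have "\<bar>LINT s:{r..<s}|lborel. G s * (- L * cd s x)\<bar> <= K * (\<bar>L\<bar> * B) * (s - r)"
   using r s by (intro GD) auto
  ultimately show ?case using LS[of r] LS[of s] r s elim by (simp del: Collect_cong)
 qed
 then have "((%r. LS_int (%s. mp s x) G r - LS_int (%s. mp s x) G s) \<longlongrightarrow> 0) (at_left s)"
  by (rule Lim_null_comparison) (auto intro!: tendsto_eq_intros)
 then show ?thesis by (rule LIM_zero_cancel)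
qed

context jump_noise
begin

section \<open>Moments of the number of jumps\<close>

text \<open>The summand 1 makes the powers at least 1, so that a multiple of \<open>W\<close> also
  absorbs the contribution of the drift.\<close>

definition W :: "'a => real" where
 "W w = 1 + (\<Sum>x\<in>S. real (card {s\<in>J x w. s < 1}))"

lemma W_ge1: "1 <= W w"
 unfolding W_def by (simp add: sum_nonneg)

lemma W_pow_ge1: "1 <= W w ^ r"
 using W_ge1 by (rule one_le_power)

lemma card_le_W: "x \<in> S ==> good_path S a L B (%s x. M s x w) (%s x. Cd s x w) ==> u <= 1 ==> real (card {s\<in>J x w. s < u}) <= W w"
proof -
 assume x: "x \<in> S" and g: "good_path S a L B (%s x. M s x w) (%s x. Cd s x w)" and u: "u <= 1"
 have "card {s\<in>J x w. s < u} <= card {s\<in>J x w. s < 1}"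
  using u by (intro card_mono good_pathD(2)[OF g x a]) auto
 also have "real \<dots> <= (\<Sum>x\<in>S. real (card {s\<in>J x w. s < 1}))"
  using finS x by (intro member_le_sum[of x S "%x. real (card {s\<in>J x w. s < 1})"]) auto
 finally show ?thesis unfolding W_def by simp
qed

lemma jump_sum_LA:
 assumes x: "x \<in> S" and u: "0 < u" and Y: "LA u Y"
  and H: "borel_on u H" "\<And>s. 0 <= s ==> s < u ==> \<bar>H s\<bar> <= K"
 shows "LA u (%t w. \<Sum>s\<in>{s\<in>J x w. s < t}. Y s w * H s * jp x w s ^ q)"
proof -
 have "(%w. \<Sum>s\<in>{s\<in>J x w. s < t}. Y s w * H s * jp x w s ^ q) \<in> borel_measurable (Fl t)" if t: "0 <= t" "t < u" for t
 proof (cases "t = 0")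
  case True
  have "{s\<in>J x w. s < 0} = {}" for w using jset_pos[of "%s x. M s x w" x] by force
  then show ?thesis unfolding True by (simp del: Collect_empty_eq)
 next
  case False
  then have t0: "0 < t" using t by simp
  have "(%s. indicator {0..<t} s * H s) = (%s. indicator {0..<t} s * (indicator {0..<u} s * H s))"
   using t by (auto simp: indicator_def fun_eq_iff)
  then have "borel_on t H" using H(1) by simp
  from jump_sum_adapted[OF x t0 LA_subset[OF Y less_imp_le[OF t(2)]] this H(2)] show ?thesis using t by simp
 qed
 moreover have "AE w in P. \<forall>t. 0 < t --> t < u --> ((%t. \<Sum>s\<in>{s\<in>J x w. s < t}. Y s w * H s * jp x w s ^ q) \<longlongrightarrow> (\<Sum>s\<in>{s\<in>J x w. s < t}. Y s w * H s * jp x w s ^ q)) (at_left t)"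
  using good
 proof eventually_elim
  case (elim w)
  show ?case
  proof (intro allI impI tendsto_eventually)
   fix t
   from jump_sum_left_const[OF good_pathD(2)[OF elim x a], of t]
   show "\<forall>\<^sub>F r in at_left t. (\<Sum>s\<in>{s\<in>J x w. s < r}. Y s w * H s * jp x w s ^ q) = (\<Sum>s\<in>{s\<in>J x w. s < t}. Y s w * H s * jp x w s ^ q)"
    by (rule eventually_mono) simp
  qed
 qed
 ultimately show ?thesis unfolding LA_def by blast
qed

lemma LA_sum: "(\<And>x. x \<in> A ==> LA u (Y x)) ==> LA u (%s w. \<Sum>x\<in>A. Y x s w)"
proof (induction A rule: infinite_finite_induct)
 case (insert y A)
 then have "LA u (%s w. Y y s w + (\<Sum>x\<in>A. Y x s w))" by (intro LA_add) auto
 then show ?case using insert by simp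
qed (auto intro: LA_const)

text \<open>Jumps of different sites never coincide, so the Ito formula for sums over all jumps splits over the sites.\<close>

lemma sum_all_jumps:
 fixes f :: "site => real => real"
 assumes g: "good_path S a L B (%s x. M s x w) (%s x. Cd s x w)"
 defines "sit \<equiv> %s. THE x. x \<in> S \<and> s \<in> J x w"
 shows "(\<Sum>s\<in>{s\<in>(\<Union>x\<in>S. {s\<in>J x w. s < u}). s < t}. f (sit s) s) = (\<Sum>x\<in>S. \<Sum>s\<in>{s\<in>J x w. s < min t u}. f x s)"
proof -
 have sit: "sit s = x" if "x \<in> S" "s \<in> J x w" for x s
  unfolding sit_def using that good_pathD(5)[OF g _ a] by (intro the_equality) blast+
 have "{s\<in>(\<Union>x\<in>S. {s\<in>J x w. s < u}). s < t} = (\<Union>x\<in>S. {s\<in>J x w. s < min t u})" by auto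
 then have "(\<Sum>s\<in>{s\<in>(\<Union>x\<in>S. {s\<in>J x w. s < u}). s < t}. f (sit s) s) = (\<Sum>s\<in>(\<Union>x\<in>S. {s\<in>J x w. s < min t u}). f (sit s) s)" by simp
 also have "\<dots> = (\<Sum>x\<in>S. \<Sum>s\<in>{s\<in>J x w. s < min t u}. f (sit s) s)"
  using good_pathD(2,5)[OF g _ a] finS by (intro sum.UNION_disjoint) blast+
 also have "\<dots> = (\<Sum>x\<in>S. \<Sum>s\<in>{s\<in>J x w. s < min t u}. f x s)"
  using sit by (intro sum.cong) auto
 finally show ?thesis .
qed

text \<open>\<open>ito_path\<close> knows a single set of jump times. Here it is the union over all
  sites, with \<open>sit\<close> naming the one site that jumps at a given time.\<close>

lemma ito_jumps:
 fixes G :: "site => real => real" and D X :: "real => real"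
 assumes g: "good_path S a L B (%s x. M s x w) (%s x. Cd s x w)" and u: "0 <= u"
  and D: "borel_on u D" "\<And>s. 0 <= s ==> s < u ==> \<bar>D s\<bar> <= C"
  and X: "\<And>t. 0 <= t ==> t <= u ==> X t = (\<Sum>x\<in>S. \<Sum>s\<in>{s\<in>J x w. s < t}. G x s) + (LINT s:{0..<t}|lborel. D s)"
  and f: "\<And>x. (f has_real_derivative f' x) (at x)"
  and f': "\<And>R. \<exists>C. \<forall>x y. \<bar>x\<bar> <= R --> \<bar>y\<bar> <= R --> \<bar>f' x - f' y\<bar> <= C * \<bar>x - y\<bar>"
 shows "f (X u) = f 0 + (\<Sum>x\<in>S. \<Sum>s\<in>{s\<in>J x w. s < u}. f (X s + G x s) - f (X s)) + (LINT s:{0..<u}|lborel. f' (X s) * D s)"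
proof -
 define sit where "sit = (%s. THE x. x \<in> S \<and> s \<in> J x w)"
 let ?A = "\<Union>x\<in>S. {s\<in>J x w. s < u}"
 have e1: "(\<Sum>s\<in>{s\<in>?A. s < t}. h (sit s) s) = (\<Sum>x\<in>S. \<Sum>s\<in>{s\<in>J x w. s < min t u}. h x s)" for h :: "site => real => real" and t
  unfolding sit_def by (rule sum_all_jumps[OF g])
 have "f (X u) = f 0 + (\<Sum>s\<in>{s\<in>?A. s < u}. f (X s + G (sit s) s) - f (X s)) + (LINT s:{0..<u}|lborel. f' (X s) * D s)"
 proof (rule ito_path[OF u _ _ D _ f f' u order_refl])
  show "finite ?A" using good_pathD(2)[OF g _ a] finS by blast
  show "?A \<subseteq> {0<..}" using jset_pos[of "%s x. M s x w"] by blast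
  show "X t = (\<Sum>s\<in>{s\<in>?A. s < t}. G (sit s) s) + (LINT s:{0..<t}|lborel. D s)" if "0 <= t" "t <= u" for t
   using X[OF that] e1[of G t] that by (simp add: min_absorb1)
 qed
 then show ?thesis using e1[of "%x s. f (X s + G x s) - f (X s)" u] by simp
qed

text \<open>Induction on \<open>r\<close>: Ito's formula writes \<open>W ^ Suc r\<close> as 1 plus a
  sum over jumps of terms of order \<open>W ^ r\<close>. The jump intensity bounds the mean of that
  sum, with \<open>W ^ r\<close> as the integrable majorant provided by the induction
  hypothesis.\<close>

lemma W_moments:
 "W \<in> borel_measurable P" "integrable P (%w. W w ^ r)"
proof -
 let ?C = "%t w. \<Sum>x\<in>S. \<Sum>s\<in>{s\<in>J x w. s < t}. (1::real)"
 have C: "LA u (?C)" if u: "0 < u" for u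
 proof (rule LA_sum)
  fix x assume x: "x \<in> S"
  show "LA u (%t w. \<Sum>s\<in>{s\<in>J x w. s < t}. 1)"
   using jump_sum_LA[OF x u LA_const[of u 1], of "%_. 1" 1 0] by simp
 qed
 have WC: "W w = 1 + ?C 1 w" for w unfolding W_def by simp
 have "?C 1 \<in> borel_measurable P" by (rule LA_measP[OF C[of 2]]) auto
 then show m[measurable]: "W \<in> borel_measurable P" unfolding WC[abs_def] by simp
 show "integrable P (%w. W w ^ r)"
 proof (induction r)
  case (Suc r)
  \<comment> \<open>Only jumps strictly before \<open>t\<close> are counted, so that
    \<open>Z\<close> is left continuous and adapted.\<close>
  define Z where "Z = (%t w. (1 + ?C t w) ^ r)"
  have Z: "LA 1 Z" unfolding Z_def by (rule LA_compose[OF C[OF zero_less_one]]) (intro continuous_intros)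
  have ZW: "AE w in P. \<forall>s. 0 <= s --> s < 1 --> 0 <= Z s w \<and> Z s w <= W w ^ r"
   using good
  proof eventually_elim
   case (elim w)
   have "?C s w <= ?C 1 w \<and> 0 <= ?C s w" if "s < 1" for s
    using that good_pathD(2)[OF elim _ a] by (auto intro!: sum_mono card_mono sum_nonneg)
   then show ?case unfolding Z_def WC by (auto intro!: power_mono)
  qed
  have fin: "(\<integral>\<^sup>+w. ennreal (\<Sum>s\<in>{s\<in>J x w. s < 1}. Z s w) \<partial>P) < \<infinity>" if "x \<in> S" for x
   using jump_intensity_LA[OF that zero_less_one Z Suc ZW] ennreal_less_top le_less_trans by fastforce
  have path: "AE w in P. W w ^ Suc r <= 1 + 2 ^ Suc r * 2 * (\<Sum>x\<in>S. \<Sum>s\<in>{s\<in>J x w. s < 1}. Z s w)"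
   using good
  proof eventually_elim
   case (elim w)
   let ?f = "%y::real. (1 + y) ^ Suc r" and ?X = "%t. ?C t w"
   have "?f (?X 1) = ?f 0 + (\<Sum>x\<in>S. \<Sum>s\<in>{s\<in>J x w. s < 1}. ?f (?X s + 1) - ?f (?X s)) + (LINT s:{0..<1}|lborel. real (Suc r) * (1 + ?X s) ^ r * 0)"
   proof (rule ito_jumps[OF elim, where G="%_ _. 1" and C=0])
    show "(?f has_real_derivative real (Suc r) * (1 + y) ^ r) (at y)" for y
     by (auto intro!: derivative_eq_intros) (cases r; simp add: algebra_simps)
    fix R :: real
    obtain C where C: "\<And>x y::real. \<bar>x\<bar> <= R + 1 ==> \<bar>y\<bar> <= R + 1 ==> \<bar>real (Suc r) * x ^ r - real (Suc r) * y ^ r\<bar> <= C * \<bar>x - y\<bar>"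
     using power_deriv_lipschitz[of "R + 1" "Suc r"] by auto
    show "\<exists>C. \<forall>x y. \<bar>x\<bar> <= R --> \<bar>y\<bar> <= R --> \<bar>real (Suc r) * (1 + x) ^ r - real (Suc r) * (1 + y) ^ r\<bar> <= C * \<bar>x - y\<bar>"
    proof (intro exI allI impI)
     fix x y :: real assume "\<bar>x\<bar> <= R" "\<bar>y\<bar> <= R"
     then have "\<bar>1 + x\<bar> <= R + 1" "\<bar>1 + y\<bar> <= R + 1" by auto
     from C[OF this] show "\<bar>real (Suc r) * (1 + x) ^ r - real (Suc r) * (1 + y) ^ r\<bar> <= C * \<bar>x - y\<bar>" by simp
    qed
   qed auto
   also have "\<dots> = 1 + (\<Sum>x\<in>S. \<Sum>s\<in>{s\<in>J x w. s < 1}. ?f (?X s + 1) - ?f (?X s))" by simp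
   also have "\<dots> <= 1 + (\<Sum>x\<in>S. \<Sum>s\<in>{s\<in>J x w. s < 1}. 2 ^ Suc r * 2 * Z s w)"
   proof (intro add_left_mono sum_mono)
    fix s
    have X0: "0 <= ?X s" by (intro sum_nonneg) simp
    have "?f (?X s + 1) - ?f (?X s) = ((1 + ?X s) + 1) ^ Suc r - (1 + ?X s) ^ Suc r" by (simp add: add_ac)
    also have "\<dots> <= 2 ^ Suc r * ((1 + ?X s) ^ r + 1)"
     using power_diff_bound1[of "Suc r" "1 + ?X s" 1] X0 by (simp add: abs_le_iff)
    also have "\<dots> <= 2 ^ Suc r * ((1 + ?X s) ^ r + (1 + ?X s) ^ r)"
     using X0 by (intro mult_left_mono add_left_mono one_le_power) auto
    finally show "?f (?X s + 1) - ?f (?X s) <= 2 ^ Suc r * 2 * Z s w" unfolding Z_def by simp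
   qed
   finally show ?case unfolding WC by (simp add: sum_distrib_left)
  qed
  have "(\<integral>\<^sup>+w. ennreal (W w ^ Suc r) \<partial>P) <= (\<integral>\<^sup>+w. ennreal 1 + ennreal (2 ^ Suc r * 2) * (\<Sum>x\<in>S. ennreal (\<Sum>s\<in>{s\<in>J x w. s < 1}. Z s w)) \<partial>P)"
  proof (rule nn_integral_mono_AE, use path ZW good in eventually_elim)
   case (elim w)
   have nn: "0 <= (\<Sum>s\<in>{s\<in>J x w. s < 1}. Z s w)" for x
    using elim(2) jset_pos[of "%s x. M s x w" x] by (intro sum_nonneg) (auto simp: less_imp_le)
   have nn2: "0 <= (\<Sum>x\<in>S. \<Sum>s\<in>{s\<in>J x w. s < 1}. Z s w)" by (rule sum_nonneg) (rule nn)
   have "ennreal (W w ^ Suc r) <= ennreal (1 + 2 ^ Suc r * 2 * (\<Sum>x\<in>S. \<Sum>s\<in>{s\<in>J x w. s < 1}. Z s w))"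
    by (rule ennreal_leI[OF elim(1)])
   also have "\<dots> = ennreal 1 + ennreal (2 ^ Suc r * 2) * (\<Sum>x\<in>S. ennreal (\<Sum>s\<in>{s\<in>J x w. s < 1}. Z s w))"
    unfolding sum_ennreal[OF nn] using nn2 by (subst ennreal_mult[symmetric], simp, simp, intro ennreal_plus) auto
   finally show ?case .
  qed
  also have "\<dots> < \<infinity>"
  proof -
   have mm: "(%w. ennreal (\<Sum>s\<in>{s\<in>J x w. s < 1}. Z s w)) \<in> borel_measurable P" if x: "x \<in> S" for x
    using meas_Fl_P[OF zero_le_one jump_sum_adapted_LA[OF x zero_less_one Z, of 0]] by simp
   then have "(\<integral>\<^sup>+w. ennreal 1 + ennreal (2 ^ Suc r * 2) * (\<Sum>x\<in>S. ennreal (\<Sum>s\<in>{s\<in>J x w. s < 1}. Z s w)) \<partial>P)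
    = 1 + ennreal (2 ^ Suc r * 2) * (\<Sum>x\<in>S. \<integral>\<^sup>+w. ennreal (\<Sum>s\<in>{s\<in>J x w. s < 1}. Z s w) \<partial>P)"
    by (subst nn_integral_add; (subst nn_integral_cmult)?; (subst nn_integral_sum)?) (auto simp: emeasure_space_1)
   also have "\<dots> < \<infinity>" using fin finS by (simp add: ennreal_mult_eq_top_iff less_top[symmetric])
   finally show ?thesis .
  qed
  finally show ?case
   by (intro integrableI_nonneg AE_I2 order_trans[OF zero_le_one W_pow_ge1]) (auto simp del: power_Suc)
 qed simp
qed

end

lemma good_path_LS_bound:
 assumes g: "good_path S a L B mp cd" "x \<in> S" "a > 0" and B: "0 <= B" and u: "0 <= u"
  and G: "borel_on u G" "\<And>s. 0 <= s ==> s < u ==> \<bar>G s\<bar> <= K" and K: "0 <= K"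
 shows "\<bar>LS_int (%s. mp s x) G u\<bar> <= K * (a * real (card {s\<in>jset mp x. s < u}) + \<bar>L\<bar> * B * u)"
  "set_integrable lborel {0..<u} (%s. G s * (- L * cd s x))"
  "borel_on u (%s. (G s * (- L * cd s x)))"
proof -
 note d = good_pathD[OF g]
 have "(%s. indicator {0..<u} s * (G s * (- L * cd s x))) = (%s. (indicator {0..<u} s * G s) * (indicator {0..u} s * (- L * cd s x)))"
  by (auto simp: indicator_def fun_eq_iff)
 then show m: "borel_on u (%s. (G s * (- L * cd s x)))"
  using borel_measurable_times[OF G(1) d(7)[of u]] by simp
 have b: "\<bar>G s * (- L * cd s x)\<bar> <= K * (\<bar>L\<bar> * B)" if "s \<in> {0..<u}" for s
  unfolding abs_mult[of "G s"] using G(2)[of s] d(6)[of s] that K by (intro mult_mono) auto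
 have sb: "{0..<u} \<subseteq> {0..u}" by auto
 show "set_integrable lborel {0..<u} (%s. G s * (- L * cd s x))" by (rule set_integrable_bounded(1)[OF m b atLeastLessThan_borel sb])
 have 1: "\<bar>LINT s:{0..<u}|lborel. G s * (- L * cd s x)\<bar> <= K * (\<bar>L\<bar> * B) * u"
  using set_integrable_bounded(2)[OF m b _ sb] u by simp
 have "\<bar>\<Sum>s\<in>{s\<in>jset mp x. s < u}. G s * jmp (%r. mp r x) s\<bar> <= (\<Sum>s\<in>{s\<in>jset mp x. s < u}. K * a)"
 proof (rule order_trans[OF sum_abs sum_mono])
  fix s assume s: "s \<in> {s\<in>jset mp x. s < u}"
  then have "0 < s" using jset_pos[of mp x] by auto
  then show "\<bar>G s * jmp (%r. mp r x) s\<bar> <= K * a"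
   unfolding abs_mult using G(2)[of s] d(3)[of s] s K by (intro mult_mono) auto
 qed
 also have "\<dots> = K * (a * real (card {s\<in>jset mp x. s < u}))" by simp
 finally have 2: "\<bar>\<Sum>s\<in>{s\<in>jset mp x. s < u}. G s * jmp (%r. mp r x) s\<bar> <= K * (a * real (card {s\<in>jset mp x. s < u}))" .
 have 3: "K * (a * real (card {s\<in>jset mp x. s < u}) + \<bar>L\<bar> * B * u) = K * (a * real (card {s\<in>jset mp x. s < u})) + K * (\<bar>L\<bar> * B) * u"
  by (simp add: algebra_simps)
 show "\<bar>LS_int (%s. mp s x) G u\<bar> <= K * (a * real (card {s\<in>jset mp x. s < u}) + \<bar>L\<bar> * B * u)"
  using 1 2 3 good_path_LS_int[OF g u G] by linarith
qed

context jump_noise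
begin

section \<open>Stochastic integrals of integrands with polynomial growth\<close>

text \<open>Up to a time \<open>u <= 1\<close> the total variation of a path over
  \<open>[0,u)\<close> is at most \<open>cW * W\<close>: it is \<open>a\<close> per jump, and at
  most \<open>\<bar>L\<bar> * B\<close> for the drift.\<close>

definition cW :: real where "cW = a + \<bar>L\<bar> * B"

lemma cW_pos: "0 < cW"
 unfolding cW_def using a B by (intro add_pos_nonneg) auto

text \<open>Polynomial growth in \<open>W\<close> is stable under products, powers and integration,
  and it implies integrability through \<open>W_moments\<close>. All interchanges of limits and
  expectations below are justified by it; its constants do not reach the final estimate.\<close>

definition polyb :: "real => (real => 'a => real) => real => nat => bool" where
 "polyb u Y C j \<longleftrightarrow> 0 <= C \<and> (AE w in P. \<forall>s. 0 <= s --> s < u --> \<bar>Y s w\<bar> <= C * W w ^ j)"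

lemma card_W: "x \<in> S ==> good_path S a L B (%s x. M s x w) (%s x. Cd s x w) ==> 0 <= u ==> u <= 1 ==>
  a * real (card {s\<in>J x w. s < u}) + \<bar>L\<bar> * B * u <= cW * W w"
proof -
 assume *: "x \<in> S" "good_path S a L B (%s x. M s x w) (%s x. Cd s x w)" "0 <= u" "u <= 1"
 have "a * real (card {s\<in>J x w. s < u}) <= a * W w" using card_le_W[OF *(1,2,4)] a by (intro mult_left_mono) auto
 moreover have "\<bar>L\<bar> * B * u <= \<bar>L\<bar> * B * W w" using *(4) W_ge1[of w] B by (intro mult_left_mono) auto
 ultimately show ?thesis unfolding cW_def by (simp add: distrib_right)
qed

lemma poly_mult_W: "0 <= C ==> y <= cW * W w ==> C * W w ^ j * y <= C * cW * W w ^ Suc j"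
proof -
 assume "0 <= C" "y <= cW * W w"
 then have "C * W w ^ j * y <= C * W w ^ j * (cW * W w)"
  using W_pow_ge1[of w j] by (intro mult_left_mono mult_nonneg_nonneg) auto
 then show ?thesis by (simp add: mult_ac)
qed

lemma integrable_poly_bound:
 assumes "Y \<in> borel_measurable P" "AE w in P. \<bar>Y w\<bar> <= C * W w ^ j"
 shows "integrable P Y"
proof (rule Bochner_Integration.integrable_bound[OF integrable_mult_right[OF W_moments(2), of C j] assms(1)])
 show "AE w in P. norm (Y w) <= norm (C * W w ^ j)" using assms(2) by (rule eventually_mono) simp
qed

lemma polybD: "polyb u Y C j ==> 0 <= C" "polyb u Y C j ==> AE w in P. \<forall>s. 0 <= s --> s < u --> \<bar>Y s w\<bar> <= C * W w ^ j"
 unfolding polyb_def by auto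

text \<open>Integrals inherit left continuity, adaptedness and polynomial growth, with one more
  power of \<open>W\<close>. They have mean zero because every term of the Riemann sums does, by
  \<open>mart_orth\<close>, and the sums are dominated by
  \<open>C * cW * W w ^ Suc j\<close>.\<close>

lemma LS_facts:
 assumes x: "x \<in> S" and u: "0 < u" "u <= 1" and Y: "LA u Y" "polyb u Y C j"
 shows "AE w in P. \<forall>t. 0 <= t --> t <= u --> \<bar>LS_int (%s. M s x w) (%s. Y s w) t\<bar> <= C * cW * W w ^ Suc j"
  "AE w in P. \<forall>t. 0 < t --> t <= u --> ((%t. LS_int (%s. M s x w) (%s. Y s w) t) \<longlongrightarrow> LS_int (%s. M s x w) (%s. Y s w) t) (at_left t)"
  "0 <= t ==> t <= u ==> (%w. LS_int (%s. M s x w) (%s. Y s w) t) \<in> borel_measurable (Fl t)"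
  "expectation (%w. LS_int (%s. M s x w) (%s. Y s w) u) = 0"
proof -
 note C = polybD[OF Y(2)]
 have *: "AE w in P. (\<forall>t. 0 <= t --> t <= u --> \<bar>LS_int (%s. M s x w) (%s. Y s w) t\<bar> <= C * cW * W w ^ Suc j) \<and>
  (\<forall>t. 0 < t --> t <= u --> ((%t. LS_int (%s. M s x w) (%s. Y s w) t) \<longlongrightarrow> LS_int (%s. M s x w) (%s. Y s w) t) (at_left t))"
  using good LA_lim[OF Y(1)] C(2)
 proof eventually_elim
  case (elim w)
  have l: "((%r. Y r w) \<longlongrightarrow> Y s w) (at_left s)" if "0 < s" "s < u" for s using elim(2) that by blast
  have b: "\<bar>Y s w\<bar> <= C * W w ^ j" if "0 <= s" "s < u" for s using elim(3) that by blast
  show ?case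
  proof (intro conjI allI impI)
   fix t assume t: "0 <= t" "t <= u"
   have "\<bar>LS_int (%s. M s x w) (%s. Y s w) t\<bar> <= C * W w ^ j * (a * real (card {s\<in>J x w. s < t}) + \<bar>L\<bar> * B * t)"
    by (rule good_path_LS_bound(1)[OF elim(1) x a B t(1)])
     (use t l b C(1) W_pow_ge1[of w j] in \<open>auto intro!: left_cont_borel mult_nonneg_nonneg\<close>)
   also have "\<dots> <= C * cW * W w ^ Suc j"
    by (rule poly_mult_W[OF C(1) card_W[OF x elim(1)]]) (use t u in auto)
   finally show "\<bar>LS_int (%s. M s x w) (%s. Y s w) t\<bar> <= C * cW * W w ^ Suc j" .
  next
   fix t assume t: "0 < t" "t <= u"
   show "((%t. LS_int (%s. M s x w) (%s. Y s w) t) \<longlongrightarrow> LS_int (%s. M s x w) (%s. Y s w) t) (at_left t)"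
    by (rule good_path_LS_left[OF elim(1) x a B t left_cont_borel[OF l] b])
  qed
 qed
 show "AE w in P. \<forall>t. 0 <= t --> t <= u --> \<bar>LS_int (%s. M s x w) (%s. Y s w) t\<bar> <= C * cW * W w ^ Suc j"
  using * by (rule eventually_mono) (rule conjunct1)
 show "AE w in P. \<forall>t. 0 < t --> t <= u --> ((%t. LS_int (%s. M s x w) (%s. Y s w) t) \<longlongrightarrow> LS_int (%s. M s x w) (%s. Y s w) t) (at_left t)"
  using * by (rule eventually_mono) (rule conjunct2)
 have ad: "(%w. LS_int (%s. M s x w) (%s. Y s w) t) \<in> borel_measurable (Fl t)" if t: "0 <= t" "t <= u" for t
 proof (cases "t = 0")
  case True
  have "LS_int X G 0 = 0" for X G by (simp add: LS_int_def Let_def set_lebesgue_integral_def)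
  then show ?thesis using True by simp
 next
  case False
  then have t0: "0 < t" using t by simp
  have "AE w in P. \<forall>s. 0 <= s --> s < t --> \<bar>Y s w\<bar> <= C * W w ^ j" using C(2) by (rule eventually_mono) (use t in auto)
  from meas_Fl_lim[OF t(1) Riemann_meas[OF x t0 LA_subset[OF Y(1) t(2)], of "%y. y"] Riemann_full_AE(1)[OF x t0 LA_subset[OF Y(1) t(2)] this]]
  show ?thesis by simp
 qed
 then show "0 <= t ==> t <= u ==> (%w. LS_int (%s. M s x w) (%s. Y s w) t) \<in> borel_measurable (Fl t)" .
 define R where "R = (%n w. \<Sum>i<n. Y (tp u n i) w * (M (tp u n (Suc i)) x w - M (tp u n i) x w))"
 have mR: "R n \<in> borel_measurable P" for n
  unfolding R_def using meas_Fl_P[OF less_imp_le[OF u(1)] Riemann_meas[OF x u(1) Y(1), of "%y. y"]] by simp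
 \<comment> \<open>\<open>W\<close> counts jumps strictly before 1, so a jump at time 1 itself has
   to be excluded for this bound of the martingale.\<close>
 have Mb: "AE w in P. \<bar>M t x w\<bar> <= cW * W w" if t: "0 <= t" "t <= 1" for t
  using good no_fixed_jump[OF x zero_less_one]
 proof eventually_elim
  case (elim w)
  have "\<bar>\<Sum>s\<in>{s\<in>J x w. s <= t}. jp x w s\<bar> <= (\<Sum>s\<in>{s\<in>J x w. s <= t}. a)"
   using good_pathD(3)[OF elim(1) x a] by (intro order_trans[OF sum_abs sum_mono]) auto
  also have "\<dots> <= a * real (card {s\<in>J x w. s < 1})"
  proof -
   have "s < 1" if "s \<in> J x w" "s <= t" for s using elim(2) that t by (cases "s = 1") auto
   then have "card {s\<in>J x w. s <= t} <= card {s\<in>J x w. s < 1}"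
    by (intro card_mono good_pathD(2)[OF elim(1) x a]) auto
   then show ?thesis using a by (simp add: mult.commute)
  qed
  finally have 1: "\<bar>\<Sum>s\<in>{s\<in>J x w. s <= t}. jp x w s\<bar> <= a * real (card {s\<in>J x w. s < 1})" .
  have "\<bar>LINT s:{0..t}|lborel. - L * Cd s x w\<bar> <= \<bar>L\<bar> * B * measure lborel {0..t}"
   using good_pathD(6)[OF elim(1) x a] by (intro set_integrable_bounded(2)[OF good_pathD(7)[OF elim(1) x a], where a=0 and b=t]) auto
  also have "\<dots> <= \<bar>L\<bar> * B * 1" using t B by (intro mult_left_mono) auto
  finally have 2: "\<bar>LINT s:{0..t}|lborel. - L * Cd s x w\<bar> <= \<bar>L\<bar> * B * 1" .
  show ?case unfolding good_pathD(4)[OF elim(1) x a t(1)] using 1 2 card_W[OF x elim(1), of 1] by linarith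
 qed
 have "expectation (R n) = 0" for n
 proof -
  have i: "integrable P (%w. Y (tp u n i) w * (M (tp u n (Suc i)) x w - M (tp u n i) x w))"
   "expectation (%w. Y (tp u n i) w * (M (tp u n (Suc i)) x w - M (tp u n i) x w)) = 0" if "i < n" for i
  proof -
   have t: "0 <= tp u n i" "tp u n i <= tp u n (Suc i)" "tp u n i < u" "0 <= tp u n (Suc i)" "tp u n (Suc i) <= u"
    using u that tp_less[of u i n] by (auto intro: tp_nonneg tp_mono tp_le)
   have "tp u n (Suc i) <= 1" using t u by simp
   have ii: "integrable P (%w. Y (tp u n i) w * M (tp u n (Suc i)) x w)"
   proof (rule integrable_poly_bound[where C="C * cW" and j="Suc j"])
    show "(%w. Y (tp u n i) w * M (tp u n (Suc i)) x w) \<in> borel_measurable P"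
     by (intro borel_measurable_times LA_measP[OF Y(1) t(1,3)] meas_MP[OF x t(4)])
    show "AE w in P. \<bar>Y (tp u n i) w * M (tp u n (Suc i)) x w\<bar> <= C * cW * W w ^ Suc j"
     using C(2) Mb[OF t(4) \<open>tp u n (Suc i) <= 1\<close>]
    proof eventually_elim
     case (elim w)
     have "\<bar>Y (tp u n i) w\<bar> <= C * W w ^ j" using elim(1) t by blast
     then have "\<bar>Y (tp u n i) w\<bar> * \<bar>M (tp u n (Suc i)) x w\<bar> <= C * W w ^ j * \<bar>M (tp u n (Suc i)) x w\<bar>" by (rule mult_right_mono) simp
     also have "\<dots> <= C * cW * W w ^ Suc j" by (rule poly_mult_W[OF C(1) elim(2)])
     finally show ?case by (simp add: abs_mult)
    qed
   qed
   note o = mart_orth[OF x t(1,2) LA_meas[OF Y(1) t(1,3)] ii]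
   show "integrable P (%w. Y (tp u n i) w * (M (tp u n (Suc i)) x w - M (tp u n i) x w))"
    unfolding right_diff_distrib using ii o(1) by (rule Bochner_Integration.integrable_diff)
   show "expectation (%w. Y (tp u n i) w * (M (tp u n (Suc i)) x w - M (tp u n i) x w)) = 0"
    unfolding right_diff_distrib using ii o by simp
  qed
  then show ?thesis unfolding R_def by (subst Bochner_Integration.integral_sum) auto
 qed
 moreover have "(%n. expectation (R n)) \<longlonglongrightarrow> expectation (%w. LS_int (%s. M s x w) (%s. Y s w) u)"
 proof (rule integral_dominated_convergence[where w="%w. C * cW * W w ^ Suc j"])
  show "(%w. LS_int (%s. M s x w) (%s. Y s w) u) \<in> borel_measurable P"
   by (rule meas_Fl_P[OF less_imp_le[OF u(1)]]) (rule ad[OF less_imp_le[OF u(1)] order_refl])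
  show "integrable P (%w. C * cW * W w ^ Suc j)" by (intro integrable_mult_right W_moments)
  show "AE w in P. (%n. R n w) \<longlonglongrightarrow> LS_int (%s. M s x w) (%s. Y s w) u"
   unfolding R_def by (rule Riemann_full_AE(1)[OF x u(1) Y(1) C(2)])
  show "AE w in P. norm (R n w) <= C * cW * W w ^ Suc j" for n
   using Riemann_full_AE(2)[OF x u(1) Y(1) C(2)] good
  proof eventually_elim
   case (elim w)
   have "\<bar>R n w\<bar> <= C * W w ^ j * (a * real (card {s\<in>J x w. s < u}) + \<bar>L\<bar> * B * u)" unfolding R_def using elim(1) by blast
   also have "\<dots> <= C * cW * W w ^ Suc j"
    by (rule poly_mult_W[OF C(1) card_W[OF x elim(2)]]) (use u in auto)
   finally show ?case by simp
  qed
 qed (rule mR)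
 ultimately show "expectation (%w. LS_int (%s. M s x w) (%s. Y s w) u) = 0"
  by (simp add: LIMSEQ_const_iff)
qed

text \<open>The weighted increment is the integral of a process that vanishes up to \<open>s\<close>
  and equals \<open>Z * Y\<close> afterwards, so the mean-zero statement for full integrals applies.
  The open half-line \<open>{s<..}\<close> makes that process left continuous, and it is adapted
  because \<open>Z\<close> is known from time \<open>s\<close> on.\<close>

lemma LS_increment_mean_zero:
 assumes x: "x \<in> S" and u: "u <= 1" and Y: "LA u Y" "polyb u Y C j" and st: "0 <= s" "s <= t" "t <= u"
  and Z: "Z \<in> borel_measurable (Fl s)" "AE w in P. \<bar>Z w\<bar> <= C' * W w ^ i" and C': "0 <= C'"
 shows "expectation (%w. Z w * (LS_int (%s. M s x w) (%s. Y s w) t - LS_int (%s. M s x w) (%s. Y s w) s)) = 0"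
proof (cases "s = t")
 case False
 then have t: "0 < t" "s < t" "t <= 1" using st u by auto
 note C = polybD[OF Y(2)]
 define Y' where "Y' = (%r w. indicator {s<..} r * Z w * Y r w)"
 have LA': "LA t Y'"
  unfolding LA_def
 proof (intro conjI allI impI)
  fix r assume r: "0 <= r" "r < t"
  show "Y' r \<in> borel_measurable (Fl r)"
  proof (cases "s < r")
   case True
   have "Z \<in> borel_measurable (Fl r)" by (rule meas_Fl_mono[OF st(1) _ Z(1)]) (use True in simp)
   moreover have "Y r \<in> borel_measurable (Fl r)" using r st by (intro LA_meas[OF Y(1)]) auto
   ultimately show ?thesis unfolding Y'_def by (intro borel_measurable_times) auto
  qed (simp add: Y'_def)
 next
  show "AE w in P. \<forall>r. 0 < r --> r < t --> ((%q. Y' q w) \<longlongrightarrow> Y' r w) (at_left r)"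
   using LA_lim[OF Y(1)]
  proof eventually_elim
   case (elim w)
   show ?case
   proof (intro allI impI)
    fix r assume r: "0 < r" "r < t"
    have "((%q. indicator {s<..} q :: real) \<longlongrightarrow> indicator {s<..} r) (at_left r)"
    proof (cases "s < r")
     case True
     have "\<forall>\<^sub>F q in at_left r. indicator {s<..} q = (indicator {s<..} r :: real)"
      by (rule eventually_at_leftI[OF _ True]) (use True in auto)
     then show ?thesis by (rule tendsto_eventually)
    next
     case False
     have "\<forall>\<^sub>F q in at_left r. indicator {s<..} q = (indicator {s<..} r :: real)"
      by (rule eventually_at_leftI[of "r - 1"]) (use False in auto)
     then show ?thesis by (rule tendsto_eventually)
    qed
    moreover have "((%q. Y q w) \<longlongrightarrow> Y r w) (at_left r)" using elim r st by auto
    ultimately show "((%q. Y' q w) \<longlongrightarrow> Y' r w) (at_left r)" unfolding Y'_def by (intro tendsto_intros)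
   qed
  qed
 qed
 have pb': "polyb t Y' (C' * C) (i + j)"
  unfolding polyb_def
 proof (intro conjI)
  show "0 <= C' * C" using C C' by simp
  show "AE w in P. \<forall>r. 0 <= r --> r < t --> \<bar>Y' r w\<bar> <= C' * C * W w ^ (i + j)"
   using C(2) Z(2)
  proof eventually_elim
   case (elim w)
   show ?case
   proof (intro allI impI)
    fix r assume "0 <= r" "r < t"
    then have "\<bar>Y r w\<bar> <= C * W w ^ j" using elim st by auto
    then have "\<bar>Z w\<bar> * \<bar>Y r w\<bar> <= (C' * W w ^ i) * (C * W w ^ j)" using elim(2) by (intro mult_mono) auto
    moreover from this have "0 <= (C' * W w ^ i) * (C * W w ^ j)" by (rule order_trans[rotated]) simp
    ultimately show "\<bar>Y' r w\<bar> <= C' * C * W w ^ (i + j)"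
     unfolding Y'_def by (cases "s < r") (auto simp: abs_mult power_add mult_ac)
   qed
  qed
 qed
 \<comment> \<open>The increment integrates over \<open>[s,t)\<close> but \<open>Y'\<close> starts
   strictly after \<open>s\<close>. The two agree because a jump at the fixed time \<open>s\<close>
   has probability zero.\<close>
 have nj: "AE w in P. s \<notin> J x w"
 proof (cases "s = 0")
  case True
  then show ?thesis using jset_pos[of "%s x. M s x _" x] by (intro AE_I2) (auto simp: jmp_def)
 next
  case False then show ?thesis using st by (intro no_fixed_jump[OF x]) simp
 qed
 have "AE w in P. LS_int (%s. M s x w) (%s. Y' s w) t = Z w * (LS_int (%s. M s x w) (%s. Y s w) t - LS_int (%s. M s x w) (%s. Y s w) s)"
  using good nj LA_lim[OF Y(1)] C(2) LA_lim[OF LA'] polybD(2)[OF pb']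
 proof eventually_elim
  case (elim w)
  note d = good_pathD[OF elim(1) x a]
  have l: "((%r. Y r w) \<longlongrightarrow> Y q w) (at_left q)" if "0 < q" "q < u" for q using elim(3) that by blast
  have b: "\<bar>Y q w\<bar> <= C * W w ^ j" if "0 <= q" "q < u" for q using elim(4) that by blast
  have l': "((%r. Y' r w) \<longlongrightarrow> Y' q w) (at_left q)" if "0 < q" "q < t" for q using elim(5) that by blast
  have b': "\<bar>Y' q w\<bar> <= C' * C * W w ^ (i + j)" if "0 <= q" "q < t" for q using elim(6) that by blast
  let ?D = "%r. - L * Cd r x w"
  have K: "0 <= C * W w ^ j" using C(1) W_pow_ge1[of w j] by (intro mult_nonneg_nonneg) auto
  have Yt: "borel_on q (%r. Y r w)" "\<And>r. 0 <= r ==> r < q ==> \<bar>Y r w\<bar> <= C * W w ^ j" if "q <= u" for q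
   using that l b by (auto intro!: left_cont_borel)
  have e: "LS_int (%s. M s x w) (%s. Y s w) q = (\<Sum>r\<in>{r\<in>J x w. r < q}. Y r w * jp x w r) + (LINT r:{0..<q}|lborel. Y r w * ?D r)"
   if "0 <= q" "q <= u" for q
   by (rule good_path_LS_int[OF elim(1) x a that(1) Yt[OF that(2)]])
  have si: "set_integrable lborel {0..<q} (%r. Y r w * ?D r)" if "0 <= q" "q <= u" for q
   by (rule good_path_LS_bound(2)[OF elim(1) x a B that(1) Yt[OF that(2)] K])
  have si2: "set_integrable lborel {s..<t} (%r. Y r w * ?D r)"
   by (rule set_integrable_subset[OF si[of t]]) (use st in auto)
  have i2: "(LINT r:{0..<t}|lborel. Y r w * ?D r) = (LINT r:{0..<s}|lborel. Y r w * ?D r) + (LINT r:{s..<t}|lborel. Y r w * ?D r)"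
   using st by (intro set_lebesgue_integral_split si si2) auto
  have s2: "(\<Sum>r\<in>{r\<in>J x w. r < t}. Y r w * jp x w r) = (\<Sum>r\<in>{r\<in>J x w. r < s}. Y r w * jp x w r) + (\<Sum>r\<in>{r\<in>{r\<in>J x w. r < t}. s <= r \<and> r < t}. Y r w * jp x w r)"
  proof -
   have "{r\<in>{r\<in>J x w. r < t}. r < t} = {r\<in>J x w. r < t}" "{r\<in>{r\<in>J x w. r < t}. r < s} = {r\<in>J x w. r < s}" using st by auto
   then show ?thesis using sum_less_split[OF d(2)[of t] st(2), of "%r. Y r w * jp x w r"] by simp
  qed
  have s3: "(\<Sum>r\<in>{r\<in>J x w. r < t}. Y' r w * jp x w r) = Z w * (\<Sum>r\<in>{r\<in>{r\<in>J x w. r < t}. s <= r \<and> r < t}. Y r w * jp x w r)"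
   unfolding sum_distrib_left
  proof (rule sum.mono_neutral_cong_right[OF d(2)])
   show "{r \<in> {r \<in> J x w. r < t}. s <= r \<and> r < t} \<subseteq> {r \<in> J x w. r < t}" by auto
   show "\<forall>r\<in>{r \<in> J x w. r < t} - {r \<in> {r \<in> J x w. r < t}. s <= r \<and> r < t}. Y' r w * jp x w r = 0"
    by (auto simp: Y'_def indicator_def split: if_splits)
   fix r assume r: "r \<in> {r \<in> {r \<in> J x w. r < t}. s <= r \<and> r < t}"
   then have "r \<noteq> s" using elim(2) by auto
   then show "Y' r w * jp x w r = Z w * (Y r w * jp x w r)" using r by (simp add: Y'_def)
  qed
  have i3: "(LINT r:{0..<t}|lborel. Y' r w * ?D r) = Z w * (LINT r:{s..<t}|lborel. Y r w * ?D r)"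
   unfolding set_integral_mult_right[symmetric] unfolding set_lebesgue_integral_def real_scaleR_def
  proof (rule integral_cong_AE)
   have K': "0 <= C' * C * W w ^ (i + j)" using b'[of 0] t by force
   show "(%r. indicator {0..<t} r * (Y' r w * ?D r)) \<in> borel_measurable lborel"
    using good_path_LS_bound(3)[OF elim(1) x a B _ left_cont_borel[OF l'] b' K'] t by simp
   show "(%r. indicator {s..<t} r * (Z w * (Y r w * ?D r))) \<in> borel_measurable lborel"
    using set_integrable_mult_right[OF si2, of "Z w"] unfolding set_integrable_def real_scaleR_def by (rule borel_measurable_integrable)
   show "AE r in lborel. indicator {0..<t} r * (Y' r w * ?D r) = indicator {s..<t} r * (Z w * (Y r w * ?D r))"
    by (rule AE_mp[OF AE_lborel_singleton[of s] AE_I2]) (use st in \<open>auto simp: Y'_def indicator_def\<close>)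
  qed
  have "LS_int (%s. M s x w) (%s. Y' s w) t = (\<Sum>r\<in>{r\<in>J x w. r < t}. Y' r w * jp x w r) + (LINT r:{0..<t}|lborel. Y' r w * ?D r)"
   by (rule good_path_LS_int[OF elim(1) x a _ left_cont_borel[OF l'] b']) (use t in simp)
  moreover note e[of t] e[of s]
  ultimately show ?case unfolding s3 i3 using st s2 i2 by (simp add: algebra_simps)
 qed
 then have "expectation (%w. Z w * (LS_int (%s. M s x w) (%s. Y s w) t - LS_int (%s. M s x w) (%s. Y s w) s)) = expectation (%w. LS_int (%s. M s x w) (%s. Y' s w) t)"
 proof (intro integral_cong_AE)
  have 1: "(%w. LS_int (%s. M s x w) (%s. Y s w) q) \<in> borel_measurable P" if "0 <= q" "q <= u" for q
   by (rule meas_Fl_P[OF that(1) LS_facts(3)[OF x _ u Y that]]) (use t st in simp)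
  then show "(%w. Z w * (LS_int (%s. M s x w) (%s. Y s w) t - LS_int (%s. M s x w) (%s. Y s w) s)) \<in> borel_measurable P"
   using st by (intro borel_measurable_times borel_measurable_diff meas_Fl_P[OF st(1) Z(1)]) auto
  show "(%w. LS_int (%s. M s x w) (%s. Y' s w) t) \<in> borel_measurable P"
   using t by (intro meas_Fl_P[OF _ LS_facts(3)[OF x t(1,3) LA' pb']]) auto
 qed (auto elim: eventually_mono)
 also have "\<dots> = 0" by (rule LS_facts(4)[OF x t(1,3) LA' pb'])
 finally show ?thesis .
qed simp

end

section \<open>Moment estimates for a single level\<close>

text \<open>Hoelder's inequality for integer exponents at the price of a factor 2: after
  normalisation it reduces to \<open>\<alpha> ^ i * \<beta> ^ j <= \<alpha> ^ (i + j) + \<beta> ^ (i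
  + j)\<close>, by comparing which of the two numbers is larger.\<close>

lemma (in prob_space) holder_power:
 fixes f h :: "'a => real"
 assumes f: "integrable M (%w. f w ^ (i + j))" "\<And>w. 0 <= f w" "(\<integral>w. f w ^ (i + j) \<partial>M) <= x ^ (i + j)" "0 <= x"
  and h: "integrable M (%w. h w ^ (i + j))" "\<And>w. 0 <= h w" "(\<integral>w. h w ^ (i + j) \<partial>M) <= y ^ (i + j)" "0 <= y"
  and m: "f \<in> borel_measurable M" "h \<in> borel_measurable M"
 shows "(\<integral>w. f w ^ i * h w ^ j \<partial>M) <= 2 * x ^ i * y ^ j"
proof -
 have ag: "\<alpha> ^ i * \<beta> ^ j <= \<alpha> ^ (i + j) + \<beta> ^ (i + j)" if "0 <= \<alpha>" "0 <= \<beta>" for \<alpha> \<beta> :: real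
 proof (cases "\<alpha> <= \<beta>")
  case True
  then have "\<alpha> ^ i * \<beta> ^ j <= \<beta> ^ i * \<beta> ^ j" using that by (intro mult_right_mono power_mono) auto
  then show ?thesis using that by (simp add: power_add add_increasing)
 next
  case False
  then have "\<alpha> ^ i * \<beta> ^ j <= \<alpha> ^ i * \<alpha> ^ j" using that by (intro mult_left_mono power_mono) auto
  then show ?thesis using that by (simp add: power_add add_increasing2)
 qed
 \<comment> \<open>Strictly larger bounds \<open>x'\<close> and \<open>y'\<close> are positive and
   can be divided by; they are removed by a limit at the end.\<close>
 have pos: "(\<integral>w. f w ^ i * h w ^ j \<partial>M) <= 2 * x' ^ i * y' ^ j" if x': "x < x'" "y < y'" for x' y'
 proof -
  have p: "0 < x'" "0 < y'" using x' f(4) h(4) by auto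
  have le: "f w ^ i * h w ^ j <= x' ^ i * y' ^ j * (f w ^ (i + j) / x' ^ (i + j) + h w ^ (i + j) / y' ^ (i + j))" for w
  proof -
   have "f w ^ i * h w ^ j = x' ^ i * y' ^ j * ((f w / x') ^ i * (h w / y') ^ j)" using p by (simp add: power_divide)
   also have "\<dots> <= x' ^ i * y' ^ j * ((f w / x') ^ (i + j) + (h w / y') ^ (i + j))"
    using p f(2) h(2) by (intro mult_left_mono ag) auto
   finally show ?thesis by (simp add: power_divide)
  qed
  have i: "integrable M (%w. x' ^ i * y' ^ j * (f w ^ (i + j) / x' ^ (i + j) + h w ^ (i + j) / y' ^ (i + j)))"
   using f(1) h(1) by simp
  have "integrable M (%w. f w ^ i * h w ^ j)"
  proof (rule Bochner_Integration.integrable_bound[OF i])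
   show "(%w. f w ^ i * h w ^ j) \<in> borel_measurable M" using m by measurable
   have "norm (f w ^ i * h w ^ j) = f w ^ i * h w ^ j" for w using f(2) h(2) by simp
   then show "AE w in M. norm (f w ^ i * h w ^ j) <= norm (x' ^ i * y' ^ j * (f w ^ (i + j) / x' ^ (i + j) + h w ^ (i + j) / y' ^ (i + j)))"
    using order_trans[OF le abs_ge_self] by (intro AE_I2) simp
  qed
  then have "(\<integral>w. f w ^ i * h w ^ j \<partial>M) <= (\<integral>w. x' ^ i * y' ^ j * (f w ^ (i + j) / x' ^ (i + j) + h w ^ (i + j) / y' ^ (i + j)) \<partial>M)"
   using i le by (intro integral_mono) auto
  also have "\<dots> = x' ^ i * y' ^ j * ((\<integral>w. f w ^ (i + j) \<partial>M) / x' ^ (i + j) + (\<integral>w. h w ^ (i + j) \<partial>M) / y' ^ (i + j))"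
   using f(1) h(1) by simp
  also have "\<dots> <= x' ^ i * y' ^ j * (1 + 1)"
  proof (intro mult_left_mono add_mono)
   have "(\<integral>w. f w ^ (i + j) \<partial>M) <= x' ^ (i + j)" using f(3) power_mono[of x x' "i + j"] x' f(4) by linarith
   then show "(\<integral>w. f w ^ (i + j) \<partial>M) / x' ^ (i + j) <= 1" using p by (simp add: divide_le_eq)
   have "(\<integral>w. h w ^ (i + j) \<partial>M) <= y' ^ (i + j)" using h(3) power_mono[of y y' "i + j"] x' h(4) by linarith
   then show "(\<integral>w. h w ^ (i + j) \<partial>M) / y' ^ (i + j) <= 1" using p by (simp add: divide_le_eq)
  qed (use p in auto)
  finally show ?thesis by (simp add: mult_ac)
 qed
 have "(%n. 1 / real (Suc n)) \<longlonglongrightarrow> 0" using lim_1_over_n LIMSEQ_Suc by blast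
 then have "(%n. 2 * (x + 1 / real (Suc n)) ^ i * (y + 1 / real (Suc n)) ^ j) \<longlonglongrightarrow> 2 * (x + 0) ^ i * (y + 0) ^ j"
  by (intro tendsto_intros)
 moreover have "(\<integral>w. f w ^ i * h w ^ j \<partial>M) <= 2 * (x + 1 / real (Suc n)) ^ i * (y + 1 / real (Suc n)) ^ j" for n
  by (rule pos) auto
 ultimately show ?thesis by (intro LIMSEQ_le_const[of "%n. 2 * (x + 1 / real (Suc n)) ^ i * (y + 1 / real (Suc n)) ^ j"]) auto
qed

section \<open>Doob's maximal inequality\<close>

primrec runmax :: "(nat => real) => nat => real" where
 "runmax y 0 = \<bar>y 0\<bar>"
| "runmax y (Suc n) = max (runmax y n) \<bar>y (Suc n)\<bar>"

lemma runmax_ge: "i <= n ==> \<bar>y i\<bar> <= runmax y n"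
 by (induction n) (auto simp: le_Suc_eq max_def)

lemma runmax_nonneg: "0 <= runmax y n"
 by (rule order_trans[OF abs_ge_zero runmax_ge[OF le_refl]])

lemma runmax_le: "(\<And>i. i <= n ==> \<bar>y i\<bar> <= c) ==> runmax y n <= c"
 by (induction n) auto

text \<open>A pathwise form of Doob's inequality: for a martingale \<open>y\<close> the sum on the left has mean zero.\<close>

lemma pathwise_doob:
 assumes "y 0 = 0" and p: "2 <= p"
 shows "(\<Sum>i<n. runmax y i ^ (p - 1) * sgn (y i) * (y (Suc i) - y i)) + runmax y n ^ p / 2 <= runmax y n ^ (p - 1) * \<bar>y n\<bar>"
proof (induction n)
 case 0
 then show ?case using assms by (simp add: power_0_left)
next
 case (Suc n)
 let ?m = "runmax y n" and ?m' = "runmax y (Suc n)"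
 have m0: "0 <= ?m" "?m <= ?m'" by (auto simp: runmax_nonneg)
 \<comment> \<open>\<open>sgn (y n)\<close> is a subgradient of the absolute value at
   \<open>y n\<close>.\<close>
 have sg: "sgn (y n) * (y (Suc n) - y n) <= \<bar>y (Suc n)\<bar> - \<bar>y n\<bar>"
  by (cases "y n > 0"; cases "y n = 0") (auto simp: sgn_if)
 have "?m ^ (p - 1) * sgn (y n) * (y (Suc n) - y n) <= ?m ^ (p - 1) * (\<bar>y (Suc n)\<bar> - \<bar>y n\<bar>)"
  unfolding mult.assoc using m0 by (intro mult_left_mono sg) simp
 then have 1: "(\<Sum>i<Suc n. runmax y i ^ (p - 1) * sgn (y i) * (y (Suc i) - y i)) <= ?m ^ (p - 1) * \<bar>y (Suc n)\<bar> - ?m ^ p / 2"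
  using Suc.IH by (simp add: right_diff_distrib)
 \<comment> \<open>If the maximum does not change, both sides agree. Otherwise it becomes
   \<open>w = \<bar>y (Suc n)\<bar>\<close> and the claim is that \<open>m ^ (p - 1) * w\<close> is
   at most the mean of \<open>m ^ p\<close> and \<open>w ^ p\<close>; this follows from
   \<open>m * (2 * w - m) <= w * w\<close> and \<open>m <= w\<close>.\<close>
 have "?m ^ (p - 1) * \<bar>y (Suc n)\<bar> - ?m ^ p / 2 + ?m' ^ p / 2 <= ?m' ^ (p - 1) * \<bar>y (Suc n)\<bar>"
 proof (cases "\<bar>y (Suc n)\<bar> <= ?m")
  case True
  then show ?thesis by (simp add: max_absorb1)
 next
  case False
  then have e: "?m' = \<bar>y (Suc n)\<bar>" by simp
  obtain q where q: "p = Suc q" "1 <= q" using p by (cases p) auto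
  let ?w = "\<bar>y (Suc n)\<bar>"
  have "?m ^ q * ?w <= (?m * ?m ^ q + ?w * ?w ^ q) / 2"
  proof -
   have mw: "?m <= ?w" using False by simp
   have "?m ^ q <= ?w ^ q" using mw m0 by (intro power_mono) auto
   have "?m * (?m ^ (q - 1) * (2 * ?w - ?m)) <= ?w * ?w ^ q"
   proof -
    have a: "?m * (2 * ?w - ?m) <= ?w * ?w" using zero_le_power2[of "?w - ?m"] by (simp add: power2_eq_square algebra_simps)
    have "?m * (?m ^ (q - 1) * (2 * ?w - ?m)) = ?m ^ (q - 1) * (?m * (2 * ?w - ?m))" by simp
    also have "\<dots> <= ?m ^ (q - 1) * (?w * ?w)" using a m0 by (intro mult_left_mono) auto
    also have "\<dots> <= ?w ^ (q - 1) * (?w * ?w)" using mw m0 by (intro mult_right_mono power_mono) auto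
    also have "\<dots> = ?w * ?w ^ q" using q(2) by (simp add: power_eq_if)
    finally show ?thesis .
   qed
   moreover have "?m * ?m ^ (q - 1) = ?m ^ q" using q(2) by (simp add: power_eq_if)
   ultimately have "?m ^ q * (2 * ?w - ?m) <= ?w * ?w ^ q" by (simp add: mult.assoc[symmetric])
   then show ?thesis by (simp add: algebra_simps)
  qed
  then show ?thesis unfolding e q by (simp add: mult_ac)
 qed
 then show ?case using 1 by linarith
qed

text \<open>\<open>v\<close> is the weight of a site in the spatial measure and \<open>v * a\<close>
  the weighted jump size. The condition \<open>scale\<close> says that the squared weighted jumps of
  one site accumulate at rate \<open>K0 * v\<close>, so that summing over sites produces
  \<open>K0\<close> times an integral against the normalised spatial measure.\<close>

locale weighted_noise = jump_noise +
 fixes v K0 :: real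
 assumes v: "0 < v" and K0: "0 <= K0" and scale: "\<kappa> * (v * a)\<^sup>2 = K0 * v"
begin

abbreviation \<eta> :: real where "\<eta> \<equiv> v * a"

lemma eta_pos: "0 < \<eta>"
 using v a by simp

definition Mint :: "(site => real => 'a => real) => real => 'a => real" where
 "Mint Y t w = (\<Sum>x\<in>S. v * LS_int (%s. M s x w) (%s. Y x s w) t)"

lemma Mint_facts:
 assumes u: "0 < u" "u <= 1" and Y: "\<And>x. x \<in> S ==> LA u (Y x)" "\<And>x. x \<in> S ==> polyb u (Y x) C j" and C: "0 <= C"
 defines "C' \<equiv> real (card S) * v * C * cW"
 shows "LA u (Mint Y)" "AE w in P. \<forall>t. 0 <= t --> t <= u --> \<bar>Mint Y t w\<bar> <= C' * W w ^ Suc j" "polyb u (Mint Y) C' (Suc j)" "0 <= C'"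
  "AE w in P. \<forall>t. 0 < t --> t <= u --> ((%t. Mint Y t w) \<longlongrightarrow> Mint Y t w) (at_left t)"
  "0 <= t ==> t <= u ==> Mint Y t \<in> borel_measurable (Fl t)"
proof -
 note F = LS_facts[OF _ u Y]
 show C'0: "0 <= C'" unfolding C'_def using v C cW_pos by simp
 have "AE w in P. \<forall>x\<in>S. \<forall>t. 0 <= t --> t <= u --> \<bar>LS_int (%s. M s x w) (%s. Y x s w) t\<bar> <= C * cW * W w ^ Suc j"
  using finS F(1) by (intro AE_finite_allI) auto
 then show b: "AE w in P. \<forall>t. 0 <= t --> t <= u --> \<bar>Mint Y t w\<bar> <= C' * W w ^ Suc j"
 proof eventually_elim
  case (elim w)
  show ?case
  proof (intro allI impI)
   fix t assume t: "0 <= t" "t <= u"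
   have "\<bar>Mint Y t w\<bar> <= (\<Sum>x\<in>S. v * (C * cW * W w ^ Suc j))"
    unfolding Mint_def
   proof (rule order_trans[OF sum_abs sum_mono])
    fix x assume "x \<in> S"
    then have "\<bar>LS_int (%s. M s x w) (%s. Y x s w) t\<bar> <= C * cW * W w ^ Suc j" using elim t by blast
    then show "\<bar>v * LS_int (%s. M s x w) (%s. Y x s w) t\<bar> <= v * (C * cW * W w ^ Suc j)"
     using v by (simp add: abs_mult)
   qed
   then show "\<bar>Mint Y t w\<bar> <= C' * W w ^ Suc j" unfolding C'_def by (simp add: mult_ac)
  qed
 qed
 then show "polyb u (Mint Y) C' (Suc j)" unfolding polyb_def using C'0 by (auto elim!: eventually_mono)
 have "AE w in P. \<forall>x\<in>S. \<forall>t. 0 < t --> t <= u --> ((%t. LS_int (%s. M s x w) (%s. Y x s w) t) \<longlongrightarrow> LS_int (%s. M s x w) (%s. Y x s w) t) (at_left t)"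
  using finS F(2) by (intro AE_finite_allI) auto
 then show l: "AE w in P. \<forall>t. 0 < t --> t <= u --> ((%t. Mint Y t w) \<longlongrightarrow> Mint Y t w) (at_left t)"
 proof eventually_elim
  case (elim w)
  show ?case unfolding Mint_def using elim by (intro allI impI tendsto_sum tendsto_mult tendsto_const) blast
 qed
 have m: "Mint Y t \<in> borel_measurable (Fl t)" if t: "0 <= t" "t <= u" for t
  unfolding Mint_def using F(3)[OF _ _ _ t] by (intro borel_measurable_sum borel_measurable_times) auto
 then show "0 <= t ==> t <= u ==> Mint Y t \<in> borel_measurable (Fl t)" .
 show "LA u (Mint Y)" unfolding LA_def
 proof (intro conjI allI impI)
  fix t assume "0 <= t" "t < u" then show "Mint Y t \<in> borel_measurable (Fl t)" by (intro m) auto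
 next
  show "AE w in P. \<forall>t. 0 < t --> t < u --> ((%t. Mint Y t w) \<longlongrightarrow> Mint Y t w) (at_left t)" using l by (rule eventually_mono) auto
 qed
qed

text \<open>The supremum over real times is not known to be measurable, hence the majorant
  \<open>Vp\<close>: the lower limit of running maxima over finer and finer grids. Left continuity
  puts every value of \<open>Mint\<close> below it, and Fatou's lemma transfers the bound obtained
  on the grids.\<close>

lemma doob_max:
 assumes u: "0 < u" "u <= 1" and Y: "\<And>x. x \<in> S ==> LA u (Y x)" "\<And>x. x \<in> S ==> polyb u (Y x) C j" and C: "0 <= C"
  and p: "2 <= p" and X: "expectation (%w. \<bar>Mint Y u w\<bar> ^ p) <= y ^ p" "0 <= y"
 shows "\<exists>Vp. Vp \<in> borel_measurable P \<and> (AE w in P. \<forall>t. 0 <= t --> t <= u --> ennreal (\<bar>Mint Y t w\<bar> ^ p) <= Vp w) \<and>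
  (\<integral>\<^sup>+w. Vp w \<partial>P) <= ennreal ((4 * y) ^ p)"
proof -
 define C' where "C' = real (card S) * v * C * cW"
 have F2: "AE w in P. \<forall>t. 0 <= t --> t <= u --> \<bar>Mint Y t w\<bar> <= C' * W w ^ Suc j"
  unfolding C'_def by (rule Mint_facts(2)[OF u Y C])
 have F4: "0 <= C'" unfolding C'_def by (rule Mint_facts(4)[OF u Y C])
 have F5: "AE w in P. \<forall>t. 0 < t --> t <= u --> ((%t. Mint Y t w) \<longlongrightarrow> Mint Y t w) (at_left t)"
  by (rule Mint_facts(5)[OF u Y C])
 have F6: "Mint Y t \<in> borel_measurable (Fl t)" if "0 <= t" "t <= u" for t
  by (rule Mint_facts(6)[OF u Y C that])
 define X where "X = (%n w i. Mint Y (tp u n i) w)"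
 define R where "R = (%n w. runmax (X n w) n)"
 have M0: "Mint Y 0 w = 0" for w by (simp add: Mint_def LS_int_def Let_def set_lebesgue_integral_def)
 have t: "0 <= tp u n i" "tp u n i <= u" if "i <= n" "n > 0" for n i using u that by (auto intro: tp_nonneg tp_le)
 have mX: "(%w. X n w i) \<in> borel_measurable (Fl (tp u n k))" if "i <= k" "k <= n" "n > 0" for n i k
  unfolding X_def using that u by (intro meas_Fl_mono[OF _ _ F6] t tp_mono) auto
 have mR: "(%w. runmax (X n w) k) \<in> borel_measurable (Fl (tp u n k'))" if "k <= k'" "k' <= n" "n > 0" for n k k'
  using that(1)
 proof (induction k)
  case 0 then show ?case using mX[OF _ that(2,3), of 0] by simp
 next
  case (Suc k) then show ?case using mX[OF Suc.prems that(2,3)] by simp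
 qed
 have Xb: "AE w in P. \<forall>i\<le>n. \<bar>X n w i\<bar> <= C' * W w ^ Suc j" if "n > 0" for n
  using F2
 proof eventually_elim
  case (elim w)
  show ?case unfolding X_def using elim t[OF _ that] by simp
 qed
 have Rb: "AE w in P. \<forall>i\<le>n. runmax (X n w) i <= C' * W w ^ Suc j" if "n > 0" for n
  using Xb[OF that] by (rule eventually_mono) (auto intro!: runmax_le)
 have est: "(\<integral>\<^sup>+w. ennreal (R n w ^ p) \<partial>P) <= ennreal ((4 * y) ^ p)" if n: "n > 0" for n
 proof -
  have tn: "tp u n n = u" using n by simp
  have mRu: "R n \<in> borel_measurable P" unfolding R_def using meas_Fl_P[OF t(1)[OF le_refl n] mR[OF le_refl le_refl n]] .
  have mXu: "Mint Y u \<in> borel_measurable P" using meas_Fl_P[OF _ F6] u by simp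
  have iR: "integrable P (%w. R n w ^ p)"
  proof (rule integrable_poly_bound[where C="C' ^ p" and j="Suc j * p"])
   show "(%w. R n w ^ p) \<in> borel_measurable P" using mRu by measurable
   show "AE w in P. \<bar>R n w ^ p\<bar> <= C' ^ p * W w ^ (Suc j * p)"
    using Rb[OF n]
   proof eventually_elim
    case (elim w)
    then have "R n w ^ p <= (C' * W w ^ Suc j) ^ p" unfolding R_def by (intro power_mono runmax_nonneg) auto
    then show ?case unfolding R_def using runmax_nonneg by (simp add: power_mult_distrib power_mult[symmetric] del: power_Suc)
   qed
  qed
  have iX: "integrable P (%w. \<bar>Mint Y u w\<bar> ^ p)"
  proof (rule Bochner_Integration.integrable_bound[OF iR])
   show "(%w. \<bar>Mint Y u w\<bar> ^ p) \<in> borel_measurable P" using mXu by measurable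
   have "\<bar>Mint Y u w\<bar> <= R n w" for w using runmax_ge[of n n "X n w"] unfolding R_def X_def tn by simp
   then show "AE w in P. norm (\<bar>Mint Y u w\<bar> ^ p) <= norm (R n w ^ p)"
    using runmax_nonneg[of _ n] by (intro AE_I2) (auto simp: R_def intro!: power_mono)
  qed
  \<comment> \<open>The martingale transform from \<open>pathwise_doob\<close>. It has mean zero
    because the running maximum and the sign at step \<open>i\<close> are known at time
    \<open>tp u n i\<close>.\<close>
  define T where "T = (%w. \<Sum>i<n. runmax (X n w) i ^ (p - 1) * sgn (X n w i) * (X n w (Suc i) - X n w i))"
  have T: "integrable P T" "expectation T = 0"
  proof -
   have *: "integrable P (%w. runmax (X n w) i ^ (p - 1) * sgn (X n w i) * (X n w (Suc i) - X n w i))"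
    "expectation (%w. runmax (X n w) i ^ (p - 1) * sgn (X n w i) * (X n w (Suc i) - X n w i)) = 0" if i: "i < n" for i
   proof -
    define Z where "Z = (%w. runmax (X n w) i ^ (p - 1) * sgn (X n w i))"
    have ti: "0 <= tp u n i" "tp u n i <= tp u n (Suc i)" "tp u n (Suc i) <= u" using i n u by (auto intro: t tp_mono)
    have mZ: "Z \<in> borel_measurable (Fl (tp u n i))"
     unfolding Z_def using mR[of i i n] mX[of i i n] i n by (intro borel_measurable_times borel_measurable_power borel_measurable_sgn) auto
    have Zb: "AE w in P. \<bar>Z w\<bar> <= C' ^ (p - 1) * W w ^ (Suc j * (p - 1))"
     using Rb[OF n]
    proof eventually_elim
     case (elim w)
     have "\<bar>Z w\<bar> <= runmax (X n w) i ^ (p - 1) * 1"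
      unfolding Z_def abs_mult using runmax_nonneg[of "X n w" i] by (intro mult_mono) (auto simp: sgn_if)
     also have "\<dots> <= (C' * W w ^ Suc j) ^ (p - 1)" using elim i runmax_nonneg by (simp add: power_mono del: power_Suc)
     finally show ?case by (simp add: power_mult_distrib power_mult[symmetric] del: power_Suc)
    qed
    have zero: "expectation (%w. Z w * (LS_int (%s. M s x w) (%s. Y x s w) (tp u n (Suc i)) - LS_int (%s. M s x w) (%s. Y x s w) (tp u n i))) = 0" if x: "x \<in> S" for x
     by (rule LS_increment_mean_zero[OF x u(2) Y(1,2)[OF x] ti mZ Zb]) (use F4 in simp)
    have int: "integrable P (%w. Z w * (LS_int (%s. M s x w) (%s. Y x s w) (tp u n (Suc i)) - LS_int (%s. M s x w) (%s. Y x s w) (tp u n i)))" if x: "x \<in> S" for x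
    proof (rule integrable_poly_bound[where C="C' ^ (p - 1) * (2 * (C * cW))" and j="Suc j * (p - 1) + Suc j"])
     have "(%w. LS_int (%s. M s x w) (%s. Y x s w) q) \<in> borel_measurable P" if "0 <= q" "q <= u" for q
      by (rule meas_Fl_P[OF that(1) LS_facts(3)[OF x u Y(1,2)[OF x] that]])
     then show "(%w. Z w * (LS_int (%s. M s x w) (%s. Y x s w) (tp u n (Suc i)) - LS_int (%s. M s x w) (%s. Y x s w) (tp u n i))) \<in> borel_measurable P"
      using ti by (intro borel_measurable_times borel_measurable_diff meas_Fl_P[OF ti(1) mZ]) auto
     show "AE w in P. \<bar>Z w * (LS_int (%s. M s x w) (%s. Y x s w) (tp u n (Suc i)) - LS_int (%s. M s x w) (%s. Y x s w) (tp u n i))\<bar> <= C' ^ (p - 1) * (2 * (C * cW)) * W w ^ (Suc j * (p - 1) + Suc j)"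
      using LS_facts(1)[OF x u Y(1,2)[OF x]] Zb
     proof eventually_elim
      case (elim w)
      have l1: "\<bar>LS_int (%s. M s x w) (%s. Y x s w) (tp u n (Suc i))\<bar> <= C * cW * W w ^ Suc j" "\<bar>LS_int (%s. M s x w) (%s. Y x s w) (tp u n i)\<bar> <= C * cW * W w ^ Suc j"
       using elim(1) ti by auto
      then have "\<bar>LS_int (%s. M s x w) (%s. Y x s w) (tp u n (Suc i)) - LS_int (%s. M s x w) (%s. Y x s w) (tp u n i)\<bar> <= 2 * (C * cW) * W w ^ Suc j" by linarith
      then have "\<bar>Z w\<bar> * \<bar>LS_int (%s. M s x w) (%s. Y x s w) (tp u n (Suc i)) - LS_int (%s. M s x w) (%s. Y x s w) (tp u n i)\<bar> <= (C' ^ (p - 1) * W w ^ (Suc j * (p - 1))) * (2 * (C * cW) * W w ^ Suc j)"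
       using elim(2) by (intro mult_mono) auto
      then show ?case unfolding abs_mult power_add by (simp add: mult_ac del: power_Suc)
     qed
    qed
    have eq: "runmax (X n w) i ^ (p - 1) * sgn (X n w i) * (X n w (Suc i) - X n w i) =
     (\<Sum>x\<in>S. v * (Z w * (LS_int (%s. M s x w) (%s. Y x s w) (tp u n (Suc i)) - LS_int (%s. M s x w) (%s. Y x s w) (tp u n i))))" for w
     unfolding Z_def[symmetric] X_def Mint_def by (simp add: sum_subtractf[symmetric] sum_distrib_left algebra_simps Z_def X_def Mint_def)
    show "integrable P (%w. runmax (X n w) i ^ (p - 1) * sgn (X n w i) * (X n w (Suc i) - X n w i))"
     unfolding eq using int by (intro Bochner_Integration.integrable_sum integrable_mult_right) auto
    show "expectation (%w. runmax (X n w) i ^ (p - 1) * sgn (X n w i) * (X n w (Suc i) - X n w i)) = 0"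
     unfolding eq using int zero by (subst Bochner_Integration.integral_sum) auto
   qed
   show "integrable P T" unfolding T_def using * by (intro Bochner_Integration.integrable_sum) auto
   show "expectation T = 0" unfolding T_def using * by (subst Bochner_Integration.integral_sum) auto
  qed
  have path: "T w + R n w ^ p / 2 <= R n w ^ (p - 1) * \<bar>Mint Y u w\<bar> ^ 1" for w
   using pathwise_doob[of "X n w" p n] p unfolding T_def R_def by (simp add: X_def M0 n)
  \<comment> \<open>With \<open>r\<close> the norm of the maximum, the pathwise inequality and
    Hoelder give \<open>r ^ p / 2 <= 2 * r ^ (p - 1) * y\<close>, whence the factor 4.\<close>
  define r where "r = root p (expectation (%w. R n w ^ p))"
  have eR: "0 <= expectation (%w. R n w ^ p)" using runmax_nonneg by (intro integral_nonneg_AE AE_I2) (simp add: R_def)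
  have r: "0 <= r" "r ^ p = expectation (%w. R n w ^ p)" unfolding r_def using eR p by auto
  have pe: "p - 1 + 1 = p" using p by simp
  have hol: "expectation (%w. R n w ^ (p - 1) * \<bar>Mint Y u w\<bar> ^ 1) <= 2 * r ^ (p - 1) * y ^ 1"
   by (rule holder_power) (use iR iX r X mRu mXu pe runmax_nonneg in \<open>auto simp: R_def simp del: One_nat_def\<close>)
  have "expectation (%w. T w + R n w ^ p / 2) <= expectation (%w. R n w ^ (p - 1) * \<bar>Mint Y u w\<bar> ^ 1)"
  proof (rule integral_mono)
   show "integrable P (%w. T w + R n w ^ p / 2)" using T iR by simp
   show "integrable P (%w. R n w ^ (p - 1) * \<bar>Mint Y u w\<bar> ^ 1)"
   proof (rule Bochner_Integration.integrable_bound[OF iR])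
    show "(%w. R n w ^ (p - 1) * \<bar>Mint Y u w\<bar> ^ 1) \<in> borel_measurable P" using mRu mXu by measurable
    have "R n w ^ (p - 1) * \<bar>Mint Y u w\<bar> ^ 1 <= R n w ^ (p - 1) * R n w ^ 1" for w
     using runmax_ge[of n n "X n w"] runmax_nonneg[of "X n w" n] unfolding R_def X_def tn by (intro mult_left_mono) auto
    then show "AE w in P. norm (R n w ^ (p - 1) * \<bar>Mint Y u w\<bar> ^ 1) <= norm (R n w ^ p)"
     using runmax_nonneg unfolding power_add[symmetric] pe by (intro AE_I2) (simp add: R_def abs_mult power_abs)
   qed
  qed (rule path)
  then have "r ^ p / 2 <= 2 * r ^ (p - 1) * y" using hol T iR r by simp
  moreover have "r ^ p = r ^ (p - 1) * r" by (subst pe[symmetric]) (simp only: power_add power_one_right)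
  moreover have "r ^ (p - 1) * (4 * y) = 2 * (2 * r ^ (p - 1) * y)" by simp
  ultimately have "r ^ (p - 1) * r <= r ^ (p - 1) * (4 * y)" by linarith
  then have "r <= 4 * y" using r(1) X(2) by (cases "r = 0") (auto simp: mult_le_cancel_left_pos)
  then have "r ^ p <= (4 * y) ^ p" using r(1) by (rule power_mono)
  moreover have "(\<integral>\<^sup>+w. ennreal (R n w ^ p) \<partial>P) = ennreal (expectation (%w. R n w ^ p))"
   using iR runmax_nonneg by (intro nn_integral_eq_integral AE_I2) (simp_all add: R_def)
  ultimately show ?thesis using r(2) by (simp add: ennreal_leI)
 qed
 show ?thesis
 proof (intro exI[of _ "%w. liminf (%n. ennreal (R (Suc n) w ^ p))"] conjI)
  have mR': "R (Suc n) \<in> borel_measurable P" for n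
   unfolding R_def using meas_Fl_P[OF t(1)[OF le_refl zero_less_Suc] mR[OF le_refl le_refl zero_less_Suc]] .
  then show "(%w. liminf (%n. ennreal (R (Suc n) w ^ p))) \<in> borel_measurable P" by measurable
  have "(\<integral>\<^sup>+w. liminf (%n. ennreal (R (Suc n) w ^ p)) \<partial>P) <= liminf (%n. \<integral>\<^sup>+w. ennreal (R (Suc n) w ^ p) \<partial>P)"
   using mR' by (intro nn_integral_liminf) measurable
  also have "\<dots> <= liminf (%n. ennreal ((4 * y) ^ p))" by (intro Liminf_mono always_eventually allI est) simp
  finally show "(\<integral>\<^sup>+w. liminf (%n. ennreal (R (Suc n) w ^ p)) \<partial>P) <= ennreal ((4 * y) ^ p)" by (simp add: Liminf_const)
  show "AE w in P. \<forall>t. 0 <= t --> t <= u --> ennreal (\<bar>Mint Y t w\<bar> ^ p) <= liminf (%n. ennreal (R (Suc n) w ^ p))"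
   using F5
  proof eventually_elim
   case (elim w)
   show ?case
   proof (intro allI impI)
    fix q assume q: "0 <= q" "q <= u"
    show "ennreal (\<bar>Mint Y q w\<bar> ^ p) <= liminf (%n. ennreal (R (Suc n) w ^ p))"
    proof (cases "q = 0")
     case True then show ?thesis using M0 p by (simp add: power_0_left)
    next
     case False
     then have q0: "0 < q" using q by simp
     have "(%n. Mint Y (lgrid u n q) w) \<longlonglongrightarrow> Mint Y q w"
      using elim q q0 by (intro filterlim_compose[OF _ lgrid_at_left[OF u(1) q0 q(2)]]) blast
     then have "(%n. Mint Y (lgrid u (Suc n) q) w) \<longlonglongrightarrow> Mint Y q w" by (rule LIMSEQ_Suc)
     then have "(%n. ennreal (\<bar>Mint Y (lgrid u (Suc n) q) w\<bar> ^ p)) \<longlonglongrightarrow> ennreal (\<bar>Mint Y q w\<bar> ^ p)"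
      by (intro tendsto_ennrealI tendsto_power tendsto_rabs)
     then have "ennreal (\<bar>Mint Y q w\<bar> ^ p) = liminf (%n. ennreal (\<bar>Mint Y (lgrid u (Suc n) q) w\<bar> ^ p))"
      by (rule lim_imp_Liminf[OF sequentially_bot, symmetric])
     also have "\<dots> <= liminf (%n. ennreal (R (Suc n) w ^ p))"
     proof (intro Liminf_mono always_eventually allI ennreal_leI power_mono)
      fix n
      have "tidx u (Suc n) q < Suc n" using tidx_props(1)[OF u(1) zero_less_Suc q0 q(2)] .
      then show "\<bar>Mint Y (lgrid u (Suc n) q) w\<bar> <= R (Suc n) w"
       using runmax_ge[of "tidx u (Suc n) q" "Suc n" "X (Suc n) w"] unfolding R_def X_def lgrid_def by simp
     qed simp
     finally show ?thesis .
    qed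
   qed
  qed
 qed
qed

end

lemma set_integral_weighted_sum:
 fixes f :: "'i => real => real"
 assumes "\<And>x. x \<in> I ==> set_integrable lborel A (f x)"
 shows "(LINT s:A|lborel. (\<Sum>x\<in>I. c * f x s)) = (\<Sum>x\<in>I. c * (LINT s:A|lborel. f x s))"
proof -
 have "(LINT s:A|lborel. (\<Sum>x\<in>I. c * f x s)) = (LINT s|lborel. (\<Sum>x\<in>I. c * (indicator A s *\<^sub>R f x s)))"
  unfolding set_lebesgue_integral_def by (simp add: sum_distrib_left mult_ac)
 also have "\<dots> = (\<Sum>x\<in>I. (LINT s|lborel. c * (indicator A s *\<^sub>R f x s)))"
  using assms unfolding set_integrable_def by (intro Bochner_Integration.integral_sum integrable_mult_right)
 finally show ?thesis unfolding set_lebesgue_integral_def by simp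
qed

context weighted_noise
begin

section \<open>One level with a component of size one\<close>

text \<open>The intensity bound in the form needed for moments: the mean of the integrand is itself
  only estimated, by a deterministic Borel function \<open>g\<close>.\<close>

lemma int_Hp:
 assumes x: "x \<in> S" and u: "0 < u" "u <= 1" and Y: "LA u Y" "polyb u Y C j"
  and H: "borel_on u H" "\<And>s. 0 <= s ==> s < u ==> 0 <= H s \<and> H s <= K"
  and g: "borel_on u g" "\<And>s. 0 <= s ==> s < u ==> \<bar>g s\<bar> <= K'"
   "\<And>s. 0 <= s ==> s < u ==> expectation (%w. \<bar>Y s w\<bar>) * H s <= g s"
 shows "(\<integral>\<^sup>+w. ennreal (\<Sum>s\<in>{s\<in>J x w. s < u}. \<bar>Y s w\<bar> * H s) \<partial>P) <= ennreal (\<kappa> * (LINT s:{0..<u}|lborel. g s))"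
proof -
 note C = polybD[OF Y(2)]
 have LAY: "LA u (%s w. \<bar>Y s w\<bar>)" by (rule LA_compose[OF Y(1)]) (intro continuous_intros)
 have V: "integrable P (%w. C * W w ^ j)" by (intro integrable_mult_right W_moments)
 have Yb: "AE w in P. \<forall>s. 0 <= s --> s < u --> 0 <= \<bar>Y s w\<bar> \<and> \<bar>Y s w\<bar> <= C * W w ^ j" using C(2) by (rule eventually_mono) auto
 have Yb': "AE w in P. \<forall>s. 0 <= s --> s < u --> \<bar>\<bar>Y s w\<bar>\<bar> <= C * W w ^ j" using C(2) by (rule eventually_mono) auto
 have "(\<integral>\<^sup>+w. ennreal (\<Sum>s\<in>{s\<in>J x w. s < u}. \<bar>Y s w\<bar> * H s) \<partial>P) <= ennreal (\<kappa> * (LINT s:{0..<u}|lborel. expectation (%w. \<bar>Y s w\<bar>) * H s))"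
  by (rule jump_intensity[OF x u(1) LAY V Yb H])
 also have "\<dots> <= ennreal (\<kappa> * (LINT s:{0..<u}|lborel. g s))"
 proof (intro ennreal_leI mult_left_mono \<kappa>)
  have e: "((%r. expectation (%w. \<bar>Y r w\<bar>)) \<longlongrightarrow> expectation (%w. \<bar>Y s w\<bar>)) (at_left s)" if "0 < s" "s < u" for s
   by (rule expect_left_cont[OF LAY V Yb' that])
  have "(%s. indicator {0..<u} s * (expectation (%w. \<bar>Y s w\<bar>) * H s)) = (%s. (indicator {0..<u} s * expectation (%w. \<bar>Y s w\<bar>)) * (indicator {0..<u} s * H s))"
   by (auto simp: indicator_def)
  then have m: "borel_on u (%s. (expectation (%w. \<bar>Y s w\<bar>) * H s))"
   using borel_measurable_times[OF left_cont_borel[OF e] H(1)] by simp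
  have sb: "{0..<u} \<subseteq> {0..u}" by auto
  have b: "\<bar>expectation (%w. \<bar>Y s w\<bar>) * H s\<bar> <= K'" if "s \<in> {0..<u}" for s
  proof -
   have "0 <= expectation (%w. \<bar>Y s w\<bar>) * H s" using H(2)[of s] that by (intro mult_nonneg_nonneg integral_nonneg_AE) auto
   then show ?thesis using g(2)[of s] g(3)[of s] that by auto
  qed
  have "set_integrable lborel {0..<u} (%s. expectation (%w. \<bar>Y s w\<bar>) * H s)"
   by (rule set_integrable_bounded(1)[OF m b atLeastLessThan_borel sb])
  moreover have "set_integrable lborel {0..<u} g"
   by (rule set_integrable_bounded(1)[OF g(1) _ atLeastLessThan_borel sb, of K']) (use g(2) in auto)
  ultimately show "(LINT s:{0..<u}|lborel. expectation (%w. \<bar>Y s w\<bar>) * H s) <= (LINT s:{0..<u}|lborel. g s)"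
   by (rule set_integral_mono) (use g(3) in auto)
 qed
 finally show ?thesis .
qed

lemma polyb_power: "polyb u Y C j ==> polyb u (%s w. Y s w ^ q) (C ^ q) (j * q)"
proof -
 assume A: "polyb u Y C j"
 note C = polybD[OF A]
 have "AE w in P. \<forall>s. 0 <= s --> s < u --> \<bar>Y s w ^ q\<bar> <= C ^ q * W w ^ (j * q)"
  using C(2)
 proof eventually_elim
  case (elim w)
  show ?case
  proof (intro allI impI)
   fix s assume "0 <= s" "s < u"
   then have "\<bar>Y s w\<bar> ^ q <= (C * W w ^ j) ^ q" using elim by (intro power_mono) auto
   then show "\<bar>Y s w ^ q\<bar> <= C ^ q * W w ^ (j * q)" by (simp add: power_abs power_mult_distrib power_mult)
  qed
 qed
 then show ?thesis using C(1) unfolding polyb_def by simp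
qed

lemma polyb_mult: "polyb u Y C j ==> polyb u Z C' j' ==> polyb u (%s w. Y s w * Z s w) (C * C') (j + j')"
proof -
 assume A: "polyb u Y C j" "polyb u Z C' j'"
 note C = polybD[OF A(1)] and C' = polybD[OF A(2)]
 have "AE w in P. \<forall>s. 0 <= s --> s < u --> \<bar>Y s w * Z s w\<bar> <= C * C' * W w ^ (j + j')"
  using C(2) C'(2)
 proof eventually_elim
  case (elim w)
  show ?case
  proof (intro allI impI)
   fix s assume s: "0 <= s" "s < u"
   have 1: "\<bar>Y s w\<bar> <= C * W w ^ j" "\<bar>Z s w\<bar> <= C' * W w ^ j'" using elim s by auto
   have "\<bar>Y s w\<bar> * \<bar>Z s w\<bar> <= (C * W w ^ j) * (C' * W w ^ j')"
    using 1 order_trans[OF abs_ge_zero 1(1)] by (intro mult_mono) auto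
   then show "\<bar>Y s w * Z s w\<bar> <= C * C' * W w ^ (j + j')" by (simp add: abs_mult power_add mult_ac)
  qed
 qed
 then show ?thesis using C(1) C'(1) unfolding polyb_def by simp
qed

lemma polyb_const: "0 <= c ==> polyb u (%s w. c) c 0"
 unfolding polyb_def by simp

lemma polyb_mono: "polyb u Y C j ==> t <= u ==> polyb t Y C j"
 unfolding polyb_def by (auto elim!: eventually_mono)

lemma polyb_integrable: "LA u Y ==> polyb u Y C j ==> 0 <= s ==> s < u ==> integrable P (Y s)"
 by (rule integrable_poly_bound[OF LA_measP]) (auto simp: polyb_def elim!: eventually_mono)

lemma integrable_abs_power: "LA u Y ==> polyb u Y C j ==> 0 <= s ==> s < u ==> integrable P (%w. \<bar>Y s w\<bar> ^ q)"
proof -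
 assume A: "LA u Y" "polyb u Y C j" "0 <= s" "s < u"
 have "integrable P (%w. Y s w ^ q)"
  by (rule polyb_integrable[OF LA_compose[OF A(1), of "%y. y ^ q"] polyb_power[OF A(2)] A(3,4)]) (intro continuous_intros)
 from integrable_abs[OF this] show ?thesis by (simp add: power_abs)
qed

text \<open>Ito's formula for \<open>x ^ p\<close>, from which the mean-zero integral of
  \<open>p * X ^ (p - 1) * Y\<close> is subtracted. What remains is a second-order Taylor remainder
  at the jumps, with one term in \<open>X ^ (p - 2)\<close> and the square of \<open>Y\<close>, and
  one in \<open>Y ^ p\<close>. The number \<open>y\<close> bounds the moments of \<open>Mint\<close>
  before \<open>u\<close>, which prepares the absorption argument.\<close>

lemma moment_estimate1:
 assumes u: "0 < u" "u <= 1" and Y: "\<And>x. x \<in> S ==> LA u (Y x)" "\<And>x. x \<in> S ==> polyb u (Y x) C j" and C: "0 <= C"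
  and p: "2 <= p" "even p"
  and g: "\<And>x. x \<in> S ==> borel_on u (%s. g x s)"
   "\<And>x s. x \<in> S ==> 0 <= s ==> s < u ==> 0 <= g x s \<and> g x s <= gi"
   "\<And>x s. x \<in> S ==> 0 <= s ==> s < u ==> expectation (%w. \<bar>Y x s w\<bar> ^ p) <= g x s ^ p" and gi: "0 <= gi"
  and y: "0 <= y" "\<And>s. 0 <= s ==> s < u ==> expectation (%w. \<bar>Mint Y s w\<bar> ^ p) <= y ^ p"
 shows "expectation (%w. \<bar>Mint Y u w\<bar> ^ p) <= 2 ^ p * 2 * K0 * (v * (\<Sum>x\<in>S. LINT s:{0..<u}|lborel. (g x s)\<^sup>2)) * (y ^ (p - 2) + (\<eta> * gi) ^ (p - 2))"
proof -
 have pw: "b ^ p = b ^ (p - 2) * b\<^sup>2" for b :: real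
 proof -
  have "p - 2 + 2 = p" using p by simp
  then show ?thesis using power_add[of b "p - 2" 2] by (simp only:)
 qed
 define C' where "C' = real (card S) * v * C * cW"
 have X1: "LA u (Mint Y)" by (rule Mint_facts(1)[OF u Y C])
 have X2: "polyb u (Mint Y) C' (Suc j)" unfolding C'_def by (rule Mint_facts(3)[OF u Y C])
 have X6: "Mint Y t \<in> borel_measurable (Fl t)" if "0 <= t" "t <= u" for t by (rule Mint_facts(6)[OF u Y C that])
 have Xb: "AE w in P. \<bar>Mint Y u w\<bar> <= C' * W w ^ Suc j"
  unfolding C'_def using Mint_facts(2)[OF u Y C] by (rule eventually_mono) (use u in auto)
 define Z where "Z = (%x s w. real p * Mint Y s w ^ (p - 1) * Y x s w)"
 define CZ where "CZ = real p * C' ^ (p - 1) * C"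
 define jZ where "jZ = Suc j * (p - 1) + j"
 have LAXp: "LA u (%s w. real p * Mint Y s w ^ (p - 1))" by (rule LA_compose[OF X1]) (intro continuous_intros)
 have Z1: "LA u (Z x)" if "x \<in> S" for x unfolding Z_def by (rule LA_mult[OF LAXp Y(1)[OF that]])
 have Z2: "polyb u (Z x) CZ jZ" if "x \<in> S" for x
  unfolding Z_def CZ_def jZ_def
  using polyb_mult[OF polyb_mult[OF polyb_const polyb_power[OF X2]] Y(2)[OF that], of "real p" "p - 1"] by simp
 define Q where "Q = (%w. \<Sum>x\<in>S. \<Sum>s\<in>{s\<in>J x w. s < u}. 2 ^ p * (\<eta>\<^sup>2 * (\<bar>Mint Y s w\<bar> ^ (p - 2) * \<bar>Y x s w\<bar> ^ 2) + \<eta> ^ p * \<bar>Y x s w\<bar> ^ p))"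
 define N where "N = (%w. \<Sum>x\<in>S. v * LS_int (%s. M s x w) (%s. Z x s w) u)"
 have path: "AE w in P. \<bar>Mint Y u w\<bar> ^ p - N w <= Q w"
 proof -
  have Yl: "AE w in P. \<forall>x\<in>S. \<forall>s. 0 < s --> s < u --> ((%r. Y x r w) \<longlongrightarrow> Y x s w) (at_left s)"
   using finS LA_lim[OF Y(1)] by (intro AE_finite_allI) auto
  have Yb: "AE w in P. \<forall>x\<in>S. \<forall>s. 0 <= s --> s < u --> \<bar>Y x s w\<bar> <= C * W w ^ j"
   using finS polybD(2)[OF Y(2)] by (intro AE_finite_allI) auto
  show ?thesis
   using good Yl Yb LA_lim[OF X1] polybD(2)[OF X2]
  proof eventually_elim
   case (elim w)
   note dd = good_pathD[OF elim(1) _ a]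
   have Ym: "borel_on t (%s. Y x s w)" if "x \<in> S" "t <= u" for x t
    using elim(2) that by (intro left_cont_borel) auto
   have Yb: "\<bar>Y x s w\<bar> <= C * W w ^ j" if "x \<in> S" "0 <= s" "s < u" for x s using elim(3) that by blast
   have Xm: "borel_on u (%s. Mint Y s w)"
    using elim(4) by (intro left_cont_borel) auto
   have Xbb: "\<bar>Mint Y s w\<bar> <= C' * W w ^ Suc j" if "0 <= s" "s < u" for s using elim(5) that by blast
   have K: "0 <= C * W w ^ j" using C W_pow_ge1[of w j] by (intro mult_nonneg_nonneg) auto
   define D where "D = (%s. \<Sum>x\<in>S. v * (Y x s w * (- L * Cd s x w)))"
   have Di: "set_integrable lborel {0..<t} (%s. Y x s w * (- L * Cd s x w))" if "x \<in> S" "0 <= t" "t <= u" for x t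
    by (rule good_path_LS_bound(2)[OF elim(1) that(1) a B that(2) Ym[OF that(1,3)] _ K]) (use Yb that in auto)
   have Dm1: "borel_on u (%s. (Y x s w * (- L * Cd s x w)))" if "x \<in> S" for x
    by (rule good_path_LS_bound(3)[OF elim(1) that a B _ Ym[OF that order_refl] _ K]) (use Yb that u in auto)
   have Dm: "borel_on u D"
   proof -
    have "(%s. indicator {0..<u} s * D s) = (%s. \<Sum>x\<in>S. v * (indicator {0..<u} s * (Y x s w * (- L * Cd s x w))))"
     unfolding D_def by (simp add: sum_distrib_left mult_ac)
    moreover have "(%s. \<Sum>x\<in>S. v * (indicator {0..<u} s * (Y x s w * (- L * Cd s x w)))) \<in> borel_measurable borel"
     by (intro borel_measurable_sum borel_measurable_times[OF borel_measurable_const Dm1])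
    ultimately show ?thesis by (simp only:)
   qed
   have Db: "\<bar>D s\<bar> <= (\<Sum>x\<in>S. v * (C * W w ^ j * (\<bar>L\<bar> * B)))" if "0 <= s" "s < u" for s
    unfolding D_def
   proof (rule order_trans[OF sum_abs sum_mono])
    fix x assume x: "x \<in> S"
    have "\<bar>Y x s w\<bar> * \<bar>- L * Cd s x w\<bar> <= C * W w ^ j * (\<bar>L\<bar> * B)" using Yb[OF x that] dd(6)[OF x that(1)] K by (intro mult_mono) auto
    then show "\<bar>v * (Y x s w * (- L * Cd s x w))\<bar> <= v * (C * W w ^ j * (\<bar>L\<bar> * B))"
     unfolding abs_mult[of v] abs_mult[of "Y x s w"] using v by simp
   qed
   have XX: "Mint Y t w = (\<Sum>x\<in>S. \<Sum>s\<in>{s\<in>J x w. s < t}. v * (Y x s w * jp x w s)) + (LINT s:{0..<t}|lborel. D s)" if t: "0 <= t" "t <= u" for t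
   proof -
    have "LS_int (%s. M s x w) (%s. Y x s w) t = (\<Sum>s\<in>{s\<in>J x w. s < t}. Y x s w * jp x w s) + (LINT s:{0..<t}|lborel. Y x s w * (- L * Cd s x w))" if x: "x \<in> S" for x
     by (rule good_path_LS_int[OF elim(1) x a t(1) Ym[OF x t(2)], where K="C * W w ^ j"]) (use Yb x t in auto)
    moreover have "(LINT s:{0..<t}|lborel. D s) = (\<Sum>x\<in>S. v * (LINT s:{0..<t}|lborel. Y x s w * (- L * Cd s x w)))"
     unfolding D_def by (rule set_integral_weighted_sum) (rule Di[OF _ t])
    ultimately show ?thesis unfolding Mint_def by (simp add: distrib_left sum.distrib sum_distrib_left)
   qed
   have ito: "Mint Y u w ^ p = 0 ^ p + (\<Sum>x\<in>S. \<Sum>s\<in>{s\<in>J x w. s < u}. (Mint Y s w + v * (Y x s w * jp x w s)) ^ p - Mint Y s w ^ p)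
     + (LINT s:{0..<u}|lborel. real p * Mint Y s w ^ (p - 1) * D s)"
    by (rule ito_jumps[OF elim(1) less_imp_le[OF u(1)] Dm Db XX, where f="%y. y ^ p" and f'="%y. real p * y ^ (p - 1)"])
     (use power_deriv_lipschitz in \<open>auto intro!: derivative_eq_intros\<close>)
   have ZY: "Z x s w = real p * Mint Y s w ^ (p - 1) * Y x s w" for x s by (simp add: Z_def)
   have Zm: "borel_on u (%s. Z x s w)" if x: "x \<in> S" for x
   proof -
    have "(%s. indicator {0..<u} s * Z x s w) = (%s. real p * (indicator {0..<u} s * Mint Y s w) ^ (p - 1) * (indicator {0..<u} s * Y x s w))"
     unfolding ZY by (auto simp: indicator_def)
    then show ?thesis using Xm Ym[OF x order_refl] by simp
   qed
   define KZ where "KZ = real p * (C' * W w ^ Suc j) ^ (p - 1) * (C * W w ^ j)"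
   have Zb: "\<bar>Z x s w\<bar> <= KZ" if "x \<in> S" "0 <= s" "s < u" for x s
    unfolding ZY KZ_def abs_mult power_abs using Xbb[OF that(2,3)] Yb[OF that] order_trans[OF abs_ge_zero Xbb[OF that(2,3)]]
    by (intro mult_mono power_mono mult_nonneg_nonneg) auto
   have "0 <= C' * W w ^ Suc j" using Xbb[of 0] u by linarith
   then have KZ: "0 <= KZ" unfolding KZ_def by (rule mult_nonneg_nonneg[OF mult_nonneg_nonneg[OF of_nat_0_le_iff zero_le_power] K])
   have NN: "LS_int (%s. M s x w) (%s. Z x s w) u = (\<Sum>s\<in>{s\<in>J x w. s < u}. Z x s w * jp x w s) + (LINT s:{0..<u}|lborel. Z x s w * (- L * Cd s x w))" if x: "x \<in> S" for x
    by (rule good_path_LS_int[OF elim(1) x a less_imp_le[OF u(1)] Zm[OF x] Zb[OF x]])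
   have Zi: "set_integrable lborel {0..<u} (%s. Z x s w * (- L * Cd s x w))" if "x \<in> S" for x
    by (rule good_path_LS_bound(2)[OF elim(1) that a B less_imp_le[OF u(1)] Zm[OF that] Zb[OF that] KZ])
   have drift: "(LINT s:{0..<u}|lborel. real p * Mint Y s w ^ (p - 1) * D s) = (\<Sum>x\<in>S. v * (LINT s:{0..<u}|lborel. Z x s w * (- L * Cd s x w)))"
   proof -
    have "real p * Mint Y s w ^ (p - 1) * D s = (\<Sum>x\<in>S. v * (Z x s w * (- L * Cd s x w)))" for s
     unfolding D_def ZY by (simp add: sum_distrib_left mult_ac)
    then show ?thesis by (simp only:) (rule set_integral_weighted_sum[OF Zi])
   qed
   \<comment> \<open>The whole drift of the Ito formula cancels against that of \<open>N w\<close>,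
     and so does the part linear in the jumps. The remainder can therefore be bounded without the
     factor \<open>L\<close> of the drift, which grows as the lattice is refined.\<close>
   have "\<bar>Mint Y u w\<bar> ^ p - N w = (\<Sum>x\<in>S. \<Sum>s\<in>{s\<in>J x w. s < u}. (Mint Y s w + v * (Y x s w * jp x w s)) ^ p - Mint Y s w ^ p - real p * Mint Y s w ^ (p - 1) * (v * (Y x s w * jp x w s)))"
    using ito drift p NN unfolding N_def
    by (simp add: power_even_abs power_0_left distrib_left sum.distrib sum_distrib_left sum_subtractf ZY mult_ac)
   also have "\<dots> <= Q w"
    unfolding Q_def
   proof (intro sum_mono)
    fix x s assume x: "x \<in> S" and s: "s \<in> {s\<in>J x w. s < u}"
    have js: "\<bar>jp x w s\<bar> = a" using dd(3)[OF x] s by auto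
    let ?y = "v * (Y x s w * jp x w s)"
    have ay: "\<bar>?y\<bar> = \<eta> * \<bar>Y x s w\<bar>" unfolding abs_mult js using v by simp
    have y2: "?y ^ 2 = \<eta>\<^sup>2 * \<bar>Y x s w\<bar> ^ 2" by (metis ay power2_abs power_mult_distrib)
    have "(Mint Y s w + ?y) ^ p - Mint Y s w ^ p - real p * Mint Y s w ^ (p - 1) * ?y <= 2 ^ p * (\<bar>Mint Y s w\<bar> ^ (p - 2) * ?y ^ 2 + \<bar>?y\<bar> ^ p)"
     using power_diff_bound2[OF p(1), of "Mint Y s w" ?y] by linarith
    also have "\<dots> = 2 ^ p * (\<eta>\<^sup>2 * (\<bar>Mint Y s w\<bar> ^ (p - 2) * \<bar>Y x s w\<bar> ^ 2) + \<eta> ^ p * \<bar>Y x s w\<bar> ^ p)"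
     unfolding ay y2 by (simp add: power_mult_distrib mult_ac)
    finally show "(Mint Y s w + ?y) ^ p - Mint Y s w ^ p - real p * Mint Y s w ^ (p - 1) * ?y <= 2 ^ p * (\<eta>\<^sup>2 * (\<bar>Mint Y s w\<bar> ^ (p - 2) * \<bar>Y x s w\<bar> ^ 2) + \<eta> ^ p * \<bar>Y x s w\<bar> ^ p)" .
   qed
   finally show ?case .
  qed
 qed
 have NI: "integrable P (%w. v * LS_int (%s. M s x w) (%s. Z x s w) u)" "expectation (%w. v * LS_int (%s. M s x w) (%s. Z x s w) u) = 0" if x: "x \<in> S" for x
 proof -
  have "AE w in P. \<bar>LS_int (%s. M s x w) (%s. Z x s w) u\<bar> <= CZ * cW * W w ^ Suc jZ"
   using LS_facts(1)[OF x u Z1[OF x] Z2[OF x]] by (rule eventually_mono) (use u in simp)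
  moreover have "(%w. LS_int (%s. M s x w) (%s. Z x s w) u) \<in> borel_measurable P"
   by (rule meas_Fl_P[OF _ LS_facts(3)[OF x u Z1[OF x] Z2[OF x]]]) (use u in auto)
  ultimately have "integrable P (%w. LS_int (%s. M s x w) (%s. Z x s w) u)" by (rule integrable_poly_bound[rotated])
  then show "integrable P (%w. v * LS_int (%s. M s x w) (%s. Z x s w) u)" by simp
  show "expectation (%w. v * LS_int (%s. M s x w) (%s. Z x s w) u) = 0" using LS_facts(4)[OF x u Z1[OF x] Z2[OF x]] by simp
 qed
 have Nint: "integrable P N" "expectation N = 0"
 proof -
  show "integrable P N" unfolding N_def by (intro Bochner_Integration.integrable_sum NI)
  have "expectation N = (\<Sum>x\<in>S. expectation (%w. v * LS_int (%s. M s x w) (%s. Z x s w) u))"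
   unfolding N_def by (intro Bochner_Integration.integral_sum NI)
  also have "\<dots> = 0" by (intro sum.neutral ballI NI(2))
  finally show "expectation N = 0" .
 qed
 have mXu: "Mint Y u \<in> borel_measurable P" using meas_Fl_P[OF _ X6] u by simp
 have Xint: "integrable P (%w. \<bar>Mint Y u w\<bar> ^ p)"
 proof (rule integrable_poly_bound[where C="C' ^ p" and j="Suc j * p"])
  show "(%w. \<bar>Mint Y u w\<bar> ^ p) \<in> borel_measurable P" using mXu by measurable
  show "AE w in P. \<bar>\<bar>Mint Y u w\<bar> ^ p\<bar> <= C' ^ p * W w ^ (Suc j * p)"
   using Xb
  proof eventually_elim
   case (elim w)
   then have "\<bar>Mint Y u w\<bar> ^ p <= (C' * W w ^ Suc j) ^ p" by (intro power_mono) auto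
   then show ?case by (simp add: power_mult_distrib power_mult[symmetric] del: power_Suc)
  qed
 qed
 define I where "I = (\<Sum>x\<in>S. LINT s:{0..<u}|lborel. (g x s)\<^sup>2)"
 have g2: "borel_on u (%s. (c * (g x s)\<^sup>2))" if "x \<in> S" for x c
 proof -
  have "(%s. indicator {0..<u} s * (c * (g x s)\<^sup>2)) = (%s. c * (indicator {0..<u} s * g x s)\<^sup>2)" by (auto simp: indicator_def)
  then show ?thesis using g(1)[OF that] by simp
 qed
 have g2b: "\<bar>c * (g x s)\<^sup>2\<bar> <= \<bar>c\<bar> * gi\<^sup>2" if "x \<in> S" "0 <= s" "s < u" for x s c
  unfolding abs_mult using g(2)[OF that] by (intro mult_left_mono) (auto intro!: power_mono)
 \<comment> \<open>Hoelder with exponents \<open>p - 2\<close> and 2 separates the moments of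
   \<open>Mint\<close> from those of its integrand.\<close>
 have t1: "(\<integral>\<^sup>+w. ennreal (\<Sum>s\<in>{s\<in>J x w. s < u}. \<bar>Mint Y s w\<bar> ^ (p - 2) * \<bar>Y x s w\<bar> ^ 2) \<partial>P) <= ennreal (\<kappa> * (LINT s:{0..<u}|lborel. 2 * y ^ (p - 2) * (g x s)\<^sup>2))" if x: "x \<in> S" for x
 proof -
  have "LA u (%s w. Mint Y s w ^ (p - 2) * Y x s w ^ 2)"
   by (intro LA_mult LA_compose[OF X1, of "%y. y ^ (p - 2)"] LA_compose[OF Y(1)[OF x], of "%y. y ^ 2"] continuous_intros)
  moreover have "polyb u (%s w. Mint Y s w ^ (p - 2) * Y x s w ^ 2) (C' ^ (p - 2) * C ^ 2) (Suc j * (p - 2) + j * 2)"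
   by (intro polyb_mult polyb_power X2 Y(2) x)
  ultimately have "(\<integral>\<^sup>+w. ennreal (\<Sum>s\<in>{s\<in>J x w. s < u}. \<bar>Mint Y s w ^ (p - 2) * Y x s w ^ 2\<bar> * 1) \<partial>P) <= ennreal (\<kappa> * (LINT s:{0..<u}|lborel. 2 * y ^ (p - 2) * (g x s)\<^sup>2))"
  proof (rule int_Hp[OF x u, where K=1 and K'="\<bar>2 * y ^ (p - 2)\<bar> * gi\<^sup>2"])
   show "borel_on u (%s. (2 * y ^ (p - 2) * (g x s)\<^sup>2))" by (rule g2[OF x])
   fix s assume s: "0 <= s" "s < u"
   show "\<bar>2 * y ^ (p - 2) * (g x s)\<^sup>2\<bar> <= \<bar>2 * y ^ (p - 2)\<bar> * gi\<^sup>2" by (rule g2b[OF x s])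
   have pe: "p - 2 + 2 = p" using p by simp
   have "expectation (%w. \<bar>Mint Y s w\<bar> ^ (p - 2) * \<bar>Y x s w\<bar> ^ 2) <= 2 * y ^ (p - 2) * g x s ^ 2"
   proof (rule holder_power, unfold pe)
    show "integrable P (%w. \<bar>Mint Y s w\<bar> ^ p)" by (rule integrable_abs_power[OF X1 X2 s])
    show "integrable P (%w. \<bar>Y x s w\<bar> ^ p)" by (rule integrable_abs_power[OF Y(1)[OF x] Y(2)[OF x] s])
    show "(%w. \<bar>Mint Y s w\<bar>) \<in> borel_measurable P" using LA_measP[OF X1 s] by measurable
    show "(%w. \<bar>Y x s w\<bar>) \<in> borel_measurable P" using LA_measP[OF Y(1)[OF x] s] by measurable
   qed (use y g x s in auto)
   then show "expectation (%w. \<bar>Mint Y s w ^ (p - 2) * Y x s w ^ 2\<bar>) * 1 <= 2 * y ^ (p - 2) * (g x s)\<^sup>2"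
    by (simp add: abs_mult power_abs)
  qed auto
  then show ?thesis by (simp add: abs_mult power_abs)
 qed
 \<comment> \<open>Two of the \<open>p\<close> factors \<open>g x s\<close> are kept for the L2
   norm, the others are estimated by the supremum \<open>gi\<close>.\<close>
 have t2: "(\<integral>\<^sup>+w. ennreal (\<Sum>s\<in>{s\<in>J x w. s < u}. \<bar>Y x s w\<bar> ^ p) \<partial>P) <= ennreal (\<kappa> * (LINT s:{0..<u}|lborel. gi ^ (p - 2) * (g x s)\<^sup>2))" if x: "x \<in> S" for x
 proof -
  have "LA u (%s w. Y x s w ^ p)" by (intro LA_compose[OF Y(1)[OF x], of "%y. y ^ p"] continuous_intros)
  moreover have "polyb u (%s w. Y x s w ^ p) (C ^ p) (j * p)" by (intro polyb_power Y(2) x)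
  ultimately have "(\<integral>\<^sup>+w. ennreal (\<Sum>s\<in>{s\<in>J x w. s < u}. \<bar>Y x s w ^ p\<bar> * 1) \<partial>P) <= ennreal (\<kappa> * (LINT s:{0..<u}|lborel. gi ^ (p - 2) * (g x s)\<^sup>2))"
  proof (rule int_Hp[OF x u, where K=1 and K'="\<bar>gi ^ (p - 2)\<bar> * gi\<^sup>2"])
   show "borel_on u (%s. (gi ^ (p - 2) * (g x s)\<^sup>2))" by (rule g2[OF x])
   fix s assume s: "0 <= s" "s < u"
   show "\<bar>gi ^ (p - 2) * (g x s)\<^sup>2\<bar> <= \<bar>gi ^ (p - 2)\<bar> * gi\<^sup>2" by (rule g2b[OF x s])
   have "g x s ^ p = g x s ^ (p - 2) * (g x s)\<^sup>2" by (rule pw)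
   also have "\<dots> <= gi ^ (p - 2) * (g x s)\<^sup>2" using g(2)[OF x s] by (intro mult_right_mono power_mono) auto
   finally show "expectation (%w. \<bar>Y x s w ^ p\<bar>) * 1 <= gi ^ (p - 2) * (g x s)\<^sup>2"
    using g(3)[OF x s] by (simp add: power_abs)
  qed auto
  then show ?thesis by (simp add: power_abs)
 qed
 have mS: "(%w. \<Sum>s\<in>{s\<in>J x w. s < u}. Z' s w) \<in> borel_measurable P" if "x \<in> S" "LA u Z'" for x Z'
  using meas_Fl_P[OF less_imp_le[OF u(1)] jump_sum_adapted_LA[OF that(1) u(1) that(2), of 0]] by simp
 have m1: "(%w. \<Sum>s\<in>{s\<in>J x w. s < u}. \<bar>Mint Y s w\<bar> ^ (p - 2) * \<bar>Y x s w\<bar> ^ 2) \<in> borel_measurable P" if x: "x \<in> S" for x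
  by (intro mS[OF x] LA_mult LA_compose[OF X1, of "%y. \<bar>y\<bar> ^ (p - 2)"] LA_compose[OF Y(1)[OF x], of "%y. \<bar>y\<bar> ^ 2"] continuous_intros)
 have m2: "(%w. \<Sum>s\<in>{s\<in>J x w. s < u}. \<bar>Y x s w\<bar> ^ p) \<in> borel_measurable P" if x: "x \<in> S" for x
  by (intro mS[OF x] LA_compose[OF Y(1)[OF x], of "%y. \<bar>y\<bar> ^ p"] continuous_intros)
 \<comment> \<open>A non-integrable \<open>Q\<close> would have Bochner integral 0 by default, so
   the case of an infinite integral is separated before passing to \<open>ennreal\<close>.\<close>
 have "ennreal (expectation (%w. \<bar>Mint Y u w\<bar> ^ p - N w)) <= (\<integral>\<^sup>+w. ennreal (Q w) \<partial>P)"
 proof (cases "integrable P Q")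
  case True
  have Q0: "0 <= Q w" for w unfolding Q_def using eta_pos by (intro sum_nonneg mult_nonneg_nonneg add_nonneg_nonneg) auto
  have "expectation (%w. \<bar>Mint Y u w\<bar> ^ p - N w) <= expectation Q"
   using path Xint Nint True by (intro integral_mono_AE) auto
  then show ?thesis using nn_integral_eq_integral[OF True] Q0 by (simp add: ennreal_leI)
 next
  case False
  have mQ: "Q \<in> borel_measurable P"
  proof -
   have "Q = (%w. \<Sum>x\<in>S. 2 ^ p * (\<eta>\<^sup>2 * (\<Sum>s\<in>{s\<in>J x w. s < u}. \<bar>Mint Y s w\<bar> ^ (p - 2) * \<bar>Y x s w\<bar> ^ 2) + \<eta> ^ p * (\<Sum>s\<in>{s\<in>J x w. s < u}. \<bar>Y x s w\<bar> ^ p)))"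
    unfolding Q_def by (simp add: sum_distrib_left sum.distrib distrib_left)
   moreover have "\<dots> \<in> borel_measurable P"
    by (intro borel_measurable_sum borel_measurable_times borel_measurable_add borel_measurable_const m1 m2)
   ultimately show ?thesis by (simp only:)
  qed
  have Q0: "0 <= Q w" for w unfolding Q_def using eta_pos by (intro sum_nonneg mult_nonneg_nonneg add_nonneg_nonneg) auto
  have "(\<integral>\<^sup>+w. ennreal (Q w) \<partial>P) = \<infinity>"
  proof (rule ccontr)
   assume "\<not> ?thesis"
   then have "integrable P Q" using mQ Q0 by (intro integrableI_nonneg) (auto simp: top.not_eq_extremum)
   then show False using False by simp
  qed
  then show ?thesis by simp
 qed
 also have "(\<integral>\<^sup>+w. ennreal (Q w) \<partial>P) = (\<integral>\<^sup>+w. (\<Sum>x\<in>S. ennreal (2 ^ p * \<eta>\<^sup>2) * ennreal (\<Sum>s\<in>{s\<in>J x w. s < u}. \<bar>Mint Y s w\<bar> ^ (p - 2) * \<bar>Y x s w\<bar> ^ 2)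
   + ennreal (2 ^ p * \<eta> ^ p) * ennreal (\<Sum>s\<in>{s\<in>J x w. s < u}. \<bar>Y x s w\<bar> ^ p)) \<partial>P)"
 proof (rule nn_integral_cong)
  fix w
  have "Q w = (\<Sum>x\<in>S. 2 ^ p * \<eta>\<^sup>2 * (\<Sum>s\<in>{s\<in>J x w. s < u}. \<bar>Mint Y s w\<bar> ^ (p - 2) * \<bar>Y x s w\<bar> ^ 2) + 2 ^ p * \<eta> ^ p * (\<Sum>s\<in>{s\<in>J x w. s < u}. \<bar>Y x s w\<bar> ^ p))"
   unfolding Q_def by (simp add: sum_distrib_left sum.distrib distrib_left mult.assoc)
  then show "ennreal (Q w) = (\<Sum>x\<in>S. ennreal (2 ^ p * \<eta>\<^sup>2) * ennreal (\<Sum>s\<in>{s\<in>J x w. s < u}. \<bar>Mint Y s w\<bar> ^ (p - 2) * \<bar>Y x s w\<bar> ^ 2)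
   + ennreal (2 ^ p * \<eta> ^ p) * ennreal (\<Sum>s\<in>{s\<in>J x w. s < u}. \<bar>Y x s w\<bar> ^ p))"
   using eta_pos by (simp add: ennreal_mult[symmetric] ennreal_plus[symmetric] sum_nonneg sum_ennreal del: ennreal_plus)
 qed
 also have "\<dots> = (\<Sum>x\<in>S. ennreal (2 ^ p * \<eta>\<^sup>2) * (\<integral>\<^sup>+w. ennreal (\<Sum>s\<in>{s\<in>J x w. s < u}. \<bar>Mint Y s w\<bar> ^ (p - 2) * \<bar>Y x s w\<bar> ^ 2) \<partial>P)
   + ennreal (2 ^ p * \<eta> ^ p) * (\<integral>\<^sup>+w. ennreal (\<Sum>s\<in>{s\<in>J x w. s < u}. \<bar>Y x s w\<bar> ^ p) \<partial>P))"
  using m1 m2 by (subst nn_integral_sum) (auto simp: nn_integral_add nn_integral_cmult intro!: sum.cong)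
 also have "\<dots> <= (\<Sum>x\<in>S. ennreal (2 ^ p * \<eta>\<^sup>2) * ennreal (\<kappa> * (LINT s:{0..<u}|lborel. 2 * y ^ (p - 2) * (g x s)\<^sup>2))
   + ennreal (2 ^ p * \<eta> ^ p) * ennreal (\<kappa> * (LINT s:{0..<u}|lborel. gi ^ (p - 2) * (g x s)\<^sup>2)))"
  by (intro sum_mono add_mono mult_left_mono t1 t2) auto
 also have "\<dots> = ennreal (\<Sum>x\<in>S. 2 ^ p * \<kappa> * \<eta>\<^sup>2 * (2 * y ^ (p - 2) + \<eta> ^ (p - 2) * gi ^ (p - 2)) * (LINT s:{0..<u}|lborel. (g x s)\<^sup>2))"
 proof -
  have i0: "0 <= (LINT s:{0..<u}|lborel. (g x s)\<^sup>2)" for x by (auto simp: set_lebesgue_integral_def intro!: integral_nonneg_AE)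
  have pe: "\<eta> ^ p = \<eta>\<^sup>2 * \<eta> ^ (p - 2)" using pw[of \<eta>] by (simp only: mult.commute)
  have "ennreal (2 ^ p * \<eta>\<^sup>2) * ennreal (\<kappa> * (LINT s:{0..<u}|lborel. 2 * y ^ (p - 2) * (g x s)\<^sup>2)) + ennreal (2 ^ p * \<eta> ^ p) * ennreal (\<kappa> * (LINT s:{0..<u}|lborel. gi ^ (p - 2) * (g x s)\<^sup>2))
   = ennreal (2 ^ p * \<kappa> * \<eta>\<^sup>2 * (2 * y ^ (p - 2) + \<eta> ^ (p - 2) * gi ^ (p - 2)) * (LINT s:{0..<u}|lborel. (g x s)\<^sup>2))" for x
  proof -
   let ?I = "LINT s:{0..<u}|lborel. (g x s)\<^sup>2" and ?e = "\<eta>"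
   have e0: "0 <= ?e" using eta_pos by simp
   have n: "0 <= 2 ^ p * ?e\<^sup>2" "0 <= \<kappa> * (2 * y ^ (p - 2) * ?I)" "0 <= 2 ^ p * ?e ^ p" "0 <= \<kappa> * (gi ^ (p - 2) * ?I)"
    using i0[of x] \<kappa> y(1) gi e0 by (auto intro!: mult_nonneg_nonneg zero_le_power simp del: mult_nonneg_nonneg power_mult_distrib)
   have "ennreal (2 ^ p * ?e\<^sup>2) * ennreal (\<kappa> * (2 * y ^ (p - 2) * ?I)) + ennreal (2 ^ p * ?e ^ p) * ennreal (\<kappa> * (gi ^ (p - 2) * ?I))
    = ennreal (2 ^ p * ?e\<^sup>2 * (\<kappa> * (2 * y ^ (p - 2) * ?I)) + 2 ^ p * ?e ^ p * (\<kappa> * (gi ^ (p - 2) * ?I)))"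
    unfolding ennreal_mult[OF n(1,2), symmetric] ennreal_mult[OF n(3,4), symmetric]
    by (rule ennreal_plus[symmetric]) (rule mult_nonneg_nonneg n)+
   also have "2 ^ p * ?e\<^sup>2 * (\<kappa> * (2 * y ^ (p - 2) * ?I)) + 2 ^ p * ?e ^ p * (\<kappa> * (gi ^ (p - 2) * ?I))
    = 2 ^ p * \<kappa> * ?e\<^sup>2 * (2 * y ^ (p - 2) + ?e ^ (p - 2) * gi ^ (p - 2)) * ?I"
    unfolding pe by (simp only: distrib_left distrib_right mult_ac)
   finally show ?thesis unfolding set_integral_mult_right .
  qed
  then show ?thesis using i0 \<kappa> y gi eta_pos by (simp add: sum_ennreal)
 qed
 \<comment> \<open>By \<open>scale\<close>, intensity times squared weighted jump size is
   \<open>K0 * v\<close>; the weight \<open>v\<close> turns the sum over sites into the normalised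
   spatial integral.\<close>
 also have "(\<Sum>x\<in>S. 2 ^ p * \<kappa> * \<eta>\<^sup>2 * (2 * y ^ (p - 2) + \<eta> ^ (p - 2) * gi ^ (p - 2)) * (LINT s:{0..<u}|lborel. (g x s)\<^sup>2)) = 2 ^ p * (K0 * v) * (2 * y ^ (p - 2) + (\<eta> * gi) ^ (p - 2)) * I"
  unfolding scale[symmetric] I_def sum_distrib_left[symmetric] by (simp add: power_mult_distrib mult_ac)
 finally have "expectation (%w. \<bar>Mint Y u w\<bar> ^ p - N w) <= 2 ^ p * (K0 * v) * (2 * y ^ (p - 2) + (\<eta> * gi) ^ (p - 2)) * I"
 proof (rule ennreal_le_iff[THEN iffD1, rotated])
  have "0 <= I" unfolding I_def by (auto simp: set_lebesgue_integral_def intro!: sum_nonneg integral_nonneg_AE)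
  then show "0 <= 2 ^ p * (K0 * v) * (2 * y ^ (p - 2) + (\<eta> * gi) ^ (p - 2)) * I" using K0 v y gi eta_pos by simp
 qed
 moreover have "\<dots> <= 2 ^ p * 2 * K0 * (v * I) * (y ^ (p - 2) + (\<eta> * gi) ^ (p - 2))"
 proof -
  have I0: "0 <= I" unfolding I_def by (auto simp: set_lebesgue_integral_def intro!: sum_nonneg integral_nonneg_AE)
  have "2 ^ p * (K0 * v) * I * (2 * y ^ (p - 2) + (\<eta> * gi) ^ (p - 2)) <= 2 ^ p * (K0 * v) * I * (2 * (y ^ (p - 2) + (\<eta> * gi) ^ (p - 2)))"
   using I0 K0 v gi eta_pos by (intro mult_left_mono) auto
  then show ?thesis by (simp only: mult_ac)
 qed
 ultimately have "expectation (%w. \<bar>Mint Y u w\<bar> ^ p - N w) <= 2 ^ p * 2 * K0 * (v * I) * (y ^ (p - 2) + (\<eta> * gi) ^ (p - 2))"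
  by (rule order_trans)
 moreover have "expectation (%w. \<bar>Mint Y u w\<bar> ^ p - N w) = expectation (%w. \<bar>Mint Y u w\<bar> ^ p)"
  using Xint Nint by simp
 ultimately show ?thesis unfolding I_def by (simp only:)
qed

end

context weighted_noise
begin

text \<open>Absorption: let \<open>y\<close> be the p-th root of the supremum \<open>b\<close> of
  the moments, so that \<open>moment_estimate1\<close> reads
  \<open>y ^ p <= A * (y ^ (p - 2) + (\<eta> * gi) ^ (p - 2))\<close>. Either
  \<open>y <= \<eta> * gi\<close>, or the first term dominates and \<open>y * y <= 2 * A\<close>;
  the square root in the constant is that of \<open>2 * A\<close> over \<open>l2\<close>. Doob's
  inequality contributes the factor 4.\<close>

lemma single_level1:
 assumes u: "0 < u" "u <= 1" and Y: "\<And>x. x \<in> S ==> LA u (Y x)" "\<And>x. x \<in> S ==> polyb u (Y x) C j" and C: "0 <= C"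
  and p: "2 <= p" "even p"
  and g: "\<And>x. x \<in> S ==> borel_on u (%s. g x s)"
   "\<And>x s. x \<in> S ==> 0 <= s ==> s < u ==> 0 <= g x s \<and> g x s <= gi"
   "\<And>x s. x \<in> S ==> 0 <= s ==> s < u ==> expectation (%w. \<bar>Y x s w\<bar> ^ p) <= g x s ^ p" and gi: "0 <= gi"
  and l2: "v * (\<Sum>x\<in>S. LINT s:{0..<u}|lborel. (g x s)\<^sup>2) <= l2\<^sup>2" "0 <= l2"
 shows "\<exists>Vp. Vp \<in> borel_measurable P \<and> (AE w in P. \<forall>t. 0 <= t --> t <= u --> ennreal (\<bar>Mint Y t w\<bar> ^ p) <= Vp w) \<and>
  (\<integral>\<^sup>+w. Vp w \<partial>P) <= ennreal ((4 * (1 + sqrt (2 ^ p * 4 * K0)) * (l2 + \<eta> * gi)) ^ p)"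
proof -
 define C' where "C' = real (card S) * v * C * cW"
 have X6: "Mint Y t \<in> borel_measurable P" if "0 <= t" "t <= u" for t
  by (rule meas_Fl_P[OF that(1) Mint_facts(6)[OF u Y C that]])
 have Xb: "AE w in P. \<forall>t. 0 <= t --> t <= u --> \<bar>Mint Y t w\<bar> <= C' * W w ^ Suc j"
  unfolding C'_def by (rule Mint_facts(2)[OF u Y C])
 define e where "e = (%t. expectation (%w. \<bar>Mint Y t w\<bar> ^ p))"
 define b where "b = (SUP t\<in>{0..u}. e t)"
 \<comment> \<open>A crude bound of which only the finiteness matters: it makes \<open>b\<close> a
   genuine supremum, without which nothing could be absorbed.\<close>
 have eb: "e t <= expectation (%w. C' ^ p * W w ^ (Suc j * p))" if t: "0 <= t" "t <= u" for t
 proof -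
  have le: "AE w in P. \<bar>Mint Y t w\<bar> ^ p <= C' ^ p * W w ^ (Suc j * p)"
   using Xb
  proof eventually_elim
   case (elim w)
   then have "\<bar>Mint Y t w\<bar> ^ p <= (C' * W w ^ Suc j) ^ p" using t by (intro power_mono) auto
   then show ?case by (simp add: power_mult_distrib power_mult[symmetric] del: power_Suc)
  qed
  have m: "(%w. \<bar>Mint Y t w\<bar> ^ p) \<in> borel_measurable P" using X6[OF t] by measurable
  have "integrable P (%w. \<bar>Mint Y t w\<bar> ^ p)" by (rule integrable_poly_bound[OF m, of "C' ^ p" "Suc j * p"]) (use le in simp)
  then show ?thesis unfolding e_def using le W_moments(2) by (intro integral_mono_AE) auto
 qed
 have bdd: "bdd_above (e ` {0..u})" using eb by (intro bdd_aboveI2) auto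
 have le_b: "e t <= b" if "0 <= t" "t <= u" for t unfolding b_def using that bdd by (intro cSUP_upper) auto
 have e0: "0 <= e t" for t unfolding e_def by (intro integral_nonneg_AE AE_I2) auto
 have b0: "0 <= b" using order_trans[OF e0 le_b[of 0]] u by simp
 define y where "y = root p b"
 have y: "0 <= y" "y ^ p = b" unfolding y_def using b0 p by auto
 define A where "A = 2 ^ p * 2 * K0 * l2\<^sup>2"
 have A0: "0 <= A" unfolding A_def using K0 by simp
 have eta: "0 <= \<eta>" using eta_pos by simp
 have est: "e t <= A * (y ^ (p - 2) + (\<eta> * gi) ^ (p - 2))" if t: "0 <= t" "t <= u" for t
 proof (cases "t = 0")
  case True
  have "Mint Y 0 w = 0" for w by (simp add: Mint_def LS_int_def Let_def set_lebesgue_integral_def)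
  then have "e t = 0" unfolding e_def True using p by (simp add: power_0_left)
  then show ?thesis using A0 y gi eta by simp
 next
  case False
  then have t0: "0 < t" "t <= 1" using t u by auto
  have gm: "borel_on t (%s. g x s)" if "x \<in> S" for x
  proof -
   have "(%s. indicator {0..<t} s * g x s) = (%s. indicator {0..<t} s * (indicator {0..<u} s * g x s))"
    using t by (auto simp: indicator_def fun_eq_iff)
   then show ?thesis using g(1)[OF that] by simp
  qed
  have "e t <= 2 ^ p * 2 * K0 * (v * (\<Sum>x\<in>S. LINT s:{0..<t}|lborel. (g x s)\<^sup>2)) * (y ^ (p - 2) + (\<eta> * gi) ^ (p - 2))"
   unfolding e_def
  proof (rule moment_estimate1[OF t0 _ _ C p gm _ _ gi y(1)])
   fix x assume x: "x \<in> S"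
   show "LA t (Y x)" by (rule LA_subset[OF Y(1)[OF x] t(2)])
   show "polyb t (Y x) C j" by (rule polyb_mono[OF Y(2)[OF x] t(2)])
   fix s assume s: "0 <= s" "s < t"
   show "0 <= g x s \<and> g x s <= gi" "expectation (%w. \<bar>Y x s w\<bar> ^ p) <= g x s ^ p" using g x s t by auto
  next
   fix s assume "0 <= s" "s < t"
   then show "expectation (%w. \<bar>Mint Y s w\<bar> ^ p) <= y ^ p" using le_b[of s] t unfolding y(2) e_def by simp
  qed
  also have "\<dots> <= 2 ^ p * 2 * K0 * l2\<^sup>2 * (y ^ (p - 2) + (\<eta> * gi) ^ (p - 2))"
  proof (rule mult_right_mono[OF mult_left_mono])
   have "(LINT s:{0..<t}|lborel. (g x s)\<^sup>2) <= (LINT s:{0..<u}|lborel. (g x s)\<^sup>2)" if x: "x \<in> S" for x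
   proof -
    have m: "borel_on u (%s. (g x s)\<^sup>2)"
    proof -
     have "(%s. indicator {0..<u} s * (g x s)\<^sup>2) = (%s. (indicator {0..<u} s * g x s)\<^sup>2)" by (auto simp: indicator_def)
     then show ?thesis using g(1)[OF x] by simp
    qed
    have sb: "{0..<u} \<subseteq> {0..u}" by auto
    have "\<bar>(g x s)\<^sup>2\<bar> <= gi\<^sup>2" if "s \<in> {0..<u}" for s using g(2)[OF x, of s] that by (auto intro!: power_mono)
    then have i: "set_integrable lborel {0..<u} (%s. (g x s)\<^sup>2)" by (rule set_integrable_bounded(1)[OF m _ atLeastLessThan_borel sb])
    have i2: "set_integrable lborel {0..<t} (%s. (g x s)\<^sup>2)" by (rule set_integrable_subset[OF i]) (use t in auto)
    show ?thesis unfolding set_lebesgue_integral_def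
     using i i2 t unfolding set_integrable_def by (intro integral_mono) (auto simp: indicator_def)
   qed
   then have "v * (\<Sum>x\<in>S. LINT s:{0..<t}|lborel. (g x s)\<^sup>2) <= v * (\<Sum>x\<in>S. LINT s:{0..<u}|lborel. (g x s)\<^sup>2)"
    using v by (intro mult_left_mono sum_mono) auto
   then show "v * (\<Sum>x\<in>S. LINT s:{0..<t}|lborel. (g x s)\<^sup>2) <= l2\<^sup>2" using l2 by simp
   show "0 <= 2 ^ p * 2 * K0" using K0 by simp
   show "0 <= y ^ (p - 2) + (\<eta> * gi) ^ (p - 2)" by (intro add_nonneg_nonneg zero_le_power y(1) mult_nonneg_nonneg[OF eta gi])
  qed
  finally show ?thesis unfolding A_def .
 qed
 define z where "z = (1 + sqrt (2 ^ p * 4 * K0)) * (l2 + \<eta> * gi)"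
 have eg: "0 <= \<eta> * gi" using eta gi by (rule mult_nonneg_nonneg)
 have sq0: "0 <= sqrt (2 ^ p * 4 * K0)" using K0 by simp
 have z1: "\<eta> * gi <= z"
 proof -
  have "1 * (0 + \<eta> * gi) <= z" unfolding z_def using sq0 l2(2) eg by (intro mult_mono) auto
  then show ?thesis by simp
 qed
 have z2: "sqrt (2 ^ p * 4 * K0) * l2 <= z"
  unfolding z_def using sq0 l2(2) eg by (intro mult_mono) auto
 have "b <= A * (y ^ (p - 2) + (\<eta> * gi) ^ (p - 2))"
  unfolding b_def using est u by (intro cSUP_least) auto
 then have yle: "y ^ p <= A * (y ^ (p - 2) + (\<eta> * gi) ^ (p - 2))" unfolding y(2) .
 have yz: "y <= z"
 proof (cases "y <= \<eta> * gi")
  case True then show ?thesis using z1 by simp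
 next
  case False
  then have yp: "0 < y" "\<eta> * gi <= y" using eg by auto
  have "(\<eta> * gi) ^ (p - 2) <= y ^ (p - 2)" using yp eg by (intro power_mono)
  then have "A * (y ^ (p - 2) + (\<eta> * gi) ^ (p - 2)) <= A * (2 * y ^ (p - 2))" using A0 by (intro mult_left_mono) auto
  with yle have "y ^ p <= A * (2 * y ^ (p - 2))" by linarith
  moreover have "p - 2 + 2 = p" using p by simp
  then have "y ^ p = y ^ (p - 2) * y\<^sup>2" using power_add[of y "p - 2" 2] by (simp only:)
  ultimately have "y ^ (p - 2) * y\<^sup>2 <= y ^ (p - 2) * (2 * A)" by (simp add: mult_ac)
  then have "y\<^sup>2 <= 2 * A" using yp by (simp add: mult_le_cancel_left_pos)
  also have "2 * A = (sqrt (2 ^ p * 4 * K0) * l2)\<^sup>2" unfolding A_def power_mult_distrib using K0 by simp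
  finally have "y <= sqrt (2 ^ p * 4 * K0) * l2" by (rule power2_le_imp_le) (use sq0 l2 in simp)
  then show ?thesis using z2 by simp
 qed
 have "expectation (%w. \<bar>Mint Y u w\<bar> ^ p) <= z ^ p"
 proof -
  have "expectation (%w. \<bar>Mint Y u w\<bar> ^ p) <= y ^ p" using le_b[of u] u unfolding y(2) e_def by simp
  also have "\<dots> <= z ^ p" using yz y(1) by (rule power_mono)
  finally show ?thesis .
 qed
 from doob_max[OF u Y C p(1) this order_trans[OF y(1) yz]] show ?thesis by (simp only: z_def mult.assoc)
qed

section \<open>One level with a larger component\<close>

definition Jint :: "nat => (site => real => 'a => real) => real => 'a => real" where
 "Jint q Y t w = (\<Sum>x\<in>S. \<Sum>s\<in>{s\<in>J x w. s < t}. Y x s w * (v * jp x w s) ^ q)"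

text \<open>The integrand is dominated by a left-continuous random factor \<open>Y\<close> times a
  deterministic Borel factor \<open>H\<close>. At the first level \<open>Y = 1\<close> and
  \<open>H\<close> carries the integrand; at later levels \<open>H = 1\<close>. The sum
  \<open>Z\<close> of absolute values increases with time, so its value at \<open>u\<close> controls
  the supremum over times at once.\<close>

lemma single_level2:
 assumes u: "0 < u" "u <= 1" and Y: "\<And>x. x \<in> S ==> LA u (Y x)" "\<And>x. x \<in> S ==> polyb u (Y x) C j" and C: "0 <= C"
  and H: "\<And>x. x \<in> S ==> borel_on u (%s. H x s)" "\<And>x s. x \<in> S ==> 0 <= s ==> s < u ==> 0 <= H x s \<and> H x s <= K" "0 <= K"
  and G: "\<And>x s w. x \<in> S ==> 0 <= s ==> s < u ==> \<bar>G x s w\<bar> <= \<bar>Y x s w\<bar> * H x s"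
  and p: "2 <= p"
  and g: "\<And>x. x \<in> S ==> borel_on u (%s. g x s)"
   "\<And>x s. x \<in> S ==> 0 <= s ==> s < u ==> 0 <= g x s \<and> g x s <= gi"
   "\<And>x s. x \<in> S ==> 0 <= s ==> s < u ==> expectation (%w. \<bar>Y x s w\<bar> ^ p) * H x s ^ p <= g x s ^ p" and gi: "0 <= gi"
  and l1: "v * (\<Sum>x\<in>S. LINT s:{0..<u}|lborel. g x s) <= l1" "0 <= l1"
 shows "\<exists>Vp. Vp \<in> borel_measurable P \<and> (AE w in P. \<forall>t. 0 <= t --> t <= u --> ennreal (\<bar>Jint q G t w\<bar> ^ p) <= Vp w) \<and>
  (\<integral>\<^sup>+w. Vp w \<partial>P) <= ennreal ((\<eta> ^ q * (gi + 2 ^ p * 3 * K0 / \<eta>\<^sup>2 * l1)) ^ p)"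
proof -
 have eta: "0 < \<eta>" by (rule eta_pos)
 define Z where "Z = (%t w. \<Sum>x\<in>S. \<Sum>s\<in>{s\<in>J x w. s < t}. \<bar>Y x s w\<bar> * H x s)"
 have Hb: "\<bar>H x s\<bar> <= K" if "x \<in> S" "0 <= s" "s < u" for x s using H(2)[OF that] by simp
 have aY: "LA u (%s w. \<bar>Y x s w\<bar>)" if "x \<in> S" for x by (rule LA_compose[OF Y(1)[OF that]]) (intro continuous_intros)
 have Z1: "LA u Z"
  unfolding Z_def
 proof (rule LA_sum)
  fix x assume x: "x \<in> S"
  show "LA u (%t w. \<Sum>s\<in>{s\<in>J x w. s < t}. \<bar>Y x s w\<bar> * H x s)"
   using jump_sum_LA[OF x u(1) aY[OF x] H(1)[OF x] Hb[OF x], of 0] by simp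
 qed
 have Zu: "Z u \<in> borel_measurable P"
  unfolding Z_def
 proof (rule borel_measurable_sum)
  fix x assume x: "x \<in> S"
  show "(%w. \<Sum>s\<in>{s\<in>J x w. s < u}. \<bar>Y x s w\<bar> * H x s) \<in> borel_measurable P"
   using meas_Fl_P[OF less_imp_le[OF u(1)] jump_sum_adapted[OF x u(1) aY[OF x] H(1)[OF x] Hb[OF x], of 0]] by simp
 qed
 define CZ where "CZ = real (card S) * (C * K)"
 have CZ0: "0 <= CZ" unfolding CZ_def using C H(3) by simp
 have nn: "0 <= (\<Sum>s\<in>{s\<in>J x w. s < t}. \<bar>Y x s w\<bar> * H x s)" if "x \<in> S" "t <= u" for x t w
 proof (intro sum_nonneg mult_nonneg_nonneg abs_ge_zero)
  fix s assume "s \<in> {s\<in>J x w. s < t}"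
  then show "0 <= H x s" using H(2)[OF that(1), of s] jset_pos[of "%s x. M s x w" x] that by auto
 qed
 have Zb: "AE w in P. \<forall>t. 0 <= t --> t <= u --> 0 <= Z t w \<and> Z t w <= Z u w \<and> Z t w <= CZ * W w ^ Suc j"
 proof -
  have Yb: "AE w in P. \<forall>x\<in>S. \<forall>s. 0 <= s --> s < u --> \<bar>Y x s w\<bar> <= C * W w ^ j"
   using finS polybD(2)[OF Y(2)] by (intro AE_finite_allI) auto
  show ?thesis using good Yb
  proof eventually_elim
   case (elim w)
   show ?case
   proof (intro allI impI conjI)
    fix t assume t: "0 <= t" "t <= u"
    show "0 <= Z t w" unfolding Z_def by (rule sum_nonneg) (rule nn[OF _ t(2)])
    have pos: "0 <= s" "0 <= H x s" "H x s <= K" if "x \<in> S" "s \<in> J x w" "s < u" for x s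
     using H(2)[OF that(1), of s] jset_pos[of "%s x. M s x w" x] that by auto
    show "Z t w <= Z u w"
     unfolding Z_def using good_pathD(2)[OF elim(1) _ a] pos t by (intro sum_mono sum_mono2) auto
    have "Z t w <= (\<Sum>x\<in>S. W w * (C * W w ^ j * K))"
     unfolding Z_def
    proof (rule sum_mono)
     fix x assume x: "x \<in> S"
     have "(\<Sum>s\<in>{s\<in>J x w. s < t}. \<bar>Y x s w\<bar> * H x s) <= (\<Sum>s\<in>{s\<in>J x w. s < t}. C * W w ^ j * K)"
     proof (rule sum_mono)
      fix s assume s: "s \<in> {s\<in>J x w. s < t}"
      have ps: "0 <= s" "0 <= H x s" "H x s <= K" using pos[OF x, of s] s t by auto
      have yb: "\<bar>Y x s w\<bar> <= C * W w ^ j" using elim(2) x ps s t by auto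
      show "\<bar>Y x s w\<bar> * H x s <= C * W w ^ j * K"
       using ps yb order_trans[OF abs_ge_zero yb] by (intro mult_mono) auto
     qed
     also have "\<dots> = real (card {s\<in>J x w. s < t}) * (C * W w ^ j * K)" by simp
     also have "\<dots> <= W w * (C * W w ^ j * K)"
      using card_le_W[OF x elim(1), of t] t u C H(3) W_pow_ge1[of w j] by (intro mult_right_mono mult_nonneg_nonneg) auto
     finally show "(\<Sum>s\<in>{s\<in>J x w. s < t}. \<bar>Y x s w\<bar> * H x s) <= W w * (C * W w ^ j * K)" .
    qed
    then show "Z t w <= CZ * W w ^ Suc j" unfolding CZ_def by (simp add: mult_ac)
   qed
  qed
 qed
 have Z2: "polyb u Z CZ (Suc j)" unfolding polyb_def using Zb CZ0 by (auto elim!: eventually_mono)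
 have iZ: "integrable P (%w. \<bar>Z t w\<bar> ^ p)" if t: "0 <= t" "t <= u" "Z t \<in> borel_measurable P" for t
 proof (rule integrable_poly_bound[where C="CZ ^ p" and j="Suc j * p"])
  show "(%w. \<bar>Z t w\<bar> ^ p) \<in> borel_measurable P" using t(3) by measurable
  show "AE w in P. \<bar>\<bar>Z t w\<bar> ^ p\<bar> <= CZ ^ p * W w ^ (Suc j * p)"
   using Zb
  proof eventually_elim
   case (elim w)
   then have "\<bar>Z t w\<bar> <= CZ * W w ^ Suc j" using t by auto
   then have "\<bar>Z t w\<bar> ^ p <= (CZ * W w ^ Suc j) ^ p" by (intro power_mono) auto
   then show ?case by (simp add: power_mult_distrib power_mult[symmetric] del: power_Suc)
  qed
 qed
 have iZu: "integrable P (%w. \<bar>Z u w\<bar> ^ p)" using u Zu by (intro iZ) auto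
 define y where "y = root p (expectation (%w. \<bar>Z u w\<bar> ^ p))"
 have "0 <= expectation (%w. \<bar>Z u w\<bar> ^ p)" by (intro integral_nonneg_AE AE_I2) simp
 then have y: "0 <= y" "y ^ p = expectation (%w. \<bar>Z u w\<bar> ^ p)" unfolding y_def using p by auto
 have yt: "expectation (%w. \<bar>Z t w\<bar> ^ p) <= y ^ p" if t: "0 <= t" "t < u" for t
  unfolding y(2)
 proof (rule integral_mono_AE)
  show "integrable P (%w. \<bar>Z t w\<bar> ^ p)" using t LA_measP[OF Z1 t] by (intro iZ) auto
  show "AE w in P. \<bar>Z t w\<bar> ^ p <= \<bar>Z u w\<bar> ^ p" using Zb
  proof eventually_elim
   case (elim w)
   then have "0 <= Z t w \<and> Z t w <= Z u w" using t by simp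
   then show ?case by (intro power_mono) auto
  qed
 qed (rule iZu)
 have pe: "p - 1 + 1 = p" using p by simp
 have pw: "b ^ p = b ^ (p - 1) * b" for b :: real using power_add[of b "p - 1" 1] unfolding pe by simp
 \<comment> \<open>Ito's formula for \<open>Z ^ p\<close> without drift. Unlike in the compensated
   case there is no mean-zero part to subtract, so the bound is of first order in the
   increments.\<close>
 have path: "AE w in P. ennreal (\<bar>Z u w\<bar> ^ p) <= (\<Sum>x\<in>S. ennreal (2 ^ p) * ennreal (\<Sum>s\<in>{s\<in>J x w. s < u}. \<bar>Z s w ^ (p - 1) * Y x s w\<bar> * H x s) + ennreal (2 ^ p) * ennreal (\<Sum>s\<in>{s\<in>J x w. s < u}. \<bar>Y x s w ^ p\<bar> * H x s ^ p))"
  using good Zb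
 proof eventually_elim
  case (elim w)
  have pos: "0 <= s" "0 <= H x s" if "x \<in> S" "s \<in> J x w" "s < u" for x s
   using H(2)[OF that(1), of s] jset_pos[of "%s x. M s x w" x] that by auto
  have "Z u w ^ p = 0 ^ p + (\<Sum>x\<in>S. \<Sum>s\<in>{s\<in>J x w. s < u}. (Z s w + \<bar>Y x s w\<bar> * H x s) ^ p - Z s w ^ p) + (LINT s:{0..<u}|lborel. real p * Z s w ^ (p - 1) * 0)"
   by (rule ito_jumps[OF elim(1) less_imp_le[OF u(1)], where f="%y. y ^ p" and f'="%y. real p * y ^ (p - 1)" and C=0])
    (use power_deriv_lipschitz in \<open>auto intro!: derivative_eq_intros simp: Z_def set_lebesgue_integral_def\<close>)
  also have "\<dots> = (\<Sum>x\<in>S. \<Sum>s\<in>{s\<in>J x w. s < u}. (Z s w + \<bar>Y x s w\<bar> * H x s) ^ p - Z s w ^ p)"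
   using p by (simp add: power_0_left set_lebesgue_integral_def)
  also have "\<dots> <= (\<Sum>x\<in>S. \<Sum>s\<in>{s\<in>J x w. s < u}. 2 ^ p * (\<bar>Z s w ^ (p - 1) * Y x s w\<bar> * H x s) + 2 ^ p * (\<bar>Y x s w ^ p\<bar> * H x s ^ p))"
  proof (intro sum_mono)
   fix x s assume x: "x \<in> S" and s: "s \<in> {s\<in>J x w. s < u}"
   have ps: "0 <= H x s" using pos[OF x] s by auto
   have "(Z s w + \<bar>Y x s w\<bar> * H x s) ^ p - Z s w ^ p <= 2 ^ p * (\<bar>Z s w\<bar> ^ (p - 1) * \<bar>\<bar>Y x s w\<bar> * H x s\<bar> + \<bar>\<bar>Y x s w\<bar> * H x s\<bar> ^ p)"
    using power_diff_bound1[of p "Z s w" "\<bar>Y x s w\<bar> * H x s"] p by linarith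
   also have "\<dots> = 2 ^ p * (\<bar>Z s w ^ (p - 1) * Y x s w\<bar> * H x s) + 2 ^ p * (\<bar>Y x s w ^ p\<bar> * H x s ^ p)"
    using ps by (simp add: abs_mult power_abs power_mult_distrib distrib_left mult.assoc)
   finally show "(Z s w + \<bar>Y x s w\<bar> * H x s) ^ p - Z s w ^ p <= 2 ^ p * (\<bar>Z s w ^ (p - 1) * Y x s w\<bar> * H x s) + 2 ^ p * (\<bar>Y x s w ^ p\<bar> * H x s ^ p)" .
  qed
  also have "\<dots> = (\<Sum>x\<in>S. 2 ^ p * (\<Sum>s\<in>{s\<in>J x w. s < u}. \<bar>Z s w ^ (p - 1) * Y x s w\<bar> * H x s) + 2 ^ p * (\<Sum>s\<in>{s\<in>J x w. s < u}. \<bar>Y x s w ^ p\<bar> * H x s ^ p))"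
   by (simp add: sum.distrib sum_distrib_left)
  finally have le: "Z u w ^ p <= \<dots>" .
  have n: "0 <= (\<Sum>s\<in>{s\<in>J x w. s < u}. \<bar>Z s w ^ (p - 1) * Y x s w\<bar> * H x s)" "0 <= (\<Sum>s\<in>{s\<in>J x w. s < u}. \<bar>Y x s w ^ p\<bar> * H x s ^ p)" if "x \<in> S" for x
   using pos[OF that] by (auto intro!: sum_nonneg mult_nonneg_nonneg zero_le_power)
  have "ennreal (\<bar>Z u w\<bar> ^ p) = ennreal (Z u w ^ p)" using elim(2) u by simp
  also have "\<dots> <= ennreal (\<Sum>x\<in>S. 2 ^ p * (\<Sum>s\<in>{s\<in>J x w. s < u}. \<bar>Z s w ^ (p - 1) * Y x s w\<bar> * H x s) + 2 ^ p * (\<Sum>s\<in>{s\<in>J x w. s < u}. \<bar>Y x s w ^ p\<bar> * H x s ^ p))"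
   by (rule ennreal_leI[OF le])
  also have "\<dots> = (\<Sum>x\<in>S. ennreal (2 ^ p) * ennreal (\<Sum>s\<in>{s\<in>J x w. s < u}. \<bar>Z s w ^ (p - 1) * Y x s w\<bar> * H x s) + ennreal (2 ^ p) * ennreal (\<Sum>s\<in>{s\<in>J x w. s < u}. \<bar>Y x s w ^ p\<bar> * H x s ^ p))"
  proof (subst sum_ennreal[symmetric])
   show "0 <= 2 ^ p * (\<Sum>s\<in>{s\<in>J x w. s < u}. \<bar>Z s w ^ (p - 1) * Y x s w\<bar> * H x s) + 2 ^ p * (\<Sum>s\<in>{s\<in>J x w. s < u}. \<bar>Y x s w ^ p\<bar> * H x s ^ p)" if "x \<in> S" for x
    by (intro add_nonneg_nonneg mult_nonneg_nonneg n[OF that]) auto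
   show "(\<Sum>x\<in>S. ennreal (2 ^ p * (\<Sum>s\<in>{s\<in>J x w. s < u}. \<bar>Z s w ^ (p - 1) * Y x s w\<bar> * H x s) + 2 ^ p * (\<Sum>s\<in>{s\<in>J x w. s < u}. \<bar>Y x s w ^ p\<bar> * H x s ^ p)))
    = (\<Sum>x\<in>S. ennreal (2 ^ p) * ennreal (\<Sum>s\<in>{s\<in>J x w. s < u}. \<bar>Z s w ^ (p - 1) * Y x s w\<bar> * H x s) + ennreal (2 ^ p) * ennreal (\<Sum>s\<in>{s\<in>J x w. s < u}. \<bar>Y x s w ^ p\<bar> * H x s ^ p))"
   proof (rule sum.cong[OF refl])
    fix x assume x: "x \<in> S"
    have two: "(0::real) <= 2 ^ p" by simp
    show "ennreal (2 ^ p * (\<Sum>s\<in>{s\<in>J x w. s < u}. \<bar>Z s w ^ (p - 1) * Y x s w\<bar> * H x s) + 2 ^ p * (\<Sum>s\<in>{s\<in>J x w. s < u}. \<bar>Y x s w ^ p\<bar> * H x s ^ p))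
     = ennreal (2 ^ p) * ennreal (\<Sum>s\<in>{s\<in>J x w. s < u}. \<bar>Z s w ^ (p - 1) * Y x s w\<bar> * H x s) + ennreal (2 ^ p) * ennreal (\<Sum>s\<in>{s\<in>J x w. s < u}. \<bar>Y x s w ^ p\<bar> * H x s ^ p)"
     unfolding ennreal_mult[OF two n(1)[OF x], symmetric] ennreal_mult[OF two n(2)[OF x], symmetric]
     by (rule ennreal_plus) (rule mult_nonneg_nonneg two n[OF x])+
   qed
  qed
  finally show ?case .
 qed
 have gm: "borel_on u (%s. (c * g x s))" if "x \<in> S" for x c
  using borel_measurable_times[OF borel_measurable_const g(1)[OF that], of c] by (simp add: mult.left_commute)
 have gb: "\<bar>c * g x s\<bar> <= \<bar>c\<bar> * gi" if "x \<in> S" "0 <= s" "s < u" for x s c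
  unfolding abs_mult using g(2)[OF that] by (intro mult_left_mono) auto
 have LA1: "LA u (%s w. Z s w ^ (p - 1) * Y x s w)" if x: "x \<in> S" for x
  by (intro LA_mult LA_compose[OF Z1, of "%y. y ^ (p - 1)"] Y(1)[OF x] continuous_intros)
 have LA2: "LA u (%s w. Y x s w ^ p)" if x: "x \<in> S" for x
  by (intro LA_compose[OF Y(1)[OF x], of "%y. y ^ p"] continuous_intros)
 have Hp: "borel_on u (%s. H x s ^ p)" "\<And>s. 0 <= s ==> s < u ==> 0 <= H x s ^ p \<and> H x s ^ p <= K ^ p" if x: "x \<in> S" for x
 proof -
  have "(%s. indicator {0..<u} s * H x s ^ p) = (%s. (indicator {0..<u} s * H x s) ^ p)" using p by (auto simp: indicator_def power_0_left)
  then show "borel_on u (%s. H x s ^ p)" using H(1)[OF x] by simp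
  show "0 <= H x s ^ p \<and> H x s ^ p <= K ^ p" if "0 <= s" "s < u" for s using H(2)[OF x that] by (auto intro: power_mono)
 qed
 \<comment> \<open>Hoelder with exponents \<open>p - 1\<close> and 1; the Borel factor is attached
   to \<open>Y\<close>, matching the hypothesis on \<open>g\<close>.\<close>
 have t1: "(\<integral>\<^sup>+w. ennreal (\<Sum>s\<in>{s\<in>J x w. s < u}. \<bar>Z s w ^ (p - 1) * Y x s w\<bar> * H x s) \<partial>P) <= ennreal (\<kappa> * (LINT s:{0..<u}|lborel. 2 * y ^ (p - 1) * g x s))" if x: "x \<in> S" for x
 proof (rule int_Hp[OF x u LA1[OF x] polyb_mult[OF polyb_power[OF Z2] Y(2)[OF x]] H(1,2)[OF x] gm[OF x] gb[OF x]])
  fix s assume s: "0 <= s" "s < u"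
  have h0: "0 <= H x s" using H(2)[OF x s] by simp
  have "expectation (%w. \<bar>Z s w\<bar> ^ (p - 1) * (\<bar>Y x s w\<bar> * H x s) ^ 1) <= 2 * y ^ (p - 1) * g x s ^ 1"
  proof (rule holder_power, unfold pe)
   show "integrable P (%w. \<bar>Z s w\<bar> ^ p)" by (rule integrable_abs_power[OF Z1 Z2 s])
   show "integrable P (%w. (\<bar>Y x s w\<bar> * H x s) ^ p)"
    unfolding power_mult_distrib by (intro integrable_mult_left integrable_abs_power[OF Y(1)[OF x] Y(2)[OF x] s])
   show "(%w. \<bar>Z s w\<bar>) \<in> borel_measurable P" using LA_measP[OF Z1 s] by measurable
   show "(%w. \<bar>Y x s w\<bar> * H x s) \<in> borel_measurable P" using LA_measP[OF Y(1)[OF x] s] by measurable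
   show "expectation (%w. (\<bar>Y x s w\<bar> * H x s) ^ p) <= g x s ^ p"
    unfolding power_mult_distrib using g(3)[OF x s] by simp
  qed (use y(1) yt[OF s] g(2)[OF x s] h0 in auto)
  moreover have "expectation (%w. \<bar>Z s w\<bar> ^ (p - 1) * (\<bar>Y x s w\<bar> * H x s) ^ 1) = expectation (%w. \<bar>Z s w ^ (p - 1) * Y x s w\<bar>) * H x s"
   by (simp add: abs_mult power_abs mult.assoc[symmetric])
  ultimately show "expectation (%w. \<bar>Z s w ^ (p - 1) * Y x s w\<bar>) * H x s <= 2 * y ^ (p - 1) * g x s" by simp
 qed
 have t2: "(\<integral>\<^sup>+w. ennreal (\<Sum>s\<in>{s\<in>J x w. s < u}. \<bar>Y x s w ^ p\<bar> * H x s ^ p) \<partial>P) <= ennreal (\<kappa> * (LINT s:{0..<u}|lborel. gi ^ (p - 1) * g x s))" if x: "x \<in> S" for x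
 proof (rule int_Hp[OF x u LA2[OF x] polyb_power[OF Y(2)[OF x]] Hp[OF x] gm[OF x] gb[OF x]])
  fix s assume s: "0 <= s" "s < u"
  have "g x s ^ p <= gi ^ (p - 1) * g x s" unfolding pw[of "g x s"] using g(2)[OF x s] by (intro mult_right_mono power_mono) auto
  then show "expectation (%w. \<bar>Y x s w ^ p\<bar>) * H x s ^ p <= gi ^ (p - 1) * g x s"
   using g(3)[OF x s] by (simp add: power_abs)
 qed
 have m1: "(%w. \<Sum>s\<in>{s\<in>J x w. s < u}. \<bar>Z s w ^ (p - 1) * Y x s w\<bar> * H x s) \<in> borel_measurable P" if x: "x \<in> S" for x
  using meas_Fl_P[OF less_imp_le[OF u(1)] jump_sum_adapted[OF x u(1) LA_compose[OF LA1[OF x], of abs] H(1)[OF x] Hb[OF x], of 0]] by (simp add: continuous_on_rabs)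
 have m2: "(%w. \<Sum>s\<in>{s\<in>J x w. s < u}. \<bar>Y x s w ^ p\<bar> * H x s ^ p) \<in> borel_measurable P" if x: "x \<in> S" for x
 proof -
  have "\<bar>H x s ^ p\<bar> <= K ^ p" if "0 <= s" "s < u" for s using Hp(2)[OF x that] by simp
  from meas_Fl_P[OF less_imp_le[OF u(1)] jump_sum_adapted[OF x u(1) LA_compose[OF LA2[OF x], of abs] Hp(1)[OF x] this, of 0]]
  show ?thesis by (simp add: continuous_on_rabs)
 qed
 define I where "I = (\<Sum>x\<in>S. LINT s:{0..<u}|lborel. g x s)"
 have i0: "0 <= (LINT s:{0..<u}|lborel. g x s)" if "x \<in> S" for x
  unfolding set_lebesgue_integral_def using g(2)[OF that] by (intro integral_nonneg_AE AE_I2) (auto simp: indicator_def)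
 have I0: "0 <= I" unfolding I_def by (intro sum_nonneg i0)
 have "ennreal (y ^ p) = (\<integral>\<^sup>+w. ennreal (\<bar>Z u w\<bar> ^ p) \<partial>P)"
  unfolding y(2) using iZu by (intro nn_integral_eq_integral[symmetric]) auto
 also have "\<dots> <= (\<integral>\<^sup>+w. (\<Sum>x\<in>S. ennreal (2 ^ p) * ennreal (\<Sum>s\<in>{s\<in>J x w. s < u}. \<bar>Z s w ^ (p - 1) * Y x s w\<bar> * H x s) + ennreal (2 ^ p) * ennreal (\<Sum>s\<in>{s\<in>J x w. s < u}. \<bar>Y x s w ^ p\<bar> * H x s ^ p)) \<partial>P)"
  by (rule nn_integral_mono_AE[OF path])
 also have "\<dots> = (\<Sum>x\<in>S. ennreal (2 ^ p) * (\<integral>\<^sup>+w. ennreal (\<Sum>s\<in>{s\<in>J x w. s < u}. \<bar>Z s w ^ (p - 1) * Y x s w\<bar> * H x s) \<partial>P) + ennreal (2 ^ p) * (\<integral>\<^sup>+w. ennreal (\<Sum>s\<in>{s\<in>J x w. s < u}. \<bar>Y x s w ^ p\<bar> * H x s ^ p) \<partial>P))"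
  using m1 m2 by (subst nn_integral_sum) (auto simp: nn_integral_add nn_integral_cmult intro!: sum.cong)
 also have "\<dots> <= (\<Sum>x\<in>S. ennreal (2 ^ p) * ennreal (\<kappa> * (LINT s:{0..<u}|lborel. 2 * y ^ (p - 1) * g x s)) + ennreal (2 ^ p) * ennreal (\<kappa> * (LINT s:{0..<u}|lborel. gi ^ (p - 1) * g x s)))"
  by (intro sum_mono add_mono mult_left_mono t1 t2) auto
 also have "\<dots> = (\<Sum>x\<in>S. ennreal (2 ^ p * \<kappa> * (2 * y ^ (p - 1) + gi ^ (p - 1)) * (LINT s:{0..<u}|lborel. g x s)))"
 proof (rule sum.cong)
  fix x assume x: "x \<in> S"
  show "ennreal (2 ^ p) * ennreal (\<kappa> * (LINT s:{0..<u}|lborel. 2 * y ^ (p - 1) * g x s)) + ennreal (2 ^ p) * ennreal (\<kappa> * (LINT s:{0..<u}|lborel. gi ^ (p - 1) * g x s))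
   = ennreal (2 ^ p * \<kappa> * (2 * y ^ (p - 1) + gi ^ (p - 1)) * (LINT s:{0..<u}|lborel. g x s))"
   unfolding set_integral_mult_right
   using i0[OF x] \<kappa> y(1) gi by (simp add: ennreal_mult[symmetric] ennreal_plus[symmetric] distrib_left distrib_right mult_ac del: ennreal_plus)
 qed simp
 also have "\<dots> = ennreal (2 ^ p * \<kappa> * (2 * y ^ (p - 1) + gi ^ (p - 1)) * I)"
  unfolding I_def sum_distrib_left using i0 \<kappa> y(1) gi by (intro sum_ennreal) auto
 finally have "y ^ p <= 2 ^ p * \<kappa> * (2 * y ^ (p - 1) + gi ^ (p - 1)) * I"
  by (rule ennreal_le_iff[THEN iffD1, rotated]) (use I0 \<kappa> y(1) gi in simp)
 also have "\<dots> = 2 ^ p * (2 * y ^ (p - 1) + gi ^ (p - 1)) * (\<kappa> * I)" by simp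
 \<comment> \<open>\<open>scale\<close> solved for the intensity. The division by the square of
   \<open>\<eta>\<close> is what lowers the power of the lattice spacing by two units for each
   exponent 1.\<close>
 also have "\<kappa> * I = K0 / \<eta>\<^sup>2 * (v * I)"
 proof -
  have "\<eta>\<^sup>2 \<noteq> 0" using v a by simp
  then have "\<kappa> = K0 * v / \<eta>\<^sup>2" by (rule nonzero_eq_divide_eq[THEN iffD2, OF _ scale])
  then show ?thesis by simp
 qed
 also have "2 ^ p * (2 * y ^ (p - 1) + gi ^ (p - 1)) * (K0 / \<eta>\<^sup>2 * (v * I)) <= 2 ^ p * (2 * y ^ (p - 1) + gi ^ (p - 1)) * (K0 / \<eta>\<^sup>2 * l1)"
  using l1(1) K0 y(1) gi unfolding I_def by (intro mult_left_mono) auto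
 finally have yle: "y ^ p <= 2 ^ p * (2 * y ^ (p - 1) + gi ^ (p - 1)) * (K0 / \<eta>\<^sup>2 * l1)" .
 define c where "c = K0 / \<eta>\<^sup>2 * l1"
 have c0: "0 <= c" unfolding c_def using K0 l1(2) by simp
 define z where "z = gi + 2 ^ p * 3 * K0 / \<eta>\<^sup>2 * l1"
 have zc: "z = gi + 2 ^ p * 3 * c" unfolding z_def c_def by simp
 \<comment> \<open>Absorption again: either \<open>y <= gi\<close>, or \<open>gi\<close> may be
   replaced by \<open>y\<close> and a factor \<open>y ^ (p - 1)\<close> cancels. The 3 in the
   constant is \<open>2 + 1\<close>.\<close>
 have yz: "y <= z"
 proof (cases "y <= gi")
  case True
  have "0 <= 2 ^ p * 3 * c" using c0 by simp
  with True show ?thesis unfolding zc by linarith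
 next
  case False
  then have yp: "0 < y" using gi by simp
  have "gi ^ (p - 1) <= y ^ (p - 1)" using False gi by (intro power_mono) auto
  then have "2 ^ p * (2 * y ^ (p - 1) + gi ^ (p - 1)) * c <= 2 ^ p * (3 * y ^ (p - 1)) * c" using c0 by (intro mult_right_mono mult_left_mono) auto
  then have "y ^ (p - 1) * y <= y ^ (p - 1) * (2 ^ p * 3 * c)" using yle unfolding pw[of y, symmetric] c_def[symmetric] by (simp add: mult_ac)
  then have "y <= 2 ^ p * 3 * c" using yp by (simp add: mult_le_cancel_left_pos)
  then show ?thesis using gi unfolding zc by linarith
 qed
 show ?thesis
 proof (intro exI[of _ "%w. ennreal ((\<eta> ^ q * \<bar>Z u w\<bar>) ^ p)"] conjI)
  show "(%w. ennreal ((\<eta> ^ q * \<bar>Z u w\<bar>) ^ p)) \<in> borel_measurable P" using Zu by measurable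
  have "(\<integral>\<^sup>+w. ennreal ((\<eta> ^ q * \<bar>Z u w\<bar>) ^ p) \<partial>P) = ennreal ((\<eta> ^ q) ^ p * y ^ p)"
   unfolding power_mult_distrib[of "\<eta> ^ q"] y(2) using iZu eta v a by (subst nn_integral_eq_integral) auto
  also have "\<dots> <= ennreal ((\<eta> ^ q * z) ^ p)"
   unfolding power_mult_distrib[of "\<eta> ^ q"] using yz y(1) eta v a by (intro ennreal_leI mult_left_mono power_mono) auto
  finally show "(\<integral>\<^sup>+w. ennreal ((\<eta> ^ q * \<bar>Z u w\<bar>) ^ p) \<partial>P) <= ennreal ((\<eta> ^ q * (gi + 2 ^ p * 3 * K0 / \<eta>\<^sup>2 * l1)) ^ p)" unfolding z_def .
  show "AE w in P. \<forall>t. 0 <= t --> t <= u --> ennreal (\<bar>Jint q G t w\<bar> ^ p) <= ennreal ((\<eta> ^ q * \<bar>Z u w\<bar>) ^ p)"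
   using good Zb
  proof eventually_elim
   case (elim w)
   show ?case
   proof (intro allI impI ennreal_leI power_mono abs_ge_zero)
    fix t assume t: "0 <= t" "t <= u"
    have "\<bar>Jint q G t w\<bar> <= (\<Sum>x\<in>S. \<Sum>s\<in>{s\<in>J x w. s < t}. \<bar>Y x s w\<bar> * H x s * \<eta> ^ q)"
     unfolding Jint_def
    proof (intro order_trans[OF sum_abs sum_mono])
     fix x s assume x: "x \<in> S" and s: "s \<in> {s\<in>J x w. s < t}"
     then have "0 <= s" "s < u" using jset_pos[of "%s x. M s x w" x] t by auto
     then have "\<bar>G x s w\<bar> <= \<bar>Y x s w\<bar> * H x s" by (rule G[OF x])
     moreover have "\<bar>(v * jp x w s) ^ q\<bar> = \<eta> ^ q" using good_pathD(3)[OF elim(1) x a, of s] s v by (simp add: power_abs abs_mult)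
     ultimately show "\<bar>G x s w * (v * jp x w s) ^ q\<bar> <= \<bar>Y x s w\<bar> * H x s * \<eta> ^ q"
      unfolding abs_mult[of "G x s w"] using eta v a by (simp add: mult_right_mono)
    qed
    also have "\<dots> = \<eta> ^ q * Z t w" unfolding Z_def by (simp add: sum_distrib_left mult_ac)
    also have "\<dots> <= \<eta> ^ q * \<bar>Z u w\<bar>" using elim(2) t eta v a by (intro mult_left_mono) (auto intro: order_trans[OF _ abs_ge_self])
    finally show "\<bar>Jint q G t w\<bar> <= \<eta> ^ q * \<bar>Z u w\<bar>" .
   qed
  qed
 qed
qed

end

section \<open>Iterated integrals over the ordered simplex\<close>

text \<open>The ordered simplex with endpoint \<open>u\<close>. Coordinates outside
  \<open>1..j\<close> are left free because integrands are defined on total functions.\<close>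

definition OR :: "site set => nat => real => (nat => pt) set" where
 "OR S j u = {z. (\<forall>i\<in>{1..j}. 0 <= fst (z i) \<and> fst (z i) < u \<and> snd (z i) \<in> S) \<and> (\<forall>i\<in>{1..<j}. fst (z i) < fst (z (Suc i)))}"

text \<open>Peeling off the last point leaves a simplex whose endpoint is the time of that point.
  This mirrors the recursion of \<open>ITI\<close>, and the inductions over levels rest on
  it.\<close>

lemma OR_upd: "z(Suc j := (s, x)) \<in> OR S (Suc j) u \<longleftrightarrow> z \<in> OR S j s \<and> 0 <= s \<and> s < u \<and> x \<in> S"
proof
 assume A: "z(Suc j := (s, x)) \<in> OR S (Suc j) u"
 let ?y = "z(Suc j := (s, x))"
 have a1: "0 <= fst (?y i) \<and> fst (?y i) < u \<and> snd (?y i) \<in> S" if "1 <= i" "i <= Suc j" for i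
  using A that unfolding OR_def by simp
 have a2: "fst (?y i) < fst (?y (Suc i))" if "1 <= i" "i <= j" for i
  using A that unfolding OR_def by simp
 have B: "0 <= fst (z i) \<and> fst (z i) < u \<and> snd (z i) \<in> S" if "1 <= i" "i <= j" for i using a1[of i] that by simp
 have C: "fst (z i) < fst (z (Suc i))" if "1 <= i" "i < j" for i using a2[of i] that by simp
 have E: "1 <= j ==> fst (z j) < s" "0 <= s \<and> s < u \<and> x \<in> S" using a2[of j] a1[of "Suc j"] by simp_all
 have "fst (z i) < s" if "1 <= i" "i <= j" for i
  using that(2,1)
 proof (induction rule: inc_induct)
  case (step n) then show ?case using C[of n] by simp
 qed (use E in simp)
 then show "z \<in> OR S j s \<and> 0 <= s \<and> s < u \<and> x \<in> S" using B C E(2) unfolding OR_def by auto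
next
 assume A: "z \<in> OR S j s \<and> 0 <= s \<and> s < u \<and> x \<in> S"
 then have B: "\<And>i. 1 <= i ==> i <= j ==> 0 <= fst (z i) \<and> fst (z i) < s \<and> snd (z i) \<in> S"
   "\<And>i. 1 <= i ==> i < j ==> fst (z i) < fst (z (Suc i))"
  unfolding OR_def by auto
 show "z(Suc j := (s, x)) \<in> OR S (Suc j) u"
  unfolding OR_def
 proof (intro CollectI conjI ballI)
  fix i assume "i \<in> {1..<Suc j}"
  then show "fst ((z(Suc j := (s, x))) i) < fst ((z(Suc j := (s, x))) (Suc i))"
   using B[of i] by (cases "i = j") auto
 next
  fix i assume i: "i \<in> {1..Suc j}"
  show "0 <= fst ((z(Suc j := (s, x))) i)" "fst ((z(Suc j := (s, x))) i) < u" "snd ((z(Suc j := (s, x))) i) \<in> S"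
   using B(1)[of i] A i by (cases "i = Suc j"; force)+
 qed
qed

lemma OR_mono: "s <= u ==> OR S j s \<subseteq> OR S j u"
 unfolding OR_def by force

text \<open>If the first component has several elements, all its coordinates move together along a diagonal, where
separate continuity only yields Borel measurability; left continuity is therefore not required there.\<close>

definition goodH :: "(nat => nat) => site set => nat => real => real => ((nat => pt) => real) => bool" where
 "goodH ks S j u K H \<longleftrightarrow> 0 <= K \<and> (\<forall>z. z \<notin> OR S j u --> H z = 0) \<and> (\<forall>z. \<bar>H z\<bar> <= K) \<and>
  (\<forall>z\<in>OR S j u. \<forall>i\<in>{1..j}. (i = 1 --> ks 1 = 1) --> 0 < fst (z i) -->
    ((%s. H (z(i := (s, snd (z i))))) \<longlongrightarrow> H z) (at_left (fst (z i)))) \<and>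
  (\<forall>z x. (%r. H (z(1 := (r, x)))) \<in> borel_measurable borel)"

lemma goodHD:
 assumes "goodH ks S j u K H"
 shows "0 <= K" "z \<notin> OR S j u ==> H z = 0" "\<bar>H z\<bar> <= K"
  "z \<in> OR S j u ==> 1 <= i ==> i <= j ==> (i = 1 --> ks 1 = 1) ==> 0 < fst (z i) ==> ((%s. H (z(i := (s, snd (z i))))) \<longlongrightarrow> H z) (at_left (fst (z i)))"
  "(%r. H (z(1 := (r, x)))) \<in> borel_measurable borel"
 using assms unfolding goodH_def by auto

text \<open>For an admissible \<open>(s, x)\<close> the conditions are inherited through
  \<open>OR_upd\<close>; for an inadmissible one the slice vanishes identically.\<close>

lemma goodH_slice:
 assumes g: "goodH ks S (Suc j) u K H"
 shows "goodH ks S j s K (%z. H (z(Suc j := (s, x))))"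
 unfolding goodH_def
proof (intro conjI allI impI ballI)
 show "0 <= K" "\<And>z. \<bar>H (z(Suc j := (s, x)))\<bar> <= K" using goodHD[OF g] by auto
 show "H (z(Suc j := (s, x))) = 0" if "z \<notin> OR S j s" for z
  using goodHD(2)[OF g] that by (auto simp: OR_upd)
 show "(%r. H ((z(1 := (r, y)))(Suc j := (s, x)))) \<in> borel_measurable borel" for z y
 proof (cases "j = 0")
  case False
  then have "(z(1 := (r, y)))(Suc j := (s, x)) = (z(Suc j := (s, x)))(1 := (r, y))" for r by (auto simp: fun_eq_iff)
  then show ?thesis using goodHD(5)[OF g] by simp
 qed simp
next
 fix z i assume z: "z \<in> OR S j s" and i: "i \<in> {1..j}" and k: "i = 1 --> ks 1 = 1" and p: "0 < fst (z i)"
 have tw: "(z(i := w))(Suc j := (s, x)) = (z(Suc j := (s, x)))(i := w)" for w using i by (auto simp: fun_eq_iff)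
 show "((%r. H ((z(i := (r, snd (z i))))(Suc j := (s, x)))) \<longlongrightarrow> H (z(Suc j := (s, x)))) (at_left (fst (z i)))"
 proof (cases "0 <= s \<and> s < u \<and> x \<in> S")
  case True
  then have "z(Suc j := (s, x)) \<in> OR S (Suc j) u" using z by (simp add: OR_upd)
  moreover have "(z(Suc j := (s, x))) i = z i" using i by simp
  ultimately show ?thesis using goodHD(4)[OF g, of "z(Suc j := (s, x))" i] i k p unfolding tw by simp
 next
  case False
  then have "y(Suc j := (s, x)) \<notin> OR S (Suc j) u" for y unfolding OR_upd by blast
  then have "H (y(Suc j := (s, x))) = 0" for y by (rule goodHD(2)[OF g])
  then show ?thesis by simp
 qed
qed

locale lattice_noise = weighted_noise +
 fixes N d :: nat and ks :: "nat => nat"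
 assumes S_eq: "S = Lam N d" and v_eq: "v = eps N ^ d"
begin

abbreviation I :: "nat => ((nat => pt) => real) => real => 'a => real" where
 "I j H t \<omega> \<equiv> ITI N d (%s x. M s x \<omega>) ks j H t"

abbreviation gp :: "'a => bool" where
 "gp \<omega> \<equiv> good_path S a L B (%s x. M s x \<omega>) (%s x. Cd s x \<omega>)"

lemma J_restrict: "{s\<in>{0..<t}. jmp (%r. M r x \<omega>) s \<noteq> 0} = {s\<in>J x \<omega>. s < t}"
 using jset_pos[of "%r x. M r x \<omega>" x] by auto

lemma dM_int_Mint: "dM_int N d (%s x. M s x \<omega>) (Suc 0) (%w. G w \<omega>) t = Mint (%x s \<omega>. G (s, x) \<omega>) t \<omega>"
 unfolding dM_int_def Mint_def S_eq[symmetric] v_eq[symmetric] by simp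

lemma dM_int_Jint: "q \<noteq> Suc 0 ==> dM_int N d (%s x. M s x \<omega>) q (%w. G w \<omega>) t = Jint q (%x s \<omega>. G (s, x) \<omega>) t \<omega>"
 unfolding dM_int_def Jint_def J_restrict S_eq[symmetric] v_eq[symmetric] by simp

text \<open>The first summand covers the total variation in the branch \<open>q = 1\<close> of
  \<open>dM_int\<close>, the second the jump sums in the other branch.\<close>

definition Dq :: "nat => real" where "Dq q = real (card S) * (v * cW + \<eta> ^ q)"

lemma Dq_nonneg: "0 <= Dq q"
 unfolding Dq_def using v cW_pos eta_pos by (intro mult_nonneg_nonneg add_nonneg_nonneg) auto

lemma dM_int_bound:
 assumes g: "gp \<omega>" and t: "0 <= t" "t <= 1" and K: "0 <= K"
  and G: "\<And>x. x \<in> S ==> borel_on t (%s. G (s, x))" "\<And>x s. x \<in> S ==> 0 <= s ==> s < t ==> \<bar>G (s, x)\<bar> <= K"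
 shows "\<bar>dM_int N d (%s x. M s x \<omega>) q G t\<bar> <= Dq q * K * W \<omega>"
proof (cases "q = 1")
 case True
 have "\<bar>dM_int N d (%s x. M s x \<omega>) q G t\<bar> <= (\<Sum>x\<in>S. v * (K * (cW * W \<omega>)))"
  unfolding dM_int_def if_P[OF True] S_eq[symmetric] v_eq[symmetric]
 proof (rule order_trans[OF sum_abs sum_mono])
  fix x assume x: "x \<in> S"
  have "\<bar>LS_int (%s. M s x \<omega>) (%s. G (s, x)) t\<bar> <= K * (a * real (card {s\<in>J x \<omega>. s < t}) + \<bar>L\<bar> * B * t)"
   by (rule good_path_LS_bound(1)[OF g x a B t(1)]) (use G x K in auto)
  also have "\<dots> <= K * (cW * W \<omega>)" by (rule mult_left_mono[OF card_W[OF x g t] K])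
  finally show "\<bar>v * LS_int (%s. M s x \<omega>) (%s. G (s, x)) t\<bar> <= v * (K * (cW * W \<omega>))"
   using v by (simp add: abs_mult)
 qed
 also have "\<dots> = real (card S) * (v * cW) * (K * W \<omega>)" by simp
 also have "\<dots> <= Dq q * (K * W \<omega>)"
  unfolding Dq_def using eta_pos K W_ge1[of \<omega>] by (intro mult_right_mono mult_left_mono) auto
 finally show ?thesis by (simp add: mult.assoc)
next
 case False
 have "\<bar>dM_int N d (%s x. M s x \<omega>) q G t\<bar> <= (\<Sum>x\<in>S. W \<omega> * (K * \<eta> ^ q))"
  unfolding dM_int_def using False unfolding if_not_P[OF False] S_eq[symmetric] v_eq[symmetric] J_restrict
 proof (intro order_trans[OF sum_abs sum_mono])
  fix x assume x: "x \<in> S"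
  have "\<bar>\<Sum>s\<in>{s\<in>J x \<omega>. s < t}. G (s, x) * (v * jp x \<omega> s) ^ q\<bar> <= (\<Sum>s\<in>{s\<in>J x \<omega>. s < t}. K * \<eta> ^ q)"
  proof (rule order_trans[OF sum_abs sum_mono])
   fix s assume s: "s \<in> {s\<in>J x \<omega>. s < t}"
   then have "0 < s" using jset_pos[of "%r x. M r x \<omega>" x] by auto
   then have "\<bar>G (s, x)\<bar> <= K" using G(2)[OF x] s by auto
   moreover have "\<bar>jp x \<omega> s\<bar> = a" using good_pathD(3)[OF g x a] s by auto
   ultimately show "\<bar>G (s, x) * (v * jp x \<omega> s) ^ q\<bar> <= K * \<eta> ^ q"
    using v a by (simp add: abs_mult power_abs mult_right_mono)
  qed
  also have "\<dots> = real (card {s\<in>J x \<omega>. s < t}) * (K * \<eta> ^ q)" by simp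
  also have "\<dots> <= W \<omega> * (K * \<eta> ^ q)"
   using K eta_pos by (intro mult_right_mono card_le_W x g t) auto
  finally show "\<bar>\<Sum>s\<in>{s\<in>J x \<omega>. s < t}. G (s, x) * (v * jp x \<omega> s) ^ q\<bar> <= W \<omega> * (K * \<eta> ^ q)" .
 qed
 also have "\<dots> = real (card S) * \<eta> ^ q * (K * W \<omega>)" by (simp only: sum_constant mult_ac)
 also have "\<dots> <= Dq q * (K * W \<omega>)"
  unfolding Dq_def using v cW_pos K W_ge1[of \<omega>] by (intro mult_right_mono mult_left_mono) auto
 finally show ?thesis by (simp add: mult.assoc)
qed

text \<open>Integrands and endpoints vary together. This is what left continuity in an outer time
  demands, as that time is both an argument of the integrand and the upper limit of the inner
  integral.\<close>

lemma dM_int_conv: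
 assumes g: "gp \<omega>" and t: "\<And>n. 0 <= tn n" "\<And>n. tn n <= t" "tn \<longlonglongrightarrow> t"
  and G: "\<And>x n. x \<in> S ==> borel_on (tn n) (%s. Gn n (s, x))" "\<And>x s n. x \<in> S ==> 0 <= s ==> s < tn n ==> \<bar>Gn n (s, x)\<bar> <= K"
  and lim: "\<And>x s. x \<in> S ==> 0 <= s ==> s < t ==> (%n. Gn n (s, x)) \<longlonglongrightarrow> G (s, x)"
 shows "(%n. dM_int N d (%s x. M s x \<omega>) q (Gn n) (tn n)) \<longlonglongrightarrow> dM_int N d (%s x. M s x \<omega>) q G t"
proof -
 have t0: "0 <= t" using t(1,2) order_trans by blast
 have ev: "\<forall>\<^sub>F n in sequentially. s < tn n" if "s < t" for s using order_tendstoD(1)[OF t(3) that] .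
 have l: "(%n. indicator {0..<tn n} s * Gn n (s, x)) \<longlonglongrightarrow> indicator {0..<t} s * G (s, x)" if x: "x \<in> S" for s x
 proof (cases "s \<in> {0..<t}")
  case True
  have "\<forall>\<^sub>F n in sequentially. Gn n (s, x) = indicator {0..<tn n} s * Gn n (s, x)"
   using ev[of s] True by (auto simp: indicator_def elim!: eventually_mono)
  then show ?thesis using Lim_transform_eventually[OF lim[OF x]] True by auto
 next
  case False
  then have "s \<notin> {0..<tn n}" for n using t(2)[of n] by auto
  then show ?thesis using False by simp
 qed
 have Gm: "borel_on t (%s. G (s, x))" if x: "x \<in> S" for x
  by (rule borel_measurable_LIMSEQ_real[OF l[OF x] G(1)[OF x]])
 have Gb: "\<bar>G (s, x)\<bar> <= K" if "x \<in> S" "0 <= s" "s < t" for x s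
 proof (rule LIMSEQ_le_const2)
  show "(%n. \<bar>Gn n (s, x)\<bar>) \<longlonglongrightarrow> \<bar>G (s, x)\<bar>" using lim[OF that] by (rule tendsto_rabs)
  show "\<exists>N. \<forall>n\<ge>N. \<bar>Gn n (s, x)\<bar> <= K"
   using ev[OF that(3)] G(2)[OF that(1,2)] unfolding eventually_sequentially by blast
 qed
 have js: "(%n. \<Sum>s\<in>{s\<in>J x \<omega>. s < tn n}. Gn n (s, x) * y s) \<longlonglongrightarrow> (\<Sum>s\<in>{s\<in>J x \<omega>. s < t}. G (s, x) * y s)" if x: "x \<in> S" for x and y :: "real => real"
 proof -
  have fin: "finite {s\<in>J x \<omega>. s < t}" by (rule good_pathD(2)[OF g x a])
  have eq: "(\<Sum>s\<in>{s\<in>J x \<omega>. s < tn n}. Gn n (s, x) * y s) = (\<Sum>s\<in>{s\<in>J x \<omega>. s < t}. (indicator {0..<tn n} s * Gn n (s, x)) * y s)" for n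
  proof (rule sum.mono_neutral_cong_left[OF fin])
   show "{s\<in>J x \<omega>. s < tn n} \<subseteq> {s\<in>J x \<omega>. s < t}" using t(2)[of n] by auto
   show "\<forall>s\<in>{s\<in>J x \<omega>. s < t} - {s\<in>J x \<omega>. s < tn n}. (indicator {0..<tn n} s * Gn n (s, x)) * y s = 0"
    by (auto simp: indicator_def)
   show "Gn n (s, x) * y s = (indicator {0..<tn n} s * Gn n (s, x)) * y s" if "s \<in> {s\<in>J x \<omega>. s < tn n}" for s
    using that jset_pos[of "%r x. M r x \<omega>" x] by (auto simp: indicator_def)
  qed
  have eq2: "(\<Sum>s\<in>{s\<in>J x \<omega>. s < t}. G (s, x) * y s) = (\<Sum>s\<in>{s\<in>J x \<omega>. s < t}. (indicator {0..<t} s * G (s, x)) * y s)"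
   using jset_pos[of "%r x. M r x \<omega>" x] by (intro sum.cong) (auto simp: indicator_def)
  show ?thesis unfolding eq eq2 by (intro tendsto_sum tendsto_mult tendsto_const l x)
 qed
 have ls: "(%n. LS_int (%s. M s x \<omega>) (%s. Gn n (s, x)) (tn n)) \<longlonglongrightarrow> LS_int (%s. M s x \<omega>) (%s. G (s, x)) t" if x: "x \<in> S" for x
 proof -
  let ?D = "%s. - L * Cd s x \<omega>"
  have K0: "\<bar>L\<bar> * B \<ge> 0" using B by simp
  have e: "(%s. indicator {0..<r} s * (f s * ?D s)) = (%s. (indicator {0..<r} s * f s) * (indicator {0..r} s * ?D s))" for r and f :: "real => real"
   by (auto simp: indicator_def fun_eq_iff)
  have "(%n. LINT s:{0..<tn n}|lborel. Gn n (s, x) * ?D s) \<longlonglongrightarrow> (LINT s:{0..<t}|lborel. G (s, x) * ?D s)"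
   unfolding set_lebesgue_integral_def real_scaleR_def
  proof (rule integral_dominated_convergence[where w="%s. indicator {0..t} s * (max K 0 * (\<bar>L\<bar> * B))"])
   show "(%s. indicator {0..<t} s * (G (s, x) * ?D s)) \<in> borel_measurable lborel"
    unfolding e measurable_lborel2 by (rule borel_measurable_times[OF Gm[OF x] good_pathD(7)[OF g x a]])
   show "(%s. indicator {0..<tn n} s * (Gn n (s, x) * ?D s)) \<in> borel_measurable lborel" for n
    unfolding e measurable_lborel2 by (rule borel_measurable_times[OF G(1)[OF x] good_pathD(7)[OF g x a]])
   show "integrable lborel (%s. indicator {0..t} s * (max K 0 * (\<bar>L\<bar> * B)))"
    using t0 by (intro integrable_mult_left integrable_real_indicator) auto
   show "AE s in lborel. (%n. indicator {0..<tn n} s * (Gn n (s, x) * ?D s)) \<longlonglongrightarrow> indicator {0..<t} s * (G (s, x) * ?D s)"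
    by (intro AE_I2, unfold mult.assoc[symmetric], intro tendsto_mult tendsto_const l x)
   show "AE s in lborel. norm (indicator {0..<tn n} s * (Gn n (s, x) * ?D s)) <= indicator {0..t} s * (max K 0 * (\<bar>L\<bar> * B))" for n
   proof (rule AE_I2)
    fix s
    show "norm (indicator {0..<tn n} s * (Gn n (s, x) * ?D s)) <= indicator {0..t} s * (max K 0 * (\<bar>L\<bar> * B))"
    proof (cases "s \<in> {0..<tn n}")
     case True
     then have "\<bar>Gn n (s, x)\<bar> * \<bar>?D s\<bar> <= max K 0 * (\<bar>L\<bar> * B)"
      using G(2)[OF x, of s n] good_pathD(6)[OF g x a, of s] by (intro mult_mono) auto
     then show ?thesis using True t(2)[of n] by (simp add: abs_mult)
    next
     case False
     then show ?thesis using K0 by (simp add: indicator_def)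
    qed
   qed
  qed
  from tendsto_add[OF js[OF x, of "jp x \<omega>"] this]
  show ?thesis
   using good_path_LS_int[OF g x a t(1) G(1)[OF x] G(2)[OF x]] good_path_LS_int[OF g x a t0 Gm[OF x] Gb[OF x]] by simp
 qed
 show ?thesis
 proof (cases "q = 1")
  case True
  show ?thesis unfolding dM_int_def if_P[OF True] S_eq[symmetric] by (intro tendsto_sum tendsto_mult tendsto_const ls)
 next
  case False
  show ?thesis unfolding dM_int_def if_not_P[OF False] J_restrict S_eq[symmetric] by (intro tendsto_sum js)
 qed
qed

definition Dj :: "nat => real" where "Dj j = (\<Prod>i\<in>{1..j}. Dq (ks i))"

lemma Dj_nonneg: "0 <= Dj j"
 unfolding Dj_def by (intro prod_nonneg Dq_nonneg)

text \<open>The claims support each other, so they are proved in one induction: measurability in the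
  last time feeds the bound and the convergence at the next level, convergence yields left
  continuity there, and left continuity yields measurability. The start is different when the first
  component has several elements: then measurability comes directly from
  \<open>goodH\<close>.\<close>

lemma I_path:
 assumes g: "gp \<omega>"
 shows "\<And>t K H. 0 <= t ==> t <= 1 ==> goodH ks S j t K H ==> \<bar>I j H t \<omega>\<bar> <= K * Dj j * W \<omega> ^ j"
  "\<And>t K H Hn tn. t <= 1 ==> goodH ks S j t K H ==> (\<And>n. goodH ks S j (tn n) K (Hn n)) ==> (\<And>n. 0 <= tn n \<and> tn n <= t) ==> tn \<longlonglongrightarrow> t ==>
    (\<And>z. z \<in> OR S j t ==> (%n. Hn n z) \<longlonglongrightarrow> H z) ==> (%n. I j (Hn n) (tn n) \<omega>) \<longlonglongrightarrow> I j H t \<omega>"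
  "\<And>u K H s x. u <= 1 ==> goodH ks S (Suc j) u K H ==> 0 < s ==> s < u ==> x \<in> S ==> j = 0 --> ks 1 = 1 ==>
    ((%s. I j (%z. H (z(Suc j := (s, x)))) s \<omega>) \<longlongrightarrow> I j (%z. H (z(Suc j := (s, x)))) s \<omega>) (at_left s)"
  "\<And>u K H x. u <= 1 ==> goodH ks S (Suc j) u K H ==> x \<in> S ==>
    borel_on u (%s. I j (%z. H (z(Suc j := (s, x)))) s \<omega>)"
proof (induction j)
 case 0
 { case 1 then show ?case using goodHD(3)[of ks S 0] by (simp add: Dj_def) }
 { case 2 then show ?case by (simp add: OR_def) }
 note a2 = this
 have left: "((%s. I 0 (%z. H (z(Suc 0 := (s, x)))) s \<omega>) \<longlongrightarrow> I 0 (%z. H (z(Suc 0 := (s, x)))) s \<omega>) (at_left s)"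
  if "goodH ks S (Suc 0) u K H" "0 < s" "s < u" "x \<in> S" "ks 1 = 1" for u K H s x
 proof -
  have "z0(Suc 0 := (s, x)) \<in> OR S (Suc 0) u" using that unfolding OR_upd by (simp add: OR_def)
  from goodHD(4)[OF that(1) this, of 1] show ?thesis using that by simp
 qed
 { case 3 then show ?case using left by blast }
 { case (4 u K H x) then show ?case using goodHD(5)[OF 4(2), of z0 x] by simp }
next
 case (Suc j)
 let ?G = "%H w. I j (%z. H (z(Suc j := w))) (fst w) \<omega>"
 have Gb: "\<bar>?G H (s, x)\<bar> <= K * Dj j * W \<omega> ^ j" if "goodH ks S (Suc j) t K H" "0 <= s" "s < t" "t <= 1" for H t K s x
  unfolding fst_conv by (rule Suc.IH(1)[OF that(2) _ goodH_slice[OF that(1)]]) (use that in simp)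
 have Gm: "borel_on t (%s. ?G H (s, x))" if "goodH ks S (Suc j) t K H" "t <= 1" "x \<in> S" for H t K x
  unfolding fst_conv by (rule Suc.IH(4)[OF that(2,1,3)])
 { case (1 t K H)
  have "\<bar>dM_int N d (%s x. M s x \<omega>) (ks (Suc j)) (?G H) t\<bar> <= Dq (ks (Suc j)) * (K * Dj j * W \<omega> ^ j) * W \<omega>"
   using goodHD(1)[OF 1(3)] Dj_nonneg[of j] W_ge1[of \<omega>] 1
   by (intro dM_int_bound g Gm[OF 1(3)] Gb[OF 1(3)] mult_nonneg_nonneg) auto
  then show ?case by (simp add: Dj_def mult_ac) }
 { case (2 t K H Hn tn)
  have tn: "0 <= tn n" "tn n <= t" "tn n <= 1" for n using 2(4)[of n] 2(1) by auto
  have "(%n. dM_int N d (%s x. M s x \<omega>) (ks (Suc j)) (?G (Hn n)) (tn n)) \<longlonglongrightarrow> dM_int N d (%s x. M s x \<omega>) (ks (Suc j)) (?G H) t"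
  proof (rule dM_int_conv[OF g tn(1,2) 2(5) Gm[OF 2(3) tn(3)] Gb[OF 2(3) _ _ tn(3)]])
   fix x s assume x: "x \<in> S" and s: "0 <= s" "s < t"
   have "(%n. I j (%z. Hn n (z(Suc j := (s, x)))) s \<omega>) \<longlonglongrightarrow> I j (%z. H (z(Suc j := (s, x)))) s \<omega>"
   proof (rule Suc.IH(2)[OF _ goodH_slice[OF 2(2)] goodH_slice[OF 2(3)]])
    fix z assume "z \<in> OR S j s"
    then show "(%n. Hn n (z(Suc j := (s, x)))) \<longlonglongrightarrow> H (z(Suc j := (s, x)))"
     using s x by (intro 2(6) OR_upd[THEN iffD2] conjI)
   qed (use s 2(1) in auto)
   then show "(%n. ?G (Hn n) (s, x)) \<longlonglongrightarrow> ?G H (s, x)" by simp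
  qed
  then show ?case by simp }
 note conv = this
 \<comment> \<open>Along a sequence approaching \<open>s\<close> from the left, \<open>conv\<close>
   is applied with \<open>X n\<close> as the endpoint and as the last time simultaneously.\<close>
 have left: "((%s. I (Suc j) (%z. H (z(Suc (Suc j) := (s, x)))) s \<omega>) \<longlongrightarrow> I (Suc j) (%z. H (z(Suc (Suc j) := (s, x)))) s \<omega>) (at_left s)"
  if u: "u <= 1" and H: "goodH ks S (Suc (Suc j)) u K H" and s: "0 < s" "s < u" and x: "x \<in> S" for u K H s x
 proof (rule tendsto_at_left_sequentially[OF s(1)])
  fix X :: "nat => real" assume X: "\<And>n. X n < s" "\<And>n. 0 < X n" "X \<longlonglongrightarrow> s"
  show "(%n. I (Suc j) (%z. H (z(Suc (Suc j) := (X n, x)))) (X n) \<omega>) \<longlonglongrightarrow> I (Suc j) (%z. H (z(Suc (Suc j) := (s, x)))) s \<omega>"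
  proof (rule conv[OF _ goodH_slice[OF H] goodH_slice[OF H] _ X(3)])
   fix z assume "z \<in> OR S (Suc j) s"
   then have "z(Suc (Suc j) := (s, x)) \<in> OR S (Suc (Suc j)) u" using s x by (simp add: OR_upd)
   from goodHD(4)[OF H this, of "Suc (Suc j)"] have "((%r. H (z(Suc (Suc j) := (r, x)))) \<longlongrightarrow> H (z(Suc (Suc j) := (s, x)))) (at_left s)"
    using s by simp
   moreover have "filterlim X (at_left s) sequentially"
    using X unfolding filterlim_at by (auto simp: less_imp_neq)
   ultimately show "(%n. H (z(Suc (Suc j) := (X n, x)))) \<longlonglongrightarrow> H (z(Suc (Suc j) := (s, x)))"
    by (rule filterlim_compose)
  qed (use X s u in \<open>auto simp: less_imp_le\<close>)
 qed
 { case 3 then show ?case using left by blast }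
 { case 4 then show ?case by (intro left_cont_borel left) }
qed

text \<open>The inner iterated integral as a process in the time of the next variable; that time is
  also its endpoint.\<close>

definition Y :: "nat => ((nat => pt) => real) => site => real => 'a => real" where
 "Y j H x s \<omega> = I j (%z. H (z(Suc j := (s, x)))) s \<omega>"

lemma I_Suc:
 "I (Suc j) H t \<omega> = (if ks (Suc j) = 1 then Mint (Y j H) t \<omega> else Jint (ks (Suc j)) (Y j H) t \<omega>)"
 unfolding Y_def[abs_def] by (simp add: dM_int_Mint[where G="%w \<omega>. I j (%z. H (z(Suc j := w))) (fst w) \<omega>"]
  dM_int_Jint[where G="%w \<omega>. I j (%z. H (z(Suc j := w))) (fst w) \<omega>"])

lemma I_Suc_0: "I (Suc j) H 0 \<omega> = 0"
proof -
 have e0: "{s\<in>J x \<omega>. s < 0} = {}" for x using jset_pos[of "%r x. M r x \<omega>" x] by auto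
 then show ?thesis unfolding I_Suc Mint_def Jint_def e0 sum.empty by (simp add: LS_int_def set_lebesgue_integral_def Let_def)
qed

lemma Y_polyb: "goodH ks S (Suc j) u K H ==> u <= 1 ==> polyb u (Y j H x) (K * Dj j) j"
 unfolding polyb_def
proof (intro conjI mult_nonneg_nonneg Dj_nonneg)
 assume H: "goodH ks S (Suc j) u K H" and u: "u <= 1"
 show "0 <= K" by (rule goodHD(1)[OF H])
 show "AE \<omega> in P. \<forall>s. 0 <= s --> s < u --> \<bar>Y j H x s \<omega>\<bar> <= K * Dj j * W \<omega> ^ j"
  using good
 proof eventually_elim
  case (elim \<omega>)
  show ?case unfolding Y_def using u by (intro allI impI I_path(1)[OF elim _ _ goodH_slice[OF H]]) auto
 qed
qed

text \<open>Adaptedness is a premise here because the induction in \<open>I_adapted\<close> calls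
  this lemma and supplies \<open>ad\<close> from its induction hypothesis.\<close>

lemma Y_LA_aux:
 assumes H: "goodH ks S (Suc j) u K H" and u: "u <= 1" and x: "x \<in> S" and j: "j = 0 --> ks 1 = 1"
  and ad: "\<And>s. 0 <= s ==> s < u ==> I j (%z. H (z(Suc j := (s, x)))) s \<in> borel_measurable (Fl s)"
 shows "LA u (Y j H x)"
 unfolding LA_def
proof (intro conjI allI impI)
 show "Y j H x s \<in> borel_measurable (Fl s)" if "0 <= s" "s < u" for s
  using ad[OF that] unfolding Y_def[abs_def] .
 show "AE \<omega> in P. \<forall>s. 0 < s --> s < u --> ((%r. Y j H x r \<omega>) \<longlongrightarrow> Y j H x s \<omega>) (at_left s)"
  using good
 proof eventually_elim
  case (elim \<omega>)
  show ?case unfolding Y_def using j by (intro allI impI I_path(3)[OF elim u H _ _ x]) auto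
 qed
qed

lemma I_adapted:
 "0 <= t ==> t <= 1 ==> goodH ks S j t K H ==> I j H t \<in> borel_measurable (Fl t)"
proof (induction j arbitrary: t H K)
 case 0
 then show ?case by simp
next
 case (Suc j)
 show ?case
 proof (cases "t = 0")
  case True
  show ?thesis unfolding True I_Suc_0 by simp
 next
  case False
  then have t: "0 < t" using Suc.prems(1) by simp
  have LA: "LA t (Y j H x)" if "x \<in> S" "j = 0 --> ks 1 = 1" for x
   by (rule Y_LA_aux[OF Suc.prems(3,2) that Suc.IH[OF _ _ goodH_slice[OF Suc.prems(3)]]]) (use Suc.prems in auto)
  note pb = Y_polyb[OF Suc.prems(3,2)]
  have C: "0 <= K * Dj j" using goodHD(1)[OF Suc.prems(3)] Dj_nonneg by (intro mult_nonneg_nonneg) auto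
  show ?thesis
  proof (cases "ks (Suc j) = 1")
   case True
   have "Mint (Y j H) t \<in> borel_measurable (Fl t)"
    by (rule Mint_facts(6)[OF t Suc.prems(2) LA pb C]) (use True t in auto)
   then show ?thesis unfolding I_Suc using True by simp
  next
   case q: False
   have "(%\<omega>. \<Sum>s\<in>{s\<in>J x \<omega>. s < t}. Y j H x s \<omega> * jp x \<omega> s ^ ks (Suc j)) \<in> borel_measurable (Fl t)" if x: "x \<in> S" for x
   \<comment> \<open>At the first level the integrand is deterministic and known only to be Borel,
     so it takes the place of the factor \<open>H\<close>; afterwards it is left continuous and
     takes the place of \<open>Y\<close>.\<close>
   proof (cases "j = 0")
    case True
    have "(%\<omega>. \<Sum>s\<in>{s\<in>J x \<omega>. s < t}. 1 * H (z0(1 := (s, x))) * jp x \<omega> s ^ ks (Suc j)) \<in> borel_measurable (Fl t)"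
    proof (rule jump_sum_adapted[OF x t LA_const])
     show "borel_on t (%s. H (z0(1 := (s, x))))"
      by (rule borel_measurable_times[OF borel_measurable_indicator goodHD(5)[OF Suc.prems(3)]]) simp
     show "\<bar>H (z0(1 := (s, x)))\<bar> <= K" for s by (rule goodHD(3)[OF Suc.prems(3)])
    qed
    then show ?thesis using True by (simp add: Y_def)
   next
    case False
    have "LA t (Y j H x)" using False by (intro LA x) auto
    from jump_sum_adapted[OF x t this, of "%_. 1" 1 "ks (Suc j)"] show ?thesis by simp
   qed
   then have "(%\<omega>. \<Sum>x\<in>S. v ^ ks (Suc j) * (\<Sum>s\<in>{s\<in>J x \<omega>. s < t}. Y j H x s \<omega> * jp x \<omega> s ^ ks (Suc j))) \<in> borel_measurable (Fl t)"
    by (intro borel_measurable_sum borel_measurable_times borel_measurable_const)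
   then have "Jint (ks (Suc j)) (Y j H) t \<in> borel_measurable (Fl t)"
    unfolding Jint_def[abs_def] power_mult_distrib sum_distrib_left by (simp only: mult_ac)
   then show ?thesis unfolding I_Suc using q by simp
  qed
 qed
qed

lemma Y_LA: "goodH ks S (Suc j) u K H ==> u <= 1 ==> x \<in> S ==> j = 0 --> ks 1 = 1 ==> LA u (Y j H x)"
 using Y_LA_aux I_adapted[OF _ _ goodH_slice] by simp

end

section \<open>Mixed norms\<close>

lemma epowr_mono: "0 <= a ==> x <= y ==> epowr x a <= epowr y a"
 unfolding epowr_def by (auto simp: top_unique less_top[symmetric] intro!: ennreal_leI powr_mono2 enn2real_mono)

lemma epowr_half: "epowr (ennreal x) (1/2) = ennreal (sqrt (max 0 x))"
 by (cases "0 <= x") (auto simp: epowr_def powr_half_sqrt max_def ennreal_neg)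

text \<open>Strict inequalities pass through the square root, infinite values included. Since lower
  limits are characterised by strict lower bounds, they pass through it as well.\<close>

lemma less_epowr_half: "y < epowr x (1/2) \<longleftrightarrow> y\<^sup>2 < x"
proof (cases x)
 case (real a)
 show ?thesis
 proof (cases y)
  case (real b)
  have "y\<^sup>2 = ennreal (b\<^sup>2)" using real by (simp add: ennreal_power)
  moreover have "b < sqrt a \<longleftrightarrow> b\<^sup>2 < a" using real \<open>0 <= a\<close> by (metis real_less_rsqrt real_sqrt_less_mono real_sqrt_unique linorder_not_less real_le_lsqrt)
  ultimately show ?thesis using real \<open>x = ennreal a\<close> \<open>0 <= a\<close> by (simp add: epowr_half ennreal_less_iff)
 qed (simp add: \<open>x = ennreal a\<close> epowr_half ennreal_top_eq_mult_iff power2_eq_square)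
next
 case top
 then show ?thesis by (cases y) (auto simp: epowr_def power2_eq_square ennreal_mult[symmetric] less_top[symmetric] ennreal_mult_eq_top_iff)
qed

lemma Lnorm_mono: "(\<And>w. G w <= G' w) ==> Lnorm N d T q G <= Lnorm N d T q G'"
 unfolding Lnorm_def
 by (cases q) (auto intro!: mult_left_mono sum_mono nn_integral_mono mult_right_mono power_mono epowr_mono SUP_mono)

lemma normL_mono: "(\<And>z. \<bar>H z\<bar> <= \<bar>H' z\<bar>) ==> normL N d T pv j H <= normL N d T pv j H'"
proof (induction j arbitrary: H H')
 case (Suc j)
 show ?case unfolding normL.simps
  by (intro Lnorm_mono Suc.IH) (simp add: Suc.prems abs_mult mult_right_mono)
qed (simp add: ennreal_leI)

lemma normL_cong: "(\<And>i. 1 <= i ==> i <= j ==> pv i = pv' i) ==> normL N d T pv j H = normL N d T pv' j H"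
proof (induction j arbitrary: H)
 case (Suc j)
 then have "pv (Suc j) = pv' (Suc j)" "\<And>H. normL N d T pv j H = normL N d T pv' j H" by simp_all
 then show ?case by simp
qed simp

text \<open>For a function supported on the ordered simplex, the ordering indicator in the norm is 1
  wherever the function does not vanish.\<close>

lemma normL_Suc:
 assumes "\<And>z. z \<notin> OR S (Suc j) u ==> H z = 0"
 shows "normL N d T pv (Suc j) H = Lnorm N d T (pv (Suc j)) (%w. normL N d T pv j (%z. H (z(Suc j := w))))"
proof -
 have "H (z(Suc j := w)) * (if j = 0 then 1 else if fst (z j) < fst w then 1 else 0) = H (z(Suc j := w))" for z w
 proof (cases "j = 0 \<or> fst (z j) < fst w")
  case False
  then have "z \<notin> OR S j (fst w)" unfolding OR_def by auto
  then have "H (z(Suc j := w)) = 0" by (intro assms) (metis OR_upd surjective_pairing)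
  then show ?thesis by simp
 qed auto
 then show ?thesis unfolding normL.simps by (simp only:)
qed

lemma finite_Lam: "finite (Lam N d)"
 unfolding Lam_def by (intro finite_PiE) auto

lemma card_Lam: "card (Lam N d) = N ^ d"
 unfolding Lam_def by (simp add: card_PiE)

lemma eps_card: "1 <= N ==> eps N ^ d * real (card (Lam N d)) = 1"
 unfolding eps_def card_Lam by (simp add: power_divide)

lemma eps_pos: "1 <= N ==> 0 < eps N"
 unfolding eps_def by simp

text \<open>For \<open>T <= 1\<close> the underlying measure has mass at most 1, because
  \<open>eps N ^ d\<close> is the reciprocal of the number of sites. Each of the three norms is then
  dominated by the supremum.\<close>

lemma Lnorm_le_const:
 assumes N: "1 <= N" and T: "0 <= T" "T <= 1" and K: "0 <= K" and G: "\<And>w. G w <= ennreal K"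
 shows "Lnorm N d T q G <= ennreal K"
proof -
 have base: "ennreal (eps N ^ d) * (\<Sum>x\<in>Lam N d. \<integral>\<^sup>+ r. F (r, x) * indicator {0..T} r \<partial>lborel) <= ennreal k"
  if k: "0 <= k" and F: "\<And>w. F w <= ennreal k" for F :: "pt => ennreal" and k
 proof -
  have "(\<integral>\<^sup>+ r. F (r, x) * indicator {0..T} r \<partial>lborel) <= ennreal k" for x
  proof -
   have "(\<integral>\<^sup>+ r. F (r, x) * indicator {0..T} r \<partial>lborel) <= (\<integral>\<^sup>+ r. ennreal k * indicator {0..T} r \<partial>lborel)"
    by (intro nn_integral_mono mult_right_mono F) auto
   also have "\<dots> = ennreal k * ennreal T" using T by (simp add: nn_integral_cmult)
   also have "\<dots> <= ennreal k" using k T by (simp add: ennreal_mult[symmetric] mult_left_le)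
   finally show ?thesis .
  qed
  then have "ennreal (eps N ^ d) * (\<Sum>x\<in>Lam N d. \<integral>\<^sup>+ r. F (r, x) * indicator {0..T} r \<partial>lborel) <= ennreal (eps N ^ d) * (\<Sum>x\<in>Lam N d. ennreal k)"
   by (intro mult_left_mono sum_mono) auto
  also have "\<dots> = ennreal (eps N ^ d * (real (card (Lam N d)) * k))"
   using k eps_pos[OF N] by (simp add: ennreal_of_nat_eq_real_of_nat ennreal_mult)
  also have "\<dots> = ennreal k" using eps_card[OF N] by (simp add: mult.assoc[symmetric])
  finally show ?thesis .
 qed
 show ?thesis
 proof (cases q)
  case E1 then show ?thesis unfolding Lnorm_def using base[OF K G] by simp
 next
  case E2
  have "(G w)\<^sup>2 <= ennreal (K\<^sup>2)" for w using power_mono[OF G, of w 2] K by (simp add: ennreal_power)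
  from epowr_mono[OF _ base[OF _ this], of "1/2"] show ?thesis unfolding Lnorm_def E2 using K by (simp add: epowr_half)
 next
  case Einf then show ?thesis unfolding Lnorm_def by (auto intro!: SUP_least G)
 qed
qed

lemma normL_le_const:
 assumes N: "1 <= N" and T: "0 <= T" "T <= 1" and K: "0 <= K"
 shows "(\<And>z. \<bar>H z\<bar> <= K) ==> normL N d T pv j H <= ennreal K"
proof (induction j arbitrary: H)
 case (Suc j)
 show ?case unfolding normL.simps
  by (intro Lnorm_le_const N T K Suc.IH) (use Suc.prems K in \<open>auto simp: abs_mult\<close>)
qed (simp add: ennreal_leI)

text \<open>Fatou's lemma for each of the three exponents. The weighted sum over sites is written as
  an integral against the scaled counting measure \<open>?C\<close>, so that Fatou's lemma covers it
  too. For the exponent 2 the squares are compared first and the root is taken by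
  \<open>less_epowr_half\<close>.\<close>

lemma Lnorm_liminf:
 fixes Gn :: "nat => pt => ennreal"
 assumes G: "\<And>w. G w <= liminf (%n. Gn n w)"
  and m: "\<And>n x. x \<in> Lam N d ==> (%r. Gn n (r, x) * indicator {0..T} r) \<in> borel_measurable borel"
 shows "Lnorm N d T q G <= liminf (%n. Lnorm N d T q (Gn n))"
proof -
 let ?C = "scale_measure (ennreal (eps N ^ d)) (count_space (Lam N d))"
 have eq: "ennreal (eps N ^ d) * (\<Sum>x\<in>Lam N d. \<integral>\<^sup>+ r. F (r, x) * indicator {0..T} r \<partial>lborel) = (\<integral>\<^sup>+x. \<integral>\<^sup>+ r. F (r, x) * indicator {0..T} r \<partial>lborel \<partial>?C)" for F :: "pt => ennreal"
  by (simp add: nn_integral_scale_measure nn_integral_count_space_finite finite_Lam)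
 have base: "ennreal (eps N ^ d) * (\<Sum>x\<in>Lam N d. \<integral>\<^sup>+ r. F (r, x) * indicator {0..T} r \<partial>lborel) <=
   liminf (%n. ennreal (eps N ^ d) * (\<Sum>x\<in>Lam N d. \<integral>\<^sup>+ r. Fn n (r, x) * indicator {0..T} r \<partial>lborel))"
  if F: "\<And>w. F w <= liminf (%n. Fn n w)" and Fm: "\<And>n x. x \<in> Lam N d ==> (%r. Fn n (r, x) * indicator {0..T} r) \<in> borel_measurable borel"
  for F and Fn :: "nat => pt => ennreal"
  unfolding eq
 proof -
  have "(\<integral>\<^sup>+x. \<integral>\<^sup>+ r. F (r, x) * indicator {0..T} r \<partial>lborel \<partial>?C) <= (\<integral>\<^sup>+x. liminf (%n. \<integral>\<^sup>+ r. Fn n (r, x) * indicator {0..T} r \<partial>lborel) \<partial>?C)"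
  proof (rule nn_integral_mono)
   fix x assume "x \<in> space ?C"
   then have x: "x \<in> Lam N d" by (simp add: space_scale_measure)
   have "(\<integral>\<^sup>+ r. F (r, x) * indicator {0..T} r \<partial>lborel) <= (\<integral>\<^sup>+ r. liminf (%n. Fn n (r, x) * indicator {0..T} r) \<partial>lborel)"
    using F by (intro nn_integral_mono) (auto simp: indicator_def)
   also have "\<dots> <= liminf (%n. \<integral>\<^sup>+ r. Fn n (r, x) * indicator {0..T} r \<partial>lborel)"
    using Fm[OF x] by (intro nn_integral_liminf) simp
   finally show "(\<integral>\<^sup>+ r. F (r, x) * indicator {0..T} r \<partial>lborel) <= liminf (%n. \<integral>\<^sup>+ r. Fn n (r, x) * indicator {0..T} r \<partial>lborel)" .
  qed
  also have "\<dots> <= liminf (%n. \<integral>\<^sup>+x. \<integral>\<^sup>+ r. Fn n (r, x) * indicator {0..T} r \<partial>lborel \<partial>?C)"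
   by (rule nn_integral_liminf) (auto simp: measurable_def space_scale_measure)
  finally show "(\<integral>\<^sup>+x. \<integral>\<^sup>+ r. F (r, x) * indicator {0..T} r \<partial>lborel \<partial>?C) <= liminf (%n. \<integral>\<^sup>+x. \<integral>\<^sup>+ r. Fn n (r, x) * indicator {0..T} r \<partial>lborel \<partial>?C)" .
 qed
 show ?thesis
 proof (cases q)
  case E1 then show ?thesis unfolding Lnorm_def using base[OF G m] by simp
 next
  case E2
  have c: "continuous_on UNIV (%x::ennreal. x\<^sup>2)"
   unfolding continuous_on_def power2_eq_square by (auto intro!: tendsto_mult_ennreal)
  have sq: "(G w)\<^sup>2 <= liminf (%n. (Gn n w)\<^sup>2)" for w
  proof -
   have "(G w)\<^sup>2 <= (liminf (%n. Gn n w))\<^sup>2" by (rule power_mono[OF G]) simp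
   also have "\<dots> = liminf (%n. (Gn n w)\<^sup>2)"
    by (rule Liminf_compose_continuous_mono[OF c, symmetric]) (auto simp: mono_def power_mono)
   finally show ?thesis .
  qed
  have sqm: "(%r. (Gn n (r, x))\<^sup>2 * indicator {0..T} r) \<in> borel_measurable borel" if "x \<in> Lam N d" for n x
  proof -
   have "(%r. (Gn n (r, x))\<^sup>2 * indicator {0..T} r) = (%r. (Gn n (r, x) * indicator {0..T} r)\<^sup>2)"
    by (auto simp: indicator_def fun_eq_iff)
   then show ?thesis unfolding power2_eq_square using borel_measurable_times_ennreal[OF m[OF that, of n] m[OF that, of n]] by simp
  qed
  let ?A = "ennreal (eps N ^ d) * (\<Sum>x\<in>Lam N d. \<integral>\<^sup>+ r. (G (r, x))\<^sup>2 * indicator {0..T} r \<partial>lborel)"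
  let ?An = "%n. ennreal (eps N ^ d) * (\<Sum>x\<in>Lam N d. \<integral>\<^sup>+ r. (Gn n (r, x))\<^sup>2 * indicator {0..T} r \<partial>lborel)"
  have "?A <= liminf ?An" using base[where F="%w. (G w)\<^sup>2" and Fn="%n w. (Gn n w)\<^sup>2", OF sq sqm] .
  then have "epowr ?A (1/2) <= liminf (%n. epowr (?An n) (1/2))"
   unfolding le_Liminf_iff less_epowr_half by blast
  then show ?thesis unfolding Lnorm_def E2 by simp
 next
  case Einf
  have "(SUP w\<in>{0..T} \<times> Lam N d. G w) <= liminf (%n. SUP w\<in>{0..T} \<times> Lam N d. Gn n w)"
  proof (rule SUP_least)
   fix w assume w: "w \<in> {0..T} \<times> Lam N d"
   have "G w <= liminf (%n. Gn n w)" by (rule G)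
   also have "\<dots> <= liminf (%n. SUP w\<in>{0..T} \<times> Lam N d. Gn n w)"
    by (intro Liminf_mono always_eventually allI SUP_upper w)
   finally show "G w <= liminf (%n. SUP w\<in>{0..T} \<times> Lam N d. Gn n w)" .
  qed
  then show ?thesis unfolding Lnorm_def Einf by simp
 qed
qed

text \<open>Measurability of slice norms and Fatou's lemma for mixed norms need each other: a slice
  norm is Borel because it is lower semicontinuous from the left, and that is Fatou's lemma at level
  \<open>j\<close>. The latter is therefore a premise, discharged by the induction hypothesis inside
  \<open>normL_liminf\<close>.\<close>

lemma normL_slice_borel_aux:
 assumes H: "goodH ks (Lam N d) (Suc j) u K H"
  and lsc: "\<And>H Hn. (\<And>n. \<exists>u K. goodH ks (Lam N d) j u K (Hn n)) ==> \<exists>u K. goodH ks (Lam N d) j u K H ==>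
    (\<And>z. ennreal \<bar>H z\<bar> <= liminf (%n. ennreal \<bar>Hn n z\<bar>)) ==> normL N d T pv j H <= liminf (%n. normL N d T pv j (Hn n))"
 shows "(%r. normL N d T pv j (%z. H (z(Suc j := (r, x)))) * indicator {0..T} r) \<in> borel_measurable borel"
\<comment> \<open>With a single variable the norm is the modulus of the function, and
  \<open>goodH\<close> gives Borel measurability; left continuity could fail here on a
  diagonal.\<close>
proof (cases "j = 0")
 case True
 show ?thesis using goodHD(5)[OF H, of z0 x] unfolding True by simp
next
 case False
 show ?thesis
 proof (rule left_lsc_borel)
  fix s X assume s: "0 < s" "s <= T" and X: "\<And>n::nat. 0 < X n \<and> X n < s" "X \<longlonglongrightarrow> s"
  show "normL N d T pv j (%z. H (z(Suc j := (s, x)))) <= liminf (%n. normL N d T pv j (%z. H (z(Suc j := (X n, x)))))"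
  proof (rule lsc)
   fix z
   show "ennreal \<bar>H (z(Suc j := (s, x)))\<bar> <= liminf (%n. ennreal \<bar>H (z(Suc j := (X n, x)))\<bar>)"
   proof (cases "z(Suc j := (s, x)) \<in> OR (Lam N d) (Suc j) u")
    case True
    from goodHD(4)[OF H True, of "Suc j"] have "((%r. H (z(Suc j := (r, x)))) \<longlongrightarrow> H (z(Suc j := (s, x)))) (at_left s)"
     using s False by simp
    moreover have "filterlim X (at_left s) sequentially"
     using X unfolding filterlim_at by (auto simp: less_imp_neq)
    ultimately have "(%n. H (z(Suc j := (X n, x)))) \<longlonglongrightarrow> H (z(Suc j := (s, x)))"
     by (rule filterlim_compose)
    then have "(%n. ennreal \<bar>H (z(Suc j := (X n, x)))\<bar>) \<longlonglongrightarrow> ennreal \<bar>H (z(Suc j := (s, x)))\<bar>"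
     by (intro tendsto_ennrealI tendsto_rabs)
    then show ?thesis using lim_imp_Liminf[OF sequentially_bot] by (metis order_refl)
   next
    case F: False
    then show ?thesis using goodHD(2)[OF H F] by simp
   qed
  qed (use goodH_slice[OF H] in blast)+
 qed
qed

lemma normL_liminf:
 assumes "\<And>n. \<exists>u K. goodH ks (Lam N d) j u K (Hn n)" "\<exists>u K. goodH ks (Lam N d) j u K H"
  "\<And>z. ennreal \<bar>H z\<bar> <= liminf (%n. ennreal \<bar>Hn n z\<bar>)"
 shows "normL N d T pv j H <= liminf (%n. normL N d T pv j (Hn n))"
 using assms
proof (induction j arbitrary: H Hn)
 case (Suc j)
 obtain un Kn where Hn: "\<And>n. goodH ks (Lam N d) (Suc j) (un n) (Kn n) (Hn n)" using Suc.prems(1) by metis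
 obtain u K where H: "goodH ks (Lam N d) (Suc j) u K H" using Suc.prems(2) by metis
 have e1: "normL N d T pv (Suc j) H = Lnorm N d T (pv (Suc j)) (%w. normL N d T pv j (%z. H (z(Suc j := w))))"
  by (rule normL_Suc[OF goodHD(2)[OF H]])
 have e2: "normL N d T pv (Suc j) (Hn n) = Lnorm N d T (pv (Suc j)) (%w. normL N d T pv j (%z. Hn n (z(Suc j := w))))" for n
  by (rule normL_Suc[OF goodHD(2)[OF Hn]])
 show ?case unfolding e1 e2
 proof (rule Lnorm_liminf)
  fix w
  show "normL N d T pv j (%z. H (z(Suc j := w))) <= liminf (%n. normL N d T pv j (%z. Hn n (z(Suc j := w))))"
   using goodH_slice[OF H, where s="fst w" and x="snd w"] goodH_slice[OF Hn, where s="fst w" and x="snd w"]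
   unfolding prod.collapse by (intro Suc.IH Suc.prems(3)) blast+
 next
  fix n x
  show "(%r. normL N d T pv j (%z. Hn n (z(Suc j := (r, x)))) * indicator {0..T} r) \<in> borel_measurable borel"
   by (rule normL_slice_borel_aux[OF Hn Suc.IH])
 qed
qed simp

lemma normL_slice_borel:
 "goodH ks (Lam N d) (Suc j) u K H ==> (%r. normL N d T pv j (%z. H (z(Suc j := (r, x)))) * indicator {0..T} r) \<in> borel_measurable borel"
 by (rule normL_slice_borel_aux[OF _ normL_liminf])

definition nr :: "nat => nat => real => (nat => expo) => nat => ((nat => pt) => real) => real" where
 "nr N d T pv j H = enn2real (normL N d T pv j H)"

text \<open>The right-hand side of the estimate without derivative norms, every mixed norm entering
  with power one. It is this quantity that reproduces itself in the induction over levels.\<close>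

definition SSr :: "nat => nat => real => real => (nat => nat set) => nat => ((nat => pt) => real) => real" where
 "SSr N d k T \<sigma> j H = (\<Sum>pv\<in>Padm \<sigma> j. eps N powr alpha d k \<sigma> j pv * nr N d T pv j H)"

text \<open>The constants of \<open>single_level1\<close> and \<open>single_level2\<close>. The
  parameter \<open>n\<close> stands for the number of exponent vectors and arises from squaring a
  sum over them; \<open>c\<close> is the part of the weighted jump size that does not depend on the
  lattice spacing.\<close>

definition level_const :: "nat => real => real => real => nat => real" where
 "level_const p c K0 n q = (if q = 1 then 4 * (1 + sqrt (2 ^ p * 4 * K0)) * (n + c) else c ^ q + 2 ^ p * 3 * K0 * (c ^ q / c\<^sup>2))"

primrec main_const :: "nat => real => real => (nat => nat set) => nat => real" where
 "main_const p c K0 \<sigma> 0 = 1"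
| "main_const p c K0 \<sigma> (Suc j) = level_const p c K0 (real (card (Padm \<sigma> j))) (card (\<sigma> (Suc j))) * main_const p c K0 \<sigma> j"

lemma nr_nonneg: "0 <= nr N d T pv j H"
 by (simp add: nr_def)

lemma normL_nr:
 assumes "1 <= N" "0 <= T" "T <= 1" "goodH ks S j u K H"
 shows "normL N d T pv j H = ennreal (nr N d T pv j H)" "nr N d T pv j H <= K"
proof -
 have l: "normL N d T pv j H <= ennreal K"
  by (rule normL_le_const[OF assms(1-3) goodHD(1)[OF assms(4)] goodHD(3)[OF assms(4)]])
 then have "normL N d T pv j H < \<infinity>" using ennreal_less_top[of K] by (simp add: order.strict_trans1 less_top)
 then show e: "normL N d T pv j H = ennreal (nr N d T pv j H)" by (simp add: nr_def less_top)
 then show "nr N d T pv j H <= K" using l goodHD(1)[OF assms(4)] by simp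
qed

lemma finite_Padm: "finite (Padm \<sigma> j)"
 unfolding Padm_def by (rule finite_subset[OF _ finite_PiE[of "{1..j}" "%_. {E1, E2, Einf}"]]) auto

lemma SSr_nonneg: "0 <= SSr N d k T \<sigma> j H"
 unfolding SSr_def by (intro sum_nonneg mult_nonneg_nonneg nr_nonneg) simp

lemma main_const_nonneg: "0 < c ==> 0 <= K0 ==> 0 <= main_const p c K0 \<sigma> j"
 by (induction j) (auto simp: level_const_def intro!: mult_nonneg_nonneg add_nonneg_nonneg divide_nonneg_nonneg)

lemma alpha_upd:
 "alpha d k \<sigma> (Suc j) (pv(Suc j := e)) = alpha d k \<sigma> j pv +
   (real d + k) * (real (card (\<sigma> (Suc j))) - (if e = E1 then 2 else if e = E2 then 1 else 0))"
proof -
 have c: "card {i\<in>{1..Suc j}. (pv(Suc j := e)) i = f} = card {i\<in>{1..j}. pv i = f} + (if e = f then 1 else 0)" for f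
 proof -
  have "{i\<in>{1..Suc j}. (pv(Suc j := e)) i = f} = {i\<in>{1..j}. pv i = f} \<union> (if e = f then {Suc j} else {})"
   by auto
  then show ?thesis by (simp add: card_Un_disjoint card_insert_if)
 qed
 show ?thesis unfolding alpha_def c by (auto simp: algebra_simps)
qed

lemma Padm_upd:
 assumes "pv \<in> Padm \<sigma> j" "e = E1 ==> card (\<sigma> (Suc j)) \<noteq> 1"
 shows "pv(Suc j := e) \<in> Padm \<sigma> (Suc j)"
proof -
 have 1: "pv \<in> PiE {1..j} (%_. {E1, E2, Einf})" and 2: "\<And>i. i \<in> {1..j} ==> pv i = E1 ==> card (\<sigma> i) \<noteq> 1"
  using assms(1) unfolding Padm_def Gamma1_def by auto
 have "e \<in> {E1, E2, Einf}" by (cases e) auto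
 then have "pv(Suc j := e) \<in> PiE (insert (Suc j) {1..j}) (%_. {E1, E2, Einf})"
  using 1 by (intro PiE_fun_upd) auto
 then have 3: "pv(Suc j := e) \<in> PiE {1..Suc j} (%_. {E1, E2, Einf})" by (simp add: atLeastAtMostSuc_conv)
 have "card (\<sigma> i) \<noteq> 1" if "i \<in> {1..Suc j}" "(pv(Suc j := e)) i = E1" for i
  using that 2[of i] assms(2) by (cases "i = Suc j") auto
 then show ?thesis using 3 unfolding Padm_def Gamma1_def by blast
qed

text \<open>Prescribing the exponent of the last component embeds the vectors for \<open>j\<close>
  components injectively into those for \<open>Suc j\<close>, so the left side is a partial sum of
  nonnegative terms. The premise keeps exponent 1 away from a singleton, as in
  \<open>Padm\<close>.\<close>

lemma SSr_Suc_ge: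
 assumes "e = E1 ==> card (\<sigma> (Suc j)) \<noteq> 1"
 shows "(\<Sum>pv\<in>Padm \<sigma> j. eps N powr alpha d k \<sigma> (Suc j) (pv(Suc j := e)) * nr N d T (pv(Suc j := e)) (Suc j) H) <= SSr N d k T \<sigma> (Suc j) H"
proof -
 have "inj_on (%pv. pv(Suc j := e)) (Padm \<sigma> j)"
 proof (rule inj_onI)
  fix pv pv' assume a: "pv \<in> Padm \<sigma> j" "pv' \<in> Padm \<sigma> j" "pv(Suc j := e) = pv'(Suc j := e)"
  have "pv (Suc j) = undefined" "pv' (Suc j) = undefined" using a(1,2) unfolding Padm_def by (auto simp: PiE_def extensional_def)
  then show "pv = pv'" using a(3) by (metis fun_upd_triv fun_upd_upd)
 qed
 then have "(\<Sum>pv\<in>Padm \<sigma> j. eps N powr alpha d k \<sigma> (Suc j) (pv(Suc j := e)) * nr N d T (pv(Suc j := e)) (Suc j) H)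
  = (\<Sum>pv\<in>(%pv. pv(Suc j := e)) ` Padm \<sigma> j. eps N powr alpha d k \<sigma> (Suc j) pv * nr N d T pv (Suc j) H)"
  by (simp add: sum.reindex)
 also have "\<dots> <= SSr N d k T \<sigma> (Suc j) H"
  unfolding SSr_def using assms by (intro sum_mono2 finite_Padm image_subsetI Padm_upd mult_nonneg_nonneg nr_nonneg) auto
 finally show ?thesis .
qed

text \<open>Translates a norm over \<open>[0,T]\<close> with values in \<open>ennreal\<close> into
  the pointwise and Bochner bounds over \<open>[0,u)\<close> that the single-level estimates take as
  hypotheses.\<close>

lemma Lnorm_lower_real:
 fixes f :: "pt => real"
 assumes f: "\<And>w. 0 <= f w" "\<And>w. f w <= K" and m: "\<And>x. x \<in> Lam N d ==> (%r. ennreal (f (r, x)) * indicator {0..T} r) \<in> borel_measurable borel"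
  and u: "0 <= u" "u <= T" and L: "Lnorm N d T e (%w. ennreal (f w)) = ennreal l" "0 <= l" and N: "1 <= N"
 shows "x \<in> Lam N d ==> borel_on u (%r. f (r, x))"
  "e = Einf ==> 0 <= s ==> s < u ==> x \<in> Lam N d ==> f (s, x) <= l"
  "e = E1 ==> eps N ^ d * (\<Sum>x\<in>Lam N d. LINT r:{0..<u}|lborel. f (r, x)) <= l"
  "e = E2 ==> eps N ^ d * (\<Sum>x\<in>Lam N d. LINT r:{0..<u}|lborel. (f (r, x))\<^sup>2) <= l\<^sup>2"
proof -
 have m1: "borel_on u (%r. f (r, x))" if x: "x \<in> Lam N d" for x
 proof -
  have "(%r. indicator {0..<u} r * f (r, x)) = (%r. indicator {0..<u} r * enn2real (ennreal (f (r, x)) * indicator {0..T} r))"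
   using f(1) u by (auto simp: indicator_def fun_eq_iff)
  then show ?thesis using m[OF x] by simp
 qed
 then show "x \<in> Lam N d ==> borel_on u (%r. f (r, x))" .
 have base: "ennreal (eps N ^ d * (\<Sum>x\<in>Lam N d. LINT r:{0..<u}|lborel. h (r, x))) <=
   ennreal (eps N ^ d) * (\<Sum>x\<in>Lam N d. \<integral>\<^sup>+ r. ennreal (h (r, x)) * indicator {0..T} r \<partial>lborel)"
  if h: "\<And>w. 0 <= h w" "\<And>w. h w <= K'" and hm: "\<And>x. x \<in> Lam N d ==> borel_on u (%r. h (r, x))" for h :: "pt => real" and K'
 proof -
  have "ennreal (LINT r:{0..<u}|lborel. h (r, x)) <= (\<integral>\<^sup>+ r. ennreal (h (r, x)) * indicator {0..T} r \<partial>lborel)" if x: "x \<in> Lam N d" for x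
  proof -
   have "set_integrable lborel {0..<u} (%r. h (r, x))"
    by (rule set_integrable_bounded(1)[OF hm[OF x], of K' 0 u]) (use h in auto)
   then have i: "integrable lborel (%r. indicator {0..<u} r * h (r, x))" by (simp add: set_integrable_def)
   have "ennreal (LINT r:{0..<u}|lborel. h (r, x)) = (\<integral>\<^sup>+ r. ennreal (indicator {0..<u} r * h (r, x)) \<partial>lborel)"
    unfolding set_lebesgue_integral_def real_scaleR_def using h by (intro nn_integral_eq_integral[OF i, symmetric]) auto
   also have "\<dots> <= (\<integral>\<^sup>+ r. ennreal (h (r, x)) * indicator {0..T} r \<partial>lborel)"
    using u by (intro nn_integral_mono) (auto simp: indicator_def)
   finally show ?thesis .
  qed
  then have "(\<Sum>x\<in>Lam N d. ennreal (LINT r:{0..<u}|lborel. h (r, x))) <= (\<Sum>x\<in>Lam N d. \<integral>\<^sup>+ r. ennreal (h (r, x)) * indicator {0..T} r \<partial>lborel)"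
   by (rule sum_mono)
  moreover have pos: "0 <= (LINT r:{0..<u}|lborel. h (r, x))" for x
   unfolding set_lebesgue_integral_def using h by (intro integral_nonneg_AE) auto
  ultimately show ?thesis
   using eps_pos[OF N] by (subst ennreal_mult) (auto intro!: sum_nonneg mult_left_mono simp: sum_ennreal)
 qed
 { assume "e = Einf" and w: "0 <= s" "s < u" "x \<in> Lam N d"
  then have "ennreal (f (s, x)) <= ennreal l" unfolding L(1)[symmetric] Lnorm_def using u by (auto intro!: SUP_upper2[of "(s, x)"])
  then show "f (s, x) <= l" using L(2) by simp }
 { assume e: "e = E1"
  have "ennreal (eps N ^ d * (\<Sum>x\<in>Lam N d. LINT r:{0..<u}|lborel. f (r, x))) <= ennreal l"
   using base[OF f m1] unfolding L(1)[symmetric] Lnorm_def e by simp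
  then show "eps N ^ d * (\<Sum>x\<in>Lam N d. LINT r:{0..<u}|lborel. f (r, x)) <= l" using L(2) by simp }
 { assume e: "e = E2"
  have "(%r. indicator {0..<u} r * (f (r, x))\<^sup>2) = (%r. (indicator {0..<u} r * f (r, x))\<^sup>2)" for x by (auto simp: indicator_def fun_eq_iff)
  then have m2: "borel_on u (%r. (f (r, x))\<^sup>2)" if "x \<in> Lam N d" for x
   using borel_measurable_power[OF m1[OF that], of 2] by simp
  have K: "(f w)\<^sup>2 <= K\<^sup>2" for w using f by (simp add: power_mono)
  let ?A = "ennreal (eps N ^ d) * (\<Sum>x\<in>Lam N d. \<integral>\<^sup>+ r. (ennreal (f (r, x)))\<^sup>2 * indicator {0..T} r \<partial>lborel)"
  have A: "ennreal (eps N ^ d * (\<Sum>x\<in>Lam N d. LINT r:{0..<u}|lborel. (f (r, x))\<^sup>2)) <= ?A"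
   using base[where h="%w. (f w)\<^sup>2", OF _ K m2] f(1) by (simp add: ennreal_power)
  have "epowr ?A (1/2) = ennreal l" using L(1) unfolding Lnorm_def e by simp
  moreover have "\<not> (ennreal l)\<^sup>2 < ?A" using less_epowr_half[of "ennreal l" ?A] \<open>epowr ?A (1/2) = ennreal l\<close> by simp
  ultimately have "?A <= ennreal (l\<^sup>2)" using L(2) by (simp add: ennreal_power not_less)
  with A have "ennreal (eps N ^ d * (\<Sum>x\<in>Lam N d. LINT r:{0..<u}|lborel. (f (r, x))\<^sup>2)) <= ennreal (l\<^sup>2)" by (rule order_trans)
  then show "eps N ^ d * (\<Sum>x\<in>Lam N d. LINT r:{0..<u}|lborel. (f (r, x))\<^sup>2) <= l\<^sup>2" by simp }
qed

text \<open>The norm of a slice, taken as a function of the last variable, is measured by the norm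
  with one more exponent: one claim each for infinity, 1 and 2.\<close>

lemma nr_slice:
 assumes H: "goodH ks (Lam N d) (Suc j) u K H" and N: "1 <= N" and T: "0 <= u" "u <= T" "T <= 1"
 defines "\<phi> \<equiv> %pv w. nr N d T pv j (%z. H (z(Suc j := w)))"
 shows "\<phi> pv w <= K" "x \<in> Lam N d ==> borel_on u (%r. \<phi> pv (r, x))"
  "0 <= s ==> s < u ==> x \<in> Lam N d ==> \<phi> pv (s, x) <= nr N d T (pv(Suc j := Einf)) (Suc j) H"
  "eps N ^ d * (\<Sum>x\<in>Lam N d. LINT r:{0..<u}|lborel. \<phi> pv (r, x)) <= nr N d T (pv(Suc j := E1)) (Suc j) H"
  "eps N ^ d * (\<Sum>x\<in>Lam N d. LINT r:{0..<u}|lborel. (\<phi> pv (r, x))\<^sup>2) <= (nr N d T (pv(Suc j := E2)) (Suc j) H)\<^sup>2"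
proof -
 have T': "0 <= T" using T by simp
 have e: "normL N d T pv j (%z. H (z(Suc j := w))) = ennreal (\<phi> pv w)" "\<phi> pv w <= K" for w
  using normL_nr[OF N T' T(3) goodH_slice[OF H, where s="fst w" and x="snd w"]] unfolding \<phi>_def by simp_all
 show "\<phi> pv w <= K" by (rule e)
 have L: "Lnorm N d T f (%w. ennreal (\<phi> pv w)) = ennreal (nr N d T (pv(Suc j := f)) (Suc j) H)" for f
 proof -
  have "normL N d T (pv(Suc j := f)) (Suc j) H = Lnorm N d T f (%w. normL N d T (pv(Suc j := f)) j (%z. H (z(Suc j := w))))"
   by (subst normL_Suc[OF goodHD(2)[OF H]]) simp_all
  also have "\<dots> = Lnorm N d T f (%w. ennreal (\<phi> pv w))"
   unfolding e(1)[symmetric] by (intro arg_cong[where f="Lnorm N d T f"] ext normL_cong) auto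
  finally show ?thesis using normL_nr(1)[OF N T' T(3) H] by metis
 qed
 note l = Lnorm_lower_real[where f="\<phi> pv" and K=K and T=T, OF _ e(2) _ T(1,2) L nr_nonneg N]
 have \<phi>0: "0 <= \<phi> pv w" for w unfolding \<phi>_def by (rule nr_nonneg)
 have m: "(%r. ennreal (\<phi> pv (r, x)) * indicator {0..T} r) \<in> borel_measurable borel" for x
  unfolding e(1)[symmetric] by (rule normL_slice_borel[OF H])
 show "x \<in> Lam N d ==> borel_on u (%r. \<phi> pv (r, x))" by (rule l(1)[OF \<phi>0 m])
 show "0 <= s ==> s < u ==> x \<in> Lam N d ==> \<phi> pv (s, x) <= nr N d T (pv(Suc j := Einf)) (Suc j) H" by (rule l(2)[OF \<phi>0 m refl])
 show "eps N ^ d * (\<Sum>x\<in>Lam N d. LINT r:{0..<u}|lborel. \<phi> pv (r, x)) <= nr N d T (pv(Suc j := E1)) (Suc j) H" by (rule l(3)[OF \<phi>0 m refl])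
 show "eps N ^ d * (\<Sum>x\<in>Lam N d. LINT r:{0..<u}|lborel. (\<phi> pv (r, x))\<^sup>2) <= (nr N d T (pv(Suc j := E2)) (Suc j) H)\<^sup>2" by (rule l(4)[OF \<phi>0 m refl])
qed

lemma sum_sq_le_sq_sum:
 fixes b :: "'i => real"
 assumes "\<And>i. i \<in> I ==> 0 <= b i"
 shows "(\<Sum>i\<in>I. (b i)\<^sup>2) <= (\<Sum>i\<in>I. b i)\<^sup>2"
proof -
 have "L2_set b I <= sum b I" using assms by (rule L2_set_le_sum)
 then have "(L2_set b I)\<^sup>2 <= (sum b I)\<^sup>2" by (rule power_mono) (rule L2_set_nonneg)
 then show ?thesis unfolding L2_set_def by (simp add: sum_nonneg)
qed

section \<open>Induction over the components\<close>

text \<open>The induction hypothesis, applied to the slice at \<open>(s, x)\<close>, bounds the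
  inner integral by \<open>g x s\<close>, a weighted sum of slice norms. The L1, L2 and supremum
  norms of \<open>g\<close> are bounded by mixed norms with the exponent 1, 2 or infinity appended,
  and the power of \<open>\<eta>\<close> in the single-level estimate supplies the matching
  increment of \<open>alpha\<close>.\<close>

lemma (in lattice_noise) main_bound:
 assumes N: "1 <= N" and T: "T <= 1" and \<eta>: "\<eta> = c * eps N powr (real d + k)" and c: "0 < c"
  and ks: "\<And>i. ks i = card (\<sigma> i)" and p: "2 <= p" "even p"
 shows "0 <= u ==> u <= T ==> goodH ks S j u K H ==>
  \<exists>Vp. Vp \<in> borel_measurable P \<and> (AE \<omega> in P. \<forall>t. 0 <= t --> t <= u --> ennreal (\<bar>I j H t \<omega>\<bar> ^ p) <= Vp \<omega>) \<and>
   (\<integral>\<^sup>+\<omega>. Vp \<omega> \<partial>P) <= ennreal ((main_const p c K0 \<sigma> j * SSr N d k T \<sigma> j H) ^ p)"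
proof (induction j arbitrary: u K H)
 case 0
 have "SSr N d k T \<sigma> 0 H = \<bar>H z0\<bar>"
  using eps_pos[OF N] by (simp add: SSr_def Padm_def alpha_def nr_def)
 then show ?case by (intro exI[of _ "%_. ennreal (\<bar>H z0\<bar> ^ p)"]) (simp add: emeasure_space_1)
next
 case (Suc j)
 note H = Suc.prems(3)
 note HL = H[unfolded S_eq]
 define q where "q = card (\<sigma> (Suc j))"
 have q: "ks (Suc j) = q" unfolding q_def by (rule ks)
 let ?Cj = "main_const p c K0 \<sigma> j" and ?P = "Padm \<sigma> j" and ?n = "real (card (Padm \<sigma> j))" and ?h = "eps N powr (real d + k)"
 have Cj: "0 <= ?Cj" by (rule main_const_nonneg[OF c K0])
 show ?case
 proof (cases "u = 0")
  case True
  have "ennreal (\<bar>I (Suc j) H t \<omega>\<bar> ^ p) = 0" if "0 <= t" "t <= u" for t \<omega>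
   using that I_Suc_0 True p by (simp add: power_0_left)
  then show ?thesis by (intro exI[of _ "%_. 0"]) auto
 next
  case False
  then have u: "0 < u" "u <= 1" using Suc.prems T by auto
  define w where "w pv = eps N powr alpha d k \<sigma> j pv" for pv
  define \<phi> where "\<phi> pv z' = nr N d T pv j (%z. H (z(Suc j := z')))" for pv z'
  define nn where "nn e pv = nr N d T (pv(Suc j := e)) (Suc j) H" for e pv
  define g where "g x s = ?Cj * (\<Sum>pv\<in>?P. w pv * \<phi> pv (s, x))" for x s
  note sl = nr_slice[OF HL N Suc.prems(1,2) T, folded S_eq v_eq, folded \<phi>_def nn_def]
  have w0: "0 <= w pv" for pv unfolding w_def by simp
  have \<phi>0: "0 <= \<phi> pv z" for pv z unfolding \<phi>_def by (rule nr_nonneg)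
  have nn0: "0 <= nn e pv" for e pv unfolding nn_def by (rule nr_nonneg)
  have K: "0 <= K" by (rule goodHD(1)[OF H])
  let ?T = "%e. \<Sum>pv\<in>?P. w pv * nn e pv"
  have T0: "0 <= ?T e" for e by (intro sum_nonneg mult_nonneg_nonneg w0 nn0)
  have gm: "borel_on u (%s. g x s)" if x: "x \<in> S" for x
  proof -
   have "(%s. indicator {0..<u} s * g x s) = (%s. ?Cj * (\<Sum>pv\<in>?P. w pv * (indicator {0..<u} s * \<phi> pv (s, x))))"
    unfolding g_def by (simp add: sum_distrib_left mult_ac)
   then show ?thesis by (simp only:) (intro borel_measurable_times[OF borel_measurable_const] borel_measurable_sum sl(2) x)
  qed
  have gb: "0 <= g x s \<and> g x s <= ?Cj * ?T Einf" if "x \<in> S" "0 <= s" "s < u" for x s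
   unfolding g_def using sl(3)[OF that(2,3,1)] Cj w0 \<phi>0
   by (intro conjI mult_nonneg_nonneg sum_nonneg mult_left_mono sum_mono) auto
  have gE: "expectation (%\<omega>. \<bar>Y j H x s \<omega>\<bar> ^ p) <= g x s ^ p" if x: "x \<in> S" and s: "0 <= s" "s < u" for x s
  proof -
   obtain Vp where V: "Vp \<in> borel_measurable P" "AE \<omega> in P. \<forall>t. 0 <= t --> t <= s --> ennreal (\<bar>I j (%z. H (z(Suc j := (s, x)))) t \<omega>\<bar> ^ p) <= Vp \<omega>"
    "(\<integral>\<^sup>+\<omega>. Vp \<omega> \<partial>P) <= ennreal ((?Cj * SSr N d k T \<sigma> j (%z. H (z(Suc j := (s, x))))) ^ p)"
    using Suc.IH[OF s(1) _ goodH_slice[OF H, where x=x]] s Suc.prems(2) by (meson less_imp_le order_trans)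
   have "?Cj * SSr N d k T \<sigma> j (%z. H (z(Suc j := (s, x)))) = g x s" unfolding g_def SSr_def w_def \<phi>_def ..
   note V3 = V(3)[unfolded this]
   have m: "Y j H x s \<in> borel_measurable P"
    unfolding Y_def[abs_def] by (rule meas_Fl_P[OF s(1) I_adapted[OF s(1) _ goodH_slice[OF H]]]) (use s u in simp)
   have "(\<integral>\<^sup>+\<omega>. ennreal (\<bar>Y j H x s \<omega>\<bar> ^ p) \<partial>P) <= (\<integral>\<^sup>+\<omega>. Vp \<omega> \<partial>P)"
    using V(2) s unfolding Y_def by (intro nn_integral_mono_AE) (auto elim!: eventually_mono)
   then have "(\<integral>\<^sup>+\<omega>. ennreal (\<bar>Y j H x s \<omega>\<bar> ^ p) \<partial>P) <= ennreal (g x s ^ p)" using V3 by (rule order_trans)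
   then have "enn2real (\<integral>\<^sup>+\<omega>. ennreal (\<bar>Y j H x s \<omega>\<bar> ^ p) \<partial>P) <= g x s ^ p"
    using gb[OF that] by (intro enn2real_leI) auto
   then show ?thesis using m by (subst integral_eq_nn_integral) auto
  qed
  have int: "set_integrable lborel {0..<u} (%s. \<phi> pv (s, x))" "set_integrable lborel {0..<u} (%s. (\<phi> pv (s, x))\<^sup>2)" if x: "x \<in> S" for pv x
  proof -
   show "set_integrable lborel {0..<u} (%s. \<phi> pv (s, x))"
    by (rule set_integrable_bounded(1)[OF sl(2)[OF x], where B=K and a=0 and b=u]) (use sl(1) \<phi>0 in auto)
   have "(%s. indicator {0..<u} s * (\<phi> pv (s, x))\<^sup>2) = (%s. (indicator {0..<u} s * \<phi> pv (s, x))\<^sup>2)" by (auto simp: indicator_def fun_eq_iff)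
   then have "borel_on u (%s. (\<phi> pv (s, x))\<^sup>2)"
    using borel_measurable_power[OF sl(2)[OF x], where n=2] by simp
   then show "set_integrable lborel {0..<u} (%s. (\<phi> pv (s, x))\<^sup>2)"
    by (rule set_integrable_bounded(1)[where B="K\<^sup>2" and a=0 and b=u]) (use sl(1) \<phi>0 in \<open>auto simp: power_mono\<close>)
  qed
  have lin: "v * (\<Sum>x\<in>S. LINT s:{0..<u}|lborel. (\<Sum>pv\<in>?P. a pv * f pv s x)) = (\<Sum>pv\<in>?P. a pv * (v * (\<Sum>x\<in>S. LINT s:{0..<u}|lborel. f pv s x)))"
   if "\<And>pv x. x \<in> S ==> set_integrable lborel {0..<u} (%s. f pv s x)" for a :: "(nat => expo) => real" and f :: "(nat => expo) => real => site => real"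
  proof -
   have "(LINT s:{0..<u}|lborel. (\<Sum>pv\<in>?P. a pv * f pv s x)) = (\<Sum>pv\<in>?P. a pv * (LINT s:{0..<u}|lborel. f pv s x))" if x: "x \<in> S" for x
    using set_integral_weighted_sum[where c=1 and I="?P" and f="%pv s. a pv * f pv s x" and A="{0..<u}"] that x \<open>\<And>pv x. x \<in> S ==> set_integrable lborel {0..<u} (%s. f pv s x)\<close>[OF x]
    by simp
   then have "v * (\<Sum>x\<in>S. LINT s:{0..<u}|lborel. (\<Sum>pv\<in>?P. a pv * f pv s x)) = v * (\<Sum>x\<in>S. \<Sum>pv\<in>?P. a pv * (LINT s:{0..<u}|lborel. f pv s x))"
    by simp
   also have "\<dots> = v * (\<Sum>pv\<in>?P. \<Sum>x\<in>S. a pv * (LINT s:{0..<u}|lborel. f pv s x))" by (subst sum.swap) simp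
   finally show ?thesis by (simp only: sum_distrib_left mult_ac)
  qed
  have l1: "v * (\<Sum>x\<in>S. LINT s:{0..<u}|lborel. g x s) <= ?Cj * ?T E1"
  proof -
   have "v * (\<Sum>x\<in>S. LINT s:{0..<u}|lborel. g x s) = ?Cj * (v * (\<Sum>x\<in>S. LINT s:{0..<u}|lborel. (\<Sum>pv\<in>?P. w pv * \<phi> pv (s, x))))"
    unfolding g_def set_integral_mult_right by (simp only: sum_distrib_left mult_ac)
   also have "v * (\<Sum>x\<in>S. LINT s:{0..<u}|lborel. (\<Sum>pv\<in>?P. w pv * \<phi> pv (s, x))) = (\<Sum>pv\<in>?P. w pv * (v * (\<Sum>x\<in>S. LINT s:{0..<u}|lborel. \<phi> pv (s, x))))"
    by (rule lin) (rule int(1))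
   also have "?Cj * \<dots> <= ?Cj * ?T E1"
    using sl(4) Cj w0 by (intro mult_left_mono sum_mono) auto
   finally show ?thesis .
  qed
  \<comment> \<open>Squaring the sum over exponent vectors costs a factor \<open>?n\<close> by
    Cauchy-Schwarz. The remaining sum of squares is at most the square of the sum, and
    \<open>?n\<close> is enlarged to its square to make the bound a perfect square.\<close>
  have l2: "v * (\<Sum>x\<in>S. LINT s:{0..<u}|lborel. (g x s)\<^sup>2) <= (?Cj * ?n * ?T E2)\<^sup>2"
  proof -
   have "(LINT s:{0..<u}|lborel. (g x s)\<^sup>2) <= (LINT s:{0..<u}|lborel. (\<Sum>pv\<in>?P. (?Cj\<^sup>2 * ?n * (w pv)\<^sup>2) * (\<phi> pv (s, x))\<^sup>2))" if x: "x \<in> S" for x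
   proof (rule set_integral_mono)
    have e: "(%s. indicator {0..<u} s * (g x s)\<^sup>2) = (%s. (indicator {0..<u} s * g x s)\<^sup>2)" by (auto simp: indicator_def fun_eq_iff)
    have "borel_on u (%s. (g x s)\<^sup>2)"
     unfolding e by (rule borel_measurable_power[OF gm[OF x]])
    then show "set_integrable lborel {0..<u} (%s. (g x s)\<^sup>2)"
     by (rule set_integrable_bounded(1)[where B="(?Cj * ?T Einf)\<^sup>2" and a=0 and b=u]) (use gb[OF x] in \<open>auto simp: power_mono\<close>)
    have "set_integrable lborel {0..<u} (%s. (?Cj\<^sup>2 * ?n * (w pv)\<^sup>2) * (\<phi> pv (s, x))\<^sup>2)" for pv
     by (rule set_integrable_mult_right) (rule int(2)[OF x])
    then show "set_integrable lborel {0..<u} (%s. \<Sum>pv\<in>?P. (?Cj\<^sup>2 * ?n * (w pv)\<^sup>2) * (\<phi> pv (s, x))\<^sup>2)"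
     unfolding set_integrable_def scaleR_sum_right by (intro Bochner_Integration.integrable_sum)
    fix s
    have "(g x s)\<^sup>2 = ?Cj\<^sup>2 * (\<Sum>pv\<in>?P. w pv * \<phi> pv (s, x))\<^sup>2" unfolding g_def by (simp add: power_mult_distrib)
    also have "\<dots> <= ?Cj\<^sup>2 * ((\<Sum>pv\<in>?P. (w pv * \<phi> pv (s, x))\<^sup>2) * ?n)"
     by (intro mult_left_mono sum_squared_le_sum_of_squares) simp
    also have "\<dots> = (\<Sum>pv\<in>?P. (?Cj\<^sup>2 * ?n * (w pv)\<^sup>2) * (\<phi> pv (s, x))\<^sup>2)"
     by (simp only: power_mult_distrib sum_distrib_left sum_distrib_right mult_ac)
    finally show "(g x s)\<^sup>2 <= (\<Sum>pv\<in>?P. (?Cj\<^sup>2 * ?n * (w pv)\<^sup>2) * (\<phi> pv (s, x))\<^sup>2)" .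
   qed
   then have "v * (\<Sum>x\<in>S. LINT s:{0..<u}|lborel. (g x s)\<^sup>2) <= v * (\<Sum>x\<in>S. LINT s:{0..<u}|lborel. (\<Sum>pv\<in>?P. (?Cj\<^sup>2 * ?n * (w pv)\<^sup>2) * (\<phi> pv (s, x))\<^sup>2))"
    using v by (intro mult_left_mono sum_mono) auto
   also have "\<dots> = (\<Sum>pv\<in>?P. (?Cj\<^sup>2 * ?n * (w pv)\<^sup>2) * (v * (\<Sum>x\<in>S. LINT s:{0..<u}|lborel. (\<phi> pv (s, x))\<^sup>2)))"
    by (rule lin) (rule int(2))
   also have "\<dots> <= (\<Sum>pv\<in>?P. (?Cj\<^sup>2 * ?n * (w pv)\<^sup>2) * (nn E2 pv)\<^sup>2)"
    using sl(5) by (intro sum_mono mult_left_mono) auto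
   also have "\<dots> = ?Cj\<^sup>2 * ?n * (\<Sum>pv\<in>?P. (w pv * nn E2 pv)\<^sup>2)"
    by (simp only: power_mult_distrib sum_distrib_left mult_ac)
   also have "\<dots> <= ?Cj\<^sup>2 * ?n\<^sup>2 * (?T E2)\<^sup>2"
   proof (intro mult_mono mult_left_mono sum_sq_le_sq_sum mult_nonneg_nonneg w0 nn0 sum_nonneg)
    have "card ?P <= card ?P ^ 2" unfolding power2_eq_square by (rule le_square)
    then show "?n <= ?n\<^sup>2" by (metis of_nat_mono of_nat_power)
   qed auto
   finally show ?thesis by (simp only: power_mult_distrib)
  qed
  have Cn: "0 <= K * Dj j" by (intro mult_nonneg_nonneg K Dj_nonneg)
  have mono: "y ^ p <= (main_const p c K0 \<sigma> (Suc j) * SSr N d k T \<sigma> (Suc j) H) ^ p" if "y <= level_const p c K0 ?n q * ?Cj * SSr N d k T \<sigma> (Suc j) H" "0 <= y" for y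
   using that by (intro power_mono) (simp_all add: q_def)
  \<comment> \<open>Appending the exponent \<open>e\<close> changes \<open>alpha\<close> by
    \<open>d + k\<close> times the size of the component minus 2, 1 or 0.\<close>
  have aw: "w pv * eps N powr ((real d + k) * r) = eps N powr alpha d k \<sigma> (Suc j) (pv(Suc j := e))"
   if "r = real q - (if e = E1 then 2 else if e = E2 then 1 else 0)" for pv e r
   unfolding w_def alpha_upd that q_def[symmetric] by (rule powr_add[symmetric])
  have TS: "eps N powr ((real d + k) * r) * ?T e <= SSr N d k T \<sigma> (Suc j) H"
   if "r = real q - (if e = E1 then 2 else if e = E2 then 1 else 0)" "e = E1 ==> q \<noteq> 1" for e r
  proof -
   have "eps N powr ((real d + k) * r) * ?T e = (\<Sum>pv\<in>?P. (w pv * eps N powr ((real d + k) * r)) * nn e pv)"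
    by (simp only: sum_distrib_left mult_ac)
   also have "\<dots> <= SSr N d k T \<sigma> (Suc j) H"
    unfolding aw[OF that(1)] nn_def using that(2) unfolding q_def by (rule SSr_Suc_ge)
   finally show ?thesis .
  qed
  have S0: "0 <= SSr N d k T \<sigma> (Suc j) H" by (rule SSr_nonneg)
  show ?thesis
  proof (cases "q = 1")
   case True
   have Yl: "LA u (Y j H x)" if "x \<in> S" for x
    by (rule Y_LA[OF H u(2) that]) (use q True in auto)
   let ?y = "4 * (1 + sqrt (2 ^ p * 4 * K0)) * (?Cj * ?n * ?T E2 + \<eta> * (?Cj * ?T Einf))"
   obtain Vp where V: "Vp \<in> borel_measurable P" "AE \<omega> in P. \<forall>t. 0 <= t --> t <= u --> ennreal (\<bar>Mint (Y j H) t \<omega>\<bar> ^ p) <= Vp \<omega>"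
     "(\<integral>\<^sup>+\<omega>. Vp \<omega> \<partial>P) <= ennreal (?y ^ p)"
    using single_level1[OF u Yl Y_polyb[OF H u(2)] Cn p gm gb gE mult_nonneg_nonneg[OF Cj T0] l2 mult_nonneg_nonneg[OF mult_nonneg_nonneg[OF Cj of_nat_0_le_iff] T0]] by blast
   \<comment> \<open>For a singleton the exponent 2 leaves the power of the lattice spacing
     unchanged, while the supremum term carries one factor \<open>\<eta>\<close>, which is what the
     exponent infinity adds to \<open>alpha\<close>.\<close>
   have "?T E2 <= SSr N d k T \<sigma> (Suc j) H" using TS[of 0 E2] True eps_pos[OF N] by simp
   moreover have "?h * ?T Einf <= SSr N d k T \<sigma> (Suc j) H" using TS[of 1 Einf] True by simp
   ultimately have "?Cj * ?n * ?T E2 + \<eta> * (?Cj * ?T Einf) <= ?Cj * ?n * SSr N d k T \<sigma> (Suc j) H + ?Cj * c * SSr N d k T \<sigma> (Suc j) H"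
   proof (intro add_mono)
    assume a1: "?T E2 <= SSr N d k T \<sigma> (Suc j) H" and a2: "?h * ?T Einf <= SSr N d k T \<sigma> (Suc j) H"
    show "?Cj * ?n * ?T E2 <= ?Cj * ?n * SSr N d k T \<sigma> (Suc j) H" using a1 Cj by (intro mult_left_mono) auto
    have "?Cj * c * (?h * ?T Einf) <= ?Cj * c * SSr N d k T \<sigma> (Suc j) H" using a2 Cj c by (intro mult_left_mono) auto
    then show "\<eta> * (?Cj * ?T Einf) <= ?Cj * c * SSr N d k T \<sigma> (Suc j) H" unfolding \<eta> by (simp only: mult_ac)
   qed
   then have "4 * (1 + sqrt (2 ^ p * 4 * K0)) * (?Cj * ?n * ?T E2 + \<eta> * (?Cj * ?T Einf)) <= 4 * (1 + sqrt (2 ^ p * 4 * K0)) * (?Cj * ?n * SSr N d k T \<sigma> (Suc j) H + ?Cj * c * SSr N d k T \<sigma> (Suc j) H)"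
    using K0 by (intro mult_left_mono) auto
   also have "\<dots> = level_const p c K0 ?n q * ?Cj * SSr N d k T \<sigma> (Suc j) H"
    unfolding level_const_def if_P[OF True] by (simp add: algebra_simps)
   finally have "?y <= level_const p c K0 ?n q * ?Cj * SSr N d k T \<sigma> (Suc j) H" .
   then have "?y ^ p <= (main_const p c K0 \<sigma> (Suc j) * SSr N d k T \<sigma> (Suc j) H) ^ p"
    using K0 Cj T0 by (intro mono mult_nonneg_nonneg[OF _ add_nonneg_nonneg] mult_nonneg_nonneg less_imp_le[OF eta_pos]) auto
   then have "(\<integral>\<^sup>+\<omega>. Vp \<omega> \<partial>P) <= ennreal ((main_const p c K0 \<sigma> (Suc j) * SSr N d k T \<sigma> (Suc j) H) ^ p)"
    using V(3) ennreal_leI order_trans by blast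
   then show ?thesis using V(1,2) unfolding I_Suc q if_P[OF True] by blast
  next
   case q1: False
   let ?y = "\<eta> ^ q * (?Cj * ?T Einf + 2 ^ p * 3 * K0 / \<eta>\<^sup>2 * (?Cj * ?T E1))"
   have "\<exists>Vp. Vp \<in> borel_measurable P \<and> (AE \<omega> in P. \<forall>t. 0 <= t --> t <= u --> ennreal (\<bar>Jint q (Y j H) t \<omega>\<bar> ^ p) <= Vp \<omega>) \<and>
     (\<integral>\<^sup>+\<omega>. Vp \<omega> \<partial>P) <= ennreal (?y ^ p)"
   proof (cases "j = 0")
    case True
    \<comment> \<open>The first-level integrand is deterministic: its modulus becomes the Borel
      factor, with the constant 1 as the random factor.\<close>
    let ?H = "%x s. \<bar>H (z0(Suc 0 := (s, x)))\<bar>"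
    have Y0: "Y j H x s \<omega> = H (z0(Suc 0 := (s, x)))" for x s \<omega> unfolding Y_def True by simp
    show ?thesis
    proof (rule single_level2[where Y="%_ _ _. 1" and H="?H" and K=K and C=1 and j=0, OF u LA_const polyb_const _ _ _ K _ p(1) gm gb _ mult_nonneg_nonneg[OF Cj T0] l1 mult_nonneg_nonneg[OF Cj T0]])
     show "borel_on u (%s. ?H x s)" for x
      by (rule borel_measurable_times[OF borel_measurable_indicator borel_measurable_abs[OF goodHD(5)[OF H, of z0 x, unfolded One_nat_def]]]) simp
     show "0 <= ?H x s \<and> ?H x s <= K" for x s using goodHD(3)[OF H] by simp
     show "expectation (%\<omega>. \<bar>1::real\<bar> ^ p) * ?H x s ^ p <= g x s ^ p" if "x \<in> S" "0 <= s" "s < u" for x s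
      using gE[OF that] unfolding Y0 by (simp add: prob_space)
    qed (simp_all add: Y0)
   next
    case False
    have Yl: "LA u (Y j H x)" if "x \<in> S" for x
     by (rule Y_LA[OF H u(2) that]) (use False in auto)
    show ?thesis
     by (rule single_level2[where Y="Y j H" and H="%_ _. 1" and K=1, OF u Yl Y_polyb[OF H u(2)] Cn _ _ _ _ p(1) gm gb _ mult_nonneg_nonneg[OF Cj T0] l1 mult_nonneg_nonneg[OF Cj T0]])
      (simp_all add: gE)
   qed
   then obtain Vp where V: "Vp \<in> borel_measurable P" "AE \<omega> in P. \<forall>t. 0 <= t --> t <= u --> ennreal (\<bar>Jint q (Y j H) t \<omega>\<bar> ^ p) <= Vp \<omega>"
     "(\<integral>\<^sup>+\<omega>. Vp \<omega> \<partial>P) <= ennreal (?y ^ p)" by blast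
   have h0: "0 < ?h" using eps_pos[OF N] by simp
   have hq: "?h ^ q = eps N powr ((real d + k) * real q)" using eps_pos[OF N] by (simp add: powr_power mult.commute)
   have hq2: "?h ^ q / ?h\<^sup>2 = eps N powr ((real d + k) * (real q - 2))"
   proof -
    have "?h\<^sup>2 = eps N powr ((real d + k) * 2)" using eps_pos[OF N] powr_power[of "eps N" "real d + k" 2] by (simp add: mult.commute)
    then show ?thesis unfolding hq by (simp add: powr_diff[symmetric] right_diff_distrib)
   qed
   have a: "?h ^ q * ?T Einf <= SSr N d k T \<sigma> (Suc j) H" unfolding hq by (rule TS) auto
   have b: "(?h ^ q / ?h\<^sup>2) * ?T E1 <= SSr N d k T \<sigma> (Suc j) H" unfolding hq2 by (rule TS) (use q1 in auto)
   have "?y = ?Cj * c ^ q * (?h ^ q * ?T Einf) + ?Cj * (2 ^ p * 3 * K0 * (c ^ q / c\<^sup>2)) * ((?h ^ q / ?h\<^sup>2) * ?T E1)"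
    unfolding \<eta> power_mult_distrib using c h0 by (simp add: field_simps)
   also have "\<dots> <= ?Cj * c ^ q * SSr N d k T \<sigma> (Suc j) H + ?Cj * (2 ^ p * 3 * K0 * (c ^ q / c\<^sup>2)) * SSr N d k T \<sigma> (Suc j) H"
    using a b Cj c K0 by (intro add_mono mult_left_mono mult_nonneg_nonneg) auto
   also have "\<dots> = level_const p c K0 ?n q * ?Cj * SSr N d k T \<sigma> (Suc j) H"
    unfolding level_const_def if_not_P[OF q1] by (simp add: algebra_simps)
   finally have "?y <= level_const p c K0 ?n q * ?Cj * SSr N d k T \<sigma> (Suc j) H" .
   then have "?y ^ p <= (main_const p c K0 \<sigma> (Suc j) * SSr N d k T \<sigma> (Suc j) H) ^ p"
    using K0 Cj T0 by (intro mono mult_nonneg_nonneg[OF zero_le_power[OF less_imp_le[OF eta_pos]]] add_nonneg_nonneg mult_nonneg_nonneg divide_nonneg_nonneg) auto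
   then have "(\<integral>\<^sup>+\<omega>. Vp \<omega> \<partial>P) <= ennreal ((main_const p c K0 \<sigma> (Suc j) * SSr N d k T \<sigma> (Suc j) H) ^ p)"
    using V(3) ennreal_leI order_trans by blast
   then show ?thesis using V(1,2) unfolding I_Suc q if_not_P[OF q1] by blast
  qed
 qed
qed

section \<open>The standing setting\<close>

lemma filtration_subalgebra: "filtration_usual P Fl ==> 0 <= t ==> subalgebra P (Fl t)"
 unfolding filtration_usual_def by (drule conjunct1) simp

lemma mart_set_integral:
 assumes "prob_space P" "filtration_usual P Fl" "mart P Fl X" and st: "0 <= s" "s <= t" and A: "A \<in> sets (Fl s)"
 shows "(\<integral>w. indicator A w * X t w \<partial>P) = (\<integral>w. indicator A w * X s w \<partial>P)"
proof -
 interpret prob_space P by fact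
 note sub = filtration_subalgebra[OF assms(2)]
 interpret sigma_finite_subalgebra P "Fl s"
  by (rule finite_measure_subalgebra_is_sigma_finite) (auto simp: finite_measure_subalgebra_def finite_measure_subalgebra_axioms_def sub[OF st(1)] finite_measure_axioms)
 have X: "X r \<in> borel_measurable P" "integrable P (X r)" if "0 <= r" for r
 proof -
  have "X r \<in> borel_measurable (Fl r) \<and> integrable P (X r)" using conjunct1[OF assms(3)[unfolded mart_def]] that by simp
  then show "X r \<in> borel_measurable P" "integrable P (X r)" by (auto intro: measurable_from_subalg[OF sub[OF that]])
 qed
 have AP: "A \<in> sets P" using A sub[OF st(1)] unfolding subalgebra_def by auto
 have t0: "0 <= t" using st by simp
 have iA: "integrable P (%w. indicator A w * X t w)"
  using integrable_mult_indicator[OF AP X(2)[OF t0]] by simp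
 have ae: "AE w in P. real_cond_exp P (Fl s) (X t) w = X s w" using conjunct2[OF assms(3)[unfolded mart_def]] st by simp
 have "(\<integral>w. indicator A w * X t w \<partial>P) = (\<integral>w. indicator A w * real_cond_exp P (Fl s) (X t) w \<partial>P)"
  by (rule real_cond_exp_intg(2)[OF iA _ X(1)[OF t0], symmetric]) (use A in simp)
 also have "\<dots> = (\<integral>w. indicator A w * X s w \<partial>P)"
 proof (rule integral_cong_AE)
  show "(%w. indicator A w * real_cond_exp P (Fl s) (X t) w) \<in> borel_measurable P" "(%w. indicator A w * X s w) \<in> borel_measurable P"
   using X(1)[OF st(1)] AP by measurable
  show "AE w in P. indicator A w * real_cond_exp P (Fl s) (X t) w = indicator A w * X s w"
   using ae by eventually_elim simp
 qed
 finally show ?thesis .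
qed

text \<open>A section of a jointly measurable function is measurable; this is how progressive
  measurability becomes Borel measurability of each path in time.\<close>

lemma progressive_path:
 assumes "progressive Fl Y" "0 <= t" "w \<in> space (Fl t)"
 shows "(%s. indicator {0..t} s * Y s w) \<in> borel_measurable borel"
proof -
 have "(%(s, w). Y s w) \<in> borel_measurable (restrict_space borel {0..t} \<Otimes>\<^sub>M Fl t)"
  using assms unfolding progressive_def by simp
 from measurable_compose[OF measurable_Pair2'[OF assms(3)] this]
 have "(%s. Y s w) \<in> borel_measurable (restrict_space borel {0..t})" by simp
 then show ?thesis by (subst (asm) borel_measurable_restrict_space_iff) simp_all
qed

context
 fixes d k c Cb P and Fl :: "real => 'a measure" and M Cq Cd N
 assumes set: "standing_setting d k c Cb P Fl M Cq Cd N" and N: "1 <= N" and c: "0 < c"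
begin

lemmas s1 = set[unfolded standing_setting_def]
lemmas s2 = conjunct2[OF s1] lemmas s3 = conjunct2[OF s2] lemmas s4 = conjunct2[OF s3] lemmas s5 = conjunct2[OF s4]
lemmas s6 = conjunct2[OF s5] lemmas s7 = conjunct2[OF s6] lemmas s8 = conjunct2[OF s7] lemmas s9 = conjunct2[OF s8] lemmas s10 = conjunct2[OF s9]

lemma setD:
 shows "prob_space P" "filtration_usual P Fl" "x \<in> Lam N d ==> mart P Fl (%t. M t x)"
  "x \<in> Lam N d ==> 0 <= t ==> integrable P (%w. (M t x w)\<^sup>2)" "x \<in> Lam N d ==> w \<in> space P ==> cadlag (%t. M t x w)"
  "x \<in> Lam N d ==> progressive Fl (%s. Cq s x)"
  "x \<in> Lam N d ==> mart P Fl (%t w. (M t x w)\<^sup>2 - real N ^ d * set_lebesgue_integral lborel {0..t} (%s. Cq s x w))"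
  "AE w in P. \<forall>s\<ge>0. \<forall>x\<in>Lam N d. \<bar>Cq s x w\<bar> <= Cb"
  "x \<in> Lam N d ==> progressive Fl (%s. Cd s x)"
 by (simp_all only: conjunct1[OF s1] conjunct1[OF s2] conjunct1[OF s6])
  (rule bspec[OF conjunct1[OF s3], THEN conjunct1] bspec[OF conjunct1[OF s3], THEN conjunct2, THEN conjunct1, THEN spec, THEN mp]
   bspec[OF conjunct1[OF s3], THEN conjunct2, THEN conjunct2, THEN bspec] bspec[OF conjunct1[OF s5], THEN conjunct1]
   bspec[OF conjunct1[OF s5], THEN conjunct2] bspec[OF conjunct1[OF s9]]; assumption)+

lemma Lam_nonempty: "Lam N d \<noteq> {}"
 using N unfolding Lam_def by (simp add: PiE_eq_empty_iff lessThan_empty_iff)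

lemma Cb_nonneg: "0 <= Cb"
proof -
 interpret prob_space P by (rule setD)
 have "AE w in P. 0 <= Cb" using setD(8)
 proof eventually_elim
  case (elim w)
  obtain x where "x \<in> Lam N d" using Lam_nonempty by blast
  then have "\<bar>Cq 0 x w\<bar> <= Cb" using elim by simp
  then show ?case by linarith
 qed
 then show ?thesis by simp
qed

lemma space_Fl_P: "0 <= t ==> space (Fl t) = space P"
 using filtration_subalgebra[OF setD(2)] unfolding subalgebra_def by simp

text \<open>The compensated square is a martingale, so over an event of the past the increment of
  the square has the same mean as that of the compensator, whose rate is at most
  \<open>real N ^ d * Cb\<close>.\<close>

lemma quad_bound:
 assumes x: "x \<in> Lam N d" and st: "0 <= s" "s <= t" and A: "A \<in> sets (Fl s)"
 shows "(\<integral>w. indicator A w * ((M t x w)\<^sup>2 - (M s x w)\<^sup>2) \<partial>P) <= real N ^ d * Cb * (t - s) * measure P A"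
proof -
 interpret prob_space P by (rule setD)
 let ?I = "%t w. set_lebesgue_integral lborel {0..t} (%s. Cq s x w)"
 let ?X = "%t w. (M t x w)\<^sup>2 - real N ^ d * ?I t w"
 have t0: "0 <= t" using st by simp
 have AP: "A \<in> sets P" using A filtration_subalgebra[OF setD(2) st(1)] unfolding subalgebra_def by auto
 have iX: "integrable P (?X r)" "integrable P (%w. (M r x w)\<^sup>2)" if "0 <= r" for r
  using conjunct2[OF mp[OF spec[OF conjunct1[OF setD(7)[OF x, unfolded mart_def]]] that]] setD(4)[OF x that] by simp_all
 have i: "integrable P (%w. indicator A w * f w)" if "integrable P f" for f :: "'a => real"
  using integrable_mult_indicator[OF AP that] by simp
 have iD: "integrable P (%w. ((M t x w)\<^sup>2 - (M s x w)\<^sup>2) - (?X t w - ?X s w))"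
  by (intro Bochner_Integration.integrable_diff iX t0 st(1))
 have z: "(\<integral>w. indicator A w * (?X t w - ?X s w) \<partial>P) = 0"
  using mart_set_integral[OF setD(1,2) setD(7)[OF x] st A] i[OF iX(1)[OF t0]] i[OF iX(1)[OF st(1)]]
  unfolding right_diff_distrib by (subst Bochner_Integration.integral_diff) (simp_all add: right_diff_distrib)
 have "(\<integral>w. indicator A w * ((M t x w)\<^sup>2 - (M s x w)\<^sup>2) \<partial>P) = (\<integral>w. indicator A w * (((M t x w)\<^sup>2 - (M s x w)\<^sup>2) - (?X t w - ?X s w)) + indicator A w * (?X t w - ?X s w) \<partial>P)"
  by (intro Bochner_Integration.integral_cong refl) (simp add: algebra_simps)
 also have "\<dots> = (\<integral>w. indicator A w * (((M t x w)\<^sup>2 - (M s x w)\<^sup>2) - (?X t w - ?X s w)) \<partial>P)"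
  using z by (subst Bochner_Integration.integral_add[OF i[OF iD] i]) (auto intro!: Bochner_Integration.integrable_diff iX t0 st)
 also have "\<dots> <= (\<integral>w. indicator A w * (real N ^ d * (Cb * (t - s))) \<partial>P)"
 proof (rule integral_mono_AE[OF i[OF iD] i])
  show "AE w in P. indicator A w * (((M t x w)\<^sup>2 - (M s x w)\<^sup>2) - (?X t w - ?X s w)) <= indicator A w * (real N ^ d * (Cb * (t - s)))"
   using setD(8) AE_space
  proof eventually_elim
   case (elim w)
   have b: "\<bar>Cq r x w\<bar> <= Cb" if "0 <= r" for r using elim(1) x that by blast
   have m: "(%r. indicator {0..t} r * Cq r x w) \<in> borel_measurable borel"
    using progressive_path[OF setD(6)[OF x] t0] space_Fl_P[OF t0] elim(2) by simp
   have "(%r. indicator {0..s} r * Cq r x w) = (%r. indicator {0..s} r * (indicator {0..t} r * Cq r x w))"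
    "(%r. indicator {s<..t} r * Cq r x w) = (%r. indicator {s<..t} r * (indicator {0..t} r * Cq r x w))"
    using st by (auto simp: indicator_def fun_eq_iff)
   then have m': "(%r. indicator {0..s} r * Cq r x w) \<in> borel_measurable borel" "(%r. indicator {s<..t} r * Cq r x w) \<in> borel_measurable borel"
    using m by simp_all
   have i1: "set_integrable lborel {0..s} (%r. Cq r x w)"
    using b by (intro set_integrable_bounded(1)[OF m'(1), where B=Cb and a=0 and b=s]) auto
   have i2: "set_integrable lborel {s<..t} (%r. Cq r x w)" "\<bar>LINT r:{s<..t}|lborel. Cq r x w\<bar> <= Cb * measure lborel {s<..t}"
    using b st by (intro set_integrable_bounded[OF m'(2), where B=Cb and a=s and b=t]; auto)+
   have "{0..t} = {0..s} \<union> {s<..t}" using st by auto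
   then have "?I t w = ?I s w + (LINT r:{s<..t}|lborel. Cq r x w)"
    using set_integral_Un[OF ivl_disj_int_two_Icc_Ioc i1 i2(1)] by simp
   then have "?I t w - ?I s w <= Cb * (t - s)" using i2(2) st by simp
   then have "real N ^ d * (?I t w - ?I s w) <= real N ^ d * (Cb * (t - s))" by (intro mult_left_mono) auto
   then show ?case by (intro mult_left_mono) (auto simp: algebra_simps)
  qed
 qed simp
 also have "\<dots> = real N ^ d * Cb * (t - s) * measure P A" using AP by simp
 finally show ?thesis .
qed

text \<open>The intensity is chosen so that \<open>\<kappa>\<close> times a quarter of the squared
  jump size equals the bound \<open>real N ^ d * Cb\<close> on the rate of the quadratic variation.
  Then \<open>scale\<close> holds with \<open>K0 = 4 * Cb\<close>, a number that does not depend on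
  \<open>N\<close>; the uniformity of the final constant comes from this.\<close>

lemma standing_lattice:
 "lattice_noise P Fl M Cd (Lam N d) (c * eps N powr k) (real N powr (k + real d)) Cb (4 * real N ^ d * Cb / (c * eps N powr k)\<^sup>2) (eps N ^ d) (4 * Cb) N d"
proof -
 interpret prob_space P by (rule setD)
 let ?a = "c * eps N powr k"
 have e: "0 < eps N" by (rule eps_pos[OF N])
 have a: "0 < ?a" using c e by simp
 have A3: "AE w in P. \<forall>t\<ge>0. \<forall>x\<in>Lam N d. jmp (%r. M r x w) t \<noteq> 0 --> \<bar>jmp (%r. M r x w) t\<bar> = ?a"
  and Cd: "AE w in P. \<forall>s\<ge>0. \<forall>x\<in>Lam N d. \<bar>Cd s x w\<bar> <= Cb"
  and A4: "AE w in P. \<forall>t\<ge>0. \<forall>x\<in>Lam N d.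
    M t x w = (\<Sum>s\<in>{s\<in>{0..t}. jmp (%r. M r x w) s \<noteq> 0}. jmp (%r. M r x w) s)
     - real N powr (k + real d) * set_lebesgue_integral lborel {0..t} (%s. Cd s x w)"
  and A2': "\<And>T. T > 0 ==> AE w in P. \<forall>t\<in>{0..T}. \<forall>x\<in>Lam N d. \<forall>y\<in>Lam N d. x \<noteq> y -->
    jmp (%r. M r x w) t = 0 \<or> jmp (%r. M r y w) t = 0"
  by (rule conjunct1[OF s8] conjunct1[OF s10] conjunct2[OF s10] mp[OF spec[OF conjunct1[OF s7]]]; assumption?)+
 \<comment> \<open>(A2) is given for each horizon with its own null set; integer horizons combine
   into a single one.\<close>
 have A2: "AE w in P. \<forall>n. \<forall>t\<in>{0..real (Suc n)}. \<forall>x\<in>Lam N d. \<forall>y\<in>Lam N d. x \<noteq> y -->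
    jmp (%r. M r x w) t = 0 \<or> jmp (%r. M r y w) t = 0"
  unfolding AE_all_countable by (intro allI A2') simp
 have good: "AE w in P. good_path (Lam N d) ?a (real N powr (k + real d)) Cb (%s x. M s x w) (%s x. Cd s x w)"
  using A2 A3 Cd A4 AE_space
 proof eventually_elim
  case (elim w)
  show ?case unfolding good_path_def
  proof (intro ballI conjI)
   fix x assume x: "x \<in> Lam N d"
   show "cadlag (%t. M t x w)" by (rule setD(5)[OF x elim(5)])
   show "\<forall>t\<ge>0. jmp (%r. M r x w) t \<noteq> 0 --> \<bar>jmp (%r. M r x w) t\<bar> = ?a" using elim(2) x by blast
   show "\<forall>s\<ge>0. \<bar>Cd s x w\<bar> <= Cb" using elim(3) x by blast
   show "\<forall>t\<ge>0. M t x w = (\<Sum>s\<in>{s\<in>{0..t}. jmp (%r. M r x w) s \<noteq> 0}. jmp (%r. M r x w) s)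
     - real N powr (k + real d) * set_lebesgue_integral lborel {0..t} (%s. Cd s x w)" using elim(4) x by blast
   show "\<forall>t. (%s. indicator {0..t} s * Cd s x w) \<in> borel_measurable borel"
   proof
    fix t :: real
    show "(%s. indicator {0..t} s * Cd s x w) \<in> borel_measurable borel"
    proof (cases "0 <= t")
     case True
     then show ?thesis using progressive_path[OF setD(9)[OF x] True] space_Fl_P[OF True] elim(5) by simp
    qed simp
   qed
   show "\<forall>t\<ge>0. \<forall>y\<in>Lam N d. x \<noteq> y --> jmp (%r. M r x w) t = 0 \<or> jmp (%r. M r y w) t = 0"
   proof (intro allI impI ballI)
    fix t y assume t: "(0::real) <= t" and y: "y \<in> Lam N d" "x \<noteq> y"
    obtain n where "t <= real n" using real_arch_simple by blast
    then have "t \<in> {0..real (Suc n)}" using t by auto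
    then show "jmp (%r. M r x w) t = 0 \<or> jmp (%r. M r y w) t = 0" using elim(1) x y by blast
   qed
  qed
 qed
 have scale: "4 * real N ^ d * Cb / ?a\<^sup>2 * (eps N ^ d * ?a)\<^sup>2 = 4 * Cb * eps N ^ d"
 proof -
  have "real N ^ d * eps N ^ d = 1" using eps_card[OF N, of d] unfolding card_Lam by (simp add: mult.commute)
  then have "real N ^ d * (eps N ^ d)\<^sup>2 = eps N ^ d" by (simp add: power2_eq_square mult.assoc[symmetric])
  then show ?thesis using c e by (simp add: power_mult_distrib)
 qed
 show ?thesis
 proof
  show "(\<integral>w. indicator A w * ((M t x w)\<^sup>2 - (M s x w)\<^sup>2) \<partial>P) <= ?a\<^sup>2 / 4 * (4 * real N ^ d * Cb / ?a\<^sup>2) * (t - s) * prob A"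
   if "x \<in> Lam N d" "0 <= s" "s <= t" "A \<in> sets (Fl s)" for x s t A
  proof -
   have e4: "?a\<^sup>2 / 4 * (4 * real N ^ d * Cb / ?a\<^sup>2) = real N ^ d * Cb" using c e by simp
   show ?thesis unfolding e4 by (rule quad_bound[OF that])
  qed
 qed (use setD finite_Lam a Cb_nonneg good scale e in auto)
qed

end

section \<open>The contracted integrand\<close>

lemma dM_int_cong:
 assumes "\<And>s x. 0 <= s ==> s < t ==> x \<in> Lam N d ==> G (s, x) = G' (s, x)"
 shows "dM_int N d mp q G t = dM_int N d mp q G' t"
proof -
 have "LS_int X (%s. G (s, x)) t = LS_int X (%s. G' (s, x)) t" if x: "x \<in> Lam N d" for X x
 proof -
  have "(%s. indicator {0..<t} s *\<^sub>R G (s, x)) = (%s. indicator {0..<t} s *\<^sub>R G' (s, x))"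
   using assms x by (auto simp: indicator_def fun_eq_iff)
  then show ?thesis unfolding LS_int_def set_lebesgue_integral_def by (simp only:)
 qed
 then show ?thesis unfolding dM_int_def by (auto intro!: sum.cong simp: assms)
qed

text \<open>Only values on the ordered simplex enter the iterated integral, which permits cutting
  the contracted integrand off outside it.\<close>

lemma ITI_cong: "(\<And>z. z \<in> OR (Lam N d) j t ==> H z = H' z) ==> ITI N d mp ks j H t = ITI N d mp ks j H' t"
proof (induction j arbitrary: H H' t)
 case 0
 then show ?case by (simp add: OR_def)
next
 case (Suc j)
 show ?case unfolding ITI.simps
 proof (rule dM_int_cong)
  fix s x assume s: "0 <= s" "s < t" "x \<in> Lam N d"
  show "ITI N d mp ks j (%z. H (z(Suc j := (s, x)))) (fst (s, x)) = ITI N d mp ks j (%z. H' (z(Suc j := (s, x)))) (fst (s, x))"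
   unfolding fst_conv by (intro Suc.IH Suc.prems OR_upd[THEN iffD2] conjI s)
 qed
qed

text \<open>With all exponents infinite, the nested suprema dominate the value at every point of the
  ordered simplex. The recursion evaluates at updates of \<open>z0\<close>, so the bound concerns a
  representative \<open>z'\<close> that agrees with \<open>z\<close> on the relevant
  coordinates.\<close>

lemma normL_Einf_ge:
 "z \<in> OR (Lam N d) j u ==> u <= T ==> (\<And>i. i \<in> {1..j} ==> pv i = Einf) ==> \<exists>z'. (\<forall>i\<in>{1..j}. z' i = z i) \<and> ennreal \<bar>H z'\<bar> <= normL N d T pv j H"
proof (induction j arbitrary: H z u)
 case 0
 then show ?case by (intro exI[of _ z0]) simp
next
 case (Suc j)
 let ?w = "z (Suc j)"
 have "z(Suc j := (fst ?w, snd ?w)) \<in> OR (Lam N d) (Suc j) u" using Suc.prems(1) by simp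
 then have z: "z \<in> OR (Lam N d) j (fst ?w)" "0 <= fst ?w" "fst ?w < u" "snd ?w \<in> Lam N d" unfolding OR_upd by auto
 let ?H = "%z. H (z(Suc j := ?w)) * (if j = 0 then 1 else if fst (z j) < fst ?w then 1 else 0)"
 obtain z' where z': "\<forall>i\<in>{1..j}. z' i = z i" "ennreal \<bar>?H z'\<bar> <= normL N d T pv j ?H"
 proof -
  have "fst ?w <= T" using z(3) Suc.prems(2) by simp
  moreover have "pv i = Einf" if "i \<in> {1..j}" for i using Suc.prems(3)[of i] that by simp
  ultimately show thesis using Suc.IH[OF z(1), of ?H] that by blast
 qed
 have "?H z' = H (z'(Suc j := ?w))"
 proof (cases "j = 0")
  case False
  then have "fst (z' j) < fst ?w" using z'(1) z(1) unfolding OR_def by auto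
  then show ?thesis by simp
 qed simp
 then have "ennreal \<bar>H (z'(Suc j := ?w))\<bar> <= normL N d T pv j ?H" using z'(2) by (simp only:)
 also have "\<dots> <= normL N d T pv (Suc j) H"
  unfolding normL.simps Lnorm_def using Suc.prems(2,3) z by (auto intro!: SUP_upper2[of ?w] simp: mem_Times_iff)
 finally show ?case
 proof (intro exI[of _ "z'(Suc j := ?w)"] conjI ballI)
  show "(z'(Suc j := ?w)) i = z i" if "i \<in> {1..Suc j}" for i using that z'(1) by (cases "i = Suc j") auto
 qed
qed

lemma C1_time_continuous:
 assumes "C1_time N d n F" "z \<in> PiE {1..n} (%_. {0..} \<times> Lam N d)" "i \<in> {1..n}" "0 <= s"
 shows "continuous (at s within {0..}) (%s. F (z(i := (s, snd (z i)))))"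
proof -
 obtain F' where "\<forall>s\<ge>0. ((%s. F (z(i := (s, snd (z i))))) has_real_derivative F' s) (at s within {0..})"
  using bspec[OF bspec[OF assms(1)[unfolded C1_time_def] assms(2)] assms(3)] by blast
 then show ?thesis using assms(4) by (intro DERIV_continuous) blast
qed

text \<open>Separate continuity suffices for Borel measurability along a diagonal, tying one
  coordinate at a time. The new coordinate is first given a discrete approximation of
  \<open>r\<close>, where measurability follows from the induction hypothesis by countably many
  cases; then the limit is taken in that coordinate alone.\<close>

lemma C1_time_diagonal_borel:
 assumes F: "C1_time N d n F" and x: "x \<in> Lam N d"
 shows "finite A ==> A \<subseteq> {1..n} ==> y \<in> PiE {1..n} (%_. {0..} \<times> Lam N d) ==>
  (%r. F (%i. if i \<in> A then (max 0 r, x) else y i)) \<in> borel_measurable borel"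
proof (induction A arbitrary: y rule: finite_induct)
 case (insert l A)
 let ?q = "%n r. max 0 (of_int \<lfloor>real (Suc n) * max 0 r\<rfloor> / real (Suc n))"
 let ?f = "%s r. F (%i. if i \<in> A then (max 0 r, x) else (y(l := (s, x))) i)"
 have l: "l \<in> {1..n}" using insert.prems by auto
 have yl: "y(l := (s, x)) \<in> PiE {1..n} (%_. {0..} \<times> Lam N d)" if "0 <= s" for s
  using insert.prems(2) l x that by (auto simp: PiE_iff extensional_def)
 have m: "(%r. ?f (max 0 (of_int \<lfloor>real (Suc n) * max 0 r\<rfloor> / real (Suc n))) r) \<in> borel_measurable borel" for n
 proof (rule measurable_compose_countable[where f="%k r. ?f (max 0 (of_int k / real (Suc n))) r"])
  show "?f (max 0 (of_int k / real (Suc n))) \<in> borel_measurable borel" for k :: int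
   using insert.prems by (intro insert.IH yl) auto
  show "(%r. \<lfloor>real (Suc n) * max 0 r\<rfloor>) \<in> borel \<rightarrow>\<^sub>M count_space UNIV" by measurable
 qed
 have lim: "(%n. ?f (?q n r) r) \<longlonglongrightarrow> F (%i. if i \<in> insert l A then (max 0 r, x) else y i)" for r
 proof -
  let ?r = "max 0 r"
  let ?z = "%i. if i \<in> A then (?r, x) else (y(l := (?r, x))) i"
  have z: "?z \<in> PiE {1..n} (%_. {0..} \<times> Lam N d)"
   using yl[of ?r] insert.prems(1) x by (auto simp: PiE_iff extensional_def)
  have zu: "?z(l := (s, snd (?z l))) = (%i. if i \<in> A then (?r, x) else (y(l := (s, x))) i)" for s
   using insert.hyps by (auto simp: fun_eq_iff)
  have c: "continuous (at ?r within {0..}) (%s. ?f s r)"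
   using C1_time_continuous[OF F z l, of ?r] unfolding zu by simp
  have q: "(%n. ?q n r) \<longlonglongrightarrow> ?r"
  proof (rule tendsto_sandwich)
   have b: "real_of_int \<lfloor>real (Suc n) * ?r\<rfloor> <= real (Suc n) * ?r" "real (Suc n) * ?r - 1 <= real_of_int \<lfloor>real (Suc n) * ?r\<rfloor>" for n by linarith+
   have "?r - 1 / real (Suc n) <= ?q n r" for n
   proof (rule max.coboundedI2)
    have "?r - 1 / real (Suc n) = (real (Suc n) * ?r - 1) / real (Suc n)" by (simp add: diff_divide_distrib del: of_nat_Suc)
    also have "\<dots> <= of_int \<lfloor>real (Suc n) * ?r\<rfloor> / real (Suc n)" by (intro divide_right_mono b(2)) simp
    finally show "?r - 1 / real (Suc n) <= of_int \<lfloor>real (Suc n) * ?r\<rfloor> / real (Suc n)" .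
   qed
   then show "\<forall>\<^sub>F n in sequentially. ?r - 1 / real (Suc n) <= ?q n r" by simp
   have "?q n r <= ?r" for n
   proof (rule max.boundedI)
    have "of_int \<lfloor>real (Suc n) * ?r\<rfloor> / real (Suc n) <= real (Suc n) * ?r / real (Suc n)" by (intro divide_right_mono b(1)) simp
    then show "of_int \<lfloor>real (Suc n) * ?r\<rfloor> / real (Suc n) <= ?r" by (simp del: of_nat_Suc)
   qed simp
   then show "\<forall>\<^sub>F n in sequentially. ?q n r <= ?r" by simp
   have "(%n. 1 / real (Suc n)) \<longlonglongrightarrow> 0" using lim_1_over_n LIMSEQ_Suc by blast
   then show "(%n. ?r - 1 / real (Suc n)) \<longlonglongrightarrow> ?r" using tendsto_diff[OF tendsto_const] by force
  qed simp
  have "(%n. ?f (?q n r) r) \<longlonglongrightarrow> ?f ?r r"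
   by (rule continuous_within_tendsto_compose'[OF c _ q]) simp
  moreover have "?f ?r r = F (%i. if i \<in> insert l A then (max 0 r, x) else y i)"
   by (intro arg_cong[where f=F]) (auto simp: fun_eq_iff)
  ultimately show ?thesis by simp
 qed
 show ?case by (rule borel_measurable_LIMSEQ_real[OF lim m])
qed simp

context
 fixes n m R \<sigma>
 assumes R: "equiv {1..n::nat} R" and bij: "bij_betw \<sigma> {1..m::nat} ({1..n} // R)"
begin

lemma sigma_sub: "j \<in> {1..m} ==> \<sigma> j \<subseteq> {1..n}"
 using bij_betwE[OF bij] Union_quotient[OF R] by blast

lemma cls_eq: "j \<in> {1..m} ==> i \<in> \<sigma> j ==> cls \<sigma> m i = j"
 unfolding cls_def
proof (rule the_equality)
 fix j' assume j: "j \<in> {1..m}" "i \<in> \<sigma> j" and j': "j' \<in> {1..m} \<and> i \<in> \<sigma> j'"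
 have "\<sigma> j \<in> {1..n} // R" "\<sigma> j' \<in> {1..n} // R" using bij_betwE[OF bij] j j' by auto
 then have "\<sigma> j = \<sigma> j'" using quotient_disj[OF R] j j' by blast
 then show "j' = j" using bij_betw_imp_inj_on[OF bij] j j' by (auto dest: inj_onD)
qed simp

lemma cls_mem: "i \<in> {1..n} ==> cls \<sigma> m i \<in> {1..m} \<and> i \<in> \<sigma> (cls \<sigma> m i)"
proof -
 assume "i \<in> {1..n}"
 then obtain X where X: "X \<in> {1..n} // R" "i \<in> X" using Union_quotient[OF R] by blast
 then obtain j where "j \<in> {1..m}" "\<sigma> j = X" using bij unfolding bij_betw_def by (metis imageE)
 then show ?thesis using cls_eq X(2) by blast
qed

lemma Fgs_PiE: "(\<And>j. j \<in> {1..m} ==> z j \<in> {0..} \<times> Lam N d) ==> (\<lambda>i\<in>{1..n}. z (cls \<sigma> m i)) \<in> PiE {1..n} (%_. {0..} \<times> Lam N d)"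
 using cls_mem by auto

lemma Fgs_borel:
 assumes F: "C1_time N d n F" and z: "\<And>j. j \<in> {1..m} ==> z j \<in> {0..} \<times> Lam N d" and x: "x \<in> Lam N d" and j: "j \<in> {1..m}"
 shows "(%r. Fgs n \<sigma> m F (z(j := (max 0 r, x)))) \<in> borel_measurable borel"
proof -
 have e: "(\<lambda>i\<in>{1..n}. (z(j := w)) (cls \<sigma> m i)) = (%i. if i \<in> \<sigma> j then w else (\<lambda>i\<in>{1..n}. z (cls \<sigma> m i)) i)" for w
 proof
  fix i
  show "(\<lambda>i\<in>{1..n}. (z(j := w)) (cls \<sigma> m i)) i = (if i \<in> \<sigma> j then w else (\<lambda>i\<in>{1..n}. z (cls \<sigma> m i)) i)"
  proof (cases "i \<in> \<sigma> j")
   case True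
   then have "i \<in> {1..n}" "cls \<sigma> m i = j" using sigma_sub[OF j] cls_eq[OF j] by auto
   then show ?thesis using True by simp
  next
   case False
   then have "cls \<sigma> m i \<noteq> j" if "i \<in> {1..n}" using cls_mem[OF that] by auto
   then show ?thesis using False by simp
  qed
 qed
 have "finite (\<sigma> j)" by (rule finite_subset[OF sigma_sub[OF j]]) simp
 then show ?thesis unfolding Fgs_def e
  by (rule C1_time_diagonal_borel[OF F x _ sigma_sub[OF j] Fgs_PiE[OF z]])
qed

text \<open>A singleton component moves one variable of \<open>F\<close>, which is covered by
  \<open>C1_time\<close>. A larger one moves several at once; there a finite \<open>C1norm\<close>
  asserts differentiability along the diagonal, since its definition assigns infinity
  otherwise.\<close>

lemma Fgs_left_lim:
 assumes F: "C1_time N d n F" and z: "\<And>j. j \<in> {1..m} ==> z j \<in> {0..T} \<times> Lam N d" and j: "j \<in> {1..m}" and s: "0 < fst (z j)"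
  and h: "card (\<sigma> j) \<noteq> 1 ==> C1norm N d T m j (Fgs n \<sigma> m F) \<noteq> \<infinity>"
 shows "((%r. Fgs n \<sigma> m F (z(j := (r, snd (z j))))) \<longlongrightarrow> Fgs n \<sigma> m F z) (at_left (fst (z j)))"
proof -
 have "continuous (at (fst (z j)) within {0..}) (%r. Fgs n \<sigma> m F (z(j := (r, snd (z j)))))"
 proof (cases "card (\<sigma> j) = 1")
  case True
  then obtain l where l: "\<sigma> j = {l}" by (auto simp: card_1_singleton_iff)
  have ln: "l \<in> {1..n}" using l sigma_sub[OF j] by auto
  let ?y = "\<lambda>i\<in>{1..n}. z (cls \<sigma> m i)"
  have "(\<lambda>i\<in>{1..n}. (z(j := (r, snd (z j)))) (cls \<sigma> m i)) = ?y(l := (r, snd (?y l)))" for r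
  proof
   fix i
   have "cls \<sigma> m l = j" using cls_eq[OF j] l by simp
   moreover have "cls \<sigma> m i \<noteq> j" if "i \<in> {1..n}" "i \<noteq> l" using cls_mem[OF that(1)] l that(2) by auto
   ultimately show "(\<lambda>i\<in>{1..n}. (z(j := (r, snd (z j)))) (cls \<sigma> m i)) i = (?y(l := (r, snd (?y l)))) i" using ln by auto
  qed
  moreover have "?y \<in> PiE {1..n} (%_. {0..} \<times> Lam N d)" using z by (intro Fgs_PiE) force
  ultimately show ?thesis unfolding Fgs_def using C1_time_continuous[OF F _ ln, of ?y "fst (z j)"] s by simp
 next
  case False
  let ?all = "\<forall>z\<in>{z. \<forall>j\<in>{1..m}. z j \<in> {0..T} \<times> Lam N d}. \<exists>D. ((%r. Fgs n \<sigma> m F (z(j := (r, snd (z j))))) has_real_derivative D) (at (fst (z j)) within {0..})"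
  have all: "?all"
  proof (rule ccontr)
   assume "\<not> ?all"
   then have "C1norm N d T m j (Fgs n \<sigma> m F) = \<infinity>" unfolding C1norm_def Let_def by (rule if_not_P)
   with h[OF False] show False by blast
  qed
  have "z \<in> {z. \<forall>j\<in>{1..m}. z j \<in> {0..T} \<times> Lam N d}" using z by blast
  from bspec[OF all this] obtain D where " ((%r. Fgs n \<sigma> m F (z(j := (r, snd (z j))))) has_real_derivative D) (at (fst (z j)) within {0..})" by blast
  then show ?thesis by (rule DERIV_continuous)
 qed
 then have "((%r. Fgs n \<sigma> m F (z(j := (r, snd (z j))))) \<longlongrightarrow> Fgs n \<sigma> m F z) (at (fst (z j)) within {0..})"
  unfolding continuous_within by simp
 moreover have "at (fst (z j)) within {0..} = at (fst (z j))"
  using s by (intro at_within_open_subset[of _ "{0<..}"]) auto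
 ultimately show ?thesis by (simp add: filterlim_at_split)
qed

text \<open>The condition on C1 norms starts at the second component, exactly where such norms occur
  on the right-hand side of the estimate. For the first component Borel measurability comes from
  \<open>Fgs_borel\<close>.\<close>

lemma goodH_Fgs:
 assumes F: "C1_time N d n F" and m: "1 <= m" and K: "0 <= K" "\<And>z. z \<in> OR (Lam N d) m T ==> \<bar>Fgs n \<sigma> m F z\<bar> <= K"
  and h: "\<And>j. j \<in> {2..m} ==> card (\<sigma> j) \<noteq> 1 ==> C1norm N d T m j (Fgs n \<sigma> m F) \<noteq> \<infinity>"
 shows "goodH (%j. card (\<sigma> j)) (Lam N d) m T K (%z. if z \<in> OR (Lam N d) m T then Fgs n \<sigma> m F z else 0)"
 unfolding goodH_def
proof (intro conjI allI impI ballI K(1))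
 show "(if z \<in> OR (Lam N d) m T then Fgs n \<sigma> m F z else 0) = 0" if "z \<notin> OR (Lam N d) m T" for z using that by simp
 show "\<bar>if z \<in> OR (Lam N d) m T then Fgs n \<sigma> m F z else 0\<bar> <= K" for z using K by simp
next
 fix z i assume z: "z \<in> OR (Lam N d) m T" and i: "i \<in> {1..m}" and k: "i = 1 --> card (\<sigma> 1) = 1" and s: "0 < fst (z i)"
 have zz: "0 <= fst (z j) \<and> fst (z j) < T \<and> snd (z j) \<in> Lam N d" if "j \<in> {1..m}" for j using z that unfolding OR_def by blast
 have ord: "fst (z j) < fst (z (Suc j))" if "1 <= j" "j < m" for j using z that unfolding OR_def by simp
 have lim: "((%r. Fgs n \<sigma> m F (z(i := (r, snd (z i))))) \<longlongrightarrow> Fgs n \<sigma> m F z) (at_left (fst (z i)))"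
 proof (rule Fgs_left_lim[OF F])
  show "i \<in> {1..m}" "0 < fst (z i)" by fact+
  show "z j \<in> {0..T} \<times> Lam N d" if "j \<in> {1..m}" for j using zz[OF that] by (simp add: mem_Times_iff)
  show "C1norm N d T m i (Fgs n \<sigma> m F) \<noteq> \<infinity>" if "card (\<sigma> i) \<noteq> 1" using that k i by (intro h) (cases "i = 1"; auto)+
 qed
 \<comment> \<open>The preceding time, or 0. While the i-th time stays above \<open>b\<close> the
   point stays in the simplex, so the cut-off does not disturb the left limit.\<close>
 define b where "b = (if i = 1 then 0 else fst (z (i - 1)))"
 have bs: "b < fst (z i)" unfolding b_def using s ord[of "i - 1"] i by auto
 have "i - 1 \<in> {1..m}" if "i \<noteq> 1" using i that unfolding atLeastAtMost_iff by linarith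
 then have b0: "0 <= b" unfolding b_def using zz[of "i - 1"] by simp
 have upd: "z(i := (r, snd (z i))) \<in> OR (Lam N d) m T" if r: "b < r" "r < fst (z i)" for r
  unfolding OR_def
 proof (intro CollectI conjI ballI)
  fix j assume j: "j \<in> {1..m}"
  show "0 <= fst ((z(i := (r, snd (z i)))) j)" "fst ((z(i := (r, snd (z i)))) j) < T" "snd ((z(i := (r, snd (z i)))) j) \<in> Lam N d"
   using zz[OF j] r b0 by auto
 next
  fix j assume j: "j \<in> {1..<m}"
  show "fst ((z(i := (r, snd (z i)))) j) < fst ((z(i := (r, snd (z i)))) (Suc j))"
   using ord[of j] j r unfolding b_def by (cases "j = i"; cases "Suc j = i") auto
 qed
 have "\<forall>\<^sub>F r in at_left (fst (z i)). b < r \<and> r < fst (z i)" using eventually_at_left[OF bs] bs by blast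
 then have "\<forall>\<^sub>F r in at_left (fst (z i)). Fgs n \<sigma> m F (z(i := (r, snd (z i)))) = (if z(i := (r, snd (z i))) \<in> OR (Lam N d) m T then Fgs n \<sigma> m F (z(i := (r, snd (z i)))) else 0)"
 proof eventually_elim
  case (elim r) then show ?case using upd by simp
 qed
 then show "((%r. if z(i := (r, snd (z i))) \<in> OR (Lam N d) m T then Fgs n \<sigma> m F (z(i := (r, snd (z i)))) else 0) \<longlongrightarrow>
   (if z \<in> OR (Lam N d) m T then Fgs n \<sigma> m F z else 0)) (at_left (fst (z i)))"
  using Lim_transform_eventually[OF lim] z by simp
next
 fix z x
 let ?O = "OR (Lam N d) m T"
 show "(%r. if z(1 := (r, x)) \<in> ?O then Fgs n \<sigma> m F (z(1 := (r, x))) else 0) \<in> borel_measurable borel"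
 proof (cases "\<exists>r0. z(1 := (r0, x)) \<in> ?O")
  case False
  then show ?thesis by simp
 next
  case True
  then obtain r0 where r0: "z(1 := (r0, x)) \<in> ?O" by blast
  let ?z = "z(1 := (r0, x))"
  have zz: "0 <= fst (?z j)" "fst (?z j) < T" "snd (?z j) \<in> Lam N d" if "j \<in> {1..m}" for j using r0 that unfolding OR_def by blast+
  have ord: "fst (?z j) < fst (?z (Suc j))" if "1 <= j" "j < m" for j using r0 that unfolding OR_def by simp
  have x: "x \<in> Lam N d" using zz(3)[of 1] m by simp
  \<comment> \<open>As the first time varies, membership in the simplex cuts out an interval, so the
    cut-off is a Borel factor.\<close>
  have iff: "z(1 := (r, x)) \<in> ?O \<longleftrightarrow> 0 <= r \<and> r < T \<and> (1 < m --> r < fst (z 2))" for r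
  proof
   assume "z(1 := (r, x)) \<in> ?O"
   then have a: "\<And>j. j \<in> {1..m} ==> 0 <= fst ((z(1 := (r, x))) j) \<and> fst ((z(1 := (r, x))) j) < T"
    "\<And>j. j \<in> {1..<m} ==> fst ((z(1 := (r, x))) j) < fst ((z(1 := (r, x))) (Suc j))" unfolding OR_def by blast+
   show "0 <= r \<and> r < T \<and> (1 < m --> r < fst (z 2))" using a(1)[of 1] a(2)[of 1] m by (simp add: numeral_2_eq_2)
  next
   assume r: "0 <= r \<and> r < T \<and> (1 < m --> r < fst (z 2))"
   show "z(1 := (r, x)) \<in> ?O" unfolding OR_def
   proof (intro CollectI conjI ballI)
    fix j assume j: "j \<in> {1..m}"
    show "0 <= fst ((z(1 := (r, x))) j)" "fst ((z(1 := (r, x))) j) < T" "snd ((z(1 := (r, x))) j) \<in> Lam N d"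
     using zz[OF j] r x by (auto split: if_splits)
   next
    fix j assume j: "j \<in> {1..<m}"
    show "fst ((z(1 := (r, x))) j) < fst ((z(1 := (r, x))) (Suc j))"
     using ord[of j] j r by (cases "j = 1") (auto simp: numeral_2_eq_2)
   qed
  qed
  have "(%r. if z(1 := (r, x)) \<in> ?O then Fgs n \<sigma> m F (z(1 := (r, x))) else 0)
   = (%r. indicator {r. 0 <= r \<and> r < T \<and> (1 < m --> r < fst (z 2))} r * Fgs n \<sigma> m F (?z(1 := (max 0 r, x))))"
   unfolding iff by (auto simp: indicator_def fun_eq_iff max_def)
  moreover have "(%r. Fgs n \<sigma> m F (?z(1 := (max 0 r, x)))) \<in> borel_measurable borel"
   using zz m by (intro Fgs_borel[OF F _ x]) (auto simp: mem_Times_iff)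
  moreover have "(%r. indicator {r. 0 <= r \<and> r < T \<and> (1 < m --> r < fst (z 2))} r :: real) \<in> borel_measurable borel"
   by measurable
  ultimately show ?thesis by simp
 qed
qed

end

section \<open>The exponents and the passage to the stated bound\<close>

text \<open>Listed in decreasing order, the elements of \<open>J\<close> have 0, 1, ...,
  \<open>card J - 1\<close> larger ones.\<close>

lemma sum_power_card_above:
 fixes r :: real and J :: "nat set"
 shows "finite J ==> (\<Sum>i\<in>J. r ^ card {j\<in>J. j \<ge> i + 1}) = (\<Sum>a<card J. r ^ a)"
proof (induction J rule: finite_linorder_min_induct)
 case (insert b A)
 have 1: "{j\<in>insert b A. j \<ge> i + 1} = {j\<in>A. j \<ge> i + 1}" if "i \<in> insert b A" for i using insert.hyps(2) that by force
 have 2: "{j\<in>A. j \<ge> b + 1} = A" using insert.hyps(2) by force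
 have b: "b \<notin> A" using insert.hyps(2) by blast
 have "(\<Sum>i\<in>insert b A. r ^ card {j\<in>insert b A. j \<ge> i + 1}) = (\<Sum>i\<in>insert b A. r ^ card {j\<in>A. j \<ge> i + 1})"
  using 1 by (intro sum.cong refl) (simp only:)
 also have "\<dots> = r ^ card {j\<in>A. j \<ge> b + 1} + (\<Sum>i\<in>A. r ^ card {j\<in>A. j \<ge> i + 1})"
  using insert.hyps(1) b by (rule sum.insert)
 also have "\<dots> = (\<Sum>a<card (insert b A). r ^ a)"
  unfolding 2 insert.IH using insert.hyps(1) b by simp
 finally show ?case .
qed simp

lemma finite_Jinf: "finite (Jinf \<sigma> m pv)"
 by (rule finite_subset[of _ "{1..m}"]) (auto simp: Jinf_def)

text \<open>A geometric sum with ratio \<open>(p - 1) / p\<close>, whose distance to 1 is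
  \<open>1 / p\<close>. The total power of the norms in each term of \<open>RHS\<close> is therefore
  one, which makes interpolation possible.\<close>

lemma beta_sum:
 assumes p: "2 <= p"
 shows "beta p \<sigma> m pv + (\<Sum>i\<in>Jinf \<sigma> m pv. beta_i p \<sigma> m pv i) * (1 / p) = 1"
proof -
 let ?r = "(p - 1) / p" and ?l = "card (Jinf \<sigma> m pv)"
 have r: "?r \<noteq> 1" "?r - 1 = - (1 / p)" using p by (simp_all add: field_simps)
 have "(\<Sum>i\<in>Jinf \<sigma> m pv. beta_i p \<sigma> m pv i) = (?r ^ ?l - 1) / (?r - 1)"
  unfolding beta_i_def sum_power_card_above[OF finite_Jinf] by (rule geometric_sum[OF r(1)])
 also have "\<dots> * (1 / p) = 1 - ?r ^ ?l" unfolding r(2) using p by simp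
 finally show ?thesis unfolding beta_def by simp
qed

lemma prod_ennreal_mono: "finite J ==> (\<And>i. i \<in> J ==> f i <= g i) ==> (\<Prod>i\<in>J. f i :: ennreal) <= (\<Prod>i\<in>J. g i)"
 by (induction J rule: finite_induct) (auto intro!: mult_mono)

text \<open>\<open>x\<close> is split into powers whose exponents sum to one, and each power is
  estimated by that of a quantity dominating \<open>x\<close>. The factors \<open>e i\<close> stand
  for negative powers of the lattice spacing and can only enlarge the bound.\<close>

lemma epowr_interpolate:
 assumes x: "0 <= x" and J: "finite J" and nL: "ennreal x <= nL" and C: "\<And>i. i \<in> J ==> ennreal x <= C i"
  and b: "0 <= \<beta>" "\<And>i. i \<in> J ==> 0 <= b i" "\<beta> + (\<Sum>i\<in>J. b i) * (1 / p) = 1" and p: "0 < p" and e: "\<And>i. i \<in> J ==> 1 <= e i"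
 shows "ennreal x <= epowr nL \<beta> * epowr (\<Prod>i\<in>J. e i * epowr (C i) (b i)) (1 / p)"
proof (cases "x = 0")
 case False
 then have x0: "0 < x" using x by simp
 have ex: "epowr (ennreal x) t = ennreal (x powr t)" for t using x by (simp add: epowr_def)
 have "ennreal (x powr (\<Sum>i\<in>J. b i)) = (\<Prod>i\<in>J. ennreal (x powr b i))"
  using x0 J by (simp add: powr_sum prod_ennreal)
 also have "\<dots> <= (\<Prod>i\<in>J. e i * epowr (C i) (b i))"
 proof (rule prod_ennreal_mono[OF J])
  fix i assume i: "i \<in> J"
  have "1 * ennreal (x powr b i) <= e i * epowr (C i) (b i)"
   unfolding ex[symmetric] by (intro mult_mono e epowr_mono C b i) auto
  then show "ennreal (x powr b i) <= e i * epowr (C i) (b i)" by simp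
 qed
 finally have "epowr (ennreal (x powr (\<Sum>i\<in>J. b i))) (1 / p) <= epowr (\<Prod>i\<in>J. e i * epowr (C i) (b i)) (1 / p)"
  using p by (intro epowr_mono) auto
 then have 1: "ennreal (x powr ((\<Sum>i\<in>J. b i) * (1 / p))) <= epowr (\<Prod>i\<in>J. e i * epowr (C i) (b i)) (1 / p)"
  by (simp add: epowr_def powr_powr)
 have 2: "ennreal (x powr \<beta>) <= epowr nL \<beta>" unfolding ex[symmetric] by (rule epowr_mono[OF b(1) nL])
 have "ennreal x = ennreal (x powr \<beta>) * ennreal (x powr ((\<Sum>i\<in>J. b i) * (1 / p)))"
  using x0 b(3) by (simp add: ennreal_mult[symmetric] powr_add[symmetric])
 also have "\<dots> <= epowr nL \<beta> * epowr (\<Prod>i\<in>J. e i * epowr (C i) (b i)) (1 / p)" by (rule mult_mono[OF 2 1]) auto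
 finally show ?thesis .
qed simp

lemma epowr_pos: "0 < x ==> 0 < epowr x a"
 by (cases x) (auto simp: epowr_def)

text \<open>In \<open>ennreal\<close> zero times infinity is zero, so an infinite factor makes the
  product infinite only when all factors are positive.\<close>

lemma prod_ennreal_pos_top: "finite J ==> (\<And>i. i \<in> J ==> 0 < f i) ==> 0 < (\<Prod>i\<in>J. f i :: ennreal) \<and> (\<forall>i\<in>J. f i = top --> (\<Prod>i\<in>J. f i) = top)"
proof (induction J rule: finite_induct)
 case (insert b A)
 then have IH: "0 < (\<Prod>i\<in>A. f i)" "\<And>i. i \<in> A ==> f i = top ==> (\<Prod>i\<in>A. f i) = top" and fb: "0 < f b" by auto
 show ?case using insert.hyps insert.prems IH fb by (auto simp: ennreal_zero_less_mult_iff ennreal_mult_eq_top_iff dest: gr_implies_not_zero)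
qed simp

text \<open>Descends from the q-th to the p-th moment by comparing with a threshold
  \<open>Z\<close>: below it \<open>y powr p\<close> is at most \<open>Z powr p\<close>, above it at
  most \<open>Z powr (p - q) * y ^ q\<close>. The estimate runs through the measurable majorant
  \<open>V\<close>, as the supremum is not known to be measurable.\<close>

lemma (in prob_space) sup_moment_le:
 fixes f :: "real => 'a => real"
 assumes V: "V \<in> borel_measurable M" "AE \<omega> in M. \<forall>t. 0 <= t --> t <= T --> ennreal (\<bar>f t \<omega>\<bar> ^ q) <= V \<omega>" "(\<integral>\<^sup>+\<omega>. V \<omega> \<partial>M) <= ennreal (X ^ q)"
  and p: "1 <= p" "p <= real q" and X: "0 <= X"
 shows "epowr (\<integral>\<^sup>+ \<omega>. (SUP t\<in>{0..T}. ennreal (\<bar>f t \<omega>\<bar> powr p)) \<partial>M) (1 / p) <= ennreal (2 * X)"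
proof (rule ennreal_le_epsilon)
 fix \<epsilon> :: real assume \<epsilon>: "0 < \<epsilon>"
 \<comment> \<open>A strictly positive threshold gives the negative power of \<open>Z\<close> a
   meaning when \<open>X = 0\<close>; the surplus \<open>\<epsilon>\<close> disappears in
   \<open>ennreal_le_epsilon\<close>.\<close>
 define Z where "Z = X + \<epsilon> / 2"
 have Z: "0 < Z" "X <= Z" using \<epsilon> X unfolding Z_def by auto
 have real_le: "y powr p <= Z powr p + Z powr (p - real q) * y ^ q" if "0 <= y" for y
 proof (cases "y <= Z")
  case True
  then have "y powr p <= Z powr p" using p that by (intro powr_mono2) auto
  then show ?thesis using that by (simp add: add_increasing2)
 next
  case False
  then have y: "0 < y" using Z by simp
  have "y powr (p - real q) <= Z powr (p - real q)" using False Z p by (intro powr_mono2') auto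
  then have "y powr (p - real q) * y ^ q <= Z powr (p - real q) * y ^ q" using y by (intro mult_right_mono) auto
  moreover have "y powr p = y powr (p - real q) * y ^ q" using y by (simp add: powr_realpow[symmetric] powr_add[symmetric])
  ultimately show ?thesis by (simp add: add_increasing)
 qed
 let ?W = "%\<omega>. ennreal (Z powr p) + ennreal (Z powr (p - real q)) * V \<omega>"
 have "(\<integral>\<^sup>+ \<omega>. (SUP t\<in>{0..T}. ennreal (\<bar>f t \<omega>\<bar> powr p)) \<partial>M) <= (\<integral>\<^sup>+ \<omega>. ?W \<omega> \<partial>M)"
 proof (rule nn_integral_mono_AE)
  show "AE \<omega> in M. (SUP t\<in>{0..T}. ennreal (\<bar>f t \<omega>\<bar> powr p)) <= ?W \<omega>"
   using V(2)
  proof eventually_elim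
   case (elim \<omega>)
   show ?case
   proof (rule SUP_least)
    fix t assume t: "t \<in> {0..T}"
    have "ennreal (\<bar>f t \<omega>\<bar> powr p) <= ennreal (Z powr p + Z powr (p - real q) * \<bar>f t \<omega>\<bar> ^ q)" by (intro ennreal_leI real_le) simp
    also have "\<dots> = ennreal (Z powr p) + ennreal (Z powr (p - real q)) * ennreal (\<bar>f t \<omega>\<bar> ^ q)"
     by (simp add: ennreal_plus ennreal_mult)
    also have "\<dots> <= ?W \<omega>" using elim t by (intro add_left_mono mult_left_mono) auto
    finally show "ennreal (\<bar>f t \<omega>\<bar> powr p) <= ?W \<omega>" .
   qed
  qed
 qed
 also have "\<dots> = ennreal (Z powr p) + ennreal (Z powr (p - real q)) * (\<integral>\<^sup>+\<omega>. V \<omega> \<partial>M)"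
  using V(1) by (simp add: nn_integral_add nn_integral_cmult emeasure_space_1)
 also have "\<dots> <= ennreal (Z powr p) + ennreal (Z powr (p - real q)) * ennreal (Z ^ q)"
  using V(3) ennreal_leI[OF power_mono[OF Z(2) X, of q]] by (intro add_left_mono mult_left_mono) auto
 also have "\<dots> = ennreal (2 * Z powr p)"
  using Z by (simp add: ennreal_mult[symmetric] ennreal_plus[symmetric] powr_realpow[symmetric] powr_add[symmetric] del: ennreal_plus)
 finally have "epowr (\<integral>\<^sup>+ \<omega>. (SUP t\<in>{0..T}. ennreal (\<bar>f t \<omega>\<bar> powr p)) \<partial>M) (1 / p) <= epowr (ennreal (2 * Z powr p)) (1 / p)"
  using p by (intro epowr_mono) auto
 also have "\<dots> = ennreal (2 powr (1 / p) * Z)"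
  using Z p by (simp add: epowr_def powr_mult powr_powr)
 also have "\<dots> <= ennreal (2 * Z)"
  using Z p powr_mono[of "1 / p" 1 2] by (intro ennreal_leI mult_right_mono) auto
 also have "\<dots> = ennreal (2 * X) + ennreal \<epsilon>"
  using X \<epsilon> unfolding Z_def by (simp add: ennreal_plus[symmetric] distrib_left del: ennreal_plus)
 finally show "epowr (\<integral>\<^sup>+ \<omega>. (SUP t\<in>{0..T}. ennreal (\<bar>f t \<omega>\<bar> powr p)) \<partial>M) (1 / p) <= ennreal (2 * X) + ennreal \<epsilon>" .
qed

lemma SUP_le_C1norm: "(SUP z\<in>{z. \<forall>j\<in>{1..m}. z j \<in> {0..T} \<times> Lam N d}. ennreal \<bar>H z\<bar>) <= C1norm N d T m i H"
 unfolding C1norm_def Let_def by (auto intro: add_increasing2)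

lemma OR_box: "z \<in> OR S m T ==> z \<in> {z. \<forall>j\<in>{1..m}. z j \<in> {0..T} \<times> S}"
 unfolding OR_def by (auto simp: mem_Times_iff intro: less_imp_le)

lemma ennreal_factors_finite: "0 < x ==> 0 < y ==> 0 < z ==> x * y * z \<noteq> (top :: ennreal) ==> y \<noteq> top \<and> z \<noteq> top"
 by (auto simp: ennreal_mult_eq_top_iff)

lemma epowr_top: "epowr top a = top"
 by (simp add: epowr_def)

text \<open>\<open>q\<close> is an even integer above \<open>p\<close>, since the moment estimates
  are proved for even integer powers. The summand 1 in the constant makes it positive, so that an
  infinite sum on the right is not annihilated by a zero prefactor.\<close>

lemma theorem3p5_aux:
 assumes set: "standing_setting d k c Cb P Fl M Cq Cd N" and N: "1 <= N" and c: "0 < c" and m: "1 <= m"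
  and R: "equiv {1..n::nat} R" and bij: "bij_betw \<sigma> {1..m} ({1..n} // R)" and p: "2 <= p"
  and F: "C1_time N d n F" and T: "0 <= T" "T <= 1"
 defines "q \<equiv> 2 * nat \<lceil>p\<rceil>"
 shows "epowr (\<integral>\<^sup>+ \<omega>. (SUP t\<in>{0..T}. ennreal (\<bar>Iint N d (%s x. M s x \<omega>) n \<sigma> m F t\<bar> powr p)) \<partial>P) (1 / p)
  <= RHS N d k p T (%_ _. 1) (2 * main_const q c (4 * Cb) \<sigma> m + 1) \<sigma> m (Fgs n \<sigma> m F)"
  (is "?lhs <= ?rhs")
\<comment> \<open>An infinite right-hand side is trivial; a finite one yields the boundedness and
  regularity of the integrand demanded by \<open>goodH\<close>.\<close>
proof (cases "?rhs = top")
 case True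
 then show ?thesis by simp
next
 case False
 let ?G = "Fgs n \<sigma> m F" and ?O = "OR (Lam N d) m T" and ?pv = "\<lambda>i\<in>{1..m}. Einf" and ?mc = "main_const q c (4 * Cb) \<sigma> m"
 let ?H = "%z. if z \<in> ?O then ?G z else 0"
 have Cb: "0 <= Cb" by (rule Cb_nonneg[OF set N c])
 have mc: "0 <= ?mc" using c Cb by (intro main_const_nonneg) auto
 have e: "0 < eps N" by (rule eps_pos[OF N])
 \<comment> \<open>The choice of 1 for the exponents \<open>\<kappa>\<close> is arbitrary: these
   factors enter the interpolation as numbers that are at least 1.\<close>
 have e1: "1 <= ennreal (eps N powr - 1)" using N e by (simp add: powr_minus eps_def)
 let ?t = "%pv. ennreal (eps N powr alpha d k \<sigma> m pv) * epowr (normL N d T pv m ?G) (beta p \<sigma> m pv) *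
    epowr (\<Prod>i\<in>Jinf \<sigma> m pv. ennreal (eps N powr - 1) * epowr (C1norm N d T m i ?G) (beta_i p \<sigma> m pv i)) (1 / p)"
 have rhs: "?rhs = ennreal (2 * ?mc + 1) * (\<Sum>pv\<in>Padm \<sigma> m. ?t pv)" unfolding RHS_def ..
 have "\<exists>K. goodH (%j. card (\<sigma> j)) (Lam N d) m T K ?H"
 proof (cases "\<forall>z\<in>?O. ?G z = 0")
  case True
  then have "?H = (%_. 0)" by auto
  moreover have "goodH (%j. card (\<sigma> j)) (Lam N d) m T 0 (%_. 0)" unfolding goodH_def by simp
  ultimately show ?thesis by metis
 next
  case nz: False
  let ?nL = "normL N d T ?pv m ?G"
  have nL: "ennreal \<bar>?G z\<bar> <= ?nL" if z: "z \<in> ?O" for z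
  proof -
   obtain z' where z': "\<forall>i\<in>{1..m}. z' i = z i" "ennreal \<bar>?G z'\<bar> <= ?nL"
    using normL_Einf_ge[OF z order_refl, of ?pv ?G] by auto
   have "?G z' = ?G z" unfolding Fgs_def using z'(1) cls_mem[OF R bij]
    by (intro arg_cong[where f=F] restrict_ext) auto
   then show ?thesis using z'(2) by simp
  qed
  obtain z where z: "z \<in> ?O" "?G z \<noteq> 0" using nz by blast
  have pos: "0 < ennreal \<bar>?G z\<bar>" using z(2) by simp
  have nL0: "0 < ?nL" using pos nL[OF z(1)] by (rule less_le_trans)
  have C0: "0 < C1norm N d T m i ?G" for i
   using pos order_trans[OF SUP_upper[OF OR_box[OF z(1)]] SUP_le_C1norm] by (rule less_le_trans)
  \<comment> \<open>The term with all exponents infinite already contains the supremum over the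
    simplex and, for each larger component from the second on, its C1 norm. Finiteness of this one
    term gives everything required.\<close>
  have "?pv \<in> Padm \<sigma> m" unfolding Padm_def by auto
  then have "?t ?pv <= (\<Sum>pv\<in>Padm \<sigma> m. ?t pv)" by (intro member_le_sum[OF _ zero_le finite_Padm])
  moreover have "(\<Sum>pv\<in>Padm \<sigma> m. ?t pv) \<noteq> top"
  proof
   assume "(\<Sum>pv\<in>Padm \<sigma> m. ?t pv) = top"
   \<comment> \<open>Here the positive prefactor matters: it transfers infinity from the sum to the
     whole right-hand side.\<close>
   then have "?rhs = top" unfolding rhs using mc by (simp only: ennreal_mult_top) (simp add: add_nonneg_pos)
   with False show False by blast
  qed
  ultimately have tf: "?t ?pv \<noteq> top" using top.extremum_unique[of "\<Sum>pv\<in>Padm \<sigma> m. ?t pv"] by fastforce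
  let ?f = "%i. ennreal (eps N powr - 1) * epowr (C1norm N d T m i ?G) (beta_i p \<sigma> m ?pv i)"
  have f0: "0 < ?f i" for i using epowr_pos[OF C0] e by (simp add: ennreal_zero_less_mult_iff)
  have P: "0 < (\<Prod>i\<in>Jinf \<sigma> m ?pv. ?f i) \<and> (\<forall>i\<in>Jinf \<sigma> m ?pv. ?f i = top --> (\<Prod>i\<in>Jinf \<sigma> m ?pv. ?f i) = top)"
   by (rule prod_ennreal_pos_top[OF finite_Jinf f0])
  have P0: "0 < epowr (\<Prod>i\<in>Jinf \<sigma> m ?pv. ?f i) (1 / p)" by (rule epowr_pos[OF conjunct1[OF P]])
  have a0: "0 < ennreal (eps N powr alpha d k \<sigma> m ?pv)" using e by simp
  have b0: "0 < epowr ?nL (beta p \<sigma> m ?pv)" by (rule epowr_pos[OF nL0])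
  \<comment> \<open>All three factors are positive because the integrand does not vanish on the
    simplex, so a finite product forces finite factors.\<close>
  note fin = ennreal_factors_finite[OF a0 b0 P0 tf]
  have nLf: "?nL \<noteq> top"
  proof
   assume "?nL = top"
   then have "epowr ?nL (beta p \<sigma> m ?pv) = top" using epowr_top by (simp only:)
   with fin show False by (simp only: simp_thms)
  qed
  have Pf: "(\<Prod>i\<in>Jinf \<sigma> m ?pv. ?f i) \<noteq> top"
  proof
   assume "(\<Prod>i\<in>Jinf \<sigma> m ?pv. ?f i) = top"
   then have "epowr (\<Prod>i\<in>Jinf \<sigma> m ?pv. ?f i) (1 / p) = top" using epowr_top by (simp only:)
   with fin show False by (simp only: simp_thms)
  qed
  show ?thesis
  proof (intro exI goodH_Fgs[OF R bij F m])
   show "0 <= enn2real ?nL" by simp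
   show "\<bar>?G z\<bar> <= enn2real ?nL" if "z \<in> ?O" for z
    using enn2real_mono[OF nL[OF that]] nLf by (simp add: less_top)
   show "C1norm N d T m j ?G \<noteq> \<infinity>" if j: "j \<in> {2..m}" "card (\<sigma> j) \<noteq> 1" for j
   proof
    assume inf: "C1norm N d T m j ?G = \<infinity>"
    have "j \<in> Jinf \<sigma> m ?pv" using j unfolding Jinf_def Gamma1_def by auto
    moreover have "?f j = top" using inf e by (simp add: epowr_def ennreal_mult_eq_top_iff)
    ultimately show False using conjunct2[OF P] Pf by blast
   qed
  qed
 qed
 then obtain K where H: "goodH (%j. card (\<sigma> j)) (Lam N d) m T K ?H" by blast
 note nr = normL_nr[OF N T H]
 interpret ln: lattice_noise P Fl M Cd "Lam N d" "c * eps N powr k" "real N powr (k + real d)" Cb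
  "4 * real N ^ d * Cb / (c * eps N powr k)\<^sup>2" "eps N ^ d" "4 * Cb" N d "%j. card (\<sigma> j)"
  by (rule standing_lattice[OF set N c])
 have q: "2 <= q" "even q" "p <= real q" using p unfolding q_def by (simp_all, linarith+)
 have \<eta>: "eps N ^ d * (c * eps N powr k) = c * eps N powr (real d + k)"
  using e by (simp add: powr_add powr_realpow)
 obtain V where V: "V \<in> borel_measurable P" "AE \<omega> in P. \<forall>t. 0 <= t --> t <= T --> ennreal (\<bar>ln.I m ?H t \<omega>\<bar> ^ q) <= V \<omega>"
   "(\<integral>\<^sup>+\<omega>. V \<omega> \<partial>P) <= ennreal ((?mc * SSr N d k T \<sigma> m ?H) ^ q)"
  using ln.main_bound[OF N T(2) \<eta> c refl q(1,2) T(1) order_refl H] by blast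
 have I: "Iint N d (%s x. M s x \<omega>) n \<sigma> m F t = ln.I m ?H t \<omega>" if "t <= T" for t \<omega>
  unfolding Iint_def using OR_mono[OF that] by (intro ITI_cong) auto
 have AE: "AE \<omega> in P. \<forall>t. 0 <= t --> t <= T --> ennreal (\<bar>Iint N d (%s x. M s x \<omega>) n \<sigma> m F t\<bar> ^ q) <= V \<omega>"
  using V(2) by eventually_elim (simp add: I)
 have S0: "0 <= SSr N d k T \<sigma> m ?H" by (rule SSr_nonneg)
 have "?lhs <= ennreal (2 * (?mc * SSr N d k T \<sigma> m ?H))"
  by (rule ln.sup_moment_le[OF V(1) AE V(3) _ q(3)]) (use p mc S0 in auto)
 also have "\<dots> <= ennreal ((2 * ?mc + 1) * SSr N d k T \<sigma> m ?H)" using S0 by (intro ennreal_leI) (simp add: distrib_right)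
 also have "\<dots> = ennreal (2 * ?mc + 1) * (\<Sum>pv\<in>Padm \<sigma> m. ennreal (eps N powr alpha d k \<sigma> m pv) * ennreal (nr N d T pv m ?H))"
  using mc S0 unfolding SSr_def
  by (subst ennreal_mult) (auto simp: sum_ennreal[symmetric] ennreal_mult nr_nonneg intro!: sum_nonneg mult_nonneg_nonneg)
 also have "\<dots> <= ?rhs" unfolding rhs
 proof (intro mult_left_mono sum_mono)
  fix pv assume "pv \<in> Padm \<sigma> m"
  have r: "0 <= (p - 1) / p" using p by simp
  \<comment> \<open>A mixed norm of the cut-off integrand is at most the same norm of
    \<open>?G\<close>, and also at most each C1 norm, which contains a supremum over a box larger
    than the simplex. Interpolation distributes the single power of the norm over all these
    bounds.\<close>
  have "ennreal (nr N d T pv m ?H) <= epowr (normL N d T pv m ?G) (beta p \<sigma> m pv) *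
    epowr (\<Prod>i\<in>Jinf \<sigma> m pv. ennreal (eps N powr - 1) * epowr (C1norm N d T m i ?G) (beta_i p \<sigma> m pv i)) (1 / p)"
  proof (rule epowr_interpolate[OF nr_nonneg finite_Jinf _ _ _ _ beta_sum[OF p] _ e1])
   show "ennreal (nr N d T pv m ?H) <= normL N d T pv m ?G" unfolding nr(1)[symmetric] by (rule normL_mono) simp
   show "ennreal (nr N d T pv m ?H) <= C1norm N d T m i ?G" for i
   proof (cases "C1norm N d T m i ?G = top")
    case False
    let ?S = "SUP z\<in>{z. \<forall>j\<in>{1..m}. z j \<in> {0..T} \<times> Lam N d}. ennreal \<bar>?G z\<bar>"
    have S: "?S <= C1norm N d T m i ?G" by (rule SUP_le_C1norm)
    then have Sf: "?S < top" using False by (simp add: less_top order.strict_trans1)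
    have "\<bar>?H z\<bar> <= enn2real ?S" for z
    proof (cases "z \<in> ?O")
     case True
     have "ennreal \<bar>?G z\<bar> <= ?S" by (rule SUP_upper[OF OR_box[OF True]])
     from enn2real_mono[OF this Sf] show ?thesis using True by simp
    qed simp
    then have "normL N d T pv m ?H <= ennreal (enn2real ?S)" by (intro normL_le_const N T) auto
    also have "ennreal (enn2real ?S) = ?S" using Sf by (rule ennreal_enn2real)
    also note S
    finally show ?thesis unfolding nr(1) .
   qed simp
  qed (use p r in \<open>auto simp: beta_def beta_i_def\<close>)
  then show "ennreal (eps N powr alpha d k \<sigma> m pv) * ennreal (nr N d T pv m ?H) <= ?t pv"
   unfolding mult.assoc by (rule mult_left_mono) simp
 qed simp_all
 finally show ?thesis .
qed

theorem theorem3p5: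
 fixes d n m :: nat and k c Cb :: real
  and P :: "nat \<Rightarrow> 'a measure" and Fl :: "nat \<Rightarrow> real \<Rightarrow> 'a measure"
  and Mt :: "nat \<Rightarrow> real \<Rightarrow> site \<Rightarrow> 'a \<Rightarrow> real"
  and Cq Cd :: "nat \<Rightarrow> real \<Rightarrow> site \<Rightarrow> 'a \<Rightarrow> real"
  and R :: "(nat \<times> nat) set" and \<sigma> :: "nat \<Rightarrow> nat set"
 assumes "d \<ge> 1" and "k > - real d / 2" and "c > 0"
  and "\<And>N. N \<ge> 1 \<Longrightarrow> standing_setting d k c Cb (P N) (Fl N) (Mt N) (Cq N) (Cd N) N"
  and "1 \<le> m" and "m \<le> n"
  and "equiv {1..n} R" and "card ({1..n} // R) = m"
  and "bij_betw \<sigma> {1..m} ({1..n} // R)"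
 shows "\<forall>p::real. p \<ge> 2 \<longrightarrow>
  (\<exists>(\<kappa> :: (nat \<Rightarrow> expo) \<Rightarrow> nat \<Rightarrow> real) (Cst :: real). (\<forall>pv i. \<kappa> pv i > 0) \<and>
   (\<forall>N\<ge>1. \<forall>F. C1_time N d n F \<longrightarrow> (\<forall>T\<in>{0..1}.
     epowr (\<integral>\<^sup>+ \<omega>. (SUP t\<in>{0..T}. ennreal (\<bar>Iint N d (\<lambda>s x. Mt N s x \<omega>) n \<sigma> m F t\<bar> powr p)) \<partial>P N) (1 / p)
      \<le> RHS N d k p T \<kappa> Cst \<sigma> m (Fgs n \<sigma> m F))))"
proof (intro allI impI)
 fix p :: real assume p: "2 \<le> p"
 show "\<exists>(\<kappa> :: (nat \<Rightarrow> expo) \<Rightarrow> nat \<Rightarrow> real) (Cst :: real). (\<forall>pv i. \<kappa> pv i > 0) \<and>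
   (\<forall>N\<ge>1. \<forall>F. C1_time N d n F \<longrightarrow> (\<forall>T\<in>{0..1}.
     epowr (\<integral>\<^sup>+ \<omega>. (SUP t\<in>{0..T}. ennreal (\<bar>Iint N d (\<lambda>s x. Mt N s x \<omega>) n \<sigma> m F t\<bar> powr p)) \<partial>P N) (1 / p)
      \<le> RHS N d k p T \<kappa> Cst \<sigma> m (Fgs n \<sigma> m F)))"
 \<comment> \<open>The witnesses are read off from the \<open>show\<close> below. They involve only
   \<open>p\<close>, \<open>c\<close>, \<open>Cb\<close>, \<open>\<sigma>\<close> and
   \<open>m\<close>, and thus may precede the quantifiers over \<open>N\<close>, \<open>F\<close>
   and \<open>T\<close>.\<close>
 proof (intro exI conjI allI impI ballI)
  fix N F T assume "1 \<le> N" "C1_time N d n F" "T \<in> {0..1::real}"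
  then show "epowr (\<integral>\<^sup>+ \<omega>. (SUP t\<in>{0..T}. ennreal (\<bar>Iint N d (\<lambda>s x. Mt N s x \<omega>) n \<sigma> m F t\<bar> powr p)) \<partial>P N) (1 / p)
   \<le> RHS N d k p T (\<lambda>_ _. 1) (2 * main_const (2 * nat \<lceil>p\<rceil>) c (4 * Cb) \<sigma> m + 1) \<sigma> m (Fgs n \<sigma> m F)"
   using assms(3,5) by (intro theorem3p5_aux[OF assms(4) _ _ _ assms(7,9) p]) auto
 qed simp
qed

end
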